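(* Suppose $m\ge3$ is even and let $i,j\in\mathbb Z/m\mathbb Z$. Then the following Gerstenhaber brackets hold in $\mathrm{HH}^\bullet(A)$: $[\varepsilon_i,\chi_{2,0}]=\frac{(-1)^{i+1}}{m}(\varphi_{1,0}+\psi_{1,0})$, $[\varepsilon_i,\chi_{m,-1}]=(-1)^{i+1}\varphi_{m-1,-1}$, $[\varepsilon_i,\chi_{m,1}]=(-1)^{i+1}\psi_{m-1,1}$, and $[\varepsilon_i,Y]=0$ if $Y\in\{\varepsilon_j,f_j,\varphi_{m-1,-1},\psi_{m-1,1}\}$; $[f_i,Y]=0$ if $Y\in\{\varepsilon_j,f_j,\chi_{2,0},\varphi_{m-1,-1},\psi_{m-1,1},\chi_{m,-1},\chi_{m,1}\}$; $[\chi_{2,0},\varphi_{m-1,-1}]=\chi_{m,-1}$, $[\chi_{2,0},\psi_{m-1,1}]=-\chi_{m,1}$, and $[\chi_{2,0},Y]=0$ if $Y\in\{f_j,\chi_{2,0},\chi_{m,-1},\chi_{m,1}\}$; $[\varphi_{m-1,-1},Y]=0$ and $[\psi_{m-1,1},Y]=0$ if $Y\in\{\varepsilon_j,f_j,\varphi_{m-1,-1},\psi_{m-1,1},\chi_{m,-1},\chi_{m,1}\}$; $[\chi_{m,-1},Y]=0$ and $[\chi_{m,1},Y]=0$ if $Y\in\{f_j,\chi_{2,0},\varphi_{m-1,-1},\psi_{m-1,1},\chi_{m,-1},\chi_{m,1}\}$.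
   Context: **Algebra.** Fix integers $N\ge1$, $m\ge3$ and a field $k$ whose characteristic does not divide $2$, $N$ or $m$. $Q$ is the quiver with vertex set $\mathbb Z/m\mathbb Z$ and arrows $a_i:i\to i+1$, $\bar a_i:i+1\to i$ ($i\in\mathbb Z/m\mathbb Z$); paths are composed from left to right, indices are modulo $m$. $A=kQ/\langle a_ia_{i+1},\ \bar a_{i+1}\bar a_i,\ (a_i\bar a_i)^N-(\bar a_{i-1}a_{i-1})^N\mid i\rangle$; $e_i$ is the trivial path at $i$, $E$ the span of the $e_i$, $A^e=A\otimes_kA^{op}$. **Resolution.** For $n\ge0$, $0\le r\le n$, $i\in\mathbb Z/m\mathbb Z$ define $g^n_{r,i}\in kQ$ by $g^0_{0,i}=e_i$ and, for $n\ge1$ (with $g^n_{-1,i}=g^{n-1}_{n,i}=0$, indices of the arrows $a,\bar a$ being the unique ones making paths compose): $g^n_{r,i}=g^{n-1}_{r,i}a+(-1)^ng^{n-1}_{r-1,i}\bar a(a\bar a)^{N-1}$ if $n-2r>0$; $g^n_{r,i}=g^{n-1}_{r,i}a(\bar aa)^{N-1}+(-1)^ng^{n-1}_{r-1,i}\bar a$ if $n-2r<0$; $g^n_{r,i}=g^{n-1}_{r,i}a(\bar aa)^{N-1}+g^{n-1}_{r-1,i}\bar a(a\bar a)^{N-1}$ if $n=2r$. Let $\mathcal B_n=\{g^n_{r,i}\}$ and $P_n=A\otimes_Ek\mathcal B_n\otimes_EA$. With augmentation $P_0=A\otimes_EA\to A$ given by multiplication, $P_\bullet$ is a minimal projective $A^e$-resolution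 of $A$ (Snashall–Taillefer) with $A^e$-linear differential $\partial_n:P_n\to P_{n-1}$ sending $1\otimes g^n_{r,i}\otimes1$ to: if $n-2r>0$: $1\otimes g^{n-1}_{r,i}\otimes a+(-1)^{n+r}a\otimes g^{n-1}_{r,i+1}\otimes1+(-1)^{n+r}\bar a(a\bar a)^{N-1}\otimes g^{n-1}_{r-1,i-1}\otimes1+(-1)^n1\otimes g^{n-1}_{r-1,i}\otimes\bar a(a\bar a)^{N-1}$; if $n-2r<0$: $1\otimes g^{n-1}_{r,i}\otimes a(\bar aa)^{N-1}+(-1)^{n+r}a(\bar aa)^{N-1}\otimes g^{n-1}_{r,i+1}\otimes1+(-1)^{n+r}\bar a\otimes g^{n-1}_{r-1,i-1}\otimes1+(-1)^n1\otimes g^{n-1}_{r-1,i}\otimes\bar a$; if $n=2r$: $\sum_{l=0}^{N-1}\big((\bar aa)^l\otimes g^{n-1}_{r,i}\otimes a(\bar aa)^{N-1-l}+(-1)^{n/2}(a\bar a)^la\otimes g^{n-1}_{r,i+1}\otimes(a\bar a)^{N-1-l}+(-1)^{n/2}(\bar aa)^l\bar a\otimes g^{n-1}_{r-1,i-1}\otimes(\bar aa)^{N-1-l}+(a\bar a)^l\otimes g^{n-1}_{r-1,i}\otimes\bar a(a\bar a)^{N-1-l}\big)$. **Cohomology and bracket.** $\mathrm{HH}^n(A)$ is the $n$-th cohomology of $\mathrm{Hom}_{A^e}(P_\bullet,A)$, with $\mathrm{Hom}_{A^e}(P_n,A)=\mathrm{Hom}_{E^e}(k\mathcal B_n,A)$.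 For $g\in\mathcal B_n$ and $u\in A$ parallel to $g$ (same source and target), $(g\parallel u)$ is the map sending $g$ to $u$ and all other elements of $\mathcal B_n$ to $0$; cohomology classes are named by cocycles. $\mathrm{HH}^0(A)$ is the center of $A$; $\mathrm{HH}^1(A)$ is derivations modulo inner derivations, a 1-cocycle $f$ corresponding to the derivation with $a_i\mapsto f(a_i)$, $\bar a_i\mapsto f(\bar a_i)$. (Sign convention: since the bar resolution has $1\otimes x\otimes1\mapsto x\otimes1-1\otimes x$ while $\partial_1(1\otimes a_i\otimes1)=1\otimes a_i-a_i\otimes1$, this amounts to identifying with bar cohomology through a comparison map lifting $\mathrm{id}_A$ after replacing each $\partial_n$ by $-\partial_n$.) $[-,-]$ is the Gerstenhaber bracket on $\mathrm{HH}^\bullet(A)$, defined on bar cochains of degrees $n,q$ by $[f,g]=f\circ g-(-1)^{(n-1)(q-1)}g\circ f$ with $(f\circ g)(x_1,\dots,x_{n+q-1})=\sum_{i=1}^n(-1)^{(q-1)(i-1)}f(x_1,\dots,x_{i-1},g(x_i,\dots,x_{i+q-1}),x_{i+q},\dots,x_{n+q-1})$. **Elements.** $\varepsilon_i=(a_i\bar a_i)^N$ and $f_i=a_i\bar a_i+\bar a_ia_i$ in degree $0$; $\varphi_{1,0}=\sum_{i=0}^{m-1}(g^1_{0,i}\parallel a_i)$, $\psi_{1,0}=\sum_i(g^1_{1,i}\parallel\bar a_{i-1})$ in degree $1$; $\chi_{2,0}=\sum_i(g^2_{1,i}\parallel(-1)^ie_i)$ in degree $2$; $\varphi_{m-1,-1}=\sum_i(g^{m-1}_{m-1,i}\parallel(-1)^ia_i(\bar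 a_ia_i)^{N-1})$, $\psi_{m-1,1}=\sum_i(g^{m-1}_{0,i}\parallel(-1)^i\bar a_{i-1}(a_{i-1}\bar a_{i-1})^{N-1})$ in degree $m-1$; $\chi_{m,1}=\sum_i(g^m_{0,i}\parallel e_i)$, $\chi_{m,-1}=\sum_i(g^m_{m,i}\parallel e_i)$ in degree $m$. (Together with $1$, these generate $\mathrm{HH}^\bullet(A)$ as a $k$-algebra for $m$ even; the $f_i$ are needed only when $N>1$.)
   Formalization: The zero brackets [φ_{m-1,-1},ψ_{m-1,1}], [φ_{m-1,-1},χ_{m,1}] and [ψ_{m-1,1},χ_{m,-1}] (in either order) are asserted only for N>1; for N=1 the printed list including them is false. *)

theory Defs
  imports
    "HOL-Algebra.QuotRing"
    "HOL-Library.FuncSet"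
    "HOL-Library.Poly_Mapping"
    "Graph_Theory.Arc_Walk"
begin

section \<open>Free vector spaces\<close>

text \<open>The free \<open>'k\<close>-vector space on \<open>'s\<close> is the type \<open>'s \<Rightarrow>\<^sub>0 'k\<close>; the pointwise (or convolution)
  product that the library puts on it is never used.\<close>

definition scl :: "'k::field \<Rightarrow> ('s \<Rightarrow>\<^sub>0 'k) \<Rightarrow> ('s \<Rightarrow>\<^sub>0 'k)" where
  "scl c = Poly_Mapping.map ((*) c)"

definition lin_ext :: "('s \<Rightarrow> ('t \<Rightarrow>\<^sub>0 'k::field)) \<Rightarrow> ('s \<Rightarrow>\<^sub>0 'k) \<Rightarrow> ('t \<Rightarrow>\<^sub>0 'k)" where
  "lin_ext h f = (\<Sum>s\<in>Poly_Mapping.keys f. scl (Poly_Mapping.lookup f s) (h s))"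

section \<open>The quiver and its paths\<close>

datatype arrow = Fwd int | Bwd int

text \<open>\<open>Fwd i\<close> is \<open>a\<^sub>i : i \<rightarrow> i + 1\<close> and \<open>Bwd i\<close> is its opposite \<open>i + 1 \<rightarrow> i\<close>; the vertex set
  of residues modulo \<open>m\<close> is \<open>{0..<m}\<close>.\<close>

definition quiver :: "nat \<Rightarrow> (int, arrow) pre_digraph" where
  "quiver m = \<lparr>verts = {0..<int m},
     arcs = Fwd ` {0..<int m} \<union> Bwd ` {0..<int m},
     tail = (\<lambda>x. case x of Fwd i \<Rightarrow> i | Bwd i \<Rightarrow> (i + 1) mod int m),
     head = (\<lambda>x. case x of Fwd i \<Rightarrow> (i + 1) mod int m | Bwd i \<Rightarrow> i)\<rparr>"

text \<open>A path is recorded with its source, so that \<open>(i, [])\<close> is the trivial path at \<open>i\<close>.\<close>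

type_synonym path = "int \<times> arrow list"

definition paths :: "nat \<Rightarrow> path set" where
  "paths m = {(u, p). \<exists>v. pre_digraph.awalk (quiver m) u p v}"

definition path_end :: "nat \<Rightarrow> path \<Rightarrow> int" where
  "path_end m p = last (pre_digraph.awalk_verts (quiver m) (fst p) (snd p))"

definition path_comp :: "nat \<Rightarrow> path \<Rightarrow> path \<Rightarrow> (path \<Rightarrow>\<^sub>0 'k::field)" where
  "path_comp m p q =
     (if path_end m p = fst q then Poly_Mapping.single (fst p, snd p @ snd q) 1 else 0)"

type_synonym 'k pathvec = "path \<Rightarrow>\<^sub>0 'k"
type_synonym 'k elt = "'k pathvec set"
type_synonym 'k tens = "('k elt \<times> 'k pathvec \<times> 'k elt) \<Rightarrow>\<^sub>0 'k"

text \<open>The locale only fixes the two parameters; no conditions are imposed on them here.\<close>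

locale biserial =
  fixes N m :: nat
begin

section \<open>The algebra\<close>

definition vert :: "int \<Rightarrow> 'k::field pathvec" where
  "vert i = Poly_Mapping.single (i mod int m, []) 1"

definition arr :: "int \<Rightarrow> 'k::field pathvec" where
  "arr i = Poly_Mapping.single (i mod int m, [Fwd (i mod int m)]) 1"

definition arr' :: "int \<Rightarrow> 'k::field pathvec" where
  "arr' i = Poly_Mapping.single ((i + 1) mod int m, [Bwd (i mod int m)]) 1"

definition KQ :: "'k::field pathvec ring" where
  "KQ = \<lparr>carrier = {x. Poly_Mapping.keys x \<subseteq> paths m},
     monoid.mult = (\<lambda>x y. lin_ext (\<lambda>p. lin_ext (\<lambda>q. path_comp m p q) y) x),
     one = (\<Sum>i\<in>{0..<int m}. vert i),
     zero = 0,
     add = (+)\<rparr>"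

abbreviation KQ_mult :: "'k::field pathvec \<Rightarrow> 'k pathvec \<Rightarrow> 'k pathvec" (infixl \<open>\<star>\<close> 70) where
  "x \<star> y \<equiv> x \<otimes>\<^bsub>KQ\<^esub> y"

definition relations :: "'k::field pathvec set" where
  "relations =
     {arr i \<star> arr (i + 1) | i. True} \<union>
     {arr' (i + 1) \<star> arr' i | i. True} \<union>
     {(arr i \<star> arr' i) [^]\<^bsub>KQ\<^esub> N - (arr' (i - 1) \<star> arr (i - 1)) [^]\<^bsub>KQ\<^esub> N | i. True}"

definition rel_ideal :: "'k::field pathvec set" where
  "rel_ideal = genideal KQ relations"

definition A :: "'k::field elt ring" where
  "A = KQ Quot rel_ideal"

definition cl :: "'k::field pathvec \<Rightarrow> 'k elt" where
  "cl x = rel_ideal +>\<^bsub>KQ\<^esub> x"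

abbreviation A_mult :: "'k::field elt \<Rightarrow> 'k elt \<Rightarrow> 'k elt" (infixl \<open>\<cdot>\<close> 70) where
  "x \<cdot> y \<equiv> x \<otimes>\<^bsub>A\<^esub> y"

definition sclA :: "'k::field \<Rightarrow> 'k elt \<Rightarrow> 'k elt" where
  "sclA c x = cl (scl c \<one>\<^bsub>KQ\<^esub>) \<cdot> x"

section \<open>The resolution\<close>

text \<open>The sum of all arrows of each kind. Multiplying a path by such a sum (and forming
  \<open>u \<otimes> g \<otimes> v\<close> over \<open>E\<close> with \<open>u\<close>, \<open>v\<close> built from such sums) keeps exactly the composable summand,
  so these sums stand for ``the arrow with the unique index that makes the paths compose''.\<close>

definition aa :: "'k::field pathvec" where
  "aa = (\<Sum>i\<in>{0..<int m}. arr i)"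

definition bb :: "'k::field pathvec" where
  "bb = (\<Sum>i\<in>{0..<int m}. arr' i)"

text \<open>\<open>g n r i\<close> is zero when \<open>r\<close> is not in \<open>{0..n}\<close>.\<close>

primrec g :: "nat \<Rightarrow> int \<Rightarrow> int \<Rightarrow> 'k::field pathvec" where
  "g 0 r i = (if r = 0 then vert i else 0)"
| "g (Suc n) r i =
     (if r < 0 \<or> r > int (Suc n) then 0
      else if int (Suc n) - 2 * r > 0 then
        g n r i \<star> aa + scl ((-1) ^ Suc n) (g n (r - 1) i \<star> bb \<star> (aa \<star> bb) [^]\<^bsub>KQ\<^esub> (N - 1))
      else if int (Suc n) - 2 * r < 0 then
        g n r i \<star> aa \<star> (bb \<star> aa) [^]\<^bsub>KQ\<^esub> (N - 1) + scl ((-1) ^ Suc n) (g n (r - 1) i \<star> bb)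
      else
        g n r i \<star> aa \<star> (bb \<star> aa) [^]\<^bsub>KQ\<^esub> (N - 1)
        + g n (r - 1) i \<star> bb \<star> (aa \<star> bb) [^]\<^bsub>KQ\<^esub> (N - 1))"

definition B :: "nat \<Rightarrow> 'k::field pathvec set" where
  "B n = {g n r i | r i. 0 \<le> r \<and> r \<le> int n \<and> 0 \<le> i \<and> i < int m}"

text \<open>\<open>P\<^sub>n = A \<otimes>\<^sub>E k B\<^sub>n \<otimes>\<^sub>E A\<close> is the free vector space \<open>F n\<close> on the symbols
  \<open>x \<otimes> b \<otimes> y\<close> modulo the subspace \<open>U n\<close> of the tensor product relations. Elements of \<open>P\<^sub>n\<close> are
  handled through representatives in \<open>F n\<close>, equality in \<open>P\<^sub>n\<close> being congruence modulo \<open>U n\<close>.\<close>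

definition tens :: "'k::field elt \<Rightarrow> 'k pathvec \<Rightarrow> 'k elt \<Rightarrow> 'k tens" where
  "tens x b y = (if b = 0 then 0 else Poly_Mapping.single (x, b, y) 1)"

definition F :: "nat \<Rightarrow> 'k::field tens set" where
  "F n = {f. Poly_Mapping.keys f \<subseteq> carrier A \<times> B n \<times> carrier A}"

definition tens_relations :: "nat \<Rightarrow> 'k::field tens set" where
  "tens_relations n =
     {tens (x \<oplus>\<^bsub>A\<^esub> x') b y - tens x b y - tens x' b y | x x' b y.
        x \<in> carrier A \<and> x' \<in> carrier A \<and> b \<in> B n \<and> y \<in> carrier A} \<union>
     {tens x b (y \<oplus>\<^bsub>A\<^esub> y') - tens x b y - tens x b y' | x b y y'.
        x \<in> carrier A \<and> b \<in> B n \<and> y \<in> carrier A \<and> y' \<in> carrier A} \<union>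
     {tens (sclA c x) b y - scl c (tens x b y) | c x b y.
        x \<in> carrier A \<and> b \<in> B n \<and> y \<in> carrier A} \<union>
     {tens x b (sclA c y) - scl c (tens x b y) | c x b y.
        x \<in> carrier A \<and> b \<in> B n \<and> y \<in> carrier A} \<union>
     {tens (x \<cdot> cl (vert j)) b y - tens x (vert j \<star> b) y | j x b y.
        x \<in> carrier A \<and> b \<in> B n \<and> y \<in> carrier A} \<union>
     {tens x b (cl (vert j) \<cdot> y) - tens x (b \<star> vert j) y | j x b y.
        x \<in> carrier A \<and> b \<in> B n \<and> y \<in> carrier A}"

definition U :: "nat \<Rightarrow> 'k::field tens set" where
  "U n = Modules.module.span scl (tens_relations n)"

definition bimod :: "'k::field elt \<Rightarrow> 'k tens \<Rightarrow> 'k elt \<Rightarrow> 'k tens" where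
  "bimod x f y = lin_ext (\<lambda>(u, b, v). Poly_Mapping.single (x \<cdot> u, b, v \<cdot> y) 1) f"

text \<open>\<open>diff_gen n r i\<close> is the image of \<open>1 \<otimes> g n r i \<otimes> 1\<close> under the differential, for \<open>n > 0\<close>.\<close>

definition diff_gen :: "nat \<Rightarrow> int \<Rightarrow> int \<Rightarrow> 'k::field tens" where
  "diff_gen n r i =
     (let a = cl aa; b = cl bb; one = \<one>\<^bsub>A\<^esub>; pow = (\<lambda>x (l::nat). x [^]\<^bsub>A\<^esub> l);
          T = (\<lambda>x s j y. tens x (g (n - 1) s j) y)
      in if int n - 2 * r > 0 then
           T one r i a
           + scl ((-1) powi (int n + r)) (T a r (i + 1) one)
           + scl ((-1) powi (int n + r)) (T (b \<cdot> pow (a \<cdot> b) (N - 1)) (r - 1) (i - 1) one)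
           + scl ((-1) ^ n) (T one (r - 1) i (b \<cdot> pow (a \<cdot> b) (N - 1)))
         else if int n - 2 * r < 0 then
           T one r i (a \<cdot> pow (b \<cdot> a) (N - 1))
           + scl ((-1) powi (int n + r)) (T (a \<cdot> pow (b \<cdot> a) (N - 1)) r (i + 1) one)
           + scl ((-1) powi (int n + r)) (T b (r - 1) (i - 1) one)
           + scl ((-1) ^ n) (T one (r - 1) i b)
         else
           (\<Sum>l\<in>{0..N - 1}.
             T (pow (b \<cdot> a) l) r i (a \<cdot> pow (b \<cdot> a) (N - 1 - l))
             + scl ((-1) ^ (n div 2)) (T (pow (a \<cdot> b) l \<cdot> a) r (i + 1) (pow (a \<cdot> b) (N - 1 - l)))
             + scl ((-1) ^ (n div 2)) (T (pow (b \<cdot> a) l \<cdot> b) (r - 1) (i - 1) (pow (b \<cdot> a) (N - 1 - l)))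
             + T (pow (a \<cdot> b) l) (r - 1) i (b \<cdot> pow (a \<cdot> b) (N - 1 - l))))"

text \<open>The inner sum has a single term, because \<open>(r, i) \<mapsto> g n r i\<close> is injective on the indices
  of \<open>B n\<close>.\<close>

definition diff :: "nat \<Rightarrow> 'k::field tens \<Rightarrow> 'k tens" where
  "diff n = lin_ext (\<lambda>(u, b, v).
     \<Sum>(r, i)\<in>{(r, i). 0 \<le> r \<and> r \<le> int n \<and> 0 \<le> i \<and> i < int m \<and> g n r i = b}.
       bimod u (diff_gen n r i) v)"

section \<open>Hochschild cohomology via the resolution\<close>

definition zero_cochain :: "nat \<Rightarrow> 'k::field pathvec \<Rightarrow> 'k elt" where
  "zero_cochain n = (\<lambda>b\<in>B n. \<zero>\<^bsub>A\<^esub>)"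

text \<open>An \<open>E\<^sup>e\<close>-linear map \<open>k B\<^sub>n \<rightarrow> A\<close> is given by its values on the basis, each parallel to the
  basis element.\<close>

definition cochains :: "nat \<Rightarrow> ('k::field pathvec \<Rightarrow> 'k elt) set" where
  "cochains n = {x \<in> B n \<rightarrow>\<^sub>E carrier A. \<forall>b\<in>B n. \<forall>j.
     (vert j \<star> b = b \<longrightarrow> cl (vert j) \<cdot> x b = x b) \<and>
     (b \<star> vert j = b \<longrightarrow> x b \<cdot> cl (vert j) = x b)}"

text \<open>\<open>ext x\<close> is the bimodule map \<open>u \<otimes> b \<otimes> v \<mapsto> u x(b) v\<close>; in particular \<open>ext cl\<close> is the
  augmentation on \<open>P\<^sub>0\<close>.\<close>

definition ext :: "('k::field pathvec \<Rightarrow> 'k elt) \<Rightarrow> 'k tens \<Rightarrow> 'k elt" where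
  "ext x f = (\<Oplus>\<^bsub>A\<^esub>t\<in>Poly_Mapping.keys f.
     sclA (Poly_Mapping.lookup f t) (case t of (u, b, v) \<Rightarrow> u \<cdot> x b \<cdot> v))"

definition codiff :: "nat \<Rightarrow> ('k::field pathvec \<Rightarrow> 'k elt) \<Rightarrow> ('k pathvec \<Rightarrow> 'k elt)" where
  "codiff n x = (\<lambda>b\<in>B (Suc n). ext x (diff (Suc n) (tens \<one>\<^bsub>A\<^esub> b \<one>\<^bsub>A\<^esub>)))"

definition cocycles :: "nat \<Rightarrow> ('k::field pathvec \<Rightarrow> 'k elt) set" where
  "cocycles n = {x \<in> cochains n. codiff n x = zero_cochain (Suc n)}"

definition coboundaries :: "nat \<Rightarrow> ('k::field pathvec \<Rightarrow> 'k elt) set" where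
  "coboundaries n = (case n of 0 \<Rightarrow> {zero_cochain 0} | Suc l \<Rightarrow> codiff l ` cochains l)"

definition HH_class :: "nat \<Rightarrow> ('k::field pathvec \<Rightarrow> 'k elt) \<Rightarrow> ('k pathvec \<Rightarrow> 'k elt) set" where
  "HH_class n x = {y \<in> cochains n. (\<lambda>b\<in>B n. y b \<ominus>\<^bsub>A\<^esub> x b) \<in> coboundaries n}"

definition HH :: "nat \<Rightarrow> ('k::field pathvec \<Rightarrow> 'k elt) set set" where
  "HH n = HH_class n ` cocycles n"

section \<open>Bar cochains and the Gerstenhaber bracket\<close>

definition tuples :: "nat \<Rightarrow> 'k::field elt list set" where
  "tuples n = {xs. length xs = n \<and> set xs \<subseteq> carrier A}"

definition bar_cochains :: "nat \<Rightarrow> ('k::field elt list \<Rightarrow> 'k elt) set" where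
  "bar_cochains n = {f \<in> tuples n \<rightarrow>\<^sub>E carrier A.
     \<forall>xs ys x y c. xs @ x # ys \<in> tuples n \<and> y \<in> carrier A \<longrightarrow>
       f (xs @ (x \<oplus>\<^bsub>A\<^esub> y) # ys) = f (xs @ x # ys) \<oplus>\<^bsub>A\<^esub> f (xs @ y # ys) \<and>
       f (xs @ sclA c x # ys) = sclA c (f (xs @ x # ys))}"

definition merge :: "nat \<Rightarrow> 'k::field elt list \<Rightarrow> 'k elt list" where
  "merge i xs = take (i - 1) xs @ (xs ! (i - 1) \<cdot> xs ! i) # drop (i + 1) xs"

definition bar_codiff :: "nat \<Rightarrow> ('k::field elt list \<Rightarrow> 'k elt) \<Rightarrow> ('k elt list \<Rightarrow> 'k elt)" where
  "bar_codiff n f = (\<lambda>xs\<in>tuples (Suc n).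
     hd xs \<cdot> f (tl xs)
     \<oplus>\<^bsub>A\<^esub> (\<Oplus>\<^bsub>A\<^esub>i\<in>{1..n}. sclA ((-1) ^ i) (f (merge i xs)))
     \<oplus>\<^bsub>A\<^esub> sclA ((-1) ^ Suc n) (f (butlast xs) \<cdot> last xs))"

definition bar_coboundaries :: "nat \<Rightarrow> ('k::field elt list \<Rightarrow> 'k elt) set" where
  "bar_coboundaries n =
     (case n of 0 \<Rightarrow> {\<lambda>xs\<in>tuples 0. \<zero>\<^bsub>A\<^esub>} | Suc l \<Rightarrow> bar_codiff l ` bar_cochains l)"

definition bar_class :: "nat \<Rightarrow> ('k::field elt list \<Rightarrow> 'k elt) \<Rightarrow> ('k elt list \<Rightarrow> 'k elt) set" where
  "bar_class n f =
     {h \<in> bar_cochains n. (\<lambda>xs\<in>tuples n. h xs \<ominus>\<^bsub>A\<^esub> f xs) \<in> bar_coboundaries n}"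

text \<open>If both degrees are \<open>0\<close> the bracket would have degree \<open>-1\<close>; then both compositions are empty
  sums, and with truncated subtraction the bracket below is the zero cochain of degree \<open>0\<close>.\<close>

definition gcirc :: "nat \<Rightarrow> nat \<Rightarrow> ('k::field elt list \<Rightarrow> 'k elt) \<Rightarrow> ('k elt list \<Rightarrow> 'k elt)
    \<Rightarrow> ('k elt list \<Rightarrow> 'k elt)" where
  "gcirc n q f h = (\<lambda>xs\<in>tuples (n + q - 1).
     \<Oplus>\<^bsub>A\<^esub>i\<in>{1..n}. sclA ((-1) powi ((int q - 1) * (int i - 1)))
       (f (take (i - 1) xs @ h (take q (drop (i - 1) xs)) # drop (i - 1 + q) xs)))"

definition gbracket :: "nat \<Rightarrow> nat \<Rightarrow> ('k::field elt list \<Rightarrow> 'k elt) \<Rightarrow> ('k elt list \<Rightarrow> 'k elt)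
    \<Rightarrow> ('k elt list \<Rightarrow> 'k elt)" where
  "gbracket n q f h = (\<lambda>xs\<in>tuples (n + q - 1).
     gcirc n q f h xs
     \<ominus>\<^bsub>A\<^esub> sclA ((-1) powi ((int n - 1) * (int q - 1))) (gcirc q n h f xs))"

definition class_bracket :: "nat \<Rightarrow> nat \<Rightarrow> ('k::field elt list \<Rightarrow> 'k elt) set
    \<Rightarrow> ('k elt list \<Rightarrow> 'k elt) set \<Rightarrow> ('k elt list \<Rightarrow> 'k elt) set" where
  "class_bracket n q X Y = (\<Union>f\<in>X. \<Union>h\<in>Y. bar_class (n + q - 1) (gbracket n q f h))"

section \<open>Comparison with the bar resolution\<close>

text \<open>A bimodule map from the \<open>n\<close>-th bar module \<open>A\<^bsup>\<otimes>(n+2)\<^esup>\<close> to \<open>P\<^sub>n\<close> is the same as a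
  \<open>k\<close>-multilinear map on \<open>A\<^sup>n\<close>, the image of \<open>1 \<otimes> x\<^sub>1 \<otimes> \<dots> \<otimes> x\<^sub>n \<otimes> 1\<close>. In these terms the
  predicate says that \<open>\<Phi>\<close> is a chain map lifting the identity of \<open>A\<close>, from the bar resolution to
  \<open>P\<close> with every differential replaced by its negative.\<close>

definition comparison_map :: "(nat \<Rightarrow> 'k::field elt list \<Rightarrow> 'k tens) \<Rightarrow> bool" where
  "comparison_map \<Phi> \<longleftrightarrow>
     (\<forall>n. \<forall>xs\<in>tuples n. \<Phi> n xs \<in> F n) \<and>
     (\<forall>n xs ys x y c. xs @ x # ys \<in> tuples n \<and> y \<in> carrier A \<longrightarrow>
        \<Phi> n (xs @ (x \<oplus>\<^bsub>A\<^esub> y) # ys) - (\<Phi> n (xs @ x # ys) + \<Phi> n (xs @ y # ys)) \<in> U n \<and>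
        \<Phi> n (xs @ sclA c x # ys) - scl c (\<Phi> n (xs @ x # ys)) \<in> U n) \<and>
     ext cl (\<Phi> 0 []) = \<one>\<^bsub>A\<^esub> \<and>
     (\<forall>n. \<forall>xs\<in>tuples (Suc n).
        - diff (Suc n) (\<Phi> (Suc n) xs)
        - (bimod (hd xs) (\<Phi> n (tl xs)) \<one>\<^bsub>A\<^esub>
           + (\<Sum>i\<in>{1..n}. scl ((-1) ^ i) (\<Phi> n (merge i xs)))
           + scl ((-1) ^ Suc n) (bimod \<one>\<^bsub>A\<^esub> (\<Phi> n (butlast xs)) (last xs))) \<in> U n)"

definition to_bar :: "(nat \<Rightarrow> 'k::field elt list \<Rightarrow> 'k tens) \<Rightarrow> nat \<Rightarrow> ('k pathvec \<Rightarrow> 'k elt) set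
    \<Rightarrow> ('k elt list \<Rightarrow> 'k elt) set" where
  "to_bar \<Phi> n X = (\<Union>x\<in>X. bar_class n (\<lambda>xs\<in>tuples n. ext x (\<Phi> n xs)))"

text \<open>The identity \<open>[x, y] = z\<close> between the classes of the cocycles \<open>x\<close>, \<open>y\<close>, \<open>z\<close>, the first two of
  degrees \<open>n\<close> and \<open>q\<close>: the bracket is computed in bar cohomology, with which \<open>HH\<close> is identified by
  means of \<open>\<Phi>\<close>.\<close>

definition bracket_is :: "(nat \<Rightarrow> 'k::field elt list \<Rightarrow> 'k tens) \<Rightarrow> nat \<Rightarrow> ('k pathvec \<Rightarrow> 'k elt)
    \<Rightarrow> nat \<Rightarrow> ('k pathvec \<Rightarrow> 'k elt) \<Rightarrow> ('k pathvec \<Rightarrow> 'k elt) \<Rightarrow> bool" where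
  "bracket_is \<Phi> n x q y z \<longleftrightarrow>
     x \<in> cocycles n \<and> y \<in> cocycles q \<and> z \<in> cocycles (n + q - 1) \<and>
     class_bracket n q (to_bar \<Phi> n (HH_class n x)) (to_bar \<Phi> q (HH_class q y))
       = to_bar \<Phi> (n + q - 1) (HH_class (n + q - 1) z)"

section \<open>The elements\<close>

definition cochain_add :: "nat \<Rightarrow> ('k::field pathvec \<Rightarrow> 'k elt) \<Rightarrow> ('k pathvec \<Rightarrow> 'k elt)
    \<Rightarrow> ('k pathvec \<Rightarrow> 'k elt)" where
  "cochain_add n x y = (\<lambda>h\<in>B n. x h \<oplus>\<^bsub>A\<^esub> y h)"

definition cochain_scl :: "nat \<Rightarrow> 'k::field \<Rightarrow> ('k pathvec \<Rightarrow> 'k elt) \<Rightarrow> ('k pathvec \<Rightarrow> 'k elt)" where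
  "cochain_scl n c x = (\<lambda>h\<in>B n. sclA c (x h))"

definition parallel :: "nat \<Rightarrow> 'k::field pathvec \<Rightarrow> 'k elt \<Rightarrow> ('k pathvec \<Rightarrow> 'k elt)" where
  "parallel n b u = (\<lambda>h\<in>B n. if h = b then u else \<zero>\<^bsub>A\<^esub>)"

definition cyc_sum :: "nat \<Rightarrow> (int \<Rightarrow> 'k::field pathvec \<Rightarrow> 'k elt) \<Rightarrow> ('k pathvec \<Rightarrow> 'k elt)" where
  "cyc_sum n x = (\<lambda>h\<in>B n. \<Oplus>\<^bsub>A\<^esub>i\<in>{0..<int m}. x i h)"

text \<open>A central element \<open>z\<close> is the \<open>0\<close>-cocycle \<open>e\<^sub>j \<mapsto> e\<^sub>j z\<close>.\<close>

definition central :: "'k::field elt \<Rightarrow> ('k pathvec \<Rightarrow> 'k elt)" where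
  "central z = (\<lambda>h\<in>B 0. cl h \<cdot> z)"

definition eps :: "int \<Rightarrow> ('k::field pathvec \<Rightarrow> 'k elt)" where
  "eps i = central (cl ((arr i \<star> arr' i) [^]\<^bsub>KQ\<^esub> N))"

definition fc :: "int \<Rightarrow> ('k::field pathvec \<Rightarrow> 'k elt)" where
  "fc i = central (cl (arr i \<star> arr' i + arr' i \<star> arr i))"

definition phi_1_0 :: "'k::field pathvec \<Rightarrow> 'k elt" where
  "phi_1_0 = cyc_sum 1 (\<lambda>i. parallel 1 (g 1 0 i) (cl (arr i)))"

definition psi_1_0 :: "'k::field pathvec \<Rightarrow> 'k elt" where
  "psi_1_0 = cyc_sum 1 (\<lambda>i. parallel 1 (g 1 1 i) (cl (arr' (i - 1))))"

definition chi_2_0 :: "'k::field pathvec \<Rightarrow> 'k elt" where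
  "chi_2_0 = cyc_sum 2 (\<lambda>i. parallel 2 (g 2 1 i) (sclA ((-1) powi i) (cl (vert i))))"

text \<open>In the names below \<open>m1\<close> stands for \<open>m - 1\<close>, \<open>pos\<close> for the second index \<open>1\<close> and \<open>neg\<close> for the
  second index \<open>-1\<close>.\<close>

definition phi_m1_neg :: "'k::field pathvec \<Rightarrow> 'k elt" where
  "phi_m1_neg = cyc_sum (m - 1) (\<lambda>i. parallel (m - 1) (g (m - 1) (int m - 1) i)
     (sclA ((-1) powi i) (cl (arr i \<star> (arr' i \<star> arr i) [^]\<^bsub>KQ\<^esub> (N - 1)))))"

definition psi_m1_pos :: "'k::field pathvec \<Rightarrow> 'k elt" where
  "psi_m1_pos = cyc_sum (m - 1) (\<lambda>i. parallel (m - 1) (g (m - 1) 0 i)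
     (sclA ((-1) powi i) (cl (arr' (i - 1) \<star> (arr (i - 1) \<star> arr' (i - 1)) [^]\<^bsub>KQ\<^esub> (N - 1)))))"

definition chi_m_pos :: "'k::field pathvec \<Rightarrow> 'k elt" where
  "chi_m_pos = cyc_sum m (\<lambda>i. parallel m (g m 0 i) (cl (vert i)))"

definition chi_m_neg :: "'k::field pathvec \<Rightarrow> 'k elt" where
  "chi_m_neg = cyc_sum m (\<lambda>i. parallel m (g m (int m) i) (cl (vert i)))"

end

end

theory Submission imports Defs
begin

text \<open>Alternating paths form a basis of \<open>A\<close>, which makes the resolution an explicit complex with a contracting
 homotopy and two gradings, counting the arrows \<open>a\<close> and a-bar. Comparison maps are unique up to homotopy, so
 brackets may be computed with a bihomogeneous one, and most of them vanish because no cochain has the required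
 bidegree. Brackets with the central \<open>\<epsilon>\<^sub>i\<close> are read off an explicit homotopy between left and right
 multiplication by \<open>\<epsilon>\<^sub>i\<close> on the resolution. As \<open>\<phi>\<close> is \<open>-[\<epsilon>\<^sub>0, \<chi>]\<close> for \<open>\<chi>\<close> of degree \<open>m\<close>, and \<open>[\<epsilon>\<^sub>0, \<chi>\<^sub>2]\<close> is a
 multiple of the derivation given by the grading, the Jacobi identity yields \<open>[\<chi>\<^sub>2, \<phi>] = \<chi>\<close>. The symmetry
 exchanging \<open>a\<close> and a-bar gives the rest.\<close>

text \<open>The contraction comes from filtering the complex by the length of the left factor: a
  simple formula contracts the part of the differential that keeps this length, every correction
  lengthens the left factor, and words longer than \<open>2 * N\<close> vanish, so finitely many
  corrections suffice. The homotopy for \<open>eps\<close> is written down only on a small set of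
  generators and extended by the contraction, which respects the bidegree. The bidegree is decisive
  because on an alternating path the two numbers of arrows differ by at most one and neither exceeds
  \<open>N\<close>, while those of a bracket are fixed by its arguments. Two points escape this
  count. For \<open>N = 1\<close> paths of length at most one leave room for the brackets of
  \<open>phi\<close> with \<open>psi\<close> and of either with \<open>chi\<close> of the other
  orientation, so these are treated for \<open>N > 1\<close>. For \<open>f\<close> and
  \<open>chi\<close> of degree \<open>m\<close>, with \<open>N > 1\<close>, single arrows remain as
  possible values and are excluded by the cocycle condition. Evenness of \<open>m\<close> makes the
  signs \<open>(-1)^i\<close> well defined on residues; invertibility of \<open>m\<close> lets a
  cocycle supported between two vertices be spread evenly over the cycle.\<close>

abbreviation "ks == Poly_Mapping.keys"

abbreviation "lk == Poly_Mapping.lookup"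

abbreviation Iff (infixr "<->" 25) where "P <-> Q == (P :: bool) = Q"

section \<open>Linear maps between free vector spaces\<close>

abbreviation bs :: "'s => ('s \<Rightarrow>\<^sub>0 'k::field)" where
 "bs s \<equiv> Poly_Mapping.single s 1"

lemma lookup_scl [simp]: "lk (scl c x) s = c * lk x s"
 by (simp add: scl_def Poly_Mapping.map.rep_eq when_def)

lemma scl_add: "scl c (x + y) = scl c x + scl c y"
 by (rule poly_mapping_eqI) (simp add: lookup_add algebra_simps)

lemma scl_add_left: "scl (c + d) x = scl c x + scl d x"
 by (rule poly_mapping_eqI) (simp add: lookup_add algebra_simps)

lemma scl_scl [simp]: "scl c (scl d x) = scl (c * d) x"
 by (rule poly_mapping_eqI) simp

lemma scl_1 [simp]: "scl 1 x = x"
 by (rule poly_mapping_eqI) simp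

lemma scl_zero_left [simp]: "scl 0 x = 0"
 by (rule poly_mapping_eqI) simp

lemma scl_zero [simp]: "scl c 0 = 0"
 by (rule poly_mapping_eqI) simp

lemma scl_minus_left: "scl (- c) x = - scl c x"
 by (rule poly_mapping_eqI) simp

lemma scl_minus: "scl c (- x) = - scl c x"
 by (rule poly_mapping_eqI) simp

lemma scl_diff: "scl c (x - y) = scl c x - scl c y"
 by (rule poly_mapping_eqI) (simp add: lookup_minus algebra_simps)

lemma scl_sum: "scl c (sum f S) = (SUM s:S. scl c (f s))"
 by (induction S rule: infinite_finite_induct) (auto simp: scl_add)

lemma scl_single [simp]: "scl c (Poly_Mapping.single s d) = Poly_Mapping.single s (c * d)"
 by (rule poly_mapping_eqI) (simp add: lookup_single when_def)

lemma keys_scl: "ks (scl c x) <= ks x"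
 by (auto simp: in_keys_iff)

lemma pm_decomp: "x = (SUM s:ks x. scl (lk x s) (bs s))"
proof (rule poly_mapping_eqI)
 fix t
 have "lk (SUM s:ks x. scl (lk x s) (bs s)) t
   = (SUM s:ks x. if s = t then lk x s else 0)"
  unfolding lookup_sum by (rule sum.cong) (auto simp: lookup_single when_def)
 also have "... = lk x t"
  by (simp add: sum.delta in_keys_iff)
 finally show "lk x t
   = lk (SUM s:ks x. scl (lk x s) (bs s)) t"
  by simp
qed

definition lin :: "(('s \<Rightarrow>\<^sub>0 'k::field) => ('t \<Rightarrow>\<^sub>0 'k)) => bool" where
 "lin f <-> (ALL x y. f (x + y) = f x + f y) & (ALL c x. f (scl c x) = scl c (f x))"

lemma linI: "(!!x y. f (x + y) = f x + f y) ==> (!!c x. f (scl c x) = scl c (f x)) ==> lin f"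
 by (simp add: lin_def)

lemma lin_add: "lin f ==> f (x + y) = f x + f y"
 and lin_scl: "lin f ==> f (scl c x) = scl c (f x)"
 by (auto simp: lin_def)

lemma lin_0: "lin f ==> f 0 = 0"
 using lin_scl[of f 0 0] by simp

lemma lin_minus: "lin f ==> f (- x) = - f x"
 using lin_scl[of f "-1" x] by (simp add: scl_minus_left)

lemma lin_diff: "lin f ==> f (x - y) = f x - f y"
 using lin_add[of f x "- y"] lin_minus[of f y] by simp

lemma lin_sum: "lin f ==> f (sum h S) = (SUM s:S. f (h s))"
 by (induction S rule: infinite_finite_induct) (auto simp: lin_0 lin_add)

lemma lin_id [simp]: "lin (%x. x)"
 by (simp add: lin_def)

lemma lin_const0 [simp]: "lin (%x. 0)"
 by (simp add: lin_def)

lemma lin_compose: "lin f ==> lin h ==> lin (%x. f (h x))"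
 by (simp add: lin_def)

lemma lin_plus: "lin f ==> lin h ==> lin (%x. f x + h x)"
 by (simp add: lin_def scl_add)

lemma lin_sub: "lin f ==> lin h ==> lin (%x. f x - h x)"
 by (simp add: lin_def scl_diff)

lemma lin_uminus: "lin f ==> lin (%x. - f x)"
 by (simp add: lin_def scl_minus)

lemma lin_sclI: "lin f ==> lin (%x. scl c (f x))"
 by (simp add: lin_def scl_add mult.commute)

lemma lin_sumI: "(!!s. s : S ==> lin (f s)) ==> lin (%x. SUM s:S. f s x)"
 by (simp add: lin_def sum.distrib scl_sum)

lemma lin_expand: "lin f ==> f x = (SUM s:ks x. scl (lk x s) (f (bs s)))"
 by (subst (1) pm_decomp) (simp only: lin_sum lin_scl)

lemma lin_ext_expand: "finite S ==> ks x <= S ==>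
 lin_ext h x = (SUM s:S. scl (lk x s) (h s))"
 unfolding lin_ext_def by (rule sum.mono_neutral_left) (auto simp: in_keys_iff)

lemma lin_lin_ext [simp]: "lin (lin_ext h)"
proof (rule linI)
 fix x y :: "'a \<Rightarrow>\<^sub>0 'b"
 let ?S = "ks x \<union> ks y"
 have "lin_ext h (x + y) = (SUM s:?S. scl (lk (x + y) s) (h s))"
  by (rule lin_ext_expand) (auto simp: Poly_Mapping.keys_add)
 moreover have "lin_ext h x = (SUM s:?S. scl (lk x s) (h s))"
  by (rule lin_ext_expand) auto
 moreover have "lin_ext h y = (SUM s:?S. scl (lk y s) (h s))"
  by (rule lin_ext_expand) auto
 ultimately show "lin_ext h (x + y) = lin_ext h x + lin_ext h y"
  by (simp add: lookup_add scl_add_left sum.distrib)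
next
 fix c :: 'b and x :: "'a \<Rightarrow>\<^sub>0 'b"
 have "lin_ext h (scl c x) = (SUM s:ks x. scl (lk (scl c x) s) (h s))"
  by (rule lin_ext_expand) (auto simp: keys_scl[THEN subsetD])
 thus "lin_ext h (scl c x) = scl c (lin_ext h x)"
  by (simp add: lin_ext_def scl_sum)
qed

lemma lin_ext_bs [simp]: "lin_ext h (bs s) = h s"
 by (simp add: lin_ext_def)

lemma lin_lin_extD: "(!!s. lin (%x. h x s)) ==> lin (%x. lin_ext (h x) z)"
 unfolding lin_ext_def by (intro lin_sumI lin_sclI)

lemma lin_eqI:
 assumes "lin f" "lin h" "!!s. s : ks x ==> f (bs s) = h (bs s)"
 shows "f x = h x"
 using assms by (simp add: lin_expand[of f x] lin_expand[of h x])

lemma keys_lin: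
 assumes "lin f" "!!s. s : ks x ==> ks (f (bs s)) <= K"
 shows "ks (f x) <= K"
proof -
 have "ks (f x) <= (\<Union>s\<in>ks x.
   ks (scl (lk x s) (f (bs s))))"
  unfolding lin_expand[OF assms(1), of x] by (rule keys_sum)
 with assms(2) show ?thesis by (meson SUP_least keys_scl order_trans)
qed

lemma keys_bs [simp]: "ks (bs s :: _ \<Rightarrow>\<^sub>0 'k::field) = {s}"
 by simp

lemma bs_nz [simp]: "(bs s :: _ \<Rightarrow>\<^sub>0 'k::field) ~= 0"
 by (metis keys_bs keys_zero empty_not_insert)

lemma keys_addI: "ks x <= K ==> ks y <= K ==> ks (x + y) <= K"
 using Poly_Mapping.keys_add[of x y] by blast

lemma keys_diffI: "ks x <= K ==> ks y <= K ==>
 ks ((x :: _ \<Rightarrow>\<^sub>0 'k::field) - y) <= K"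
 using Poly_Mapping.keys_diff[of x y] by blast

lemma keys_sumI: "(!!s. s : S ==> ks (f s) <= K) ==> ks (sum f S) <= K"
 using keys_sum[of f S] by blast

lemma keys_sclI: "ks x <= K ==> ks (scl c x) <= K"
 using keys_scl[of c x] by blast

text \<open>Signs act on an arbitrary abelian group and take integer exponents, so that one calculus
  serves algebra elements, chains and cochains; sign identities then reduce to a parity split via
  \<open>sg_def\<close>.\<close>

definition sg :: "int => 'a => 'a::ab_group_add" where
 "sg n x = (if even n then x else - x)"

lemma sg_0 [simp]: "sg 0 x = x" and sg_1 [simp]: "sg 1 x = - x"
 and sg_zero [simp]: "sg n 0 = 0" and sg_sg: "sg n (sg k x) = sg (n + k) x"
 and sg_add: "sg n (x + y) = sg n x + sg n y" and sg_diff: "sg n (x - y) = sg n x - sg n y"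
 and sg_minus: "sg n (- x) = - sg n x"
 by (auto simp: sg_def)

lemma sg_scl: "sg n x = scl (if even n then 1 else -1) x"
 by (auto simp: sg_def scl_minus_left)

lemma sg_sum: "sg n (sum f S) = (SUM s:S. sg n (f s))"
 by (auto simp: sg_def sum_negf)

lemma sg_lin: "lin f ==> f (sg n x) = sg n (f x)"
 by (auto simp: sg_def lin_minus)

lemma lin_sg: "lin f ==> lin (%x. sg n (f x))"
 by (simp add: sg_scl lin_sclI)

lemma scl_sg: "scl c (sg n x) = sg n (scl c x)"
 by (auto simp: sg_def scl_minus)

lemma sg_parity: "even (n + k) ==> sg n x = sg k x"
 by (auto simp: sg_def)

lemma keys_sg [simp]: "ks (sg n (x :: _ \<Rightarrow>\<^sub>0 'k::field)) = ks x"
 by (simp add: sg_def)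

lemma lin_if: "lin f ==> lin h ==> lin (%x. if P then f x else h x)"
 by (cases P) simp_all

lemmas lin_intros = lin_if lin_id lin_const0 lin_plus lin_sub lin_uminus lin_sclI lin_sumI lin_lin_ext lin_sg

section \<open>The algebra on its basis of alternating paths\<close>

text \<open>The pair \<open>(i, k)\<close> encodes the alternating path of length \<open>\<bar>k\<bar>\<close> from \<open>i\<close>, starting with \<open>a\<close> if
 \<open>k > 0\<close> and with a-bar if \<open>k < 0\<close>. In length \<open>2 * N\<close> the two paths agree in the algebra, and \<open>nrm\<close> picks
 \<open>k > 0\<close>. Pairs violating \<open>val\<close> are junk: every product with them vanishes, hence \<open>wd 0\<close> is
 a unit only on the span of the others.\<close>

type_synonym bas = "int \<times> int"
type_synonym 'k vv = "bas \<Rightarrow>\<^sub>0 'k"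

locale bis = biserial N m for N m :: nat +
 assumes N1: "N >= 1" and m3: "m >= 3" and m_even: "even m"
begin

abbreviation M :: int where "M \<equiv> int m"
abbreviation NN :: int where "NN \<equiv> 2 * int N"

lemma M_pos: "M > 0" and NN_pos: "NN >= 2" and M3: "M >= 3"
 using m3 N1 by auto

definition nrm :: "int => int" where
 "nrm k = (if k = - NN then NN else k)"

definition val :: "bas => bool" where
 "val p <-> 0 <= fst p & fst p < M & - NN < snd p & snd p <= NN"

text \<open>Displacement of the end vertex along a path: the letters of an alternating word cancel
  in pairs, so only words of odd length move, in the direction of their first letter.\<close>

definition sft :: "int => int" where
 "sft k = (if even k then 0 else if k > 0 then 1 else -1)"

definition en :: "bas => int" where
 "en p = (fst p + sft (snd p)) mod M"

text \<open>A word of even length ends with the letter opposite to its first one, so the next word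
  must begin like it; after a word of odd length it must begin with the other letter.\<close>

definition fits :: "int => int => bool" where
 "fits k l <-> k = 0 | l = 0 | (even k <-> (0 < k <-> 0 < l))"

definition jn :: "int => int => int" where
 "jn k l = (if k = 0 then l else if l = 0 then k else if k > 0 then k + \<bar>l\<bar> else k - \<bar>l\<bar>)"

text \<open>The bound on the lengths encodes the relations: a word longer than \<open>2 * N\<close>
  contains a power \<open>(a a-bar)^N\<close> or \<open>(a-bar a)^N\<close> next to another letter,
  and exchanging the two powers produces a repeated letter.\<close>

definition mulb :: "bas => bas => 'k::field vv" where
 "mulb p q = (if val p & val q & en p = fst q & fits (snd p) (snd q)
   & \<bar>snd p\<bar> + \<bar>snd q\<bar> <= NN then bs (fst p, nrm (jn (snd p) (snd q))) else 0)"

definition mul :: "'k::field vv => 'k vv => 'k vv" (infixl "<>" 70) where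
 "x <> y = lin_ext (%p. lin_ext (mulb p) y) x"

lemma mul_lin1 [simp]: "lin (%x. x <> y)"
 unfolding mul_def by simp

lemma mul_lin2 [simp]: "lin (%y. x <> y)"
 unfolding mul_def by (rule lin_lin_extD) simp

lemma mul_bs [simp]: "bs p <> bs q = mulb p q"
 by (simp add: mul_def)

lemmas mul_add_left = lin_add[OF mul_lin1] and mul_add_right = lin_add[OF mul_lin2]
 and mul_scl_left = lin_scl[OF mul_lin1] and mul_scl_right = lin_scl[OF mul_lin2]
 and mul_0_left [simp] = lin_0[OF mul_lin1] and mul_0_right [simp] = lin_0[OF mul_lin2]
 and mul_minus_left = lin_minus[OF mul_lin1] and mul_minus_right = lin_minus[OF mul_lin2]
 and mul_diff_left = lin_diff[OF mul_lin1] and mul_diff_right = lin_diff[OF mul_lin2]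
 and mul_sum_left = lin_sum[OF mul_lin1] and mul_sum_right = lin_sum[OF mul_lin2]
 and mul_sg_left = sg_lin[OF mul_lin1] and mul_sg_right = sg_lin[OF mul_lin2]

lemma lin_mul1: "lin f ==> lin (%x. f x <> y)"
 by (rule lin_compose[OF mul_lin1])

lemma lin_mul2: "lin f ==> lin (%x. y <> f x)"
 by (rule lin_compose[OF mul_lin2])

lemma nrm_id: "\<bar>k\<bar> < NN ==> nrm k = k"
 by (auto simp: nrm_def)

lemma jn_nz: "k ~= 0 ==> l ~= 0 ==> jn k l ~= 0"
 and jn_pos: "k ~= 0 ==> 0 < jn k l <-> 0 < k"
 and jn_even: "even (jn k l) <-> even (k + l)"
 and jn_abs: "\<bar>jn k l\<bar> = \<bar>k\<bar> + \<bar>l\<bar>"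
 by (auto simp: jn_def)

lemma jn_0 [simp]: "jn 0 l = l" "jn k 0 = k"
 by (auto simp: jn_def)

lemma fits_0 [simp]: "fits 0 l" "fits k 0"
 by (auto simp: fits_def)

lemma abs_nrm [simp]: "\<bar>nrm k\<bar> = \<bar>k\<bar>" and sft_nrm [simp]: "sft (nrm k) = sft k"
 and nrm_nrm [simp]: "nrm (nrm k) = nrm k" and nrm_0 [simp]: "nrm 0 = 0"
 using NN_pos by (auto simp: nrm_def sft_def)

lemma nrm_range: "\<bar>k\<bar> <= NN ==> - NN < nrm k & nrm k <= NN"
 using NN_pos by (auto simp: nrm_def)

lemma sft_jn: "fits k l ==> sft (jn k l) = sft k + sft l"
 by (cases "k = 0"; cases "l = 0") (auto simp: sft_def jn_pos jn_even fits_def)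

lemma jn_props:
 assumes "fits k l" "- NN < k" "k <= NN" "- NN < l" "l <= NN" "\<bar>k\<bar> + \<bar>l\<bar> <= NN"
 shows "\<bar>nrm (jn k l)\<bar> = \<bar>k\<bar> + \<bar>l\<bar>" "sft (nrm (jn k l)) = sft k + sft l"
  "- NN < nrm (jn k l)" "nrm (jn k l) <= NN"
 using assms nrm_range[of "jn k l"] by (auto simp: jn_abs sft_jn)

text \<open>If all three words are nonempty, the partial products are shorter than
  \<open>2 * N\<close> and \<open>nrm\<close> does not act on them. Normalisation matters only when
  some factor is trivial, and these cases are checked separately.\<close>

lemma fits_assoc:
 assumes "\<bar>k\<bar> + \<bar>l\<bar> + \<bar>q\<bar> <= NN"
 shows "fits k l & fits (nrm (jn k l)) q <-> fits l q & fits k (nrm (jn l q))" (is ?A)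
  "fits k l ==> fits l q ==> nrm (jn (nrm (jn k l)) q) = nrm (jn k (nrm (jn l q)))" (is "PROP ?B")
proof -
 consider "k = 0" | "l = 0" | "q = 0" | "k ~= 0" "l ~= 0" "q ~= 0" by blast
 hence "(fits k l & fits (nrm (jn k l)) q <-> fits l q & fits k (nrm (jn l q))) &
  (fits k l --> fits l q --> nrm (jn (nrm (jn k l)) q) = nrm (jn k (nrm (jn l q))))"
 proof cases
  case 2
  thus ?thesis using assms by (cases "k = 0"; cases "q = 0") (auto simp: nrm_def)
 next
  case 1
  thus ?thesis using assms by (cases "l = 0"; cases "q = 0") (auto simp: nrm_def)
 next
  case 3
  thus ?thesis using assms by (cases "l = 0"; cases "k = 0") (auto simp: nrm_def)
 next
  case 4
  hence "\<bar>jn k l\<bar> < NN" "\<bar>jn l q\<bar> < NN" using assms by (auto simp: jn_abs)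
  hence n: "nrm (jn k l) = jn k l" "nrm (jn l q) = jn l q" by (auto simp: nrm_id)
  have "jn (jn k l) q = jn k (jn l q)" using 4
   by (cases "k > 0"; cases "l > 0") (auto simp: jn_def)
  moreover have "fits k l & fits (jn k l) q <-> fits l q & fits k (jn l q)"
   using 4 by (auto simp: fits_def jn_nz jn_pos jn_even)
  ultimately show ?thesis using n by simp
 qed
 thus ?A
  "PROP ?B"
  by auto
qed

lemma val_mod: "val p ==> fst p mod M = fst p"
 by (simp add: val_def)

lemma en_jn: "fits k l ==> en (i, nrm (jn k l)) = (en (i, k) + sft l) mod M"
 by (simp add: en_def sft_jn mod_add_left_eq add.assoc)

lemma mulb_assoc: "mulb p q <> bs r = bs p <> mulb q r"
proof -
 obtain i k j l h q' where e: "p = (i,k)" "q = (j,l)" "r = (h,q')" by (metis prod.exhaust)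
 define C where "C <-> val p & val q & val r & en p = j & en q = h
  & \<bar>k\<bar> + \<bar>l\<bar> + \<bar>q'\<bar> <= NN"
 have 1: "mulb p q <> bs r = (if C & fits k l & fits (nrm (jn k l)) q'
   then bs (i, nrm (jn (nrm (jn k l)) q')) else 0)"
 proof (cases "val p & val q & en p = fst q & fits k l & \<bar>k\<bar> + \<bar>l\<bar> <= NN")
  case True
  have "val (i, nrm (jn k l))" using True nrm_range[of "jn k l"] by (auto simp: val_def e jn_abs)
  moreover have "en (i, nrm (jn k l)) = en q"
   using True en_jn[of k l i] by (simp add: e) (simp add: en_def)
  ultimately show ?thesis using True by (auto simp: mulb_def e C_def jn_abs)
 next
  case False
  hence "mulb p q = (0 :: 'b vv)" by (auto simp: mulb_def e)
  with False show ?thesis by (auto simp: C_def e)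
 qed
 have 2: "bs p <> mulb q r = (if C & fits l q' & fits k (nrm (jn l q'))
   then bs (i, nrm (jn k (nrm (jn l q')))) else 0)"
 proof (cases "val q & val r & en q = fst r & fits l q' & \<bar>l\<bar> + \<bar>q'\<bar> <= NN")
  case True
  have "val (j, nrm (jn l q'))" using True nrm_range[of "jn l q'"] by (auto simp: val_def e jn_abs)
  thus ?thesis using True by (auto simp: mulb_def e C_def jn_abs)
 next
  case False
  hence "mulb q r = (0 :: 'b vv)" by (auto simp: mulb_def e)
  with False show ?thesis by (auto simp: C_def e)
 qed
 show ?thesis
  unfolding 1 2 using fits_assoc[of k l q'] by (auto simp: C_def)
qed

lemma mul_assoc: "(x <> y) <> z = x <> (y <> z)"
proof (rule lin_eqI[of "%x. (x <> y) <> z" "%x. x <> (y <> z)"])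
 fix p
 show "(bs p <> y) <> z = bs p <> (y <> z)"
 proof (rule lin_eqI[of "%y. (bs p <> y) <> z" "%y. bs p <> (y <> z)"])
  fix q
  show "(bs p <> bs q) <> z = bs p <> (bs q <> z)"
   by (rule lin_eqI[of "%z. (bs p <> bs q) <> z" "%z. bs p <> (bs q <> z)"])
    (auto simp: mulb_assoc intro!: lin_mul1 lin_mul2)
 qed (auto intro!: lin_mul1 lin_mul2)
qed (auto intro!: lin_mul1 lin_mul2)

text \<open>Summing over all start vertices removes indices from calculations with words;
  \<open>vt\<close> selects one vertex. Setting overlong words to zero lets \<open>wd_wd\<close>
  hold without any bound on the lengths.\<close>

definition wd :: "int => 'k::field vv" where
 "wd k = (if \<bar>k\<bar> <= NN then SUM i:{0..<M}. bs (i, nrm k) else 0)"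

definition vt :: "int => 'k::field vv" where
 "vt i = bs (i mod M, 0)"

lemma vt_mod [simp]: "vt (i mod M) = vt i"
 by (simp add: vt_def)

lemma vt_bs: "vt i <> bs p = (if val p & fst p = i mod M then bs p else 0)"
 using NN_pos M_pos by (auto simp: vt_def mulb_def en_def sft_def val_def jn_def fits_def nrm_def)

lemma bs_vt: "bs p <> vt i = (if val p & en p = i mod M then bs p else 0)"
 using NN_pos M_pos by (cases p) (auto simp: vt_def mulb_def sft_def val_def jn_def fits_def nrm_def)

lemma vt_wd: "vt i <> wd k = (if \<bar>k\<bar> <= NN then bs (i mod M, nrm k) else 0)"
proof -
 have "(SUM j:{0..<M}. vt i <> bs (j, nrm k)) = (SUM j:{0..<M}. if j = i mod M then bs (j, nrm k) else 0)"
  if "\<bar>k\<bar> <= NN" using nrm_range[OF that]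
  by (intro sum.cong) (auto simp: vt_bs val_def)
 thus ?thesis using M_pos by (auto simp: wd_def mul_sum_right)
qed

lemma wd_vt: "wd k <> vt (i + sft k) = (if \<bar>k\<bar> <= NN then bs (i mod M, nrm k) else 0)"
proof -
 have e: "(j + sft k) mod M = (i + sft k) mod M <-> j = i mod M" if "j : {0..<M}" for j
 proof -
  have "(j + sft k) mod M = (i + sft k) mod M <-> j mod M = i mod M"
   by (simp add: mod_eq_dvd_iff)
  thus ?thesis using that by auto
 qed
 have "(SUM j:{0..<M}. bs (j, nrm k) <> vt (i + sft k)) = (SUM j:{0..<M}. if j = i mod M then bs (j, nrm k) else 0)"
  if "\<bar>k\<bar> <= NN" using nrm_range[OF that] e
  by (intro sum.cong) (auto simp: bs_vt val_def en_def)
 thus ?thesis using M_pos by (auto simp: wd_def mul_sum_left)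
qed

lemma vt_wd_comm: "vt i <> wd k = wd k <> vt (i + sft k)"
 by (simp add: vt_wd wd_vt)

lemma wd_vt_comm: "wd k <> vt i = vt (i - sft k) <> wd k"
 by (simp add: vt_wd_comm)

lemma wd_0: "wd 0 = (SUM i:{0..<M}. vt i)"
 using NN_pos by (auto simp: wd_def vt_def nrm_def intro!: sum.cong)

lemma wd_0_bs: "wd 0 <> bs p = (if val p then bs p else 0)"
proof -
 have "wd 0 <> bs p = (SUM i:{0..<M}. if val p & fst p = i then bs p else 0)"
  unfolding wd_0 mul_sum_left by (intro sum.cong) (auto simp: vt_bs)
 thus ?thesis by (cases "val p") (auto simp: val_def)
qed

lemma bs_wd_0: "bs p <> wd 0 = (if val p then bs p else 0)"
proof -
 have "bs p <> wd 0 = (SUM i:{0..<M}. if val p & en p = i then bs p else 0)"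
  unfolding wd_0 mul_sum_right by (intro sum.cong) (auto simp: bs_vt)
 moreover have "en p : {0..<M}" using M_pos by (auto simp: en_def)
 ultimately show ?thesis by (cases "val p") (auto simp:)
qed

lemma wd_bs: "wd k <> bs (j, l) = (if \<bar>k\<bar> + \<bar>l\<bar> <= NN & fits k l & val (j, l)
  then bs ((j - sft k) mod M, nrm (jn k l)) else 0)"
proof (cases "val (j,l)")
 case False
 thus ?thesis by (simp add: wd_def mul_sum_left mulb_def)
next
 case v: True
 have "wd k <> bs (j, l) = wd k <> (vt j <> bs (j, l))" using v by (simp add: vt_bs val_def)
 also have "... = (wd k <> vt (j - sft k + sft k)) <> bs (j, l)" by (simp add: mul_assoc)
 also have "... = (if \<bar>k\<bar> <= NN then mulb ((j - sft k) mod M, nrm k) (j, l) else 0)"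
  by (subst wd_vt) simp
 also have "... = (if \<bar>k\<bar> + \<bar>l\<bar> <= NN & fits k l & val (j, l)
  then bs ((j - sft k) mod M, nrm (jn k l)) else 0)"
 proof (cases "\<bar>k\<bar> <= NN")
  case True
  have "val ((j - sft k) mod M, nrm k)" using M_pos nrm_range[OF True] by (auto simp: val_def)
  moreover have "en ((j - sft k) mod M, nrm k) = j"
   using v by (simp add: en_def val_def mod_add_left_eq)
  moreover have "\<bar>nrm k\<bar> = \<bar>k\<bar>" by (auto simp: nrm_def)
  moreover have "fits (nrm k) l = fits k l" "jn (nrm k) l = jn k l" if "\<bar>k\<bar> + \<bar>l\<bar> <= NN" "l ~= 0"
   using that by (auto simp: nrm_def)
  moreover have "fits (nrm k) 0 = fits k 0" "nrm (jn (nrm k) 0) = nrm (jn k 0)"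
   by (auto simp: nrm_def fits_def jn_def)
  ultimately show ?thesis using v True by (cases "l = 0") (auto simp: mulb_def)
 next
  case False
  thus ?thesis by auto
 qed
 finally show ?thesis .
qed

lemma wd_wd: "(wd k :: 'k::field vv) <> wd l = (if fits k l then wd (jn k l) else 0)"
proof (cases "\<bar>k\<bar> + \<bar>l\<bar> <= NN")
 case True
 hence l: "\<bar>l\<bar> <= NN" by simp
 have f: "fits k (nrm l) = fits k l" "nrm (jn k (nrm l)) = nrm (jn k l)"
  using True by (auto simp: nrm_def fits_def jn_def)
 have ab: "\<bar>nrm l\<bar> = \<bar>l\<bar>" by (auto simp: nrm_def)
 have "wd k <> wd l = (SUM j:{0..<M}. wd k <> bs (j, nrm l))"
  by (simp add: wd_def[of l] l mul_sum_right)
 also have "... = (SUM j:{0..<M}. if fits k l then bs ((j - sft k) mod M, nrm (jn k l)) else 0)"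
  using nrm_range[OF l] ab True f by (intro sum.cong) (auto simp: wd_bs val_def)
 also have "... = (if fits k l then SUM j:{0..<M}. bs ((j - sft k) mod M, nrm (jn k l)) else 0)"
  by simp
 also have "(SUM j:{0..<M}. bs ((j - sft k) mod M, nrm (jn k l))) = (SUM j:{0..<M}. bs (j, nrm (jn k l)))"
  by (rule sum.reindex_bij_witness[of _ "%j. (j + sft k) mod M" "%j. (j - sft k) mod M"])
   (use M_pos in \<open>auto simp: mod_add_left_eq mod_diff_left_eq\<close>)
 finally show ?thesis using True by (auto simp: wd_def jn_def)
next
 case False
 have z: "wd (jn k l) = (0 :: 'k vv)" if "fits k l" using False by (auto simp: wd_def jn_def)
 have "wd k <> wd l = (0 :: 'k vv)"
 proof (cases "\<bar>l\<bar> <= NN")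
  case True
  have ab: "\<bar>nrm l\<bar> = \<bar>l\<bar>" by (auto simp: nrm_def)
  have "wd k <> wd l = (SUM j:{0..<M}. wd k <> (bs (j, nrm l) :: 'k vv))"
   by (simp add: wd_def[of l] True mul_sum_right)
  also have "... = 0" using False ab by (intro sum.neutral) (auto simp: wd_bs)
  finally show ?thesis .
 qed (simp add: wd_def)
 with z show ?thesis by simp
qed

lemma wd_NN: "wd (- NN) = wd NN"
 by (simp add: wd_def nrm_def)

lemma vt_vt: "vt i <> vt j = (if i mod M = j mod M then vt i else 0)"
 using vt_bs[of i "(j mod M, 0)"] M_pos NN_pos by (auto simp: vt_def val_def)

lemma bs_eq: "val (i, k) ==> bs (i, k) = vt i <> wd k"
 using nrm_range by (auto simp: vt_wd val_def nrm_def)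

lemma keys_mul:
 fixes x y :: "'k::field vv"
 shows "ks (x <> y) <= Collect val"
proof -
 have 1: "ks (mulb p q :: 'k vv) <= Collect val" for p q
  using jn_props[of "snd p" "snd q"] by (auto simp: mulb_def val_def)
 have 2: "ks (bs p <> y) <= Collect val" for p
  by (rule keys_lin[OF mul_lin2]) (use 1 in simp)
 show ?thesis by (rule keys_lin[OF mul_lin1]) (use 2 in simp)
qed

end

section \<open>The small complex and its differential\<close>

text \<open>The triple \<open>(s, r, i)\<close> stands for \<open>g (s + r) r i\<close>, and \<open>T x w y\<close> for the tensor of \<open>x\<close>, \<open>w\<close>, \<open>y\<close> over
 the vertices.\<close>

type_synonym gen = "int \<times> int \<times> int"
type_synonym 'k pp = "(bas \<times> gen \<times> bas) \<Rightarrow>\<^sub>0 'k"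
type_synonym 'k gv = "gen => 'k vv"
type_synonym 'k co = "'k vv list => 'k vv"
type_synonym 'k fam = "nat => 'k vv list => 'k pp"

lemma lin_ext_0 [simp]: "lin_ext h 0 = 0"
 by (rule lin_0) simp

context bis begin

fun sr :: "gen => int" where "sr (s, r, i) = i mod M"
fun tg :: "gen => int" where "tg (s, r, i) = (i + s - r) mod M"
fun ng :: "gen => gen" where "ng (s, r, i) = (s, r, i mod M)"
fun dgr :: "gen => int" where "dgr (s, r, i) = s + r"
fun nn :: "gen => bool" where "nn (s, r, i) <-> s >= 0 & r >= 0"

definition okk :: "bas => gen => bas => bool" where
 "okk u w v <-> val u & val v & en u = sr w & fst v = tg w & nn w"

lemma sr_ng [simp]: "sr (ng w) = sr w" and tg_ng [simp]: "tg (ng w) = tg w"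
 and ng_ng [simp]: "ng (ng w) = ng w" and nn_ng [simp]: "nn (ng w) = nn w"
 and dgr_ng [simp]: "dgr (ng w) = dgr w"
 and sr_mod [simp]: "sr w mod M = sr w" and tg_mod [simp]: "tg w mod M = tg w"
proof -
 obtain s r i where w: "w = (s, r, i)" by (cases w)
 have "(i mod M + s - r) mod M = (i + s - r) mod M"
  by (metis mod_diff_left_eq mod_add_left_eq)
 thus "sr (ng w) = sr w" "tg (ng w) = tg w" "ng (ng w) = ng w" "nn (ng w) = nn w"
  "dgr (ng w) = dgr w" "sr w mod M = sr w" "tg w mod M = tg w"
  by (auto simp: w)
qed

lemma okk_ng [simp]: "okk u (ng w) v = okk u w v"
 by (simp add: okk_def)

text \<open>A tensor product over the vertices is the span of the composable triples. Sending the
  other triples to zero, and reducing the index modulo \<open>m\<close> by \<open>ng\<close>,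
  realises it inside a free vector space without a quotient.\<close>

definition Tb :: "bas => gen => bas => 'k::field pp" where
 "Tb u w v = (if okk u w v then bs (u, ng w, v) else 0)"

definition T :: "'k::field vv => gen => 'k vv => 'k pp" where
 "T x w y = lin_ext (%u. lin_ext (%v. Tb u w v) y) x"

lemma T_lin1 [simp]: "lin (%x. T x w y)"
 unfolding T_def by simp

lemma T_lin2 [simp]: "lin (%y. T x w y)"
 unfolding T_def by (rule lin_lin_extD) simp

lemma T_bs: "T (bs u) w (bs v) = Tb u w v"
 by (simp add: T_def)

lemmas T_add_left = lin_add[OF T_lin1] and T_add_right = lin_add[OF T_lin2]
 and T_scl_left = lin_scl[OF T_lin1] and T_scl_right = lin_scl[OF T_lin2]
 and T_0_left [simp] = lin_0[OF T_lin1] and T_0_right [simp] = lin_0[OF T_lin2]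
 and T_minus_left = lin_minus[OF T_lin1] and T_minus_right = lin_minus[OF T_lin2]
 and T_sg_left = sg_lin[OF T_lin1] and T_sg_right = sg_lin[OF T_lin2]

lemma lin_T1: "lin f ==> lin (%x. T (f x) w y)"
 by (rule lin_compose[OF T_lin1])

lemma lin_T2: "lin f ==> lin (%y. T x w (f y))"
 by (rule lin_compose[OF T_lin2])

lemmas lin_ins = lin_intros lin_T1 lin_T2 lin_mul1 lin_mul2

lemma bilin_eqI:
 assumes "!!y. lin (%x. f x y)" "!!y. lin (%x. h x y)" "!!x. lin (%y. f x y)" "!!x. lin (%y. h x y)"
  "!!u v. f (bs u) (bs v) = h (bs u) (bs v)"
 shows "f x y = h x y"
proof (rule lin_eqI[of "%x. f x y" "%x. h x y"])
 fix u show "f (bs u) y = h (bs u) y"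
  by (rule lin_eqI[of "%y. f (bs u) y" "%y. h (bs u) y"]) (auto simp: assms)
qed (auto simp: assms)

lemma T_ng [simp]: "T x (ng w) y = T x w y"
 by (simp add: T_def Tb_def cong: if_cong)

lemma T_cong: "i mod M = j mod M ==> T x (s, r, i) y = T x (s, r, j) y"
 using T_ng[of x "(s,r,i)" y] T_ng[of x "(s,r,j)" y] by simp

lemma T_neg: "s < 0 | r < 0 ==> T x (s, r, i) y = 0"
 by (rule bilin_eqI[of "%x y. T x (s,r,i) y" "%x y. 0"])
  (auto simp: T_bs Tb_def okk_def)

lemma T_nn: "~ nn w ==> T x w y = 0"
 by (cases w) (auto simp: T_neg)

lemma en_mod [simp]: "en u mod M = en u"
 by (simp add: en_def)

lemma T_vt_left: "T (x <> vt j) w y = (if j mod M = sr w then T x w y else 0)"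
 by (rule bilin_eqI[of "%x y. T (x <> vt j) w y" "%x y. (if j mod M = sr w then T x w y else 0)"])
  (auto simp: bs_vt T_bs Tb_def okk_def intro!: lin_ins split: if_splits)

lemma T_vt_right: "T x w (vt j <> y) = (if j mod M = tg w then T x w y else 0)"
 by (rule bilin_eqI[of "%x y. T x w (vt j <> y)" "%x y. (if j mod M = tg w then T x w y else 0)"])
  (auto simp: vt_bs T_bs Tb_def okk_def intro!: lin_ins split: if_splits)

lemma T_wd0_left [simp]: "T (x <> wd 0) w y = T x w y" "T (wd 0 <> x) w y = T x w y"
 apply (rule bilin_eqI[of "%x y. T (x <> wd 0) w y" "%x y. T x w y"])
 apply (auto simp: bs_wd_0 T_bs Tb_def okk_def intro!: lin_ins split: if_splits)[5]
 by (rule bilin_eqI[of "%x y. T (wd 0 <> x) w y" "%x y. T x w y"])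
  (auto simp: wd_0_bs T_bs Tb_def okk_def intro!: lin_ins split: if_splits)

lemma T_wd0_right [simp]: "T x w (y <> wd 0) = T x w y" "T x w (wd 0 <> y) = T x w y"
 apply (rule bilin_eqI[of "%x y. T x w (y <> wd 0)" "%x y. T x w y"])
 apply (auto simp: bs_wd_0 T_bs Tb_def okk_def intro!: lin_ins split: if_splits)[5]
 by (rule bilin_eqI[of "%x y. T x w (wd 0 <> y)" "%x y. T x w y"])
  (auto simp: wd_0_bs T_bs Tb_def okk_def intro!: lin_ins split: if_splits)

definition PC :: "int => 'k::field pp set" where
 "PC n = {z. ALL (u, w, v):ks z. okk u w v & ng w = w & dgr w = n}"

lemma PC_keys: "z : PC n <-> ks z <= {(u, w, v). okk u w v & ng w = w & dgr w = n}"
 by (auto simp: PC_def)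

lemma PC_add: "x : PC n ==> y : PC n ==> x + y : PC n"
 unfolding PC_keys by (rule keys_addI)

lemma PC_diff: "x : PC n ==> y : PC n ==> x - y : PC n"
 unfolding PC_keys by (rule keys_diffI)

lemma PC_0 [simp]: "0 : PC n" and PC_minus: "x : PC n ==> - x : PC n"
 and PC_sg: "x : PC n ==> sg k x : PC n"
 by (simp_all add: PC_keys)

lemma PC_sum: "(!!s. s : S ==> f s : PC n) ==> sum f S : PC n"
 by (induction S rule: infinite_finite_induct) (auto intro: PC_add)

lemma T_PC: "dgr w = n ==> T x w y : PC n"
proof -
 assume n: "dgr w = n"
 have "ks (T (bs u) w y) <= {(u, w, v). okk u w v & ng w = w & dgr w = n}" for u
  by (rule keys_lin[OF T_lin2]) (auto simp: T_bs Tb_def n)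
 thus ?thesis unfolding PC_keys by (rule keys_lin[OF T_lin1])
qed

lemma okk_T: "okk u w v ==> ng w = w ==> bs (u, w, v) = T (bs u) w (bs v)"
 by (simp add: T_bs Tb_def)

lemma PC_eqI:
 assumes "z : PC n" "lin f" "lin h" "!!u w v. dgr w = n ==> okk u w v ==> ng w = w ==> f (T (bs u) w (bs v)) = h (T (bs u) w (bs v))"
 shows "f z = h z"
 by (rule lin_eqI[OF assms(2,3)]) (use assms(1,4) in \<open>auto simp: PC_def okk_T\<close>)

lemma PC_closed:
 assumes "z : PC n" "lin f" "!!u w v. dgr w = n ==> okk u w v ==> ng w = w ==> f (T (bs u) w (bs v)) : PC k"
 shows "f z : PC k"
 unfolding PC_keys
proof (rule keys_lin[OF assms(2)])
 fix p assume p: "p : ks z"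
 obtain u w v where e: "p = (u, w, v)" by (cases p)
 with p assms(1) have "okk u w v" "ng w = w" "dgr w = n" by (auto simp: PC_def)
 with assms(3)[of w u v] show "ks (f (bs p)) <= {(u, w, v). okk u w v & ng w = w & dgr w = k}"
  by (simp add: e okk_T PC_keys)
qed

lemma bs_vt_en: "val u ==> bs u <> vt (en u) = bs u" and vt_fst_bs: "val u ==> vt (fst u) <> bs u = bs u"
 by (auto simp: bs_vt vt_bs en_def val_def)

definition la :: "'k::field vv => 'k pp => 'k pp" where
 "la x z = lin_ext (%(u, w, v). T (x <> bs u) w (bs v)) z"

definition ra :: "'k::field pp => 'k vv => 'k pp" where
 "ra z y = lin_ext (%(u, w, v). T (bs u) w (bs v <> y)) z"

lemma la_lin2 [simp]: "lin (%z. la x z)" and ra_lin1 [simp]: "lin (%z. ra z x)"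
 unfolding la_def ra_def by auto

lemma la_lin1 [simp]: "lin (%x. la x z)" and ra_lin2 [simp]: "lin (%y. ra z y)"
 unfolding la_def ra_def by (rule lin_lin_extD, simp add: split_def lin_T1 lin_T2 lin_mul1 lin_mul2)+

lemma lin_la2: "lin f ==> lin (%z. la x (f z))" and lin_la1: "lin f' ==> lin (%x. la (f' x) z)"
 and lin_ra1: "lin f ==> lin (%z. ra (f z) x)" and lin_ra2: "lin f' ==> lin (%x. ra z (f' x))"
 by (auto intro: lin_compose[OF la_lin2] lin_compose[OF ra_lin1] lin_compose[OF la_lin1] lin_compose[OF ra_lin2])

lemma la_T [simp]: "la x (T u w v) = T (x <> u) w v"
proof (rule bilin_eqI[of "%u v. la x (T u w v)" "%u v. T (x <> u) w v"])
 fix u v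
 have "T (x <> bs u) w (bs v) = 0" if "~ okk u w v"
 proof (cases "val u & val v")
  case True
  hence *: "T (x <> bs u) w (bs v) = T (x <> bs u <> vt (en u)) w (vt (fst v) <> bs v)"
   by (simp add: mul_assoc bs_vt_en vt_fst_bs)
  show ?thesis unfolding * using that True by (auto simp: T_vt_left T_vt_right okk_def val_mod T_nn)
 next
  case False
  thus ?thesis
  proof (cases "val u")
   case True
   with False have "T (x <> bs u) w (wd 0 <> bs v) = 0" by (simp add: wd_0_bs)
   thus ?thesis by simp
  next
   case False
   hence "T (x <> (bs u <> wd 0)) w (bs v) = 0" by (simp add: bs_wd_0)
   thus ?thesis by (simp add: mul_assoc[symmetric])
  qed
 qed
 moreover have "la x (bs (u, ng w, v)) = T (x <> bs u) w (bs v)" by (simp add: la_def)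
 ultimately show "la x (T (bs u) w (bs v)) = T (x <> bs u) w (bs v)"
  by (auto simp: T_bs Tb_def la_def)
qed (auto intro!: lin_ins lin_la2)

lemma ra_T [simp]: "ra (T u w v) y = T u w (v <> y)"
proof (rule bilin_eqI[of "%u v. ra (T u w v) y" "%u v. T u w (v <> y)"])
 fix u v
 have "T (bs u) w (bs v <> y) = 0" if "~ okk u w v"
 proof (cases "val u & val v")
  case True
  hence *: "T (bs u) w (bs v <> y) = T (bs u <> vt (en u)) w (vt (fst v) <> (bs v <> y))"
   by (simp add: mul_assoc[symmetric] bs_vt_en vt_fst_bs)
  show ?thesis unfolding * using that True by (auto simp: T_vt_left T_vt_right okk_def val_mod T_nn)
 next
  case False
  thus ?thesis
  proof (cases "val u")
   case True
   with False have "T (bs u) w ((wd 0 <> bs v) <> y) = 0" by (simp add: wd_0_bs)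
   thus ?thesis by (simp add: mul_assoc)
  next
   case False
   hence "T (bs u <> wd 0) w (bs v <> y) = 0" by (simp add: bs_wd_0)
   thus ?thesis by simp
  qed
 qed
 moreover have "ra (bs (u, ng w, v)) y = T (bs u) w (bs v <> y)" by (simp add: ra_def)
 ultimately show "ra (T (bs u) w (bs v)) y = T (bs u) w (bs v <> y)"
  by (auto simp: T_bs Tb_def ra_def)
qed (auto intro!: lin_ins lin_ra1)

text \<open>The word that accompanies a step down in \<open>s\<close> (\<open>ka\<close>) or in
  \<open>r\<close> (\<open>kb\<close>): a single arrow for \<open>s > r\<close>, respectively
  \<open>s < r\<close>, and the word of length \<open>2 * N - 1\<close> otherwise.\<close>

definition ka :: "int => int => int" where "ka s r = (if s > r then 1 else NN - 1)"
definition kb :: "int => int => int" where "kb s r = (if s < r then - 1 else 1 - NN)"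

lemma sft_ka [simp]: "sft (ka s r) = 1" and sft_kb [simp]: "sft (kb s r) = - 1"
 using NN_pos by (auto simp: sft_def ka_def kb_def)

text \<open>With \<open>n = s + r\<close> the sign \<open>(-1)^(n + r)\<close> becomes
  \<open>(-1)^s\<close>, and so does \<open>(-1)^(n div 2)\<close> on the diagonal. Terms with a
  negative index are discarded by \<open>T_neg\<close>.\<close>

fun dgb :: "'k::field vv => gen => 'k vv => 'k pp" where
 "dgb x (s, r, i) y = (if s ~= r then
   T x (s - 1, r, i) (wd (ka s r) <> y) + sg s (T (x <> wd (ka s r)) (s - 1, r, i + 1) y)
   + sg s (T (x <> wd (kb s r)) (s, r - 1, i - 1) y) + sg (s + r) (T x (s, r - 1, i) (wd (kb s r) <> y))
  else \<Sum>l<N. T (x <> wd (- 2 * int l)) (s - 1, r, i) (wd (NN - 1 - 2 * int l) <> y)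
   + sg s (T (x <> wd (2 * int l + 1)) (s - 1, r, i + 1) (wd (NN - 2 - 2 * int l) <> y))
   + sg s (T (x <> wd (- 2 * int l - 1)) (s, r - 1, i - 1) (wd (2 + 2 * int l - NN) <> y))
   + T (x <> wd (2 * int l)) (s, r - 1, i) (wd (1 + 2 * int l - NN) <> y))"

declare dgb.simps [simp del]

definition bd :: "'k::field pp => 'k pp" where
 "bd = lin_ext (%(u, w, v). dgb (bs u) w (bs v))"

lemma bd_lin [simp]: "lin bd"
 by (simp add: bd_def)

lemma lin_bd: "lin f ==> lin (%x. bd (f x))"
 by (rule lin_compose[OF bd_lin])

lemma dgb_lin1 [simp]: "lin (%x. dgb x w y)"
 by (cases w) (auto simp: dgb.simps intro!: lin_ins)

lemma dgb_lin2 [simp]: "lin (%y. dgb x w y)"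
 by (cases w) (auto simp: dgb.simps intro!: lin_ins)

lemma dgb_ng [simp]: "dgb x (ng w) y = dgb x w y"
proof -
 obtain s r i where w: "w = (s, r, i)" by (cases w)
 have e: "T x (s, r, i mod M) y = T x (s, r, i) y" "T x (s, r, i mod M + 1) y = T x (s, r, i + 1) y"
  "T x (s, r, i mod M - 1) y = T x (s, r, i - 1) y" for s r and x y :: "'a vv"
  by (rule T_cong, simp add: mod_add_left_eq mod_diff_left_eq)+
 show ?thesis by (simp only: w ng.simps dgb.simps e)
qed

lemma sft_even [simp]: "sft (2 * k) = 0" "sft (- 2 * k) = 0" "sft (-(2 * k)) = 0" "sft (NN - 2 - 2 * k) = 0" "sft (2 + 2 * k - NN) = 0"
 by (auto simp: sft_def)

lemma sft_odd: "sft (- (2 * int l) - 1) = - 1" "l < N ==> sft (2 * int l + 1) = 1" "l < N ==> sft (- 2 * int l - 1) = - 1"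
 "l < N ==> sft (NN - 1 - 2 * int l) = 1" "l < N ==> sft (1 + 2 * int l - NN) = - 1"
 by (auto simp: sft_def)

lemma mod_shift: "(j + c) mod M = (i + c) mod M <-> j mod M = i mod M" for i j c :: int
 by (simp add: mod_eq_dvd_iff)

lemma dgb_vt_left: "dgb (x <> vt j) w y = (if j mod M = sr w then dgb x w y else 0)"
proof -
 obtain s r i where w: "w = (s, r, i)" by (cases w)
 have e: "(x <> vt j) <> wd k = (x <> wd k) <> vt (j + sft k)" for k
  by (simp add: mul_assoc vt_wd_comm)
 note ms = mod_shift[of j 1 i] mod_shift[of j "-1" i, simplified]
 show ?thesis
  by (cases "j mod M = i mod M") (simp_all add: w ms dgb.simps e T_vt_left sft_odd cong: sum.cong_simp)
qed

lemma dgb_vt_right: "dgb x w (vt j <> y) = (if j mod M = tg w then dgb x w y else 0)"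
proof -
 obtain s r i where w: "w = (s, r, i)" by (cases w)
 have e: "wd k <> (vt j <> y) = vt (j - sft k) <> (wd k <> y)" for k
  by (simp add: mul_assoc[symmetric] wd_vt_comm)
 have ms: "(j - 1) mod M = (i + (s - 1) - r) mod M <-> j mod M = (i + s - r) mod M"
  "(j + 1) mod M = (i + s - (r - 1)) mod M <-> j mod M = (i + s - r) mod M"
  "j mod M = (i + 1 + (s - 1) - r) mod M <-> j mod M = (i + s - r) mod M"
  "j mod M = (i - 1 + s - (r - 1)) mod M <-> j mod M = (i + s - r) mod M"
  by (auto simp: mod_eq_dvd_iff algebra_simps)
 show ?thesis
 proof (cases "s = r")
  case True
  have "(j - 1) mod M = (i - 1) mod M <-> j mod M = i mod M" "(j + 1) mod M = (i + 1) mod M <-> j mod M = i mod M"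
   using mod_shift[of j 1 i] mod_shift[of j "-1" i] by auto
  thus ?thesis using True
   by (cases "j mod M = i mod M") (simp_all add: w dgb.simps e T_vt_right sft_odd cong: sum.cong_simp)
 next
  case False
  with ms show ?thesis
   by (cases "j mod M = (i + s - r) mod M") (simp_all add: w dgb.simps e T_vt_right add_diff_eq)
 qed
qed

lemma dgb_wd0: "dgb (x <> wd 0) w y = dgb x w y" (is ?A) "dgb x w (wd 0 <> y) = dgb x w y" (is ?B)
proof -
 have "(x <> wd 0) <> wd k = x <> wd k" for k by (simp add: mul_assoc wd_wd)
 moreover have "wd k <> (wd 0 <> y) = wd k <> y" for k by (simp add: mul_assoc[symmetric] wd_wd)
 ultimately show ?A ?B
  by (cases w; simp add: dgb.simps)+
qed

text \<open>The formula holds for arbitrary factors because both sides vanish on triples that do not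
  compose; for \<open>dgb\<close> this is what its compatibility with \<open>vt\<close> and
  \<open>wd 0\<close> provides.\<close>

lemma bd_T: "bd (T x w y) = dgb x w y"
proof (rule bilin_eqI[of "%x y. bd (T x w y)" "%x y. dgb x w y"])
 fix u v
 have nz: "dgb (bs u) w (bs v) = 0" if "~ okk u w v"
 proof (cases "val u & val v")
  case True
  hence *: "dgb (bs u) w (bs v) = dgb (bs u <> vt (en u)) w (vt (fst v) <> bs v)"
   by (simp add: mul_assoc bs_vt_en vt_fst_bs)
  show ?thesis
  proof (cases "nn w")
   case nng: True
   show ?thesis unfolding * using that True nng
   by (auto simp: dgb_vt_left dgb_vt_right okk_def val_mod)
  next
   case False
   thus ?thesis by (cases w) (auto simp: dgb.simps T_neg)
  qed
 next
  case False
  show ?thesis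
  proof (cases "val u")
   case True
   with False have "dgb (bs u) w (wd 0 <> bs v) = 0" by (simp add: wd_0_bs lin_0[OF dgb_lin2])
   thus ?thesis by (simp add: dgb_wd0)
  next
   case False
   hence "dgb (bs u <> wd 0) w (bs v) = 0" by (simp add: bs_wd_0 lin_0[OF dgb_lin1])
   thus ?thesis by (simp add: dgb_wd0)
  qed
 qed
 have "bd (bs (u, ng w, v)) = dgb (bs u) w (bs v)" by (simp add: bd_def)
 with nz show "bd (T (bs u) w (bs v)) = dgb (bs u) w (bs v)"
  by (auto simp: T_bs Tb_def bd_def)
qed (auto intro!: lin_ins lin_bd)

lemma wd_wd_l: "wd k <> (wd l <> y) = (if fits k l then wd (jn k l) <> y else 0)"
 by (simp add: mul_assoc[symmetric] wd_wd)

lemma bd_ne: "s ~= r ==> bd (T x (s, r, i) y) =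
   T x (s - 1, r, i) (wd (ka s r) <> y) + sg s (T (x <> wd (ka s r)) (s - 1, r, i + 1) y)
   + sg s (T (x <> wd (kb s r)) (s, r - 1, i - 1) y) + sg (s + r) (T x (s, r - 1, i) (wd (kb s r) <> y))"
 by (simp add: bd_T dgb.simps)

lemma bd_eq: "bd (T x (s, s, i) y) =
 (\<Sum>l<N. T (x <> wd (- 2 * int l)) (s - 1, s, i) (wd (NN - 1 - 2 * int l) <> y)
   + sg s (T (x <> wd (2 * int l + 1)) (s - 1, s, i + 1) (wd (NN - 2 - 2 * int l) <> y))
   + sg s (T (x <> wd (- 2 * int l - 1)) (s, s - 1, i - 1) (wd (2 + 2 * int l - NN) <> y))
   + T (x <> wd (2 * int l)) (s, s - 1, i) (wd (1 + 2 * int l - NN) <> y))"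
 by (simp add: bd_T dgb.simps)

lemmas bd_simps = lin_add[OF bd_lin] lin_diff[OF bd_lin] lin_minus[OF bd_lin] lin_sum[OF bd_lin]
 sg_lin[OF bd_lin] lin_scl[OF bd_lin] lin_0[OF bd_lin]

subsection \<open>The symmetry exchanging the two orientations\<close>

lemma mul_wd0_comm: "x <> wd 0 = wd 0 <> x"
 by (rule lin_eqI[of "%x. x <> wd 0" "%x. wd 0 <> x"]) (auto simp: bs_wd_0 wd_0_bs)

lemma mul_wd_0: "x <> (y <> wd 0) = x <> y"
 by (rule bilin_eqI[of "%x y. x <> (y <> wd 0)" "%x y. x <> y"])
  (auto simp: bs_wd_0 mulb_def intro!: lin_mul1 lin_mul2)

lemma mul_wd_0': "x <> (wd 0 <> y) = x <> y"
 using mul_wd_0[of x y] mul_wd0_comm[of y] by simp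

text \<open>Induced by the reflection of the cycle at the vertex 0, which sends the arrow
  \<open>a\<close> with index \<open>i\<close> to the arrow \<open>a-bar\<close> with index
  \<open>- i - 1\<close>.\<close>

definition mi :: "'k::field vv => 'k vv" where
 "mi = lin_ext (%p. if val p then bs ((- fst p) mod M, nrm (- snd p)) else 0)"

lemma mi_lin [simp]: "lin mi" by (simp add: mi_def)

lemma mi_bs: "mi (bs p) = (if val p then bs ((- fst p) mod M, nrm (- snd p)) else 0)" by (simp add: mi_def)

lemma val_mi: "val p ==> val ((- fst p) mod M, nrm (- snd p))"
 using nrm_range[of "- snd p"] M_pos by (simp add: val_def abs_le_iff)

lemma nrm_neg: "nrm (- nrm k) = nrm (- k)"
 by (auto simp: nrm_def)

lemma sft_neg: "sft (- k) = - sft k"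
 by (auto simp: sft_def)

lemma mi_mi: "mi (mi x) = x <> wd 0"
proof (rule lin_eqI[of "%x. mi (mi x)" "%x. x <> wd 0"])
 fix p :: bas
 have "nrm (- nrm (- snd p)) = snd p" if "val p" using that by (auto simp: val_def nrm_def)
 thus "mi (mi (bs p)) = bs p <> wd 0"
  using val_mi[of p] val_mod[of p] by (cases p) (auto simp: mi_bs bs_wd_0 lin_0[OF mi_lin] mod_minus_eq val_mod)
qed (auto intro: lin_compose)

lemma mod_neg_iff: "(- i) mod M = (- j) mod M <-> i mod M = j mod M"
 by (auto simp: mod_eq_dvd_iff algebra_simps dvd_diff_commute)

lemma en_mi: "en ((- fst p) mod M, nrm (- snd p)) = (- en p) mod M"
 by (simp add: en_def sft_neg mod_minus_eq mod_diff_left_eq)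

lemma mi_mul: "mi (x <> y) = mi x <> mi y"
proof (rule bilin_eqI[of "%x y. mi (x <> y)" "%x y. mi x <> mi y"])
 fix p q :: bas
 obtain i k j l where e: "p = (i, k)" "q = (j, l)" by (metis prod.exhaust)
 show "mi (bs p <> bs q) = mi (bs p) <> (mi (bs q) :: 'a vv)"
 proof (cases "val p & val q & \<bar>k\<bar> + \<bar>l\<bar> <= NN")
  case True
  have v: "val ((- i) mod M, nrm (- k))" "val ((- j) mod M, nrm (- l))" using True val_mi[of p] val_mi[of q] by (auto simp: e)
  have r: "- NN < k" "k <= NN" "- NN < l" "l <= NN" "0 <= j" "j < M" using True by (auto simp: e val_def)
  have f: "fits (nrm (- k)) (nrm (- l)) = fits k l"
   using True r NN_pos by (cases "k = NN"; cases "l = NN") (auto simp: fits_def nrm_def)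
  have J: "nrm (jn (nrm (- k)) (nrm (- l))) = nrm (- nrm (jn k l))"
   using True r NN_pos by (cases "k = NN"; cases "l = NN") (auto simp: jn_def nrm_def)
  have en: "en ((- i) mod M, nrm (- k)) = (- j) mod M <-> en (i, k) = j"
   using en_mi[of "(i, k)"] mod_neg_iff[of "en (i, k)" j] r by (simp add: en_def)
  have "val (i, nrm (jn k l))" if "fits k l"
   using True that jn_props[of k l] r by (auto simp: e val_def)
  thus ?thesis using True v by (auto simp: e mulb_def mi_bs en f J lin_0[OF mi_lin])
 qed (auto simp: e mulb_def mi_bs lin_0[OF mi_lin])
qed (auto intro!: lin_ins lin_compose[OF mi_lin])

lemma mi_vt [simp]: "mi (vt i) = vt (- i)"
 using NN_pos M_pos by (simp add: vt_def mi_bs val_def mod_minus_eq)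

lemma mi_wd [simp]: "mi (wd k) = (wd (- k) :: 'k::field vv)"
proof -
 have v: "mi (vt i <> wd k) = (vt (- i) <> wd (- k) :: 'k vv)" for i
  using nrm_range[of k] M_pos by (auto simp: vt_wd mi_bs val_def nrm_neg mod_minus_eq lin_0[OF mi_lin])
 have "mi (wd 0 <> wd k) = (SUM i:{0..<M}. vt (- i) <> (wd (- k) :: 'k vv))"
  unfolding wd_0 mul_sum_left lin_sum[OF mi_lin] v ..
 also have "... = (SUM i:{0..<M}. vt i <> wd (- k))"
  by (rule sum.reindex_bij_witness[of _ "%i. (- i) mod M" "%i. (- i) mod M"])
   (use M_pos in \<open>auto simp: mod_minus_eq\<close>)
 finally show ?thesis by (simp add: wd_wd flip: mul_sum_left wd_0)
qed

text \<open>Exchanging \<open>s\<close> and \<open>r\<close> changes the differential by the factor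
  \<open>(-1)^n\<close> in degree \<open>n\<close>. The sign with triangular exponent on chains
  absorbs it, since the triangular numbers of \<open>n\<close> and \<open>n - 1\<close> differ by
  \<open>n\<close>.\<close>

definition cs :: "int => int" where "cs n = n * (n + 1) div 2"

lemma cs_sg: "sg (cs (n - 1)) z = sg (cs n) (sg n z)" (is ?A) "sg (cs n) (sg (cs n) z) = z" (is ?B)
proof -
 have "n * (n + 1) = (n - 1) * n + 2 * n" by (simp add: algebra_simps)
 hence "cs n = cs (n - 1) + n" by (simp add: cs_def)
 thus ?A unfolding sg_sg by (intro sg_parity) simp
 show ?B by (simp add: sg_def)
qed

definition mp :: "'k::field pp => 'k pp" where
 "mp = lin_ext (%(u, (s, r, i), v). sg (cs (s + r)) (T (mi (bs u)) (r, s, - i) (mi (bs v))))"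

lemma mp_lin [simp]: "lin mp" by (simp add: mp_def)

lemma mp_T: "mp (T (x :: 'k::field vv) (s, r, i) y) = sg (cs (s + r)) (T (mi x) (r, s, - i) (mi y))"
proof (rule bilin_eqI[of "%x y :: 'k vv. mp (T x (s, r, i) y)" "%x y. sg (cs (s + r)) (T (mi x) (r, s, - i) (mi y))"])
 fix u v
 have "T (mi (bs u)) (r, s, - i) (mi (bs v)) = (0 :: 'k pp)" if "~ okk u (s, r, i) v"
  using that mod_neg_iff[of "en u" i] mod_neg_iff[of "fst v" "i + s - r"]
  by (auto simp: mi_bs T_bs Tb_def okk_def en_mi val_mod algebra_simps)
 moreover have "T x (r, s, - (i mod M)) y = T x (r, s, - i) y" for x y :: "'k vv"
  by (rule T_cong) (simp add: mod_minus_eq)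
 ultimately show "mp (T (bs u) (s, r, i) (bs v)) = sg (cs (s + r)) (T (mi (bs u)) (r, s, - i) (mi (bs v)) :: 'k pp)"
  by (auto simp: T_bs Tb_def mp_def)
qed (auto intro!: lin_ins lin_compose[OF mp_lin] lin_compose[OF mi_lin] lin_T1 lin_T2)

lemma mp_bd_T: "mp (bd (T x w y)) = bd (mp (T x w y))"
proof -
 obtain s r i where w: "w = (s, r, i)" by (cases w)
 note mps = lin_add[OF mp_lin] lin_sum[OF mp_lin] sg_lin[OF mp_lin] mp_T mi_mul
 show ?thesis
 proof (cases "s = r")
  case True
  have c: "sg (cs (s - 1 + s)) z = sg (cs (s + s)) z" "sg (cs (s + (s - 1))) z = sg (cs (s + s)) z" for z :: "'a pp"
   using cs_sg(1)[of "s + s" z] by (simp_all add: algebra_simps) (simp_all add: sg_def)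
  have e: "- (- 2 * int l) = 2 * int l" "- (NN - 1 - 2 * int l) = 1 + 2 * int l - NN" "- (2 * int l + 1) = - 2 * int l - 1"
   "- (NN - 2 - 2 * int l) = 2 + 2 * int l - NN" "- (- 2 * int l - 1) = 2 * int l + 1" "- (2 + 2 * int l - NN) = NN - 2 - 2 * int l"
   "- (2 * int l) = - 2 * int l" "- (1 + 2 * int l - NN) = NN - 1 - 2 * int l" "- (i + 1) = - i - 1" "- (i - 1) = - i + 1" for l
   by simp_all
  show ?thesis
   unfolding w True[symmetric] mp_T sg_lin[OF bd_lin] bd_eq lin_sum[OF mp_lin] sg_sum
   by (rule sum.cong, simp, simp only: mps c mi_wd e) (simp add: sg_add sg_sg ac_simps)
 next
  case False
  have k: "- ka s r = kb r s" "- kb s r = ka r s" by (auto simp: ka_def kb_def)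
  have c: "sg (cs (s - 1 + r)) z = sg (cs (s + r)) (sg (s + r) z)" "sg (cs (s + (r - 1))) z = sg (cs (s + r)) (sg (s + r) z)" for z :: "'a pp"
   using cs_sg(1)[of "s + r" z] by (simp_all add: algebra_simps)
  have f: "r ~= s" using False by simp
  show ?thesis
   unfolding w bd_ne[OF False] mp_T sg_lin[OF bd_lin] bd_ne[OF f]
   by (simp add: mps k c sg_add sg_sg) (simp add: algebra_simps, simp add: sg_def)
 qed
qed

lemma mp_bd: "mp (bd z) = bd (mp (z :: 'k::field pp))"
proof (rule lin_eqI[of "%z. mp (bd z)" "%z. bd (mp z)"])
 fix p :: "bas \<times> gen \<times> bas"
 obtain u w v where p: "p = (u, w, v)" by (cases p)
 obtain s r i where w: "w = (s, r, i)" by (cases w)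
 have "bd (bs p :: 'k pp) = bd (T (bs u) w (bs v))" unfolding bd_T by (simp add: p bd_def)
 moreover have "mp (bs p :: 'k pp) = mp (T (bs u) w (bs v))" unfolding w mp_T by (simp add: p w mp_def)
 ultimately show "mp (bd (bs p)) = bd (mp (bs p) :: 'k pp)" by (simp add: mp_bd_T)
qed (auto intro!: lin_bd lin_compose[OF mp_lin])

subsection \<open>The differential squares to zero\<close>

lemma ka_kb: "s ~= r ==> wd (ka s r) <> wd (kb s r) = wd NN" "s ~= r ==> wd (kb s r) <> wd (ka s r) = wd NN"
 "wd (ka s r) <> wd (ka s r) = 0" "wd (kb s r) <> wd (kb s r) = 0"
 using NN_pos by (auto simp: wd_wd fits_def jn_def ka_def kb_def wd_NN)

text \<open>At distance two from the diagonal the words \<open>ka\<close> and \<open>kb\<close> stay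
  the same during both steps. Equal words multiply to zero, different ones to \<open>wd NN\<close>,
  and the surviving terms cancel in pairs.\<close>

lemma bdbd_far:
 assumes "\<bar>s - r\<bar> >= 2"
 shows "bd (bd (T x (s, r, i) y)) = 0"
proof -
 have n: "s ~= r" "s - 1 ~= r" "s ~= r - 1" using assms by auto
 have k: "ka (s - 1) r = ka s r" "ka s (r - 1) = ka s r" "kb (s - 1) r = kb s r" "kb s (r - 1) = kb s r"
  using assms by (auto simp: ka_def kb_def)
 have l: "wd (ka s r) <> (wd (ka s r) <> z) = 0" "wd (kb s r) <> (wd (kb s r) <> z) = 0"
  "wd (ka s r) <> (wd (kb s r) <> z) = wd NN <> z" "wd (kb s r) <> (wd (ka s r) <> z) = wd NN <> z" for z :: "'a vv"
  using n by (simp_all add: mul_assoc[symmetric] ka_kb)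
 show ?thesis
  using n by (simp add: bd_ne k l ka_kb bd_simps mul_assoc sg_add sg_sg) (auto simp: sg_def)
qed

lemma sum_tele: "(\<Sum>l<n. f (Suc l) - f l) = f n - (f 0 :: 'z::ab_group_add)"
 by (rule sum_lessThan_telescope)

lemma sum_single: "j < (n::nat) ==> (!!l. l < n ==> l ~= j ==> f l = 0) ==> (\<Sum>l<n. f l) = (f j :: 'z::ab_group_add)"
 by (subst sum.remove[of _ j]) (auto intro!: sum.neutral)

text \<open>The two terms that reach the diagonal contribute sums of \<open>S1\<close>, shifted
  against each other by one. Their difference telescopes, and its end terms cancel against those
  coming from the pair \<open>(r + 1, r - 1)\<close>.\<close>

lemma bdbd_up: "bd (bd (T x (r + 1, r, i) y)) = 0"
proof -
 have k: "ka (r + 1) r = 1" "kb (r + 1) r = 1 - NN" "ka (r + 1) (r - 1) = 1" "kb (r + 1) (r - 1) = 1 - NN"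
  by (auto simp: ka_def kb_def)
 define S1 where "S1 j = T (x <> wd (2 * int j)) (r, r - 1, i) (wd (2 * int j - NN) <> y)" for j
 have l0: "wd (1 - NN) <> (wd 1 <> y) = wd NN <> y" "wd 1 <> (wd (1 - NN) <> y) = wd NN <> y"
  "wd 1 <> (wd 1 <> y) = 0" "wd (1 - NN) <> (wd (1 - NN) <> y) = 0"
  "x <> wd 1 <> wd (1 - NN) = x <> wd NN" "x <> wd (1 - NN) <> wd 1 = x <> wd NN"
  "x <> wd 1 <> wd 1 = 0" "x <> wd (1 - NN) <> wd (1 - NN) = 0"
  using NN_pos by (auto simp: wd_wd_l mul_assoc wd_wd fits_def jn_def wd_NN)
 have A: "bd (T x (r, r, i) (wd 1 <> y)) =
  (\<Sum>l<N. sg r (T (x <> wd (2 * int l + 1)) (r - 1, r, i + 1) (wd (NN - 1 - 2 * int l) <> y)))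
  + sg r (T (x <> wd (1 - NN)) (r, r - 1, i - 1) (wd 1 <> y)) + (\<Sum>l<N. S1 l)"
 proof -
  have e: "wd (NN - 1 - 2 * int l) <> (wd 1 <> y) = 0"
   "wd (NN - 2 - 2 * int l) <> (wd 1 <> y) = wd (NN - 1 - 2 * int l) <> y"
   "wd (1 + 2 * int l - NN) <> (wd 1 <> y) = wd (2 * int l - NN) <> y"
   "wd (2 + 2 * int l - NN) <> (wd 1 <> y) = (if l = N - 1 then wd 1 <> y else 0)" if "l < N" for l
   using that by (auto simp: wd_wd_l fits_def jn_def intro!: arg_cong[where f = "%k. wd k <> y"])
  have "(\<Sum>l<N. sg r (T (x <> wd (- 2 * int l - 1)) (r, r - 1, i - 1) (wd (2 + 2 * int l - NN) <> (wd 1 <> y))))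
   = sg r (T (x <> wd (- 2 * int (N - 1) - 1)) (r, r - 1, i - 1) (wd (2 + 2 * int (N - 1) - NN) <> (wd 1 <> y)))"
   by (rule sum_single) (use N1 in \<open>auto simp: e\<close>)
  also have "... = sg r (T (x <> wd (1 - NN)) (r, r - 1, i - 1) (wd 1 <> y))"
   using N1 by (simp add: e of_nat_diff algebra_simps)
  finally show ?thesis
   by (simp add: bd_eq sum.distrib e S1_def cong: sum.cong_simp)
 qed
 have B: "bd (T (x <> wd 1) (r, r, i + 1) y) =
  (\<Sum>l<N. T (x <> wd (2 * int l + 1)) (r - 1, r, i + 1) (wd (NN - 1 - 2 * int l) <> y))
  + (\<Sum>l<N. sg r (S1 (Suc l))) + T (x <> wd 1) (r, r - 1, i + 1) (wd (1 - NN) <> y)"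
 proof -
  have e: "x <> wd 1 <> wd (2 * int l + 1) = 0"
   "x <> wd 1 <> wd (- 2 * int l) = x <> wd (2 * int l + 1)"
   "x <> wd 1 <> wd (- (2 * int l)) = x <> wd (2 * int l + 1)"
   "x <> wd 1 <> wd (- 2 * int l - 1) = x <> wd (2 * int (Suc l))"
   "x <> wd 1 <> wd (- (2 * int l) - 1) = x <> wd (2 * int (Suc l))"
   "x <> wd 1 <> wd (2 * int l) = (if l = 0 then x <> wd 1 else 0)" if "l < N" for l
   using that by (auto simp: mul_assoc wd_wd fits_def jn_def intro!: arg_cong[where f = "%k. x <> wd k"])
  have "(\<Sum>l<N. T (x <> wd 1 <> wd (2 * int l)) (r, r - 1, i + 1) (wd (1 + 2 * int l - NN) <> y))
   = T (x <> wd 1 <> wd (2 * int 0)) (r, r - 1, i + 1) (wd (1 + 2 * int 0 - NN) <> y)"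
   by (rule sum_single) (use N1 in \<open>auto simp: e\<close>)
  also have "... = T (x <> wd 1) (r, r - 1, i + 1) (wd (1 - NN) <> y)"
   using N1 by (simp add: mul_assoc wd_wd)
  moreover have "wd (2 + 2 * int l - NN) = wd (2 * int (Suc l) - NN)" for l by (simp add: algebra_simps)
  ultimately show ?thesis
   by (simp add: bd_eq sum.distrib e S1_def cong: sum.cong_simp)
 qed
 have S: "(\<Sum>l<N. S1 (Suc l)) = (\<Sum>l<N. S1 l) + S1 N - S1 0"
  using sum_tele[of S1 N] by (simp add: sum_subtractf algebra_simps)
 have S0: "S1 0 = T x (r, r - 1, i) (wd NN <> y)" "S1 N = T (x <> wd NN) (r, r - 1, i) y"
  by (simp_all add: S1_def wd_NN)
 have C: "bd (T (x <> wd (1 - NN)) (r + 1, r - 1, i - 1) y) =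
  T (x <> wd (1 - NN)) (r, r - 1, i - 1) (wd 1 <> y) + sg (r + 1) (T (x <> wd NN) (r, r - 1, i) y)
  + T 0 (r + 1, r - 2, i - 2) y + T (x <> wd (1 - NN)) (r + 1, r - 2, i - 1) (wd (1 - NN) <> y)"
  by (simp add: bd_ne k l0 sg_def)
 have D: "bd (T x (r + 1, r - 1, i) (wd (1 - NN) <> y)) =
  T x (r, r - 1, i) (wd NN <> y) + sg (r + 1) (T (x <> wd 1) (r, r - 1, i + 1) (wd (1 - NN) <> y))
  + sg (r + 1) (T (x <> wd (1 - NN)) (r + 1, r - 2, i - 1) (wd (1 - NN) <> y))"
  by (simp add: bd_ne k l0)
 show ?thesis
  apply (simp add: bd_ne[of "r+1" r] k bd_simps A B C D sg_add sum.distrib sg_sg sg_sum[symmetric] S S0)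
  apply (simp add: sg_def sum_negf)
  done
qed

lemma bdbd_dn: "bd (bd (T x (s, s + 1, i) y)) = 0"
proof -
 have "mp (bd (bd (T (mi x) (s + 1, s, - i) (mi y)))) = 0" by (simp add: bdbd_up lin_0[OF mp_lin])
 hence "sg (cs (s + 1 + s)) (bd (bd (T x (s, s + 1, i) y))) = 0"
  by (simp add: mp_bd mp_T mi_mi bd_simps)
 thus ?thesis by (simp add: sg_def split: if_splits)
qed

lemma bdbd_eq: "bd (bd (T x (s, s, i) y)) = 0"
proof -
 have k: "ka (s - 1) s = NN - 1" "kb (s - 1) s = - 1" "ka s (s - 1) = 1" "kb s (s - 1) = 1 - NN"
  by (auto simp: ka_def kb_def)
 have e: "wd (NN - 1) <> (wd (NN - 1 - 2 * int l) <> y) = 0"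
  "x <> wd (- (2 * int l)) <> wd (NN - 1) = (if l = 0 then x <> wd (NN - 1) else 0)"
  "wd (NN - 1) <> (wd (NN - 2 - 2 * int l) <> y) = (if l = N - 1 then wd (NN - 1) <> y else 0)"
  "x <> wd (2 * int l + 1) <> wd (NN - 1) = 0"
  "x <> wd (- (2 * int l)) <> wd (- 1) = x <> wd (- (2 * int l) - 1)"
  "wd (-1) <> (wd (NN - 1 - 2 * int l) <> y) = wd (2 * int l - NN) <> y"
  "x <> wd (2 * int l + 1) <> wd (- 1) = x <> wd (2 * int l + 2)"
  "wd (-1) <> (wd (NN - 2 - 2 * int l) <> y) = wd (1 + 2 * int l - NN) <> y"
  "wd 1 <> (wd (2 + 2 * int l - NN) <> y) = wd (NN - 1 - 2 * int l) <> y"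
  "x <> wd (- (2 * int l) - 1) <> wd 1 = x <> wd (- (2 * int l) - 2)"
  "x <> wd (- (2 * int l) - 1) <> wd (1 - NN) = 0"
  "wd (1 - NN) <> (wd (2 + 2 * int l - NN) <> y) = (if l = N - 1 then wd (1 - NN) <> y else 0)"
  "wd 1 <> (wd (1 + 2 * int l - NN) <> y) = wd (NN - 2 * int l) <> y"
  "x <> wd (2 * int l) <> wd 1 = x <> wd (2 * int l + 1)"
  "x <> wd (2 * int l) <> wd (1 - NN) = (if l = 0 then x <> wd (1 - NN) else 0)"
  "wd (1 - NN) <> (wd (1 + 2 * int l - NN) <> y) = 0"
  if "l < N" for l
  using that NN_pos N1 by (auto simp: wd_wd_l mul_assoc wd_wd fits_def jn_def
   intro!: arg_cong[where f = "%k. x <> wd k"] arg_cong[where f = "%k. wd k <> y"])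
 have s1: "(\<Sum>l<N. if l = N - 1 then z else 0) = z" "(\<Sum>l<N. if l = 0 then z else 0) = z" for z :: "'a pp"
  using N1 by (auto simp: sum.delta)
 \<comment> \<open>The words \<open>wd (NN - 1)\<close> and \<open>wd (1 - NN)\<close> annihilate
   every word of even length that they meet here except the trivial one. These terms therefore occur
   only for \<open>l = 0\<close> and \<open>l = N - 1\<close>, with opposite signs.\<close>
 define Z1 Z2 where "Z1 = T (x <> wd (NN - 1)) (s - 2, s, i + 1) (wd (NN - 1) <> y)"
  and "Z2 = T (x <> wd (1 - NN)) (s, s - 2, i - 1) (wd (1 - NN) <> y)"
 define Q1 Q2 where "Q1 l = T (x <> wd (- (2 * int l) - 1)) (s - 1, s - 1, i - 1) (wd (NN - 1 - 2 * int l) <> y)"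
  and "Q2 l = T (x <> wd (2 * int l + 1)) (s - 1, s - 1, i + 1) (wd (1 + 2 * int l - NN) <> y)" for l :: nat
 define P1 where "P1 j = T (x <> wd (- (2 * int j))) (s - 1, s - 1, i) (wd (2 * int j - NN) <> y)" for j
 define P2 where "P2 j = T (x <> wd (2 * int j)) (s - 1, s - 1, i) (wd (NN - 2 * int j) <> y)" for j
 have P: "P1 (Suc l) = T (x <> wd (- (2 * int l) - 2)) (s - 1, s - 1, i) (wd (2 + 2 * int l - NN) <> y)"
  "P2 (Suc l) = T (x <> wd (2 * int l + 2)) (s - 1, s - 1, i) (wd (NN - 2 - 2 * int l) <> y)" for l
 proof -
  have q: "- (2 * int (Suc l)) = - (2 * int l) - 2" "2 * int (Suc l) - NN = 2 + 2 * int l - NN"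
   "NN - 2 * int (Suc l) = NN - 2 - 2 * int l" "2 * int (Suc l) = 2 * int l + 2" by auto
  show "P1 (Suc l) = T (x <> wd (- (2 * int l) - 2)) (s - 1, s - 1, i) (wd (2 + 2 * int l - NN) <> y)"
   unfolding P1_def q(1,2) ..
  show "P2 (Suc l) = T (x <> wd (2 * int l + 2)) (s - 1, s - 1, i) (wd (NN - 2 - 2 * int l) <> y)"
   unfolding P2_def q(3) unfolding q(4) ..
 qed
 have ll: "- 2 * int l = - (2 * int l)" "- 2 * int l - 1 = - (2 * int l) - 1" for l by auto
 have t: "bd (T (x <> wd (- 2 * int l)) (s - 1, s, i) (wd (NN - 1 - 2 * int l) <> y)
   + sg s (T (x <> wd (2 * int l + 1)) (s - 1, s, i + 1) (wd (NN - 2 - 2 * int l) <> y))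
   + sg s (T (x <> wd (- 2 * int l - 1)) (s, s - 1, i - 1) (wd (2 + 2 * int l - NN) <> y))
   + T (x <> wd (2 * int l)) (s, s - 1, i) (wd (1 + 2 * int l - NN) <> y))
  = (if l = 0 then sg (s - 1) Z1 else 0) + (if l = N - 1 then sg s Z1 else 0)
   + (if l = N - 1 then - sg s Z2 else 0) + (if l = 0 then sg s Z2 else 0)
   + (P1 (Suc l) - P1 l) - (P2 (Suc l) - P2 l)"
  if "l < N" for l
 proof -
  have 1: "bd (T (x <> wd (- (2 * int l))) (s - 1, s, i) (wd (NN - 1 - 2 * int l) <> y))
   = (if l = 0 then sg (s - 1) Z1 else 0) + sg (s - 1) (Q1 l) - P1 l"
   using that by (auto simp: bd_ne k e Q1_def P1_def Z1_def sg_def)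
  have 2: "bd (T (x <> wd (2 * int l + 1)) (s - 1, s, i + 1) (wd (NN - 2 - 2 * int l) <> y))
   = (if l = N - 1 then Z1 else 0) + sg (s - 1) (P2 (Suc l)) - Q2 l"
  proof -
   have "T (x <> wd (2 * int l + 1)) (s - 2, s, i + 1) (if l = N - 1 then wd (NN - 1) <> y else 0)
    = (if l = N - 1 then Z1 else 0)"
   proof (cases "l = N - 1")
    case True
    hence "2 * int l + 1 = NN - 1" using that by auto
    with True show ?thesis by (simp only: Z1_def if_True simp_thms)
   qed simp
   thus ?thesis using that by (simp add: bd_ne k e Q2_def P split del: if_split) (simp add: sg_def)
  qed
  have 3: "bd (T (x <> wd (- (2 * int l) - 1)) (s, s - 1, i - 1) (wd (2 + 2 * int l - NN) <> y))
   = Q1 l + sg s (P1 (Suc l)) - (if l = N - 1 then Z2 else 0)"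
  proof -
   have "T (x <> wd (- (2 * int l) - 1)) (s, s - 2, i - 1) (if l = N - 1 then wd (1 - NN) <> y else 0)
    = (if l = N - 1 then Z2 else 0)"
   proof (cases "l = N - 1")
    case True
    hence "- (2 * int l) - 1 = 1 - NN" using that by auto
    with True show ?thesis by (simp only: Z2_def if_True simp_thms)
   qed simp
   thus ?thesis using that by (simp add: bd_ne k e Q1_def P split del: if_split) (simp add: sg_def)
  qed
  have 4: "bd (T (x <> wd (2 * int l)) (s, s - 1, i) (wd (1 + 2 * int l - NN) <> y))
   = P2 l + sg s (Q2 l) + (if l = 0 then sg s Z2 else 0)"
   using that by (auto simp: bd_ne k e Q2_def P2_def Z2_def sg_def)
  show ?thesis
   unfolding ll bd_simps 1 2 3 4 by (auto simp: sg_def)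
 qed
 have "bd (bd (T x (s, s, i) y)) = (\<Sum>l<N. (if l = 0 then sg (s - 1) Z1 else 0) + (if l = N - 1 then sg s Z1 else 0)
   + (if l = N - 1 then - sg s Z2 else 0) + (if l = 0 then sg s Z2 else 0)
   + (P1 (Suc l) - P1 l) - (P2 (Suc l) - P2 l))"
  unfolding bd_eq lin_sum[OF bd_lin] by (rule sum.cong) (simp_all only: t lessThan_iff)
 also have "... = sg (s - 1) Z1 + sg s Z1 - sg s Z2 + sg s Z2 + (P1 N - P1 0) - (P2 N - P2 0)"
  unfolding sum.distrib sum_subtractf s1 using sum_tele[of P1 N] sum_tele[of P2 N]
  by (simp add: sum_subtractf)
 also have "... = 0"
  by (simp add: P1_def P2_def wd_NN) (simp add: sg_def)
 finally show ?thesis .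
qed

lemma bdbd_T: "bd (bd (T x w y)) = 0"
proof -
 obtain s r i where w: "w = (s, r, i)" by (cases w)
 consider "\<bar>s - r\<bar> >= 2" | "s = r + 1" | "r = s + 1" | "s = r" by linarith
 thus ?thesis unfolding w
  by cases (auto simp: bdbd_far bdbd_up bdbd_dn bdbd_eq)
qed

lemma bdbd: "z : PC n ==> bd (bd z) = 0"
 by (rule PC_eqI[of z n "%z. bd (bd z)" "%z. 0"]) (auto simp: bdbd_T intro!: lin_bd)


section \<open>A contracting homotopy\<close>

definition Fil :: "int => 'k::field pp => bool" where
 "Fil c z <-> (ALL p:ks z. c <= \<bar>snd (fst p)\<bar>)"

lemma Fil_keys: "Fil c z <-> ks z <= {p. c <= \<bar>snd (fst p)\<bar>}"
 by (auto simp: Fil_def)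

lemma Fil_add: "Fil c x ==> Fil c y ==> Fil c (x + y)"
 unfolding Fil_keys by (rule keys_addI)

lemma Fil_0 [simp]: "Fil c 0" and Fil_sg: "Fil c x ==> Fil c (sg n x)"
 and Fil_minus: "Fil c x ==> Fil c (- x)"
 by (simp_all add: Fil_def)

lemma Fil_sum: "(!!s. s : S ==> Fil c (f s)) ==> Fil c (sum f S)"
 unfolding Fil_keys by (rule keys_sumI)

lemma Fil_T:
 assumes "ks x <= {p. c <= \<bar>snd p\<bar>}"
 shows "Fil c (T x w y)"
 unfolding Fil_keys
proof (rule keys_lin[OF T_lin1])
 fix u assume "u : ks x"
 with assms have c: "c <= \<bar>snd u\<bar>" by auto
 show "ks (T (bs u) w y) <= {p. c <= \<bar>snd (fst p)\<bar>}"
  by (rule keys_lin[OF T_lin2]) (use c in \<open>auto simp: T_bs Tb_def\<close>)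
qed

lemma keys_bs_wd: "ks (bs u <> wd k) <= {p. \<bar>snd u\<bar> + \<bar>k\<bar> <= \<bar>snd p\<bar>}"
 unfolding wd_def by (auto simp: mul_sum_right mulb_def jn_abs split: if_splits intro!: keys_sumI)

lemma Fil_T_wd: "c <= \<bar>k\<bar> ==> Fil (\<bar>snd u\<bar> + c) (T (bs u <> wd k) w y)"
 by (rule Fil_T) (use keys_bs_wd[of u k] in force)

text \<open>What remains of the differential when the left factor is taken modulo the radical: the
  differential of a resolution of the simple right modules. On the diagonal only summands with
  \<open>l = 0\<close> survive, those whose left word is trivial.\<close>

fun d0b :: "'k::field vv => gen => 'k vv => 'k pp" where
 "d0b x (s, r, i) y = T x (s - 1, r, i) (wd (ka s r) <> y) + sg (s + r) (T x (s, r - 1, i) (wd (kb s r) <> y))"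

declare d0b.simps [simp del]

lemma Fil_dgb: "Fil (\<bar>snd u\<bar> + 1) (dgb (bs u) w (y :: 'k::field vv) - d0b (bs u) w y)"
proof -
 obtain s r i where w: "w = (s, r, i)" by (cases w)
 let ?x = "bs u :: 'k vv"
 show ?thesis
 proof (cases "s = r")
  case False
  hence "dgb ?x w y - d0b ?x w y = sg s (T (?x <> wd (ka s r)) (s - 1, r, i + 1) y)
   + sg s (T (?x <> wd (kb s r)) (s, r - 1, i - 1) y)"
   by (simp add: w dgb.simps d0b.simps)
  thus ?thesis using NN_pos
   by (auto simp: ka_def kb_def intro!: Fil_add Fil_sg Fil_T_wd)
 next
  case True
  let ?f1 = "%l. T (?x <> wd (- 2 * int l)) (s - 1, r, i) (wd (NN - 1 - 2 * int l) <> y)"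
  let ?f2 = "%l. sg s (T (?x <> wd (2 * int l + 1)) (s - 1, r, i + 1) (wd (NN - 2 - 2 * int l) <> y))"
  let ?f3 = "%l. sg s (T (?x <> wd (- 2 * int l - 1)) (s, r - 1, i - 1) (wd (2 + 2 * int l - NN) <> y))"
  let ?f4 = "%l. T (?x <> wd (2 * int l)) (s, r - 1, i) (wd (1 + 2 * int l - NN) <> y)"
  have z: "(\<Sum>l<N. f l) = f 0 + (SUM l:{1..<N}. f l)" for f :: "nat => 'k pp"
   using N1 by (metis One_nat_def lessThan_atLeast0 less_eq_Suc_le sum.atLeast_Suc_lessThan)
  have "dgb ?x w y = (\<Sum>l<N. ?f1 l) + (\<Sum>l<N. ?f2 l) + (\<Sum>l<N. ?f3 l) + (\<Sum>l<N. ?f4 l)"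
   by (simp add: w dgb.simps True sum.distrib)
  moreover have "d0b ?x w y = ?f1 0 + ?f4 0"
   by (simp add: w d0b.simps True ka_def kb_def sg_def)
  ultimately have "dgb ?x w y - d0b ?x w y = (SUM l:{1..<N}. ?f1 l) + (\<Sum>l<N. ?f2 l) + (\<Sum>l<N. ?f3 l) + (SUM l:{1..<N}. ?f4 l)"
   unfolding z[of ?f1] z[of ?f4] by (simp add: algebra_simps)
  also have "Fil (\<bar>snd u\<bar> + 1) ..."
   by (intro Fil_add Fil_sum Fil_sg Fil_T_wd) auto
  finally show ?thesis .
 qed
qed

text \<open>Moves the first letter of the right factor into the middle. A word of length
  \<open>2 * N\<close> can be read with either first letter, and is read with \<open>a\<close> if
  \<open>s >= r\<close> and with \<open>a-bar\<close> if \<open>s < r\<close>. The last case undoes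
  multiplication by the long word when \<open>s + 1\<close> reaches the diagonal.\<close>

fun s0b :: "bas => gen => bas => 'k::field pp" where
 "s0b u (s, r, i) (j, k) =
  (if s >= r & k > 0 then Tb u (s + 1, r, i) ((j + 1) mod M, 1 - k)
  else if s = r & k < 0 | s < r & (k < 0 | k = NN)
   then sg (s + r + 1) (Tb u (s, r + 1, i) ((j - 1) mod M, - 1 - (if k = NN then - NN else k)))
  else if s = r - 1 & k = NN - 1 then Tb u (s + 1, r, i) ((j + 1) mod M, 0) else 0)"

definition s0 :: "'k::field pp => 'k pp" where
 "s0 = lin_ext (%(u, w, v). s0b u w v)"

lemma s0_lin [simp]: "lin s0"
 by (simp add: s0_def)

lemma Tb_mod: "Tb u (s, r, i mod M) v = Tb u (s, r, i) v"
 using okk_ng[of u "(s, r, i)" v] by (simp add: Tb_def cong: if_cong)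

lemma s0b_ng: "s0b u (ng w) v = s0b u w v"
 by (cases w; cases v) (simp only: ng.simps s0b.simps Tb_mod)

lemma s0_Tb: "s0 (Tb u w v) = (if okk u w v then s0b u w v else 0)"
 by (auto simp: s0_def Tb_def s0b_ng)

lemma s0b_PC: "dgr w = n ==> s0b u w v : PC (n + 1)"
 by (cases w; cases v) (auto simp: T_bs[symmetric] intro!: PC_sg T_PC)

lemma s0_PC: "z : PC n ==> s0 z : PC (n + 1)"
 by (rule PC_closed[of z n]) (auto simp: T_bs s0_Tb s0b_PC)

lemma keys_s0b: "p : ks (s0b u w v) ==> fst p = u"
 by (cases w; cases v) (auto simp: Tb_def split: if_splits)

lemma Fil_s0: "Fil c z ==> Fil c (s0 z)"
 unfolding Fil_keys
proof (rule keys_lin[OF s0_lin])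
 fix p assume a: "ks z <= {p. c <= \<bar>snd (fst p)\<bar>}" "p : ks z"
 obtain u w v where p: "p = (u, w, v)" by (cases p)
 with a show "ks (s0 (bs p)) <= {p. c <= \<bar>snd (fst p)\<bar>}"
  using keys_s0b[of _ u w v] by (force simp: s0_def)
qed

text \<open>The part of the differential that does not lengthen the left factor is contracted by \<open>s0\<close>.\<close>

lemma s0_contract:
 assumes ok: "okk u (s, r, i) (j, k)" and sr: "s + r > 0"
 shows "(if s >= r & k > 0 then d0b (bs u) (s + 1, r, i) (bs ((j + 1) mod M, 1 - k))
  else if s = r & k < 0 | s < r & (k < 0 | k = NN)
   then sg (s + r + 1) (d0b (bs u) (s, r + 1, i) (bs ((j - 1) mod M, - 1 - (if k = NN then - NN else k))))
  else if s = r - 1 & k = NN - 1 then d0b (bs u) (s + 1, r, i) (bs ((j + 1) mod M, 0)) else 0)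
  + s0 (d0b (bs u) (s, r, i) (bs (j, k))) = (Tb u (s, r, i) (j, k) :: 'k::field pp)"
proof -
 have nn: "s >= 0" "r >= 0" "val u" "en u = i mod M" "- NN < k" "k <= NN" "j = (i + s - r) mod M"
  using ok by (auto simp: okk_def val_def)
 \<comment> \<open>All terms share the left factor and the index \<open>i\<close>, and the start of
   the right factor is determined by \<open>s\<close> and \<open>r\<close>, so that three integers
   describe each term.\<close>
 define E :: "int => int => int => 'k pp" where "E s r k = Tb u (s, r, i) ((i + s - r) mod M, k)" for s r k
 have N2: "NN ~= 1" by presburger
 have okE: "okk u (s, r, i) ((i + s - r) mod M, k) <-> s >= 0 & r >= 0 & - NN < k & k <= NN" for s r k
  using nn M_pos by (auto simp: okk_def val_def)
 have E0: "s < 0 | r < 0 ==> E s r k = 0" for s r k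
  by (auto simp: E_def Tb_def okk_def)
 have sh: "((i + s - r) mod M + 1) mod M = (i + (s + 1) - r) mod M"
  "((i + s - r) mod M - 1) mod M = (i + s - (r + 1)) mod M" for s r
  by (auto simp: mod_simps algebra_simps)
 have sh2: "((i + s - r) mod M + 1) mod M = (i + s - (r - 1)) mod M"
  "((i + s - r) mod M - 1) mod M = (i + (s - 1) - r) mod M" for s r
  by (auto simp: mod_simps algebra_simps)
 have D: "d0b (bs u) (s, r, i) (bs ((i + s - r) mod M, k)) =
  (if s > r then (if k <= 0 then E (s - 1) r (1 - k) else 0)
   else if k = 0 then E (s - 1) r (NN - 1) else if k = - 1 then E (s - 1) r NN else 0)
  + sg (s + r) (if s < r then (if 0 <= k & k < NN then E s (r - 1) (nrm (- 1 - k)) else 0)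
   else if k = 0 then E s (r - 1) (1 - NN) else if k = 1 then E s (r - 1) NN else 0)"
  if "- NN < k" "k <= NN" for s r k
 proof -
  have v: "val ((i + s - r) mod M, k)" using that M_pos by (auto simp: val_def)
  have a: "wd (ka s r) <> bs ((i + s - r) mod M, k) = (if s > r then (if k <= 0 then bs ((i + (s - 1) - r) mod M, 1 - k) else 0)
   else if k = 0 then bs ((i + (s - 1) - r) mod M, NN - 1) else if k = - 1 then bs ((i + (s - 1) - r) mod M, NN) else 0)"
   using that v NN_pos N2 unfolding wd_bs sft_ka sh2
   by (auto simp: ka_def fits_def jn_def nrm_def)
  have b: "wd (kb s r) <> bs ((i + s - r) mod M, k) = (if s < r then (if 0 <= k & k < NN then bs ((i + s - (r - 1)) mod M, nrm (- 1 - k)) else 0)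
   else if k = 0 then bs ((i + s - (r - 1)) mod M, 1 - NN) else if k = 1 then bs ((i + s - (r - 1)) mod M, NN) else 0)"
   using that v NN_pos N2 unfolding wd_bs sft_kb sh2 diff_minus_eq_add
   by (auto simp: kb_def fits_def jn_def nrm_def)
  show ?thesis unfolding d0b.simps a b using N1 by (auto simp: T_bs E_def)
 qed
 have S: "s0 (E s r k) = (if s >= 0 & r >= 0 & - NN < k & k <= NN then
  (if s >= r & k > 0 then E (s + 1) r (1 - k)
  else if s = r & k < 0 | s < r & (k < 0 | k = NN)
   then sg (s + r + 1) (E s (r + 1) (- 1 - (if k = NN then - NN else k)))
  else if s = r - 1 & k = NN - 1 then E (s + 1) r 0 else 0) else 0)" for s r k
  unfolding E_def s0_Tb okE s0b.simps sh ..
 note sb = lin_minus[OF s0_lin] lin_add[OF s0_lin] sg_lin[OF s0_lin] lin_0[OF s0_lin]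
 note jj = nn(7)
 show ?thesis
 proof (cases "s > r")
  case True
  thus ?thesis
   unfolding jj sh E_def[symmetric] using nn(1-6) NN_pos N2
   apply (simp add: D sb S nrm_def split del: if_split cong: if_cong)
   apply (auto simp: E0 sg_def nrm_def S sb)
   done
 next
  case False
  show ?thesis
  proof (cases "s = r")
   case True
   note Dr = D[of _ r r, simplified] D[of _ "r + 1" r, simplified] D[of _ r "r + 1", simplified]
   from True
   show ?thesis
    unfolding jj sh E_def[symmetric] using nn(1-6) NN_pos N2 sr
    apply (simp add: D Dr sb S nrm_def split del: if_split cong: if_cong)
    apply (auto simp: E0 sg_def nrm_def S sb Dr)
    done
  next
   case F2: False
   with False have "s < r" by simp
   show ?thesis
   proof (cases "r = s + 1")
    case True
    note Dr = D[of _ s "s + 1", simplified] D[of _ s "2 + s", simplified] D[of _ s "s + 2", simplified] D[of _ "s + 1" "s + 1", simplified]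
     D[of _ 0 1, simplified] D[of _ 0 2, simplified] D[of _ 1 1, simplified]
    show ?thesis
     unfolding jj sh E_def[symmetric] using nn(1-6) NN_pos N2 unfolding True
     apply (simp add: Dr sb S nrm_def split del: if_split cong: if_cong)
     apply (auto simp: E0 sg_def nrm_def S sb Dr add.commute[of 1 s])
     done
   next
    case F3: False
    with `s < r` have "s + 1 < r" by simp
    note Dr = D[of _ 0 r, simplified] D[of _ 0 "r + 1", simplified]
    consider "k = NN" | "k < - 1" | "k = - 1" | "k = 0" | "k = NN - 1" | "0 < k" "k < NN - 1" using nn(6) by linarith
    thus ?thesis
     unfolding jj sh E_def[symmetric] using nn(1-6) NN_pos N2 `s + 1 < r`
     by cases (auto simp: E0 sg_def nrm_def S sb D Dr)
   qed
  qed
 qed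
qed

lemma bd_Tb: "bd (Tb u w v) = dgb (bs u) w (bs v)"
 by (simp add: T_bs[symmetric] bd_T)

lemma s0_step:
 assumes ok: "okk u w v" and d: "dgr w > 0"
 shows "Fil (\<bar>snd u\<bar> + 1) (bd (s0 (Tb u w v)) + s0 (bd (Tb u w v)) - (Tb u w v :: 'k::field pp))"
proof -
 obtain s r i j k where w: "w = (s, r, i)" "v = (j, k)" by (metis prod.exhaust)
 define C :: "'k pp" where "C = (if s >= r & k > 0 then d0b (bs u) (s + 1, r, i) (bs ((j + 1) mod M, 1 - k))
  else if s = r & k < 0 | s < r & (k < 0 | k = NN)
   then sg (s + r + 1) (d0b (bs u) (s, r + 1, i) (bs ((j - 1) mod M, - 1 - (if k = NN then - NN else k))))
  else if s = r - 1 & k = NN - 1 then d0b (bs u) (s + 1, r, i) (bs ((j + 1) mod M, 0)) else 0)"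
 have 1: "Fil (\<bar>snd u\<bar> + 1) (bd (s0 (Tb u w v)) - C)"
  using ok unfolding w s0_Tb C_def s0b.simps
  by (auto simp: bd_simps bd_Tb sg_diff[symmetric] intro!: Fil_dgb Fil_sg)
 have "s0 (bd (Tb u w v :: 'k pp)) - s0 (d0b (bs u) w (bs v)) = s0 (dgb (bs u) w (bs v) - d0b (bs u) w (bs v))"
  by (simp add: bd_Tb lin_diff[OF s0_lin])
 hence 2: "Fil (\<bar>snd u\<bar> + 1) (s0 (bd (Tb u w v :: 'k pp)) - s0 (d0b (bs u) w (bs v)))"
  by (simp only:) (intro Fil_s0 Fil_dgb)
 have "Tb u w v = C + s0 (d0b (bs u) w (bs v))"
  unfolding w C_def by (rule s0_contract[symmetric]) (use ok d in \<open>auto simp: w\<close>)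
 hence "bd (s0 (Tb u w v)) + s0 (bd (Tb u w v)) - Tb u w v
  = (bd (s0 (Tb u w v)) - C) + (s0 (bd (Tb u w v)) - s0 (d0b (bs u) w (bs v)))"
  by (simp only:) simp
 with 1 2 show ?thesis by (simp only: Fil_add)
qed

definition aug :: "'k::field pp => 'k vv" where
 "aug = lin_ext (%(u, w, v). if dgr w = 0 then bs u <> bs v else 0)"

lemma aug_lin [simp]: "lin aug"
 by (simp add: aug_def)

lemma aug_T: "aug (T x (0, 0, i) y) = x <> vt i <> y"
proof (rule bilin_eqI[of "%x y. aug (T x (0, 0, i) y)" "%x y. x <> vt i <> y"])
 fix u v :: bas
 show "aug (T (bs u) (0, 0, i) (bs v)) = bs u <> vt i <> bs v"
  by (auto simp: T_bs Tb_def aug_def okk_def bs_vt mulb_def)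
qed (auto intro!: lin_ins lin_compose[OF aug_lin])

text \<open>A section of the augmentation up to longer left factors; in degree 0 the composite
  \<open>sm (aug z)\<close> takes the place of \<open>s0 (bd z)\<close>.\<close>

definition sm :: "'k::field vv => 'k pp" where
 "sm = lin_ext (%p. Tb p (0, 0, en p) (en p, 0))"

lemma sm_lin [simp]: "lin sm"
 by (simp add: sm_def)

lemma s0_step0:
 assumes ok: "okk u (0, 0, i) v"
 shows "Fil (\<bar>snd u\<bar> + 1) (sm (aug (Tb u (0, 0, i) v)) + bd (s0 (Tb u (0, 0, i) v)) - (Tb u (0, 0, i) v :: 'k::field pp))"
proof -
 obtain j k where v: "v = (j, k)" by (cases v)
 have nn: "val u" "en u = i mod M" "- NN < k" "k <= NN" "j = i mod M"
  using ok by (auto simp: okk_def val_def v)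
 have au: "aug (Tb u (0, 0, i) v) = bs u <> (bs v :: 'k vv)"
  using aug_T[of "bs u" i "bs v"] nn by (simp add: T_bs bs_vt)
 show ?thesis
 proof (cases "k = 0")
  case True
  have "bs u <> (bs v :: 'k vv) = bs u <> vt i" by (simp add: v True vt_def nn)
  also have "... = bs u" using nn by (simp add: bs_vt)
  finally have "sm (aug (Tb u (0, 0, i) v)) = (Tb u (0, 0, i) v :: 'k pp)"
   unfolding au by (simp add: sm_def nn v True Tb_mod)
  moreover have "s0 (Tb u (0, 0, i) v) = (0 :: 'k pp)"
   using NN_pos by (simp add: s0_Tb v True)
  ultimately show ?thesis by (simp add: bd_simps)
 next
  case False
  have "Fil (\<bar>snd u\<bar> + 1) (sm (mulb u v) :: 'k pp)"
  proof (cases "mulb u v = (0 :: 'k vv)")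
   case True
   thus ?thesis by (simp add: lin_0[OF sm_lin])
  next
   case nz: False
   hence "mulb u v = (bs (fst u, nrm (jn (snd u) k)) :: 'k vv)" by (auto simp: mulb_def v split: if_splits)
   thus ?thesis using False
    by (auto simp: sm_def Fil_def Tb_def jn_abs split: if_splits)
  qed
  moreover have "Fil (\<bar>snd u\<bar> + 1) (bd (s0 (Tb u (0, 0, i) v)) - (Tb u (0, 0, i) v :: 'k pp))"
  proof (cases "k > 0")
   case True
   have val: "val ((j + 1) mod M, 1 - k)" using nn True M_pos by (auto simp: val_def)
   have "wd 1 <> bs ((j + 1) mod M, 1 - k) = (bs (j, k) :: 'k vv)"
    using nn True val by (auto simp: wd_bs sft_def fits_def jn_def nrm_def mod_simps)
   hence "d0b (bs u) (1, 0, i) (bs ((j + 1) mod M, 1 - k)) = (Tb u (0, 0, i) v :: 'k pp)"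
    by (simp add: d0b.simps ka_def T_bs v T_neg)
   moreover have "bd (s0 (Tb u (0, 0, i) v)) = (dgb (bs u) (1, 0, i) (bs ((j + 1) mod M, 1 - k)) :: 'k pp)"
    using ok True by (simp add: s0_Tb v bd_Tb)
   ultimately show ?thesis using Fil_dgb[of u "(1, 0, i)" "bs ((j + 1) mod M, 1 - k) :: 'k vv"] by simp
  next
   case F2: False
   have val: "val ((j - 1) mod M, - 1 - k)" using nn False F2 M_pos by (auto simp: val_def)
   have "wd (-1) <> bs ((j - 1) mod M, - 1 - k) = (bs (j, k) :: 'k vv)"
    using nn False F2 val by (auto simp: wd_bs sft_def fits_def jn_def nrm_def mod_simps)
   hence "sg 1 (d0b (bs u) (0, 1, i) (bs ((j - 1) mod M, - 1 - k))) = (Tb u (0, 0, i) v :: 'k pp)"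
    by (simp add: d0b.simps kb_def T_bs v T_neg)
   hence t: "Tb u (0, 0, i) v = - (d0b (bs u) (0, 1, i) (bs ((j - 1) mod M, - 1 - k)) :: 'k pp)" by simp
   have "bd (s0 (Tb u (0, 0, i) v)) = sg 1 (dgb (bs u) (0, 1, i) (bs ((j - 1) mod M, - 1 - k)) :: 'k pp)"
    using ok False F2 nn NN_pos by (auto simp: s0_Tb v bd_Tb bd_simps)
   hence "bd (s0 (Tb u (0, 0, i) v)) - (Tb u (0, 0, i) v :: 'k pp) =
    - (dgb (bs u) (0, 1, i) (bs ((j - 1) mod M, - 1 - k)) - d0b (bs u) (0, 1, i) (bs ((j - 1) mod M, - 1 - k)))"
    unfolding t[symmetric] by (simp add: t)
   thus ?thesis
    using Fil_minus[OF Fil_dgb[of u "(0, 1, i)" "bs ((j - 1) mod M, - 1 - k) :: 'k vv"]] by simp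
  qed
  ultimately show ?thesis unfolding au mul_bs
   using Fil_add by (metis add_diff_eq)
 qed
qed

definition cyc :: "int => 'k::field pp => bool" where
 "cyc n z <-> z : PC n & (if n = 0 then aug z = 0 else bd z = 0)"

lemma bd_PC: "z : PC n ==> bd z : PC (n - 1)"
 by (rule PC_closed[of z n bd])
  (auto simp: bd_T dgb.simps intro!: PC_add PC_sum PC_sg T_PC)

lemma PC_neg: "n < 0 ==> z : PC n ==> z = 0"
 by (rule PC_eqI[of z n "%z. z" "%z. 0"]) (auto simp: T_nn okk_def)

lemma aug_bd: "z : PC 1 ==> aug (bd z) = 0"
proof (rule PC_eqI[of z 1 "%z. aug (bd z)" "%z. 0"])
 fix u w v assume "dgr w = 1" "okk u w v"
 obtain s r i where w: "w = (s, r, i)" by (cases w)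
 with `dgr w = 1` \<open>okk u w v\<close> have "s = 1 & r = 0 | s = 0 & r = 1" by (auto simp: okk_def)
 thus "aug (bd (T (bs u) w (bs v))) = 0"
  by (auto simp: lin_add[OF aug_lin] lin_minus[OF aug_lin] lin_diff[OF aug_lin] w bd_ne T_neg ka_def kb_def aug_T sg_def mul_assoc vt_wd_comm sft_def mul_assoc[symmetric, of "vt _"])
qed (auto intro!: lin_compose[OF aug_lin] lin_bd)

text \<open>On a cycle \<open>s0\<close> provides a bounding chain up to terms with a longer left
  factor. What is left over is again a cycle, one step higher in the filtration, and is treated in
  the same way.\<close>

definition nu :: "'k::field pp => 'k pp" where
 "nu z = z - bd (s0 z)"

lemma nu_lin [simp]: "lin nu"
 unfolding nu_def by (auto intro!: lin_ins lin_bd)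

lemma nu_cyc:
 assumes "cyc n z" "n >= 0"
 shows "cyc n (nu z)"
proof -
 have z: "z : PC n" using assms by (simp add: cyc_def)
 have "nu z : PC n" unfolding nu_def using bd_PC[OF s0_PC[OF z]] by (auto intro!: PC_diff z)
 moreover have "aug (nu z) = 0" if "n = 0"
  using assms that aug_bd[of "s0 z"] s0_PC[OF z] by (simp add: nu_def lin_diff[OF aug_lin] cyc_def)
 moreover have "bd (nu z) = 0" if "n ~= 0"
  using assms that bdbd[OF s0_PC[OF z]] by (simp add: nu_def bd_simps cyc_def)
 ultimately show ?thesis by (simp add: cyc_def)
qed

lemma nu_Fil:
 assumes "cyc n z" "n >= 0" "Fil c z"
 shows "Fil (c + 1) (nu z)"
proof -
 define K :: "(bas \<times> gen \<times> bas) set" where "K = {p. c + 1 <= \<bar>snd (fst p)\<bar>}"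
 have z: "z : PC n" and fz: "ks z <= {p. c <= \<bar>snd (fst p)\<bar>}"
  using assms by (auto simp: cyc_def Fil_keys)
 have kz: "okk u w v & ng w = w & dgr w = n & c <= \<bar>snd u\<bar>" if "(u, w, v) : ks z" for u w v
  using z fz that by (auto simp: PC_def)
 show ?thesis
 proof (cases "n = 0")
  case False
  define f where "f z = bd (s0 z) + s0 (bd z) - z" for z :: "'a pp"
  have lf: "lin f" unfolding f_def by (auto intro!: lin_ins lin_bd lin_compose[OF s0_lin])
  have "ks (f z) <= K"
  proof (rule keys_lin[OF lf])
   fix p assume p: "p : ks z"
   obtain u w v where e: "p = (u, w, v)" by (cases p)
   note k = kz[OF p[unfolded e]]
   have "bs p = (Tb u w v :: 'a pp)" using k by (simp add: e Tb_def)
   thus "ks (f (bs p)) <= K"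
    using s0_step[of u w v] k False assms(2) unfolding f_def Fil_keys K_def by force
  qed
  hence "Fil (c + 1) (f z)" by (simp add: Fil_keys K_def)
  moreover have "nu z = - f z" using assms False by (simp add: f_def nu_def cyc_def lin_0[OF s0_lin])
  ultimately show ?thesis by (simp add: Fil_minus)
 next
  case True
  define f where "f z = sm (aug z) + bd (s0 z) - z" for z :: "'a pp"
  have lf: "lin f" unfolding f_def by (auto intro!: lin_ins lin_bd lin_compose[OF s0_lin] lin_compose[OF sm_lin])
  have "ks (f z) <= K"
  proof (rule keys_lin[OF lf])
   fix p assume p: "p : ks z"
   obtain u w v where e: "p = (u, w, v)" by (cases p)
   note k = kz[OF p[unfolded e]]
   obtain i where w: "w = (0, 0, i)" using k True by (cases w) (auto simp: okk_def)
   have "bs p = (Tb u w v :: 'a pp)" using k by (simp add: e Tb_def)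
   thus "ks (f (bs p)) <= K"
    using s0_step0[of u i v] k unfolding f_def Fil_keys K_def w by force
  qed
  hence "Fil (c + 1) (f z)" by (simp add: Fil_keys K_def)
  moreover have "nu z = - f z" using assms True by (simp add: f_def nu_def cyc_def lin_0[OF sm_lin])
  ultimately show ?thesis by (simp add: Fil_minus)
 qed
qed

primrec sigk :: "nat => 'k::field pp => 'k pp" where
 "sigk 0 z = 0"
| "sigk (Suc t) z = s0 z + sigk t (nu z)"

lemma sigk_Suc: "sigk (Suc t) = (%z. s0 z + sigk t (nu z))"
 by (rule ext) simp

lemma sigk_lin: "lin (sigk t)"
proof (induction t)
 case 0
 have "lin (%z. 0 :: 'a pp)" by (rule lin_const0)
 thus ?case by (simp add: lin_def)
next
 case (Suc t)
 show ?case unfolding sigk_Suc by (intro lin_plus lin_compose[OF Suc nu_lin] s0_lin)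
qed

lemma sigk_PC: "z : PC n ==> sigk t z : PC (n + 1)"
proof (induction t arbitrary: z)
 case (Suc t)
 have "nu z : PC n" unfolding nu_def using bd_PC[OF s0_PC[OF Suc.prems]] by (auto intro!: PC_diff Suc.prems)
 thus ?case using Suc by (auto intro!: PC_add s0_PC)
qed simp

lemma bd_sigk:
 assumes "cyc n z" "n >= 0" "Fil c z" "c + int t > NN"
 shows "bd (sigk t z) = z"
 using assms
proof (induction t arbitrary: z c)
 case 0
 have "z = 0"
 proof (rule ccontr)
  assume "z ~= 0"
  then obtain p where p: "p : ks z" by (metis all_not_in_conv keys_eq_empty)
  thus False using 0 by (fastforce simp: cyc_def PC_def Fil_def okk_def val_def)
 qed
 thus ?case by (simp add: bd_simps)
next
 case (Suc t)
 have "bd (sigk t (nu z)) = nu z"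
  using Suc.prems by (intro Suc.IH[of "nu z" "c + 1"] nu_cyc nu_Fil) auto
 thus ?case by (simp add: bd_simps nu_def)
qed

text \<open>The left factor has length between 0 and \<open>2 * N\<close>, so
  \<open>2 * N + 1\<close> rounds exhaust the filtration. The map is linear on all chains, and it is
  on cycles that \<open>bd (sig z) = z\<close>, as the recursive constructions of chain maps and
  homotopies demand.\<close>

definition sig :: "'k::field pp => 'k pp" where
 "sig = sigk (2 * N + 1)"

lemma sig_lin [simp]: "lin sig"
 by (simp add: sig_def sigk_lin del: sigk.simps)

lemma sig_PC: "z : PC n ==> sig z : PC (n + 1)"
 unfolding sig_def by (rule sigk_PC)

lemma bd_sig: "cyc n z ==> n >= 0 ==> bd (sig z) = z"
 unfolding sig_def by (rule bd_sigk[of n z 0]) (auto simp: Fil_def)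

end

section \<open>Multilinear maps and the bar differential\<close>

text \<open>The recursion on the first argument matches that of the bar differential and of the
  compositions; \<open>mlin_slot\<close> and \<open>mlinI\<close> translate to linearity in every
  slot.\<close>

primrec mlin :: "nat => (('s \<Rightarrow>\<^sub>0 'k::field) list => ('t \<Rightarrow>\<^sub>0 'k)) => bool" where
 "mlin 0 H = True"
| "mlin (Suc n) H = ((ALL xs. length xs = n --> lin (%x. H (x # xs))) & (ALL x. mlin n (%xs. H (x # xs))))"

lemma mlin_cong: "(!!xs. length xs = n ==> H xs = G xs) ==> mlin n H = mlin n G"
proof (induction n arbitrary: H G)
 case (Suc n)
 have "mlin n (%xs. H (x # xs)) = mlin n (%xs. G (x # xs))" for x
  by (rule Suc.IH) (simp add: Suc.prems)
 moreover have "(%x. H (x # xs)) = (%x. G (x # xs))" if "length xs = n" for xs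
  using that by (auto simp: Suc.prems)
 ultimately show ?case by simp
qed simp

lemma mlin_compose: "lin f ==> mlin n H ==> mlin n (%xs. f (H xs))"
 by (induction n arbitrary: H) (auto intro: lin_compose)

lemma mlin_plus: "mlin n H ==> mlin n G ==> mlin n (%xs. H xs + G xs)"
 by (induction n arbitrary: H G) (auto intro: lin_plus)

lemma mlin_sub: "mlin n H ==> mlin n G ==> mlin n (%xs. H xs - G xs)"
 by (induction n arbitrary: H G) (auto intro: lin_sub)

lemma mlin_0 [simp]: "mlin n (%xs. 0)"
 by (induction n) auto

lemma mlin_sg: "mlin n H ==> mlin n (%xs. sg k (H xs))"
 by (rule mlin_compose[of "sg k"]) (auto intro: lin_sg)

lemma mlin_scl: "mlin n H ==> mlin n (%xs. scl k (H xs))"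
 by (rule mlin_compose[of "scl k"]) (auto intro: lin_sclI)

lemma mlin_slot: "mlin n t ==> length xs + length ys + 1 = n ==> lin (%x. t (xs @ x # ys))"
proof (induction xs arbitrary: n t)
 case Nil
 thus ?case by (cases n) auto
next
 case (Cons a xs)
 then obtain n' where n: "n = Suc n'" by (cases n) auto
 with Cons.prems have "mlin n' (%ys. t (a # ys))" "length xs + length ys + 1 = n'" by auto
 from Cons.IH[OF this] show ?case by simp
qed

lemma mlinI: "(!!xs ys. length xs + length ys + 1 = n ==> lin (%x. t (xs @ x # ys))) ==> mlin n t"
proof (induction n arbitrary: t)
 case (Suc n)
 have "lin (%x. t (x # xs))" if "length xs = n" for xs using Suc.prems[of "[]" xs] that by simp
 moreover have "mlin n (%xs. t (x # xs))" for x
  by (rule Suc.IH) (use Suc.prems[of "x # _"] in simp)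
 ultimately show ?case by simp
qed simp

lemma mlin_map:
 fixes f :: "('s \<Rightarrow>\<^sub>0 'k::field) => ('s \<Rightarrow>\<^sub>0 'k)"
 shows "mlin n t ==> lin f ==> mlin n (%xs. t (map f xs))"
proof (rule mlinI)
 fix xs ys :: "('s \<Rightarrow>\<^sub>0 'k) list" assume t: "mlin n t" "lin f" "length xs + length ys + 1 = n"
 hence "lin (%x. t (map f xs @ x # map f ys))" by (intro mlin_slot) auto
 from lin_compose[OF this t(2)] show "lin (%x. t (map f (xs @ x # ys)))" by simp
qed

context bis begin

text \<open>All terms of the bar differential except the first, with opposite sign. Peeling off the
  first argument replaces sums over positions by structural recursion; \<open>dp_sum\<close>
  recovers the usual formula.\<close>

primrec dp :: "('w => 'k::field vv => 'w) => nat => ('k vv list => 'w) => 'k vv list => 'w::ab_group_add" where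
 "dp R 0 H xs = R (H []) (hd xs)"
| "dp R (Suc n) H xs = H ((hd xs <> hd (tl xs)) # tl (tl xs)) - dp R n (%ys. H (hd xs # ys)) (tl xs)"

text \<open>The two actions are parameters, since the same differential occurs with values in the
  algebra and with values in the small complex.\<close>

definition del :: "('k::field vv => 'w => 'w) => ('w => 'k vv => 'w) => nat => ('k vv list => 'w) => 'k vv list => 'w::ab_group_add" where
 "del L R n H xs = L (hd xs) (H (tl xs)) - dp R n H xs"

definition bim :: "('k::field vv => ('t \<Rightarrow>\<^sub>0 'k) => ('t \<Rightarrow>\<^sub>0 'k)) => (('t \<Rightarrow>\<^sub>0 'k) => 'k vv => ('t \<Rightarrow>\<^sub>0 'k)) => bool" where
 "bim L R <-> (ALL x. lin (L x)) & (ALL z. lin (%x. L x z)) & (ALL x. lin (%z. R z x)) & (ALL z. lin (R z)) &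
  (ALL x y z. L (x <> y) z = L x (L y z)) & (ALL x y z. R z (x <> y) = R (R z x) y) & (ALL x y z. L x (R z y) = R (L x z) y)"

lemma bimD:
 assumes "bim L R"
 shows "lin (L x)" "lin (%x. L x z)" "lin (%z. R z x)" "lin (R z)"
  "L (x <> y) z = L x (L y z)" "R z (x <> y) = R (R z x) y" "L x (R z y) = R (L x z) y"
 using assms by (auto simp: bim_def)

lemma bim_mul: "bim (<>) (<>)"
 by (simp add: bim_def mul_assoc)

lemma bim_P: "bim la ra"
proof -
 have 1: "la (x <> y) z = la x (la y z)" for x y and z :: "'b::field pp"
  by (rule lin_eqI[of "%z. la (x <> y) z" "%z. la x (la y z)"])
   (auto simp: la_def[of _ "bs _"] mul_assoc intro!: lin_la2)
 have 2: "ra z (x <> y) = ra (ra z x) y" for x y and z :: "'b::field pp"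
  by (rule lin_eqI[of "%z. ra z (x <> y)" "%z. ra (ra z x) y"])
   (auto simp: ra_def[of "bs _"] mul_assoc intro!: lin_ra1)
 have 3: "la x (ra z y) = ra (la x z) y" for x y and z :: "'b::field pp"
  by (rule lin_eqI[of "%z. la x (ra z y)" "%z. ra (la x z) y"])
   (auto simp: ra_def[of "bs _"] la_def[of _ "bs _"] mul_assoc intro!: lin_ra1 lin_la2)
 show ?thesis unfolding bim_def by (auto simp: 1 2 3)
qed

lemma dp_cong: "(!!ys. length ys = n ==> H ys = G ys) ==> length xs = Suc n ==> dp R n H xs = dp R n G xs"
proof (induction n arbitrary: H G xs)
 case (Suc n)
 then obtain x y ys where xs: "xs = x # y # ys" "length ys = n"
  by (metis (no_types, lifting) length_Suc_conv)
 have "dp R n (%ys. H (x # ys)) (y # ys) = dp R n (%ys. G (x # ys)) (y # ys)"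
  by (rule Suc.IH) (auto simp: xs Suc.prems)
 thus ?case using Suc.prems xs by simp
qed auto

lemma del_cong: "(!!ys. length ys = n ==> H ys = G ys) ==> length xs = Suc n ==> del L R n H xs = del L R n G xs"
 unfolding del_def by (subst dp_cong[of n H G]) auto

lemma dp_hom:
 assumes "!!z w. f (z - w) = f z - f w" "!!z x. f (R z x) = R' (f z) x"
 shows "f (dp R n H xs) = dp R' n (%ys. f (H ys)) xs"
 by (induction n arbitrary: H xs) (auto simp: assms)

lemma dp_plus:
 assumes "!!x. lin (%z. R z x)"
 shows "dp R n (%ys. H ys + G ys) xs = dp R n H xs + dp R n G xs"
 by (induction n arbitrary: H G xs) (auto simp: lin_add[OF assms])

lemma dp_sub:
 assumes "!!x. lin (%z. R z x)"
 shows "dp R n (%ys. H ys - G ys) xs = dp R n H xs - dp R n G xs"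
 by (induction n arbitrary: H G xs) (auto simp: lin_diff[OF assms])

lemma dp_scl:
 assumes "!!x. lin (%z. R z x)"
 shows "dp R n (%ys. scl c (H ys)) xs = scl c (dp R n H xs)"
 by (induction n arbitrary: H xs) (auto simp: lin_scl[OF assms] scl_diff)

lemma dp_0:
 assumes "!!x. lin (%z. R z x)"
 shows "dp R n (%ys. 0) xs = 0"
 by (induction n arbitrary: xs) (auto simp: lin_0[OF assms])

lemma del_plus: "bim L R ==> del L R n (%ys. H ys + G ys) xs = del L R n H xs + del L R n G xs"
 by (simp add: del_def dp_plus bimD lin_add[OF bimD(1)])

lemma del_sub: "bim L R ==> del L R n (%ys. H ys - G ys) xs = del L R n H xs - del L R n G xs"
 by (simp add: del_def dp_sub bimD lin_diff[OF bimD(1)])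

lemma del_scl: "bim L R ==> del L R n (%ys. scl c (H ys)) xs = scl c (del L R n H xs)"
 by (simp add: del_def dp_scl bimD lin_scl[OF bimD(1)] scl_diff)

lemma del_sg: "bim L R ==> del L R n (%ys. sg k (H ys)) xs = sg k (del L R n H xs)"
 unfolding sg_scl by (rule del_scl)

lemma del_0: "bim L R ==> del L R n (%ys. 0) xs = 0"
 by (simp add: del_def dp_0 bimD lin_0[OF bimD(1)])

lemma del_hom:
 assumes "lin f" "!!z x. f (R z x) = R' (f z) x" "!!z x. f (L x z) = L' x (f z)"
 shows "f (del L R n H xs) = del L' R' n (%ys. f (H ys)) xs"
 by (simp add: del_def lin_diff[OF assms(1)] assms(3) dp_hom[of f R R', OF lin_diff[OF assms(1)] assms(2)])

lemma dp_lin: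
 assumes "!!x. lin (%z. R z x)" "!!ys. length ys = n ==> lin (%u. H u ys)" "length xs = Suc n"
 shows "lin (%u. dp R n (H u) xs)"
 using assms(2,3)
proof (induction n arbitrary: H xs)
 case 0
 have "lin (%u. H u [])" using 0 by simp
 thus ?case using lin_compose[OF assms(1)] by simp
next
 case (Suc n)
 then obtain x y ys where xs: "xs = x # y # ys" "length ys = n"
  by (metis (no_types, lifting) length_Suc_conv)
 have "lin (%u. dp R n (%ys. H u (x # ys)) (y # ys))"
  by (rule Suc.IH) (auto simp: xs Suc.prems)
 thus ?case using Suc.prems xs by (auto intro!: lin_sub)
qed

lemma mlin_merge: "mlin (Suc n) H ==> mlin (Suc n) (%xs. H ((x <> hd xs) # tl xs))"
 by (auto intro: lin_compose[of "%u. H (u # _)"])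

lemma mlin_dp: "bim L R ==> mlin n H ==> mlin (Suc n) (dp R n H)"
proof (induction n arbitrary: H)
 case 0
 thus ?case by (simp add: bimD)
next
 case (Suc n)
 have "lin (%x. dp R (Suc n) H (x # xs))" if l: "length xs = Suc n" for xs
 proof -
  obtain y ys where xs: "xs = y # ys" "length ys = n" using l by (metis length_Suc_conv)
  have "lin (%x. H ((x <> y) # ys))"
   using Suc.prems xs by (auto intro: lin_compose[of "%u. H (u # _)"])
  moreover have "lin (%u. dp R n (%zs. H (u # zs)) xs)"
   by (rule dp_lin) (use Suc.prems l in \<open>auto simp: bimD\<close>)
  ultimately show ?thesis by (simp add: xs lin_sub)
 qed
 moreover have "mlin (Suc n) (%xs. dp R (Suc n) H (x # xs))" for x
  unfolding dp.simps list.sel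
  by (intro mlin_sub mlin_merge Suc.IH) (use Suc.prems in auto)
 ultimately show ?case by (subst mlin.simps) blast
qed

lemma mlin_mulhd: "bim L R ==> mlin n H ==> mlin (Suc n) (%xs. L (hd xs) (H (tl xs)))"
 by (auto simp: bimD intro: mlin_compose)

lemma mlin_del: "bim L R ==> mlin n H ==> mlin (Suc n) (del L R n H)"
 using mlin_sub[OF mlin_mulhd mlin_dp, of L R n H L R H] by (auto simp: del_def[abs_def])

text \<open>Once the induction hypothesis has removed the part that leaves the first argument alone,
  two expressions remain, which agree by associativity of the leading factors.\<close>

lemma dp_dp: "bim L R ==> length xs = Suc (Suc n) ==> dp R (Suc n) (dp R n H) xs = 0"
proof (induction n arbitrary: H xs)
 case 0
 thus ?case by (simp add: bimD)
next
 case (Suc n)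
 then obtain x y ys where xs: "xs = x # y # ys" "length ys = Suc n"
  by (metis (no_types, lifting) length_Suc_conv)
 have "dp R (Suc n) (%ys. dp R (Suc n) H (x # ys)) (y # ys)
  = dp R (Suc n) (%ys. H ((x <> hd ys) # tl ys)) (y # ys) - dp R (Suc n) (dp R n (%ys. H (x # ys))) (y # ys)"
  unfolding dp.simps(2)[of R n H] list.sel by (rule dp_sub) (rule bimD(3)[OF Suc.prems(1)])
 also have "dp R (Suc n) (dp R n (%ys. H (x # ys))) (y # ys) = 0"
  by (rule Suc.IH) (use xs Suc.prems in auto)
 finally have "dp R (Suc n) (%ys. dp R (Suc n) H (x # ys)) (y # ys)
  = dp R (Suc n) (%ys. H ((x <> hd ys) # tl ys)) (y # ys)" by simp
 thus ?case by (simp add: xs mul_assoc)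
qed

lemma dp_mulhd:
 assumes "bim L R" "length xs = Suc n"
 shows "dp R (Suc n) (%ys. L (hd ys) (H (tl ys))) (x # xs) = L x (del L R n H xs)"
proof -
 have "L x (dp R n H xs) = dp R n (%ys. L x (H ys)) xs"
  by (rule dp_hom) (use bimD[OF assms(1)] lin_diff[OF bimD(1)[OF assms(1)]] in auto)
 thus ?thesis
  by (simp add: del_def bimD(5)[OF assms(1)] lin_diff[OF bimD(1)[OF assms(1)]])
qed

lemma del_del: "bim L R ==> length xs = Suc (Suc n) ==> del L R (Suc n) (del L R n H) xs = 0"
proof -
 assume b: "bim L R" and l: "length xs = Suc (Suc n)"
 then obtain x ys where xs: "xs = x # ys" "length ys = Suc n" by (metis length_Suc_conv)
 have "dp R (Suc n) (del L R n H) xs = dp R (Suc n) (%ys. L (hd ys) (H (tl ys))) xs - dp R (Suc n) (dp R n H) xs"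
  unfolding del_def[abs_def] by (rule dp_sub) (rule bimD(3)[OF b])
 also have "... = L x (del L R n H ys)"
  using dp_dp[OF b l, of H] dp_mulhd[OF b xs(2), of H x] by (simp only: xs) simp
 finally show ?thesis by (simp add: del_def[of L R "Suc n"] xs)
qed

section \<open>Circle products and the Gerstenhaber bracket\<close>

text \<open>Each argument that \<open>h\<close> is moved past costs the sign
  \<open>(-1)^(q - 1)\<close>. The target of \<open>f\<close> is left general, so that arguments can
  also be inserted into maps with values in chains.\<close>

primrec cp :: "nat => nat => ('k::field vv list => 'w) => ('k co) => 'k vv list => 'w::ab_group_add" where
 "cp 0 q f h xs = 0"
| "cp (Suc n) q f h xs = f (h (take q xs) # drop q xs) + sg (int q + 1) (cp n q (%ys. f (hd xs # ys)) h (tl xs))"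

lemma cp_cong:
 "(!!ys. length ys = n ==> f ys = f' ys) ==> (!!ys. length ys = q ==> h ys = h' ys) ==> length xs + 1 = n + q ==>
  cp n q f h xs = cp n q f' h' xs"
proof (induction n arbitrary: f f' xs)
 case (Suc n)
 have "cp n q (%ys. f (hd xs # ys)) h (tl xs) = cp n q (%ys. f' (hd xs # ys)) h' (tl xs)"
 proof (cases n)
  case (Suc n')
  with Suc.prems have "length (tl xs) + 1 = n + q" by simp
  thus ?thesis by (intro Suc.IH) (auto simp: Suc.prems)
 qed simp
 thus ?case using Suc.prems by auto
qed simp

lemma cp_plus: "cp n q (%ys. f ys + f' ys) h xs = cp n q f h xs + cp n q f' h xs"
 by (induction n arbitrary: f f' xs) (auto simp: sg_add)

lemma cp_sub: "cp n q (%ys. f ys - f' ys) h xs = cp n q f h xs - cp n q f' h xs"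
 by (induction n arbitrary: f f' xs) (auto simp: sg_diff)

lemma cp_0 [simp]: "cp n q (%ys. 0) h xs = 0"
 by (induction n arbitrary: xs) auto

lemma cp_sg: "cp n q (%ys. sg k (f ys)) h xs = sg k (cp n q f h xs)"
 by (induction n arbitrary: f xs) (auto simp: sg_add sg_sg add.commute)

lemma cp_scl: "cp n q (%ys. scl c (f ys)) h xs = scl c (cp n q f h xs)"
 by (induction n arbitrary: f xs) (auto simp: scl_add scl_sg)

lemma cp_lin:
 "(!!ys. length ys = n ==> lin (%u. H u ys)) ==> length xs + 1 = n + q ==> lin (%u. cp n q (H u) h xs)"
proof (induction n arbitrary: H xs)
 case (Suc n)
 have "lin (%u. cp n q (%ys. H u (hd xs # ys)) h (tl xs))"
 proof (cases n)
  case (Suc n')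
  with Suc.prems have "length (tl xs) + 1 = n + q" by simp
  thus ?thesis by (intro Suc.IH) (auto simp: Suc.prems)
 qed simp
 moreover have "lin (%u. H u (h (take q xs) # drop q xs))"
  using Suc.prems by auto
 ultimately show ?case by (auto intro!: lin_plus lin_sg)
qed simp

lemma cp_plus2: "mlin n f ==> length xs + 1 = n + q ==> cp n q f (%ys. h ys + h' ys) xs = cp n q f h xs + cp n q f h' xs"
proof (induction n arbitrary: f xs)
 case (Suc n)
 have "cp n q (%ys. f (hd xs # ys)) (%ys. h ys + h' ys) (tl xs) = cp n q (%ys. f (hd xs # ys)) h (tl xs) + cp n q (%ys. f (hd xs # ys)) h' (tl xs)"
 proof (cases n)
  case (Suc n')
  with Suc.prems have "length (tl xs) + 1 = n + q" by simp
  thus ?thesis using Suc.prems by (intro Suc.IH) auto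
 qed simp
 moreover have la: "lin (%u. f (u # drop q xs))" using Suc.prems by auto
 ultimately show ?case by (simp add: lin_add[OF la] sg_add)
qed simp

lemma cp_scl2: "mlin n f ==> length xs + 1 = n + q ==> cp n q f (%ys. scl c (h ys)) xs = scl c (cp n q f h xs)"
proof (induction n arbitrary: f xs)
 case (Suc n)
 have "cp n q (%ys. f (hd xs # ys)) (%ys. scl c (h ys)) (tl xs) = scl c (cp n q (%ys. f (hd xs # ys)) h (tl xs))"
 proof (cases n)
  case (Suc n')
  with Suc.prems have "length (tl xs) + 1 = n + q" by simp
  thus ?thesis using Suc.prems by (intro Suc.IH) auto
 qed simp
 moreover have la: "lin (%u. f (u # drop q xs))" using Suc.prems by auto
 ultimately show ?case by (simp add: lin_scl[OF la] scl_add scl_sg)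
qed simp

lemma cp_sg2: "mlin n f ==> length xs + 1 = n + q ==> cp n q f (%ys. sg k (h ys)) xs = sg k (cp n q f h xs)"
 unfolding sg_scl by (rule cp_scl2)

lemma cp_sub2: "mlin n f ==> length xs + 1 = n + q ==> cp n q f (%ys. h ys - h' ys) xs = cp n q f h xs - cp n q f h' xs"
 using cp_plus2[of n f xs q h "%ys. sg 1 (h' ys)"] cp_sg2[of n f xs q 1 h'] by simp

lemma mlin_ins: "mlin (Suc n) f ==> mlin q h ==> mlin (q + n) (%xs. f (h (take q xs) # drop q xs))"
proof (induction q arbitrary: h)
 case (Suc q)
 have "lin (%x. f (h (x # take q xs) # drop q xs))" if "length xs = q + n" for xs
  using Suc.prems that by (auto intro: lin_compose[of "%u. f (u # _)"])
 moreover have "mlin (q + n) (%xs. f (h (x # take q xs) # drop q xs))" for x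
  by (rule Suc.IH) (use Suc.prems in auto)
 ultimately show ?case by simp
qed auto

lemma mlin_cp: "mlin n f ==> mlin q h ==> k + 1 = n + q ==> mlin k (cp n q f h)"
proof (induction n arbitrary: f k)
 case 0
 have "mlin k (%xs. 0)" by simp
 thus ?case by (subst mlin_cong[of k _ "%xs. 0"]) auto
next
 case (Suc n)
 have k: "k = q + n" using Suc.prems by simp
 have 1: "mlin k (%xs. f (h (take q xs) # drop q xs))"
  unfolding k by (rule mlin_ins) (use Suc.prems in auto)
 have 2: "mlin k (%xs. cp n q (%ys. f (hd xs # ys)) h (tl xs))"
 proof (cases n)
  case (Suc n')
  hence k': "k = Suc (q + n')" using k by simp
  have "lin (%x. cp n q (%ys. f (x # ys)) h xs)" if "length xs = q + n'" for xs
   by (rule cp_lin) (use Suc.prems that Suc in auto)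
  moreover have "mlin (q + n') (cp n q (%ys. f (x # ys)) h)" for x
   by (rule Suc.IH) (use Suc.prems Suc in auto)
  ultimately show ?thesis by (simp add: k')
 qed simp
 show ?case using mlin_plus[OF 1 mlin_sg[OF 2]] by (subst mlin_cong) auto
qed

definition br :: "nat => nat => ('k::field co) => ('k co) => 'k co" where
 "br n q f h xs = cp n q f h xs - sg ((int n + 1) * (int q + 1)) (cp q n h f xs)"

lemma mlin_br: "mlin n f ==> mlin q h ==> k + 1 = n + q ==> mlin k (br n q f h)"
 using mlin_sub[OF mlin_cp[of n f q h k] mlin_sg[OF mlin_cp[of q h n f k]]]
 by (subst mlin_cong) (auto simp: br_def)

lemma br_cong:
 "(!!ys. length ys = n ==> f ys = f' ys) ==> (!!ys. length ys = q ==> h ys = h' ys) ==> length xs + 1 = n + q ==>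
  br n q f h xs = br n q f' h' xs"
 unfolding br_def by (subst cp_cong[of n f f' q h h'], auto, subst cp_cong[of q h h' n f f'], auto)

lemma br_anti: "br n q f h xs = - sg ((int n + 1) * (int q + 1)) (br q n h f xs)"
 by (simp add: br_def sg_diff sg_sg mult.commute) (simp add: sg_def)

lemma br_sub: "mlin q h ==> length xs + 1 = n + q ==> br n q (%ys. f ys - f' ys) h xs = br n q f h xs - br n q f' h xs"
 by (simp add: br_def cp_sub cp_sub2 sg_diff)

lemma br_scl: "mlin q h ==> length xs + 1 = n + q ==> br n q (%ys. scl c (f ys)) h xs = scl c (br n q f h xs)"
 by (simp add: br_def cp_scl cp_scl2 scl_diff scl_sg)

lemma br_0: "mlin q h ==> length xs + 1 = n + q ==> br n q (%ys. 0) h xs = 0"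
 using br_scl[of q h xs n 0 "%_. 0"] by simp

lemma br_02: "mlin n f ==> length xs + 1 = n + q ==> br n q f (%ys. 0) xs = 0"
 by (subst br_anti) (simp add: br_0 add.commute)

text \<open>Inserting \<open>h\<close> hits either an argument of \<open>g'\<close> or one to the
  right of it; in the second case \<open>h\<close> first passes \<open>p\<close> arguments, which
  gives the sign.\<close>

lemma cp_ins:
 assumes "mlin (Suc n) f" "p + q >= 1" "length xs + 1 = p + n + q"
 shows "cp (p + n) q (%ys. f (g' (take p ys) # drop p ys)) h xs
  = f (cp p q g' h (take (p + q - 1) xs) # drop (p + q - 1) xs)
   + sg ((int q + 1) * int p) (cp n q (%ys. f (g' (take p xs) # ys)) h (drop p xs))"
 using assms(2,3)
proof (induction p arbitrary: g' xs)
 case 0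
 have l: "lin (%u. f (u # drop (q - 1) xs))" using assms(1) 0 by auto
 thus ?case using lin_0[OF l] by simp
next
 case (Suc p)
 define x where "x = hd xs"
 have la: "lin (%u. f (u # drop (p + q) xs))" using assms(1) Suc.prems by auto
 have tk: "take q (take (p + q) xs) = take q xs" "drop q (take (p + q) xs) = take p (drop q xs)"
  by (auto simp: drop_take min_def)
 have 1: "cp (Suc p + n) q (%ys. f (g' (take (Suc p) ys) # drop (Suc p) ys)) h xs
  = f (g' (h (take q xs) # take p (drop q xs)) # drop (p + q) xs)
  + sg (int q + 1) (cp (p + n) q (%ys. f (g' (x # take p ys) # drop p ys)) h (tl xs))"
  by (simp add: x_def)
 have 2: "f (cp (Suc p) q g' h (take (p + q) xs) # drop (p + q) xs)
  = f (g' (h (take q xs) # take p (drop q xs)) # drop (p + q) xs)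
  + sg (int q + 1) (f (cp p q (%ys. g' (hd (take (p + q) xs) # ys)) h (tl (take (p + q) xs)) # drop (p + q) xs))"
  by (simp add: tk lin_add[OF la] sg_lin[OF la])
 show ?case
 proof (cases "p + q = 0")
  case True
  hence z: "p = 0" "q = 0" by auto
  have l0: "lin (%u. f (u # xs))" using la z by simp
  show ?thesis
  proof (cases xs)
   case Nil
   with Suc.prems z have "n = 0" by simp
   thus ?thesis using 1 2 z Nil lin_0[OF l0] by simp
  next
   case (Cons a list)
   thus ?thesis using 1 2 z lin_0[OF l0] by (simp add: x_def)
  qed
 next
  case False
  hence pq: "p + q >= 1" by linarith
  then obtain l where l: "p + q = Suc l" by (metis Suc_le_D One_nat_def)
  hence "length xs = Suc (l + n)" using Suc.prems by simp
  then obtain xs' where xs: "xs = x # xs'" unfolding x_def by (cases xs) auto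
  have IH: "cp (p + n) q (%ys. f (g' (x # take p ys) # drop p ys)) h xs' =
   f (cp p q (%ys. g' (x # ys)) h (take (p + q - 1) xs') # drop (p + q - 1) xs')
   + sg ((int q + 1) * int p) (cp n q (%ys. f (g' (x # take p xs') # ys)) h (drop p xs'))"
   by (rule Suc.IH[of xs' "%ys. g' (x # ys)"]) (use pq Suc.prems xs in auto)
  have "sg (int q + 1) (sg ((int q + 1) * int p) (z :: 'b \<Rightarrow>\<^sub>0 'a)) = sg ((int q + 1) * int (Suc p)) z" for z
   by (simp add: sg_sg algebra_simps)
  thus ?thesis
   using 1 2 IH by (simp add: xs l sg_add)
 qed
qed

text \<open>The associator of the circle product.\<close>

definition asr :: "nat => nat => nat => ('k::field co) => ('k co) => ('k co) => 'k co" where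
 "asr n p q f g' h xs = cp (n + p - 1) q (cp n p f g') h xs - cp n (p + q - 1) f (cp p q g' h) xs"

text \<open>Nested insertions cancel in the associator, leaving insertions of \<open>g'\<close> and
  \<open>h\<close> into different slots of \<open>f\<close>. The three terms distinguish whether the
  first slot receives \<open>g'\<close>, \<open>h\<close> or neither.\<close>

lemma asr_Suc:
 assumes "mlin (Suc n) f" "p + q >= 1" "length xs + 1 = n + p + q"
 shows "asr (Suc n) p q f g' h xs =
   sg ((int q + 1) * int p) (cp n q (%ys. f (g' (take p xs) # ys)) h (drop p xs))
  + sg (int p + 1) (cp n p (%ys. f (h (take q xs) # ys)) g' (drop q xs))
  + sg (int p + int q) (asr n p q (%ys. f (hd xs # ys)) g' h (tl xs))"
proof -
 define Q where "Q ys = sg (int p + 1) (cp n p (%zs. f (hd ys # zs)) g' (tl ys))" for ys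
 have "cp (Suc n) p f g' = (%ys. f (g' (take p ys) # drop p ys) + Q ys)"
  by (rule ext) (simp add: Q_def)
 hence 1: "cp (Suc n + p - 1) q (cp (Suc n) p f g') h xs
  = f (cp p q g' h (take (p + q - 1) xs) # drop (p + q - 1) xs)
   + sg ((int q + 1) * int p) (cp n q (%ys. f (g' (take p xs) # ys)) h (drop p xs)) + cp (p + n) q Q h xs"
  using cp_ins[OF assms(1,2), of xs g' h] assms(3) by (simp add: cp_plus add.commute)
 have 2: "cp (p + n) q Q h xs = sg (int p + 1) (cp n p (%ys. f (h (take q xs) # ys)) g' (drop q xs))
  + sg (int p + int q) (cp (n + p - 1) q (cp n p (%ys. f (hd xs # ys)) g') h (tl xs))"
 proof (cases n)
  case 0
  hence "Q = (%ys. 0)" "cp n p (%ys. f (hd xs # ys)) g' = (%ys. 0)" by (auto simp: Q_def)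
  thus ?thesis by (simp add: 0)
 next
  case (Suc n')
  have "cp (p + n) q Q h xs = cp (Suc (n + p - 1)) q Q h xs"
   by (simp add: Suc add.commute)
  also have "... = Q (h (take q xs) # drop q xs) + sg (int q + 1) (cp (n + p - 1) q (%ys. Q (hd xs # ys)) h (tl xs))"
   by (simp only: cp.simps)
  also have "(%ys. Q (hd xs # ys)) = (%ys. sg (int p + 1) (cp n p (%zs. f (hd xs # zs)) g' ys))"
   by (simp add: Q_def)
  finally have a: "cp (p + n) q Q h xs = Q (h (take q xs) # drop q xs) + sg (int q + 1)
   (cp (n + p - 1) q (%ys. sg (int p + 1) (cp n p (%zs. f (hd xs # zs)) g' ys)) h (tl xs))" .
  have b: "Q (h (take q xs) # drop q xs) = sg (int p + 1) (cp n p (%ys. f (h (take q xs) # ys)) g' (drop q xs))"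
   by (simp add: Q_def)
  show ?thesis
   unfolding a b cp_sg sg_sg by (auto simp: sg_def)
 qed
 have 3: "cp (Suc n) (p + q - 1) f (cp p q g' h) xs
  = f (cp p q g' h (take (p + q - 1) xs) # drop (p + q - 1) xs)
  + sg (int p + int q) (cp n (p + q - 1) (%ys. f (hd xs # ys)) (cp p q g' h) (tl xs))"
  using assms(2) by (simp add: of_nat_diff)
 show ?thesis unfolding asr_def 1 2 3 by (simp add: sg_diff)
qed

text \<open>As \<open>g'\<close> and \<open>h\<close> occupy different slots, the recursion
  \<open>asr_Suc\<close> is symmetric in them up to sign. This is the pre-Lie identity.\<close>

lemma prelie:
 assumes "mlin n f" "p + q >= 1" "length xs + 2 = n + p + q"
 shows "asr n p q f g' h xs = sg ((int p + 1) * (int q + 1)) (asr n q p f h g' xs)"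
 using assms
proof (induction n arbitrary: f xs)
 case 0
 have "cp 0 p f g' = (%ys. 0)" for p g' by (rule ext) simp
 thus ?case by (simp add: asr_def)
next
 case (Suc n)
 have IH: "asr n p q (%ys. f (hd xs # ys)) g' h (tl xs) = sg ((int p + 1) * (int q + 1)) (asr n q p (%ys. f (hd xs # ys)) h g' (tl xs))"
 proof (cases n)
  case 0
  have "cp 0 p f g' = (%ys. 0)" for p and f g' :: "'a vv list => 'a vv" by (rule ext) simp
  thus ?thesis by (simp add: asr_def 0)
 next
  case (Suc n')
  thus ?thesis using Suc.prems by (intro Suc.IH) auto
 qed
 have pq: "q + p >= 1" "length xs + 1 = n + p + q" "length xs + 1 = n + q + p" using Suc.prems by auto
 show ?case
  unfolding asr_Suc[OF Suc.prems(1,2) pq(2)] asr_Suc[OF Suc.prems(1) pq(1,3)] IH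
  by (auto simp: sg_def)
qed

text \<open>Expanding the brackets gives twelve double compositions, and the pre-Lie identity for
  each of the three outermost functions cancels them. The conditions on the degrees keep every inner
  bracket in nonnegative degree.\<close>

lemma jacobi:
 assumes "mlin n f" "mlin p g'" "mlin q h" "n + p >= 1" "n + q >= 1" "p + q >= 1" "length xs + 2 = n + p + q"
 shows "br (n + p - 1) q (br n p f g') h xs =
  br n (p + q - 1) f (br p q g' h) xs + sg ((int p + 1) * (int q + 1)) (br (n + q - 1) p (br n q f h) g' xs)"
proof -
 have l: "length xs + 1 = n + p - 1 + q" "length xs + 1 = n + (p + q - 1)" "length xs + 1 = n + q - 1 + p"
  "length xs + 1 = q + (n + p - 1)" "length xs + 1 = p + q - 1 + n" "length xs + 1 = p + (n + q - 1)"
  using assms by auto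
 have B1: "br (n + p - 1) q (br n p f g') h xs =
  cp (n + p - 1) q (cp n p f g') h xs - sg ((int n + 1) * (int p + 1)) (cp (n + p - 1) q (cp p n g' f) h xs)
  - sg ((int n + int p) * (int q + 1)) (cp q (n + p - 1) h (cp n p f g') xs
   - sg ((int n + 1) * (int p + 1)) (cp q (n + p - 1) h (cp p n g' f) xs))"
  unfolding br_def[of "n + p - 1"] br_def[of n p f g', abs_def] cp_sub cp_sg cp_sub2[OF assms(3) l(4)] cp_sg2[OF assms(3) l(4)]
  using assms(4) by (simp add: of_nat_diff)
 have B2: "br n (p + q - 1) f (br p q g' h) xs =
  cp n (p + q - 1) f (cp p q g' h) xs - sg ((int p + 1) * (int q + 1)) (cp n (p + q - 1) f (cp q p h g') xs)
  - sg ((int n + 1) * (int p + int q)) (cp (p + q - 1) n (cp p q g' h) f xs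
   - sg ((int p + 1) * (int q + 1)) (cp (p + q - 1) n (cp q p h g') f xs))"
  unfolding br_def[of n "p + q - 1"] br_def[of p q g' h, abs_def] cp_sub cp_sg cp_sub2[OF assms(1) l(2)] cp_sg2[OF assms(1) l(2)]
  using assms(6) by (simp add: of_nat_diff)
 have B3: "br (n + q - 1) p (br n q f h) g' xs =
  cp (n + q - 1) p (cp n q f h) g' xs - sg ((int n + 1) * (int q + 1)) (cp (n + q - 1) p (cp q n h f) g' xs)
  - sg ((int n + int q) * (int p + 1)) (cp p (n + q - 1) g' (cp n q f h) xs
   - sg ((int n + 1) * (int q + 1)) (cp p (n + q - 1) g' (cp q n h f) xs))"
  unfolding br_def[of "n + q - 1"] br_def[of n q f h, abs_def] cp_sub cp_sg cp_sub2[OF assms(2) l(6)] cp_sg2[OF assms(2) l(6)]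
  using assms(5) by (simp add: of_nat_diff)
 have P1: "asr n p q f g' h xs = sg ((int p + 1) * (int q + 1)) (asr n q p f h g' xs)"
  by (rule prelie) (use assms in auto)
 have P2: "asr p n q g' f h xs = sg ((int n + 1) * (int q + 1)) (asr p q n g' h f xs)"
  by (rule prelie) (use assms in auto)
 have P3: "asr q n p h f g' xs = sg ((int n + 1) * (int p + 1)) (asr q p n h g' f xs)"
  by (rule prelie) (use assms in auto)
 have c: "p + n = n + p" "q + n = n + q" "q + p = p + q" by auto
 note P = P1[unfolded asr_def c] P2[unfolded asr_def c] P3[unfolded asr_def c]
 have P': "cp (n + p - 1) q (cp n p f g') h xs = cp n (p + q - 1) f (cp p q g' h) xs
   + sg ((int p + 1) * (int q + 1)) (cp (n + q - 1) p (cp n q f h) g' xs - cp n (p + q - 1) f (cp q p h g') xs)"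
  "cp (n + p - 1) q (cp p n g' f) h xs = cp p (n + q - 1) g' (cp n q f h) xs
   + sg ((int n + 1) * (int q + 1)) (cp (p + q - 1) n (cp p q g' h) f xs - cp p (n + q - 1) g' (cp q n h f) xs)"
  "cp (n + q - 1) p (cp q n h f) g' xs = cp q (n + p - 1) h (cp n p f g') xs
   + sg ((int n + 1) * (int p + 1)) (cp (p + q - 1) n (cp q p h g') f xs - cp q (n + p - 1) h (cp p n g' f) xs)"
  using P by (simp_all add: algebra_simps)
 show ?thesis
  unfolding B1 B2 B3 P'
  by (cases "even n"; cases "even p"; cases "even q") (simp_all add: sg_def)
qed

definition mu2 :: "'k::field co" where
 "mu2 xs = hd xs <> hd (tl xs)"

lemma mu2_Cons [simp]: "mu2 (x # y # ys) = x <> y"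
 by (simp add: mu2_def)

lemma mlin_mu2: "mlin 2 mu2"
 by (auto simp: numeral_2_eq_2 mu2_def)

abbreviation dl :: "nat => ('k::field co) => 'k co" where
 "dl \<equiv> del (<>) (<>)"

lemma dp_cp: "length xs = Suc n ==> dp (<>) n f xs = cp n 2 f mu2 xs + sg (int n) (f (butlast xs) <> last xs)"
proof (induction n arbitrary: f xs)
 case 0
 then obtain x where "xs = [x]" by (metis length_0_conv length_Suc_conv)
 thus ?case by simp
next
 case (Suc n)
 then obtain x y ys where xs: "xs = x # y # ys" "length ys = n"
  by (metis (no_types, lifting) length_Suc_conv)
 have "dp (<>) n (%zs. f (x # zs)) (y # ys) = cp n 2 (%zs. f (x # zs)) mu2 (y # ys)
   + sg (int n) (f (x # butlast (y # ys)) <> last (y # ys))"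
  by (rule Suc.IH) (simp add: xs)
 thus ?case by (simp add: xs) (simp add: sg_def)
qed

lemma dl_br: "length xs = Suc n ==> dl n f xs = - br n 2 f mu2 xs"
proof -
 assume l: "length xs = Suc n"
 then obtain x ys where xs: "xs = x # ys" "length ys = n" by (metis length_Suc_conv)
 have c: "cp 2 n mu2 f xs = f (butlast xs) <> last xs + sg (int n + 1) (x <> f ys)"
 proof (cases ys rule: rev_cases)
  case Nil
  thus ?thesis using xs by (simp add: numeral_2_eq_2)
 next
  case (snoc zs z)
  hence n: "n = Suc (length zs)" using xs by simp
  show ?thesis using xs snoc by (simp add: numeral_2_eq_2 n butlast_append)
 qed
 show ?thesis
  unfolding del_def br_def dp_cp[OF l] c by (simp add: xs) (simp add: sg_def)
qed

text \<open>The differential is bracketing with the multiplication, so that it is a derivation of the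
 bracket by the Jacobi identity.\<close>

lemma br_dl:
 assumes "mlin l u" "mlin q h" "l + q >= 1" "length xs = l + q"
  "!!ys. length ys = Suc q ==> dl q h ys = 0"
 shows "br (Suc l) q (dl l u) h xs = sg (int q + 1) (dl (l + q - 1) (br l q u h) xs)"
proof -
 have z: "br 2 q mu2 h ys = 0" if "length ys = Suc q" for ys
  using assms(5)[OF that] dl_br[OF that, of h] br_anti[of 2 q mu2 h ys] by (simp add: sg_def)
 have "br (Suc l) q (dl l u) h xs = br (l + 2 - 1) q (%ys. 0 - br l 2 u mu2 ys) h xs"
  using assms(4) by (simp, intro br_cong) (auto simp: dl_br)
 also have "... = - br (l + 2 - 1) q (br l 2 u mu2) h xs"
  using br_sub[OF assms(2), of xs "l + 2 - 1" "%_. 0" "br l 2 u mu2"] br_0[OF assms(2), of xs "l + 2 - 1"] assms(4) by simp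
 also have "br (l + 2 - 1) q (br l 2 u mu2) h xs
  = br l (2 + q - 1) u (br 2 q mu2 h) xs + sg ((2 + 1) * (int q + 1)) (br (l + q - 1) 2 (br l q u h) mu2 xs)"
  using jacobi[OF assms(1) mlin_mu2 assms(2), of xs] assms(3,4) by simp
 also have "br l (2 + q - 1) u (br 2 q mu2 h) xs = br l (2 + q - 1) u (%ys. 0) xs"
  by (rule br_cong) (use z assms(4) in auto)
 also have "... = 0" using assms(1,4) by (intro br_02) auto
 also have "br (l + q - 1) 2 (br l q u h) mu2 xs = - dl (l + q - 1) (br l q u h) xs"
  using assms(3,4) by (simp add: dl_br)
 finally show ?thesis by (simp add: sg_def)
qed

section \<open>Cocycles and cohomologous cochains\<close>

definition zc :: "nat => ('k::field co) => bool" where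
 "zc n f <-> mlin n f & (ALL xs. length xs = Suc n --> dl n f xs = 0)"

lemma zc_br:
 assumes "zc n f" "zc q h" "n + q >= 1"
 shows "zc (n + q - 1) (br n q f h)"
proof -
 have m: "mlin n f" "mlin q h" using assms by (auto simp: zc_def)
 have "dl (n + q - 1) (br n q f h) xs = 0" if l: "length xs = Suc (n + q - 1)" for xs
 proof -
  have l': "length xs = n + q" using l assms(3) by simp
  have "sg (int q + 1) (dl (n + q - 1) (br n q f h) xs) = br (Suc n) q (dl n f) h xs"
   by (rule br_dl[symmetric]) (use assms m l' in \<open>auto simp: zc_def\<close>)
  also have "... = br (Suc n) q (%ys. 0) h xs"
   by (rule br_cong) (use assms l' in \<open>auto simp: zc_def\<close>)
  also have "... = 0" using m l' by (intro br_0) auto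
  finally show ?thesis by (auto simp: sg_def split: if_splits)
 qed
 thus ?thesis using mlin_br[OF m, of "n + q - 1"] assms(3) by (simp add: zc_def)
qed

definition coh :: "nat => ('k::field co) => ('k co) => bool" where
 "coh n f h <-> (case n of 0 => f [] = h []
  | Suc l => EX t. mlin l t & (ALL xs. length xs = n --> f xs - h xs = dl l t xs))"

lemma cohI: "mlin l t ==> (!!xs. length xs = Suc l ==> f xs - h xs = dl l t xs) ==> coh (Suc l) f h"
 by (auto simp: coh_def)

lemma coh_eqI: "(!!xs. length xs = n ==> f xs = h xs) ==> coh n f h"
proof (cases n)
 case (Suc l)
 assume "!!xs. length xs = n ==> f xs = h xs"
 thus ?thesis unfolding Suc by (intro cohI[of l "%_. 0"]) (auto simp: Suc del_0[OF bim_mul])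
qed (auto simp: coh_def)

lemma coh_refl: "coh n f f"
 by (rule coh_eqI) simp

lemma coh_scl: "coh n f h ==> coh n (%xs. scl c (f xs)) (%xs. scl c (h xs))"
proof (cases n)
 case (Suc l)
 assume "coh n f h"
 then obtain t where t: "mlin l t" "!!xs. length xs = Suc l ==> f xs - h xs = dl l t xs"
  by (auto simp: coh_def Suc)
 thus ?thesis unfolding Suc
  by (intro cohI[of l "%xs. scl c (t xs)"] mlin_scl) (auto simp: del_scl[OF bim_mul] scl_diff[symmetric])
qed (auto simp: coh_def)

lemma coh_plus: "coh n f h ==> coh n f' h' ==> coh n (%xs. f xs + f' xs) (%xs. h xs + h' xs)"
proof (cases n)
 case (Suc l)
 assume "coh n f h" "coh n f' h'"
 then obtain t t' where t: "mlin l t" "!!xs. length xs = Suc l ==> f xs - h xs = dl l t xs"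
  "mlin l t'" "!!xs. length xs = Suc l ==> f' xs - h' xs = dl l t' xs"
  by (auto simp: coh_def Suc)
 have "f xs + f' xs - (h xs + h' xs) = dl l (%xs. t xs + t' xs) xs" if "length xs = Suc l" for xs
  unfolding del_plus[OF bim_mul] t(2)[OF that, symmetric] t(4)[OF that, symmetric] by simp
 with t show ?thesis unfolding Suc
  by (intro cohI[of l "%xs. t xs + t' xs"] mlin_plus) auto
qed (auto simp: coh_def)

lemma coh_minus: "coh n f h ==> coh n (%xs. - f xs) (%xs. - h xs)"
 using coh_scl[of n f h "-1"] by (simp add: scl_minus_left)

lemma coh_sg: "coh n f h ==> coh n (%xs. sg k (f xs)) (%xs. sg k (h xs))"
 unfolding sg_scl by (rule coh_scl)

lemma coh_sym: "coh n f h ==> coh n h f"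
proof -
 assume "coh n f h"
 from coh_plus[OF coh_minus[OF this] coh_refl[of n "%xs. f xs + h xs"]] show ?thesis by simp
qed

lemma coh_trans: "coh n f h ==> coh n h k ==> coh n f k"
proof -
 assume "coh n f h" "coh n h k"
 from coh_plus[OF coh_plus[OF this] coh_refl[of n "%xs. - h xs"]] show ?thesis by simp
qed

text \<open>If \<open>t\<close> cobounds the difference of \<open>f\<close> and \<open>f'\<close>,
  then the bracket of \<open>t\<close> with \<open>h\<close> cobounds that of the brackets, up to
  sign. Its degree \<open>n + q - 2\<close> has to be nonnegative, whence the last condition; for
  \<open>n = 0\<close> there is no \<open>t\<close> and the cochains agree.\<close>

lemma coh_br1:
 assumes "coh n f f'" "zc q h" "n + q >= 2 | n = 0"
 shows "coh (n + q - 1) (br n q f h) (br n q f' h)"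
proof (cases n)
 case 0
 show ?thesis
 proof (cases q)
  case 0
  thus ?thesis using `n = 0` by (intro coh_eqI) (simp add: br_def)
 next
  case (Suc q')
  thus ?thesis using assms `n = 0` by (intro coh_eqI br_cong) (auto simp: coh_def)
 qed
next
 case (Suc l)
 then obtain t where t: "mlin l t" "!!xs. length xs = Suc l ==> f xs - f' xs = dl l t xs"
  using assms by (auto simp: coh_def)
 have h: "mlin q h" using assms by (simp add: zc_def)
 have lq: "l + q >= 1" using assms Suc by auto
 hence e: "n + q - 1 = Suc (l + q - 1)" using Suc by simp
 have "br n q f h xs - br n q f' h xs = dl (l + q - 1) (%xs. sg (int q + 1) (br l q t h xs)) xs"
  if len: "length xs = Suc (l + q - 1)" for xs
 proof -
  have len': "length xs + 1 = n + q" "length xs = l + q" using len lq Suc by auto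
  have "br n q f h xs - br n q f' h xs = br n q (%ys. f ys - f' ys) h xs"
   using br_sub[OF h len'(1)] by simp
  also have "... = br (Suc l) q (dl l t) h xs"
   unfolding Suc by (rule br_cong) (use t len' Suc in auto)
  also have "... = sg (int q + 1) (dl (l + q - 1) (br l q t h) xs)"
   by (rule br_dl) (use t h lq len' assms(2) in \<open>auto simp: zc_def\<close>)
  finally show ?thesis by (simp add: del_sg[OF bim_mul])
 qed
 moreover have "mlin (l + q - 1) (%xs. sg (int q + 1) (br l q t h xs))"
  using lq by (intro mlin_sg mlin_br t h) simp
 ultimately show ?thesis unfolding e by (intro cohI) auto
qed

lemma coh_br2:
 assumes "coh q h h'" "zc n f" "n + q >= 2 | q = 0"
 shows "coh (n + q - 1) (br n q f h) (br n q f h')"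
 unfolding br_anti[of n q f, abs_def]
 using coh_minus[OF coh_sg[OF coh_br1[OF assms(1,2)]]] assms(3) by (simp add: add.commute)

lemma coh_br:
 assumes "coh n f f'" "coh q h h'" "zc q h" "zc n f'" "n + q >= 2 | (n = 0 & q = 0)"
 shows "coh (n + q - 1) (br n q f h) (br n q f' h')"
 by (rule coh_trans[OF coh_br1 coh_br2]) (use assms in auto)

lemma zc_coh: "zc n f ==> coh n f h ==> mlin n h ==> zc n h"
proof -
 assume a: "zc n f" "coh n f h" "mlin n h"
 have "dl n h xs = 0" if "length xs = Suc n" for xs
 proof (cases n)
  case 0
  hence "dl n h xs = dl n f xs" using a that by (cases xs) (auto simp: coh_def del_def)
  thus ?thesis using a that by (simp add: zc_def)
 next
  case (Suc l)
  then obtain t where t: "!!xs. length xs = Suc l ==> f xs - h xs = dl l t xs" using a by (auto simp: coh_def)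
  have "dl n h xs = dl n (%ys. f ys - dl l t ys) xs"
   by (rule del_cong) (use t Suc that in \<open>auto simp: t[symmetric]\<close>)
  also have "... = 0" using a that by (simp add: del_sub[OF bim_mul] del_del[OF bim_mul] Suc zc_def)
  finally show ?thesis .
 qed
 with a show ?thesis by (simp add: zc_def)
qed

subsection \<open>Sum formulas\<close>

definition mrg :: "nat => 'k::field vv list => 'k vv list" where
 "mrg i xs = take (i - 1) xs @ (xs ! (i - 1) <> xs ! i) # drop (i + 1) xs"

lemma mrg_Cons: "i >= 1 ==> mrg (Suc i) (x # xs) = x # mrg i xs"
 by (cases i) (auto simp: mrg_def)

lemma sum_1_Suc: "(SUM i:{1..Suc n}. f i) = f 1 + (SUM i:{1..n}. f (Suc i))" for f :: "nat => 'w::comm_monoid_add"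
 by (subst sum.atLeast_Suc_atMost) (auto simp: sum.shift_bounds_cl_Suc_ivl simp del: sum.cl_ivl_Suc)

lemma dp_sum: "length xs = Suc n ==>
 dp R n H xs = - (SUM i:{1..n}. sg (int i) (H (mrg i xs))) - sg (int n + 1) (R (H (butlast xs)) (last xs))"
proof (induction n arbitrary: H xs)
 case 0
 then obtain x where "xs = [x]" by (metis length_Suc_conv length_0_conv)
 thus ?case by simp
next
 case (Suc n)
 then obtain x y ys where xs: "xs = x # y # ys" "length ys = n" by (metis length_Suc_conv)
 have "dp R n (%ys. H (x # ys)) (y # ys) = - (SUM i:{1..n}. sg (int i) (H (x # mrg i (y # ys))))
   - sg (int n + 1) (R (H (x # butlast (y # ys))) (last (y # ys)))"
  by (rule Suc.IH) (simp add: xs)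
 moreover have "(SUM i:{1..n}. sg (int i) (H (x # mrg i (y # ys)))) = (SUM i:{1..n}. sg (int i) (H (mrg (Suc i) xs)))"
  by (rule sum.cong) (auto simp: xs mrg_Cons)
 moreover have "mrg 1 xs = (x <> y) # ys" by (simp add: mrg_def xs)
 moreover have "(SUM i:{1..n}. sg (int (Suc i)) (H (mrg (Suc i) xs))) = - (SUM i:{1..n}. sg (int i) (H (mrg (Suc i) xs)))"
  unfolding sum_negf[symmetric] by (rule sum.cong) (auto simp: sg_def)
 moreover have "sg (int (Suc n) + 1) z = - sg (int n + 1) z" for z :: 'b by (simp add: sg_def)
 moreover have "butlast xs = x # butlast (y # ys)" "last xs = last (y # ys)"
  "dp R (Suc n) H xs = H ((x <> y) # ys) - dp R n (%ys. H (x # ys)) (y # ys)" by (simp_all add: xs)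
 ultimately show ?case
  unfolding sum_1_Suc by simp
qed

lemma cp_sum: "length xs + 1 = n + q ==> cp n q f h xs =
 (SUM i:{1..n}. sg ((int q + 1) * (int i - 1)) (f (take (i - 1) xs @ h (take q (drop (i - 1) xs)) # drop (i - 1 + q) xs)))"
proof (induction n arbitrary: f xs)
 case (Suc n)
 have r: "cp n q (%ys. f (hd xs # ys)) h (tl xs) = (SUM i:{1..n}. sg ((int q + 1) * (int i - 1)) (f (take i xs @ h (take q (drop i xs)) # drop (i + q) xs)))"
 proof (cases xs)
  case Nil
  hence "n = 0" using Suc.prems by simp
  thus ?thesis by simp
 next
  case (Cons x ys)
  hence "cp n q (%ys. f (hd xs # ys)) h (tl xs) = (SUM i:{1..n}. sg ((int q + 1) * (int i - 1))
   (f (x # take (i - 1) ys @ h (take q (drop (i - 1) ys)) # drop (i - 1 + q) ys)))"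
   using Suc.IH[of ys "%ys. f (x # ys)"] Suc.prems by simp
  also have "... = (SUM i:{1..n}. sg ((int q + 1) * (int i - 1)) (f (take i xs @ h (take q (drop i xs)) # drop (i + q) xs)))"
  proof (rule sum.cong)
   fix i assume "i : {1..n}"
   then obtain k where "i = Suc k" by (cases i) auto
   thus "sg ((int q + 1) * (int i - 1)) (f (x # take (i - 1) ys @ h (take q (drop (i - 1) ys)) # drop (i - 1 + q) ys))
    = sg ((int q + 1) * (int i - 1)) (f (take i xs @ h (take q (drop i xs)) # drop (i + q) xs))" by (simp add: Cons)
  qed simp
  finally show ?thesis .
 qed
 have s: "sg (int q + 1) (sg ((int q + 1) * (int i - 1)) z) = sg ((int q + 1) * (int (Suc i) - 1)) z" for i z
  by (simp add: sg_sg algebra_simps)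
 show ?case
  unfolding sum_1_Suc cp.simps(2) r sg_sum s by simp
qed simp

lemma dp_map:
 assumes "!!x y. h (x <> y) = h x <> h y" "!!z w. f (z - w) = f z - f w" "!!z x. f (R z (h x)) = R' (f z) x"
 shows "length xs = Suc n ==> f (dp R n H (map h xs)) = dp R' n (%ys. f (H (map h ys))) xs"
proof (induction n arbitrary: H xs)
 case 0
 thus ?case by (cases xs) (auto simp: assms(3))
next
 case (Suc n)
 then obtain x y zs where xs: "xs = x # y # zs" "length zs = n" by (metis length_Suc_conv)
 have "f (dp R n (%us. H (h x # us)) (map h (y # zs))) = dp R' n (%us. f (H (h x # map h us))) (y # zs)"
  by (rule Suc.IH) (simp add: xs)
 thus ?case by (simp add: xs assms(1,2))
qed


lemma la_bs: "la x (bs (u, w, v)) = T (x <> bs u) w (bs v)" and ra_bs: "ra (bs (u, w, v)) x = T (bs u) w (bs v <> x)"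
 by (simp_all add: la_def ra_def)

lemma bd_bs: "bd (bs (u, w, v)) = dgb (bs u) w (bs v)"
 by (simp add: bd_def)

lemma la_dgb: "la x (dgb u w v) = dgb (x <> u) w v" and ra_dgb: "ra (dgb u w v) x = dgb u w (v <> x)"
 by (cases w, simp add: dgb.simps lin_add[OF la_lin2] lin_sum[OF la_lin2] sg_lin[OF la_lin2] mul_assoc
  lin_add[OF ra_lin1] lin_sum[OF ra_lin1] sg_lin[OF ra_lin1])+

lemma bd_la: "bd (la x z) = la x (bd z)"
 by (rule lin_eqI[of "%z. bd (la x z)" "%z. la x (bd z)"])
  (auto simp: la_bs bd_bs bd_T la_dgb intro!: lin_bd lin_la2)

lemma bd_ra: "bd (ra z x) = ra (bd z) x"
 by (rule lin_eqI[of "%z. bd (ra z x)" "%z. ra (bd z) x"])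
  (auto simp: ra_bs bd_bs bd_T ra_dgb intro!: lin_bd lin_ra1)

lemma la_PC: "z : PC n ==> la x z : PC n" and ra_PC: "z : PC n ==> ra z x : PC n"
 by (auto intro!: PC_closed[of z n "la x" n] PC_closed[of z n "%z. ra z x" n] T_PC)

lemma dp_PC: "(!!ys. H ys : PC k) ==> dp ra n H xs : PC k"
 by (induction n arbitrary: H xs) (auto intro!: ra_PC PC_diff)

lemma del_PC: "(!!ys. H ys : PC k) ==> del la ra n H xs : PC k"
 unfolding del_def by (intro PC_diff la_PC dp_PC)

lemma del_bd: "bd (del la ra n H xs) = del la ra n (%ys. bd (H ys)) xs"
 by (rule del_hom) (auto simp: bd_la bd_ra)

text \<open>The bimodule generator \<open>1 \<otimes> w \<otimes> 1\<close>; by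
  \<open>one_of_T\<close> its image determines a bimodule map.\<close>

definition ow :: "gen => 'k::field pp" where
 "ow w = T (vt (sr w)) w (vt (tg w))"

lemma one_of_T: "la x (ra (ow w) y) = T x w y"
 by (simp add: ow_def T_vt_left T_vt_right)

lemma one_of_PC: "dgr w = n ==> ow w : PC n"
 by (simp add: ow_def T_PC)

lemma one_of_ng [simp]: "ow (ng w) = ow w"
 by (simp add: ow_def)

lemma bd_T_one: "bd (T x w y) = la x (ra (bd (ow w)) y)"
 by (metis one_of_T bd_la bd_ra)

subsection \<open>Cochains on the small complex\<close>

definition px :: "('k::field gv) => 'k pp => 'k vv" where
 "px y = lin_ext (%(u, w, v). bs u <> y w <> bs v)"

lemma px_lin [simp]: "lin (px y)"
 by (simp add: px_def)

text \<open>Bimodule maps over the vertices, as functions on all triples of indices. Vanishing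
  outside the quadrant lets formulas such as \<open>px_T\<close> hold for every index.\<close>

definition par :: "('k::field gv) => bool" where
 "par y <-> (ALL w. y (ng w) = y w & vt (sr w) <> y w = y w & y w <> vt (tg w) = y w & (~ nn w --> y w = 0))"

lemma parD: "par y ==> y (ng w) = y w" "par y ==> vt (sr w) <> y w = y w" "par y ==> y w <> vt (tg w) = y w"
 "par y ==> ~ nn w ==> y w = 0"
 unfolding par_def by blast+

lemma px_T: "par y ==> px y (T u w v) = u <> y w <> v"
proof (rule bilin_eqI[of "%u v. px y (T u w v)" "%u v. u <> y w <> v"])
 fix u v assume y: "par y"
 have "bs u <> y w <> bs v = 0" if n: "~ okk u w v"
 proof -
  have e: "bs u <> y w <> bs v = (bs u <> vt (sr w)) <> y w <> (vt (tg w) <> bs v)"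
   using parD(2,3)[OF y, of w] by (metis mul_assoc)
  show ?thesis
  proof (cases "nn w")
   case True
   hence "~ val u | ~ val v | en u ~= sr w | fst v ~= tg w" using n by (auto simp: okk_def)
   thus ?thesis unfolding e by (auto simp: bs_vt vt_bs)
  qed (simp add: parD(4)[OF y])
 qed
 thus "px y (T (bs u) w (bs v)) = bs u <> y w <> bs v"
  by (auto simp: T_bs Tb_def px_def parD(1)[OF y])
qed (auto intro!: lin_ins lin_compose[OF px_lin])

lemma px_la: "par y ==> px y (la x z) = x <> px y z"
 by (rule lin_eqI[of "%z. px y (la x z)" "%z. x <> px y z"])
  (auto simp: la_bs px_T mul_assoc px_def[THEN fun_cong, of _ "bs _"] intro!: lin_ins lin_la2 lin_compose[OF px_lin])

lemma px_ra: "par y ==> px y (ra z x) = px y z <> x"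
 by (rule lin_eqI[of "%z. px y (ra z x)" "%z. px y z <> x"])
  (auto simp: ra_bs px_T mul_assoc px_def[THEN fun_cong, of _ "bs _"] intro!: lin_ins lin_ra1 lin_compose[OF px_lin])

lemma px_cong: "z : PC n ==> (!!w. dgr w = n ==> ng w = w ==> nn w ==> y w = y' w) ==> px y z = px y' z"
 unfolding px_def by (rule lin_eqI[OF lin_lin_ext lin_lin_ext]) (auto simp: PC_def okk_def)

lemma px_plus: "px (%w. y w + y' w) z = px y z + px y' z"
 unfolding px_def by (rule lin_eqI[of _ "%z. _ z + _ z"])
  (auto simp: mul_add_left mul_add_right intro!: lin_ins)

lemma px_scl: "px (%w. scl c (y w)) z = scl c (px y z)"
 unfolding px_def by (rule lin_eqI[of _ "%z. scl c (_ z)"])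
  (auto simp: mul_scl_left mul_scl_right intro!: lin_ins)

definition pcc :: "int => ('k::field gv) => bool" where
 "pcc n y <-> par y & (ALL w. dgr w = n + 1 --> ng w = w --> nn w --> px y (bd (ow w)) = 0)"

lemma pcc_bd: "pcc n y ==> z : PC (n + 1) ==> px y (bd z) = 0"
 by (rule PC_eqI[of z "n + 1" "%z. px y (bd z)" "%z. 0"])
  (auto simp: bd_T_one px_la px_ra pcc_def okk_def intro!: lin_bd lin_compose[OF px_lin])

definition cob :: "('k::field gv) => 'k gv" where
 "cob y w = px y (bd (ow w))"

lemma one_of_vt: "la (vt (sr w)) (ow w) = ow w" "ra (ow w) (vt (tg w)) = ow w"
 by (simp_all add: ow_def vt_vt)

lemma cob_par: "par y ==> par (cob y)"
proof -
 assume y: "par y"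
 have "vt (sr w) <> cob y w = cob y w" "cob y w <> vt (tg w) = cob y w" for w
  unfolding cob_def px_la[OF y, symmetric] px_ra[OF y, symmetric] bd_la[symmetric] bd_ra[symmetric] one_of_vt
  by auto
 moreover have "cob y w = 0" if "~ nn w" for w
  using that by (simp add: cob_def ow_def T_nn bd_simps lin_0[OF px_lin])
 ultimately show ?thesis by (simp add: par_def cob_def)
qed

lemma px_cob: "par y ==> z : PC n ==> px (cob y) z = px y (bd z)"
 by (rule PC_eqI[of z n "%z. px (cob y) z" "%z. px y (bd z)"])
  (auto simp: bd_T_one px_la px_ra px_T cob_par cob_def mul_assoc intro!: lin_bd lin_compose[OF px_lin])

subsection \<open>Chain maps from the bar resolution\<close>

text \<open>The minus sign is the convention of \<open>comparison_map\<close>, where the resolution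
  carries \<open>- diff\<close>. As a consequence, pulling back along \<open>Z\<close> turns
  \<open>cob\<close> into minus the bar differential.\<close>

definition cmap :: "('k::field fam) => bool" where
 "cmap Z <-> (ALL n. mlin n (Z n)) & (ALL n xs. Z n xs : PC (int n)) &
  (ALL n xs. length xs = Suc n --> bd (Z (Suc n) xs) = - del la ra n (Z n) xs) & aug (Z 0 []) = wd 0"

lemma cmapD:
 assumes "cmap Z"
 shows "mlin n (Z n)" "Z n xs : PC (int n)" "length xs = Suc n ==> bd (Z (Suc n) xs) = - del la ra n (Z n) xs"
  "aug (Z 0 []) = wd 0"
 using assms by (auto simp: cmap_def)

lemma px_del: "par y ==> px y (del la ra n H xs) = dl n (%ys. px y (H ys)) xs"
 by (rule del_hom) (auto simp: px_la px_ra)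

lemma pb_dl:
 assumes "cmap Z" "par y" "length xs = Suc n"
 shows "dl n (%ys. px y (Z n ys)) xs = - px y (bd (Z (Suc n) xs))"
 using cmapD(3)[OF assms(1,3)] by (simp add: px_del[OF assms(2), symmetric] lin_minus[OF px_lin])

lemma mlin_pb: "cmap Z ==> mlin n (%xs. px y (Z n xs))"
 by (rule mlin_compose[OF px_lin]) (rule cmapD)

lemma zc_pb:
 assumes "cmap Z" "pcc (int n) y"
 shows "zc n (%xs. px y (Z n xs))"
proof -
 have y: "par y" using assms by (simp add: pcc_def)
 have "Z (Suc n) xs : PC (int n + 1)" for xs
  using cmapD(2)[OF assms(1), of "Suc n"] by (simp add: add.commute)
 from pcc_bd[OF assms(2) this] have "px y (bd (Z (Suc n) xs)) = 0" for xs .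
 with pb_dl[OF assms(1) y] show ?thesis by (simp add: zc_def mlin_pb assms(1))
qed

lemma coh_pb:
 assumes "cmap Z" "par x" "!!w. dgr w = int (Suc n) ==> ng w = w ==> nn w ==> y w - y' w = cob x w"
 shows "coh (Suc n) (%xs. px y (Z (Suc n) xs)) (%xs. px y' (Z (Suc n) xs))"
proof (rule cohI[of n "%xs. - px x (Z n xs)"])
 show "mlin n (%xs. - px x (Z n xs))"
  using mlin_sg[OF mlin_pb[OF assms(1), of n x], of 1] by simp
 fix xs :: "'a vv list" assume l: "length xs = Suc n"
 have "px y (Z (Suc n) xs) = px (%w. cob x w + y' w) (Z (Suc n) xs)"
  by (rule px_cong[OF cmapD(2)[OF assms(1)]]) (use assms(3) in \<open>simp add: algebra_simps\<close>)
 also have "... = px x (bd (Z (Suc n) xs)) + px y' (Z (Suc n) xs)"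
  by (simp add: px_plus px_cob[OF assms(2) cmapD(2)[OF assms(1)]])
 finally show "px y (Z (Suc n) xs) - px y' (Z (Suc n) xs) = dl n (%xs. - px x (Z n xs)) xs"
  using pb_dl[OF assms(1,2) l] del_sg[OF bim_mul, of n 1 "%xs. px x (Z n xs)" xs] by simp
qed

primrec kk :: "('k::field fam) => 'k fam" where
 "kk D 0 xs = sig (D 0 [])"
| "kk D (Suc n) xs = sig (D (Suc n) xs - del la ra n (kk D n) xs)"

text \<open>A family \<open>D\<close> of degree \<open>c\<close> that commutes with the
  differentials and starts with a cycle is null homotopic: what remains in each degree is a cycle,
  and \<open>sig\<close> bounds it. The case \<open>c = 0\<close> compares two chain maps,
  \<open>c = 1\<close> two homotopies.\<close>

lemma kk_props:
 assumes mD: "!!n. mlin n (D n)" and pD: "!!n xs. D n xs : PC (int n + c)" and "c >= 0" and c0: "cyc c (D 0 [])"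
  and ch: "!!n xs. length xs = Suc n ==> bd (D (Suc n) xs) = del la ra n (D n) xs"
 shows "mlin n (kk D n) & (ALL xs. kk D n xs : PC (int n + c + 1)) &
  (ALL xs. length xs = n --> D n xs = bd (kk D n xs) + (case n of 0 => 0 | Suc k => del la ra k (kk D k) xs))"
proof (induction n)
 case 0
 thus ?case using bd_sig[OF c0 `c >= 0`] sig_PC[OF pD[of 0 "[]"]] by simp
next
 case (Suc n)
 have p: "D (Suc n) xs - del la ra n (kk D n) xs : PC (int (Suc n) + c)" for xs
  using Suc by (intro PC_diff pD del_PC) (auto simp: algebra_simps)
 have "mlin (Suc n) (%xs. sig (D (Suc n) xs - del la ra n (kk D n) xs))"
  using Suc by (intro mlin_compose[OF sig_lin] mlin_sub mD mlin_del[OF bim_P]) auto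
 hence 1: "mlin (Suc n) (kk D (Suc n))" by (subst mlin_cong) auto
 have 2: "kk D (Suc n) xs : PC (int (Suc n) + c + 1)" for xs
  using sig_PC[OF p] by simp
 have 3: "D (Suc n) xs = bd (kk D (Suc n) xs) + del la ra n (kk D n) xs" if l: "length xs = Suc n" for xs
 proof -
  have "bd (D (Suc n) xs - del la ra n (kk D n) xs) = del la ra n (%ys. D n ys - bd (kk D n ys)) xs"
   by (simp add: bd_simps ch l del_bd del_sub[OF bim_P])
  also have "... = del la ra n (%ys. case n of 0 => 0 | Suc k => del la ra k (kk D k) ys) xs"
   by (rule del_cong) (use Suc l in auto)
  also have "... = 0"
   using l by (cases n) (simp_all add: del_0[OF bim_P] del_del[OF bim_P])
  finally have "cyc (int (Suc n) + c) (D (Suc n) xs - del la ra n (kk D n) xs)"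
   using p `c >= 0` by (simp add: cyc_def)
  from bd_sig[OF this] show ?thesis using `c >= 0` by simp
 qed
 from 1 2 3 show ?case by (simp del: kk.simps mlin.simps)
qed

lemma null_coh:
 assumes mD: "!!n. mlin n (D n)" and pD: "!!n xs. D n xs : PC (int n + c)" and "c >= 0" and c0: "cyc c (D 0 [])"
  and ch: "!!n xs. length xs = Suc n ==> bd (D (Suc n) xs) = del la ra n (D n) xs"
  and y: "pcc (int n + c) y"
 shows "coh n (%xs. px y (D n xs)) (%xs. 0)"
proof -
 note k = kk_props[of D, OF mD pD `c >= 0` c0 ch]
 have py: "par y" using y by (simp add: pcc_def)
 have z: "px y (bd (kk D n xs)) = 0" for xs
  by (rule pcc_bd[OF y]) (use k[of n] in auto)
 show ?thesis
 proof (cases n)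
  case 0
  hence "D 0 [] = bd (kk D 0 [])" using k[of 0] by simp
  thus ?thesis using z[of "[]"] 0 by (simp add: coh_def)
 next
  case (Suc l)
  show ?thesis unfolding Suc
  proof (rule cohI[of l "%xs. px y (kk D l xs)"])
   show "mlin l (%xs. px y (kk D l xs))" using k[of l] by (auto intro: mlin_compose)
   fix xs :: "'a vv list" assume "length xs = Suc l"
   hence "D (Suc l) xs = bd (kk D (Suc l) xs) + del la ra l (kk D l) xs" using k[of "Suc l"] by simp
   thus "px y (D (Suc l) xs) - 0 = dl l (%xs. px y (kk D l xs)) xs"
    using z[of xs] by (simp only: lin_add[OF px_lin] Suc px_del[OF py]) simp
  qed
 qed
qed

lemma cmap_coh:
 assumes "cmap Z" "cmap \<Xi>" "pcc (int n) y"
 shows "coh n (%xs. px y (Z n xs)) (%xs. px y (\<Xi> n xs))"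
proof -
 \<comment> \<open>Both maps anticommute with the differentials by the convention of
   \<open>cmap\<close>; the sign \<open>(-1)^n\<close> makes their difference commute, as
   \<open>null_coh\<close> demands.\<close>
 define D where "D n xs = sg (int n) (Z n xs - \<Xi> n xs)" for n xs
 have "coh n (%xs. px y (D n xs)) (%xs. 0)"
 proof (rule null_coh[where c = 0])
  show "mlin n (D n)" for n unfolding D_def by (intro mlin_sg mlin_sub cmapD assms)
  show "D n xs : PC (int n + 0)" for n xs unfolding D_def using cmapD(2)[OF assms(1)] cmapD(2)[OF assms(2)]
   by (auto intro!: PC_sg PC_diff)
  show "cyc 0 (D 0 [])" using cmapD(4)[OF assms(1)] cmapD(4)[OF assms(2)] cmapD(2)[OF assms(1), of 0] cmapD(2)[OF assms(2), of 0]
   by (auto simp: cyc_def D_def lin_diff[OF aug_lin] intro: PC_diff)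
  show "bd (D (Suc n) xs) = del la ra n (D n) xs" if "length xs = Suc n" for n xs
   unfolding D_def del_sg[OF bim_P] del_sub[OF bim_P] bd_simps cmapD(3)[OF assms(1) that] cmapD(3)[OF assms(2) that]
   by (auto simp: sg_def)
 qed (use assms in auto)
 from coh_sg[OF this, of "int n"] have "coh n (%xs. px y (Z n xs) - px y (\<Xi> n xs)) (%xs. 0)"
  by (simp add: D_def sg_lin[OF px_lin] lin_diff[OF px_lin] sg_sg) (simp add: sg_def)
 from coh_plus[OF this coh_refl[of n "%xs. px y (\<Xi> n xs)"]] show ?thesis by simp
qed

text \<open>A comparison map made from \<open>sig\<close> alone, and therefore homogeneous for every
  grading that \<open>sig\<close> preserves.\<close>

primrec Xi :: "'k::field fam" where
 "Xi 0 xs = (SUM i:{0..<M}. ow (0, 0, i))"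
| "Xi (Suc n) xs = sig (- del la ra n (Xi n) xs)"

lemma aug_la: "z : PC 0 ==> aug (la x z) = x <> aug z"
proof (rule PC_eqI[of z 0 "%z. aug (la x z)" "%z. x <> aug z"])
 fix u w v assume "dgr w = 0" "okk u w v"
 then obtain i where "w = (0, 0, i)" by (cases w) (auto simp: okk_def)
 thus "aug (la x (T (bs u) w (bs v))) = x <> aug (T (bs u) w (bs v))"
  by (simp add: aug_T mul_assoc)
qed (auto intro!: lin_ins lin_la2 lin_compose[OF aug_lin])

lemma aug_ra: "z : PC 0 ==> aug (ra z x) = aug z <> x"
proof (rule PC_eqI[of z 0 "%z. aug (ra z x)" "%z. aug z <> x"])
 fix u w v assume "dgr w = 0" "okk u w v"
 then obtain i where "w = (0, 0, i)" by (cases w) (auto simp: okk_def)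
 thus "aug (ra (T (bs u) w (bs v)) x) = aug (T (bs u) w (bs v)) <> x"
  by (simp add: aug_T mul_assoc)
qed (auto intro!: lin_ins lin_ra1 lin_compose[OF aug_lin])

lemma Xi_aug: "aug (Xi 0 xs) = wd 0"
 by (simp add: lin_sum[OF aug_lin] ow_def aug_T vt_vt wd_0)

lemma Xi_PC: "Xi n xs : PC (int n)"
proof (induction n arbitrary: xs)
 case 0
 thus ?case by (auto intro!: PC_sum one_of_PC)
next
 case (Suc n)
 have "- del la ra n (Xi n) xs : PC (int n)" by (intro PC_minus del_PC Suc)
 from sig_PC[OF this] show ?case by (simp add: add.commute)
qed

lemma Xi_bd: "length xs = Suc n ==> bd (Xi (Suc n) xs) = - del la ra n (Xi n) xs"
proof (induction n arbitrary: xs)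
 case 0
 have "aug (del la ra 0 (Xi 0) xs) = hd xs <> wd 0 - wd 0 <> hd xs"
  unfolding del_def dp.simps lin_diff[OF aug_lin]
  by (simp only: aug_la[OF Xi_PC[of 0, unfolded of_nat_0]] aug_ra[OF Xi_PC[of 0, unfolded of_nat_0]] Xi_aug)
 hence "cyc 0 (- del la ra 0 (Xi 0) xs)"
  by (simp add: del_PC[OF Xi_PC[of 0, unfolded of_nat_0]] cyc_def PC_minus lin_minus[OF aug_lin] mul_wd0_comm del: Xi.simps)
 thus ?case by (simp add: bd_sig del: Xi.simps(1))
next
 case (Suc n)
 have "bd (- del la ra (Suc n) (Xi (Suc n)) xs) = - del la ra (Suc n) (%ys. bd (Xi (Suc n) ys)) xs"
  by (simp only: bd_simps del_bd)
 also have "del la ra (Suc n) (%ys. bd (Xi (Suc n) ys)) xs = del la ra (Suc n) (%ys. sg 1 (del la ra n (Xi n) ys)) xs"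
  by (rule del_cong) (use Suc in auto)
 also have "... = 0" using Suc.prems by (simp only: del_sg[OF bim_P] del_del[OF bim_P] sg_zero)
 finally have "bd (- del la ra (Suc n) (Xi (Suc n)) xs) = 0" by (simp only: minus_zero)
 moreover have "- del la ra (Suc n) (Xi (Suc n)) xs : PC (int (Suc n))" by (intro PC_minus del_PC Xi_PC)
 ultimately have "cyc (int (Suc n)) (- del la ra (Suc n) (Xi (Suc n)) xs)"
  by (simp add: cyc_def del: Xi.simps)
 hence "bd (sig (- del la ra (Suc n) (Xi (Suc n)) xs)) = - del la ra (Suc n) (Xi (Suc n)) xs"
  by (rule bd_sig) simp
 thus ?case by (simp only: Xi.simps(2)[of "Suc n"])
qed

lemma mlin_Xi: "mlin n (Xi n :: 'k::field vv list => 'k pp)"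
proof (induction n)
 case (Suc n)
 have "mlin (Suc n) (%xs. sig (- del la ra n (Xi n :: 'k vv list => 'k pp) xs))"
  by (rule mlin_compose[OF lin_compose[OF sig_lin lin_uminus[OF lin_id]] mlin_del[OF bim_P Suc]])
 thus ?case by (subst mlin_cong) auto
qed simp

lemma cmap_Xi: "cmap Xi"
 unfolding cmap_def using mlin_Xi Xi_PC Xi_bd Xi_aug by blast

subsection \<open>The homotopy defined by a central element\<close>

definition iz :: "nat => 'k::field vv => ('k vv list => 'w) => 'k vv list => 'w::ab_group_add" where
 "iz n c f xs = cp n 0 f (%_. c) xs"

lemma iz_0 [simp]: "iz 0 c f xs = 0"
 by (simp add: iz_def)

lemma iz_Suc: "iz (Suc n) c f xs = f (c # xs) - iz n c (%ys. f (hd xs # ys)) (tl xs)"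
 by (simp add: iz_def)

lemma iz_dp:
 assumes b: "bim L R" and c: "!!x. c <> x = x <> c"
 shows "length xs = n ==> iz (Suc n) c (dp R n f) xs = R (f xs) c - (case n of 0 => 0 | Suc k => dp R k (iz n c f) xs)"
proof (induction n arbitrary: f xs)
 case 0
 thus ?case by (simp add: iz_Suc)
next
 case (Suc n)
 then obtain x ys where xs: "xs = x # ys" "length ys = n" by (metis length_Suc_conv)
 have Rl: "!!x. lin (%z. R z x)" by (rule bimD(3)[OF b])
 define fx where "fx = (%ys. f (x # ys))"
 have 1: "iz (Suc n) c (%ys. dp R (Suc n) f (x # ys)) ys
  = iz (Suc n) c (%ys. f ((x <> hd ys) # tl ys)) ys - iz (Suc n) c (dp R n fx) ys"
  by (simp add: iz_def cp_sub fx_def)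
 have 2: "iz (Suc n) c (%ys. f ((x <> hd ys) # tl ys)) ys = f ((c <> x) # ys)
  - (case n of 0 => 0 | Suc k => iz n c (%zs. f ((x <> hd ys) # zs)) (tl ys))"
  by (cases n) (auto simp: iz_Suc c)
 have 3: "iz (Suc n) c (dp R n fx) ys = R (fx ys) c - (case n of 0 => 0 | Suc k => dp R k (iz n c fx) ys)"
  by (rule Suc.IH) (use xs in auto)
 have 4: "dp R n (iz (Suc n) c f) (x # ys) = dp R n (%zs. f (c # zs)) (x # ys)
  - (case n of 0 => 0 | Suc k => iz n c (%zs. f ((x <> hd ys) # zs)) (tl ys) - dp R k (iz n c fx) ys)"
 proof -
  have "dp R n (iz (Suc n) c f) (x # ys) = dp R n (%zs. f (c # zs)) (x # ys) - dp R n (%zs. iz n c (%ys. f (hd zs # ys)) (tl zs)) (x # ys)"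
   unfolding iz_Suc by (rule dp_sub[OF Rl])
  also have "dp R n (%zs. iz n c (%ys. f (hd zs # ys)) (tl zs)) (x # ys)
   = (case n of 0 => 0 | Suc k => iz n c (%zs. f ((x <> hd ys) # zs)) (tl ys) - dp R k (iz n c fx) ys)"
   by (cases n) (auto simp: lin_0[OF Rl] fx_def)
  finally show ?thesis .
 qed
 have "iz (Suc (Suc n)) c (dp R (Suc n) f) xs = f ((c <> x) # ys) - dp R n (%zs. f (c # zs)) xs
   - iz (Suc n) c (%ys. dp R (Suc n) f (x # ys)) ys"
  unfolding iz_Suc[of "Suc n"] xs by (simp only: dp.simps list.sel)
 also have "... = R (f xs) c - dp R n (iz (Suc n) c f) xs"
  unfolding xs 1 2 3 4 by (simp add: fx_def split: nat.split)
 finally show ?case by (simp del: dp.simps)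
qed

text \<open>Inserting a central \<open>c\<close> into all slots, with alternating signs, is a
  homotopy between left and right multiplication by \<open>c\<close> on the bar side: insertions
  into neighbouring slots produce the same products and cancel, and only the two ends
  remain.\<close>

lemma iz_del:
 assumes b: "bim L R" and c: "!!x. c <> x = x <> c" and l: "length xs = Suc n"
 shows "iz (Suc (Suc n)) c (del L R (Suc n) f) xs = L c (f xs) - R (f xs) c - del L R n (iz (Suc n) c f) xs"
proof -
 obtain x ys where xs: "xs = x # ys" "length ys = n" using l by (metis length_Suc_conv)
 have h: "h x (iz k c f zs) = iz k c (%zs. h x (f zs)) zs" if "lin (h x)" for h :: "'a vv => _ => ('t \<Rightarrow>\<^sub>0 'a)" and k zs f
  unfolding iz_def by (induction k arbitrary: f zs) (auto simp: that lin_0[OF that] lin_add[OF that] lin_diff[OF that] sg_lin[OF that])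
 have "iz (Suc (Suc n)) c (%ys. L (hd ys) (f (tl ys))) xs = L c (f xs) - iz (Suc n) c (%ys. L x (f ys)) ys"
  by (simp add: iz_Suc[of "Suc n"] xs)
 also have "iz (Suc n) c (%ys. L x (f ys)) ys = L x (iz (Suc n) c f ys)"
  by (rule h[symmetric]) (rule bimD(1)[OF b])
 finally have 1: "iz (Suc (Suc n)) c (%ys. L (hd ys) (f (tl ys))) xs = L c (f xs) - L x (iz (Suc n) c f ys)" .
 have "iz (Suc (Suc n)) c (del L R (Suc n) f) xs = iz (Suc (Suc n)) c (%ys. L (hd ys) (f (tl ys))) xs
  - iz (Suc (Suc n)) c (dp R (Suc n) f) xs"
  unfolding del_def[abs_def] iz_def by (rule cp_sub)
 thus ?thesis
  using iz_dp[OF b c l, of f] 1 by (simp add: del_def xs)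
qed

definition hx :: "(gen => 'k::field pp) => 'k pp => 'k pp" where
 "hx h = lin_ext (%(u, w, v). la (bs u) (ra (h w) (bs v)))"

lemma hx_lin [simp]: "lin (hx h)"
 by (simp add: hx_def)

definition hpar :: "(gen => 'k::field pp) => bool" where
 "hpar h <-> (ALL w. h (ng w) = h w & la (vt (sr w)) (h w) = h w & ra (h w) (vt (tg w)) = h w & (~ nn w --> h w = 0)
  & h w : PC (dgr w + 1))"

lemma hparD: assumes "hpar h"
 shows "h (ng w) = h w" "la (vt (sr w)) (h w) = h w" "ra (h w) (vt (tg w)) = h w" "~ nn w ==> h w = 0" "h w : PC (dgr w + 1)"
 using assms unfolding hpar_def by blast+

lemmas bimP = bimD[OF bim_P]

lemma hx_T: "hpar h ==> hx h (T u w v) = la u (ra (h w) v)"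
proof (rule bilin_eqI[of "%u v. hx h (T u w v)" "%u v. la u (ra (h w) v)"])
 fix u v assume y: "hpar h"
 have "la (bs u) (ra (h w) (bs v)) = 0" if n: "~ okk u w v"
 proof -
  have e: "la (bs u) (ra (h w) (bs v)) = la (bs u <> vt (sr w)) (ra (h w) (vt (tg w) <> bs v))"
   using hparD(2,3)[OF y, of w] by (simp add: bimP(5,6,7))
  show ?thesis
  proof (cases "nn w")
   case True
   hence "~ val u | ~ val v | en u ~= sr w | fst v ~= tg w" using n by (auto simp: okk_def)
   thus ?thesis unfolding e by (auto simp: bs_vt vt_bs lin_0[OF la_lin1] lin_0[OF la_lin2] lin_0[OF ra_lin2])
  qed (simp add: hparD(4)[OF y] lin_0[OF la_lin2] lin_0[OF ra_lin1])
 qed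
 thus "hx h (T (bs u) w (bs v)) = la (bs u) (ra (h w) (bs v))"
  by (auto simp: T_bs Tb_def hx_def hparD(1)[OF y])
qed (auto intro!: lin_ins lin_compose[OF hx_lin] lin_la1 lin_la2 lin_ra2)

lemma hx_la: "hpar h ==> hx h (la x z) = la x (hx h z)"
 by (rule lin_eqI[of "%z. hx h (la x z)" "%z. la x (hx h z)"])
  (auto simp: la_bs hx_T bimP(5) hx_def[THEN fun_cong, of _ "bs _"] intro!: lin_la2 lin_compose[OF hx_lin])

lemma hx_ra: "hpar h ==> hx h (ra z x) = ra (hx h z) x"
 by (rule lin_eqI[of "%z. hx h (ra z x)" "%z. ra (hx h z) x"])
  (auto simp: ra_bs hx_T bimP(6,7) hx_def[THEN fun_cong, of _ "bs _"] intro!: lin_ra1 lin_compose[OF hx_lin])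

lemma hx_PC: "hpar h ==> z : PC n ==> hx h z : PC (n + 1)"
 by (rule PC_closed[of z n "hx h"]) (auto simp: hx_T intro!: la_PC ra_PC dest: hparD(5))

text \<open>Generators suffice because \<open>hx h\<close> is a bimodule map and \<open>c\<close> is
  central. The statement concerns a single degree, since a homotopy under construction satisfies its
  equation only up to the degree reached so far.\<close>

lemma hx_homotopy_deg:
 assumes h: "hpar h" and eq: "!!w. dgr w = n ==> nn w ==> ng w = w ==> bd (h w) + hx h (bd (ow w)) = la c (ow w) - ra (ow w) c"
  and c: "!!x. c <> x = x <> c" and z: "z : PC n"
 shows "bd (hx h z) + hx h (bd z) = la c z - ra z c"
proof (rule PC_eqI[OF z, of "%z. bd (hx h z) + hx h (bd z)" "%z. la c z - ra z c"])
 fix u w v assume d: "dgr w = n" and a: "okk u w v" "ng w = w"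
 hence "nn w" by (simp add: okk_def)
 have t: "T (bs u) w (bs v) = la (bs u) (ra (ow w) (bs v))" by (simp add: one_of_T)
 have 1: "bd (hx h (T (bs u) w (bs v))) = la (bs u) (ra (bd (h w)) (bs v))"
  by (simp add: hx_T[OF h] bd_la bd_ra)
 have 2: "hx h (bd (T (bs u) w (bs v))) = la (bs u) (ra (hx h (bd (ow w))) (bs v))"
  unfolding t by (simp add: bd_la bd_ra hx_la[OF h] hx_ra[OF h])
 have "bd (hx h (T (bs u) w (bs v))) + hx h (bd (T (bs u) w (bs v)))
  = la (bs u) (ra (bd (h w) + hx h (bd (ow w))) (bs v))"
  unfolding 1 2 by (simp add: lin_add[OF la_lin2] lin_add[OF ra_lin1])
 also have "... = la (bs u) (ra (la c (ow w) - ra (ow w) c) (bs v))"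
  using eq[OF d `nn w` a(2)] by simp
 also have "... = la c (T (bs u) w (bs v)) - ra (T (bs u) w (bs v)) c"
 proof -
  have "la (bs u) (ra (la c (ow w)) (bs v)) = T (bs u <> c) w (bs v)"
   by (simp only: bimP(7)[symmetric] bimP(5)[symmetric] one_of_T la_T)
  moreover have "la (bs u) (ra (ra (ow w) c) (bs v)) = T (bs u) w (c <> bs v)"
   by (simp only: bimP(6)[symmetric] one_of_T)
  ultimately show ?thesis by (simp add: lin_diff[OF ra_lin1] lin_diff[OF la_lin2] c)
 qed
 finally show "bd (hx h (T (bs u) w (bs v))) + hx h (bd (T (bs u) w (bs v))) = la c (T (bs u) w (bs v)) - ra (T (bs u) w (bs v)) c" .
qed (auto intro!: lin_ins lin_bd lin_la2 lin_ra1 lin_compose[OF hx_lin])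

lemma hx_homotopy:
 assumes "hpar h" "!!w. nn w ==> ng w = w ==> bd (h w) + hx h (bd (ow w)) = la c (ow w) - ra (ow w) c"
  "!!x. c <> x = x <> c" "z : PC n"
 shows "bd (hx h z) + hx h (bd z) = la c z - ra z c"
 using assms by (intro hx_homotopy_deg) auto

lemma px_hx: "hpar h ==> par y ==> z : PC n ==> px y (hx h z) = px (%w. px y (h w)) z"
proof (rule PC_eqI[of z n "%z. px y (hx h z)" "%z. px (%w. px y (h w)) z"])
 assume h: "hpar h" and y: "par y"
 have "par (%w. px y (h w))"
  unfolding par_def px_la[OF y, symmetric] px_ra[OF y, symmetric]
  by (auto simp: hparD[OF h] lin_0[OF px_lin] simp del: sr.simps tg.simps ng.simps nn.simps)
 thus "px y (hx h (T (bs u) w (bs v))) = px (%w. px y (h w)) (T (bs u) w (bs v))" for u w v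
  by (simp add: px_T hx_T h y px_la px_ra mul_assoc)
qed (auto intro!: lin_compose[OF px_lin])

text \<open>The insertions of \<open>c\<close> on the bar side and the homotopy \<open>h\<close> on
  the small complex both connect left and right multiplication by \<open>c\<close>. Compared through
  \<open>Z\<close> they differ by a null homotopic family, so bracketing with \<open>c\<close>
  amounts to composition with \<open>- h\<close>. For odd \<open>n\<close> the bracket is the plain
  insertion, without a sign.\<close>

lemma br_0_coh:
 assumes h: "hpar h" and eq: "!!w. nn w ==> ng w = w ==> bd (h w) + hx h (bd (ow w)) = la c (ow w) - ra (ow w) c"
  and c: "!!x. c <> x = x <> (c :: 'k::field vv)" and f: "cmap Z" and y: "pcc (int n + 1) y" and n: "odd n"
 shows "coh n (br 0 (Suc n) (%_. c) (%xs. px y (Z (Suc n) xs))) (%xs. - px (%w. px y (h w)) (Z n xs))"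
proof -
 have py: "par y" using y by (simp add: pcc_def)
 \<comment> \<open>A sum and not a difference: the minus sign in \<open>cmap\<close> makes the
   insertion term a homotopy of the opposite sign.\<close>
 define D where "D n xs = iz (Suc n) c (Z (Suc n)) xs + hx h (Z n xs)" for n xs
 have p: "Z n xs : PC (int n)" for n xs by (rule cmapD(2)[OF f])
 have izPC: "iz k c g' xs : PC j" if "!!ys. g' ys : PC j" for k and g' :: "'k vv list => 'k pp" and xs j
  using that by (induction k arbitrary: g' xs) (auto simp: iz_Suc intro!: PC_diff)
 have co: "coh n (%xs. px y (D n xs)) (%xs. 0)"
 proof (rule null_coh[where c = 1])
  show "mlin n (D n)" for n
   unfolding D_def iz_def by (intro mlin_plus mlin_cp[of "Suc n" _ 0] mlin_compose[OF hx_lin] cmapD(1)[OF f]) auto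
  show "D n xs : PC (int n + 1)" for n xs
   unfolding D_def using p[of "Suc n"] hx_PC[OF h p] by (intro PC_add izPC) (auto simp: add.commute)
  have b0: "bd (Z 0 []) = 0" using bd_PC[OF p[of 0]] by (intro PC_neg[of "-1"]) auto
  have "bd (D 0 []) = - del la ra 0 (Z 0) [c] + (la c (Z 0 []) - ra (Z 0 []) c)"
   using hx_homotopy[OF h eq c p[of 0], of "[]"] cmapD(3)[OF f, of "[c]" 0]
   by (simp add: D_def iz_Suc bd_simps b0 lin_0[OF hx_lin])
  also have "... = 0" by (simp add: del_def)
  finally show "cyc 1 (D 0 [])"
   unfolding cyc_def D_def using p[of 1] hx_PC[OF h p[of 0]] by (auto intro!: PC_add izPC)
  show "bd (D (Suc n) xs) = del la ra n (D n) xs" if l: "length xs = Suc n" for n xs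
  proof -
   have bl: "bd (iz k c g' zs) = iz k c (%zs. bd (g' zs)) zs" for k and g' :: "'k vv list => 'k pp" and zs
    by (induction k arbitrary: g' zs) (auto simp: iz_Suc bd_simps)
   have "bd (iz (Suc (Suc n)) c (Z (Suc (Suc n))) xs) = iz (Suc (Suc n)) c (%ys. sg 1 (del la ra (Suc n) (Z (Suc n)) ys)) xs"
    unfolding bl unfolding iz_def by (rule cp_cong) (use l cmapD(3)[OF f] in auto)
   also have "... = - (la c (Z (Suc n) xs) - ra (Z (Suc n) xs) c - del la ra n (iz (Suc n) c (Z (Suc n))) xs)"
    using iz_del[OF bim_P c l, of "Z (Suc n)"] unfolding iz_def cp_sg by simp
   finally have 1: "bd (iz (Suc (Suc n)) c (Z (Suc (Suc n))) xs)
    = - (la c (Z (Suc n) xs) - ra (Z (Suc n) xs) c - del la ra n (iz (Suc n) c (Z (Suc n))) xs)" .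
   have "hx h (bd (Z (Suc n) xs)) = - del la ra n (%ys. hx h (Z n ys)) xs"
    using del_hom[of "hx h" ra ra la la n "Z n" xs, OF hx_lin hx_ra[OF h] hx_la[OF h]] cmapD(3)[OF f l]
    by (simp add: lin_minus[OF hx_lin])
   with hx_homotopy[OF h eq c p[of "Suc n" xs]]
   have 2: "bd (hx h (Z (Suc n) xs)) = la c (Z (Suc n) xs) - ra (Z (Suc n) xs) c + del la ra n (%ys. hx h (Z n ys)) xs"
    by (simp add: algebra_simps)
   show ?thesis unfolding D_def bd_simps 1 2 del_plus[OF bim_P] by simp
  qed
 qed (use y in auto)
 have e: "px y (D n xs) = br 0 (Suc n) (%_. c) (%xs. px y (Z (Suc n) xs)) xs + px (%w. px y (h w)) (Z n xs)" for xs
 proof -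
  have "px y (iz k c g' xs) = iz k c (%zs. px y (g' zs)) xs" for k and g' :: "'k vv list => 'k pp" and xs
   by (induction k arbitrary: g' xs) (auto simp: iz_Suc lin_0[OF px_lin] lin_diff[OF px_lin])
  thus ?thesis unfolding D_def lin_add[OF px_lin] px_hx[OF h py p] br_def
   using n by (simp add: iz_def sg_def del: cp.simps(2))
 qed
 from coh_plus[OF co[unfolded e] coh_refl[of n "%xs. - px (%w. px y (h w)) (Z n xs)"]] show ?thesis by simp
qed

end

lemma lin_ext_cong: "(!!s. s : ks z ==> h s = k s) ==> lin_ext h z = lin_ext k z"
 by (rule lin_eqI) auto

lemma lin_ext_sub: "lin_ext (%s. h s - k s) z = lin_ext h z - lin_ext k z"
 by (rule lin_eqI[of "lin_ext _" "%z. lin_ext h z - lin_ext k z"]) (auto intro!: lin_sub)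

lemma lin_ext_plus: "lin_ext (%s. h s + k s) z = lin_ext h z + lin_ext k z"
 by (rule lin_eqI[of "lin_ext _" "%z. lin_ext h z + lin_ext k z"]) (auto intro!: lin_plus)

lemma lin_ext_hom: "lin f ==> lin_ext (%s. f (h s)) z = f (lin_ext h z)"
 by (rule lin_eqI[of "lin_ext _" "%z. f (lin_ext h z)"]) (auto intro!: lin_compose[of f])

lemma lin_ext_zero [simp]: "lin_ext (%s. 0) z = 0"
 by (simp add: lin_ext_def)

context bis begin

section \<open>From bar cochains back to the small complex\<close>

text \<open>Composition with a comparison map from the small complex to the bar resolution. That map
  is given recursively by the differential, followed by the contraction of the bar resolution that
  puts a 1 in front.\<close>

primrec psi :: "nat => ('k::field co) => 'k gv" where
 "psi 0 f w = (if nn w then f [] <> vt (sr w) else 0)"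
| "psi (Suc p) f w = - lin_ext (%(u, w', v). psi p (%xs. f (bs u # xs)) w' <> bs v) (bd (ow w))"

definition thl :: "nat => ('k::field co) => 'k pp => 'k vv" where
 "thl p f z = lin_ext (%(u, w, v). psi p (%xs. f (bs u # xs)) w <> bs v) z"

lemma psi_Suc: "psi (Suc p) f w = - thl p f (bd (ow w))"
 by (simp add: thl_def)

declare psi.simps(2) [simp del]

lemma thl_lin [simp]: "lin (thl p f)"
 unfolding thl_def by (rule lin_lin_ext)

lemma psi_cong: "(!!ys. length ys = p ==> f ys = f' ys) ==> psi p f w = psi p f' w"
proof (induction p arbitrary: f f' w)
 case (Suc p)
 have "psi p (%xs. f (x # xs)) w' = psi p (%xs. f' (x # xs)) w'" for x w'
  by (rule Suc.IH) (simp add: Suc.prems)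
 thus ?case by (simp add: psi_Suc thl_def)
qed simp

lemma thl_cong: "(!!ys. length ys = Suc p ==> f ys = f' ys) ==> thl p f z = thl p f' z"
proof -
 assume a: "!!ys. length ys = Suc p ==> f ys = f' ys"
 have "psi p (%xs. f (x # xs)) w' = psi p (%xs. f' (x # xs)) w'" for x w'
  by (rule psi_cong) (simp add: a)
 thus ?thesis by (simp add: thl_def)
qed

lemma psi_sub: "psi p (%xs. f xs - f' xs) w = psi p f w - psi p f' w"
 by (induction p arbitrary: f f' w) (auto simp: psi_Suc thl_def mul_diff_left lin_ext_sub split_def)

lemma psi_plus: "psi p (%xs. f xs + f' xs) w = psi p f w + psi p f' w"
 by (induction p arbitrary: f f' w) (auto simp: psi_Suc thl_def mul_add_left lin_ext_plus split_def)

lemma psi_0: "psi p (%xs. 0) w = 0"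
 by (induction p arbitrary: w) (auto simp: psi_Suc thl_def split_def)

lemma psi_lmul: "psi p (%xs. x <> f xs) w = x <> psi p f w"
proof (induction p arbitrary: f w)
 case (Suc p)
 show ?case by (simp add: psi_Suc thl_def Suc split_def mul_assoc lin_ext_hom[OF mul_lin2] mul_minus_right)
qed (auto simp: mul_assoc)

lemma thl_sub: "thl p (%xs. f xs - f' xs) z = thl p f z - thl p f' z"
 by (simp add: thl_def psi_sub mul_diff_left lin_ext_sub split_def)

lemma thl_plus: "thl p (%xs. f xs + f' xs) z = thl p f z + thl p f' z"
 by (simp add: thl_def psi_plus mul_add_left lin_ext_plus split_def)

lemma thl_0: "thl p (%xs. 0) z = 0"
 by (simp add: thl_def psi_0 split_def)

lemma thl_lmul: "thl p (%xs. x <> f xs) z = x <> thl p f z"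
 by (simp add: thl_def psi_lmul split_def mul_assoc lin_ext_hom[OF mul_lin2])

lemma psi_lin: "(!!ys. length ys = p ==> lin (%u. f u ys)) ==> lin (%u. psi p (f u) w)"
proof (induction p arbitrary: f w)
 case 0
 hence "lin (%u. f u [])" by simp
 thus ?case by (auto intro!: lin_if lin_mul1)
next
 case (Suc p)
 have "lin (%u. psi p (%xs. f u (x # xs)) w')" for x w'
  by (rule Suc.IH) (simp add: Suc.prems)
 thus ?case unfolding psi_Suc thl_def
  by (intro lin_uminus lin_lin_extD) (simp add: split_def lin_mul1)
qed

lemma thl_lin2: "(!!ys. length ys = Suc p ==> lin (%u. f u ys)) ==> lin (%u. thl p (f u) z)"
 unfolding thl_def by (rule lin_lin_extD) (simp add: split_def lin_mul1 psi_lin)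

lemma psi_ng [simp]: "psi p f (ng w) = psi p f w"
 by (cases p) (auto simp: psi_Suc)

lemma psi_nn: "~ nn w ==> psi p f w = 0"
 by (cases p) (auto simp: psi_Suc ow_def T_nn bd_simps lin_0[OF thl_lin])

lemma psi_lin_slot: "mlin (Suc p) f ==> lin (%x. psi p (%xs. f (x # xs)) w)"
 by (rule psi_lin) simp

lemma thl_T_aux:
 assumes P: "!!f :: 'k::field co. mlin p f ==> psi p f w <> vt (tg w) = psi p f w" and f: "mlin (Suc p) (f :: 'k co)"
 shows "thl p f (T x w y) = psi p (%xs. f ((x <> vt (sr w)) # xs)) w <> y"
proof (rule bilin_eqI[of "%x y. thl p f (T x w y)" "%x y. psi p (%xs. f ((x <> vt (sr w)) # xs)) w <> y"])
 fix u v
 show "thl p f (T (bs u) w (bs v)) = psi p (%xs. f ((bs u <> vt (sr w)) # xs)) w <> bs v"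
 proof (cases "okk u w v")
  case True
  thus ?thesis by (simp add: T_bs Tb_def thl_def) (simp add: okk_def bs_vt)
 next
  case False
  have z: "psi p (%xs. f ((bs u <> vt (sr w)) # xs)) w <> bs v = 0"
  proof (cases "nn w")
   case True
   hence "(~ val u | en u ~= sr w) | (~ val v | fst v ~= tg w)" using False by (auto simp: okk_def)
   thus ?thesis
   proof
    assume "~ val u | en u ~= sr w"
    thus ?thesis using lin_0[OF psi_lin_slot[OF f, of w]] by (auto simp: bs_vt)
   next
    assume "~ val v | fst v ~= tg w"
    hence v0: "vt (tg w) <> bs v = (0 :: 'k vv)" by (auto simp: vt_bs)
    have "mlin p (%xs. f (((bs u :: 'k vv) <> vt (sr w)) # xs))" using f by simp
    from P[OF this] have "psi p (%xs. f ((bs u <> vt (sr w)) # xs)) w <> bs v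
     = psi p (%xs. f ((bs u <> vt (sr w)) # xs)) w <> (vt (tg w) <> bs v)"
     by (simp add: mul_assoc[symmetric])
    thus ?thesis by (simp add: v0)
   qed
  qed (simp add: psi_nn)
  thus ?thesis using False by (simp add: T_bs Tb_def lin_0[OF thl_lin])
 qed
qed (auto intro!: lin_ins lin_compose[OF thl_lin] lin_compose[OF psi_lin_slot[OF f]])

lemma psi_tg: "mlin p f ==> dgr w = int p ==> psi p f w <> vt (tg w) = psi p f w"
proof (induction p arbitrary: f w)
 case 0
 obtain s r i where w: "w = (s, r, i)" by (cases w)
 show ?case
 proof (cases "nn w")
  case True
  hence "s = 0" "r = 0" using 0 w by auto
  thus ?thesis using w by (simp add: mul_assoc vt_vt)
 qed simp
next
 case (Suc p)
 have "thl p f (ra z x) = thl p f z <> x" if "z : PC (int p)" for z x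
 proof (rule PC_eqI[OF that, of "%z. thl p f (ra z x)" "%z. thl p f z <> x"])
  fix u w' v assume d: "dgr w' = int p"
  note t = thl_T_aux[of p w' f, OF Suc.IH[OF _ d] Suc.prems(1)]
  show "thl p f (ra (T (bs u) w' (bs v)) x) = thl p f (T (bs u) w' (bs v)) <> x"
   by (simp add: t mul_assoc)
 qed (auto intro!: lin_ins lin_ra1 lin_compose[OF thl_lin])
 moreover have "bd (ow w) : PC (int p)"
  using bd_PC[OF one_of_PC[OF Suc.prems(2)]] by simp
 moreover have "ra (bd (ow w)) (vt (tg w)) = bd (ow w)"
  by (simp add: bd_ra[symmetric] one_of_vt)
 ultimately show ?case by (metis psi_Suc mul_minus_left)
qed

lemma thl_T: "mlin (Suc p) f ==> dgr w = int p ==> thl p f (T x w y) = psi p (%xs. f ((x <> vt (sr w)) # xs)) w <> y"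
 by (rule thl_T_aux[OF psi_tg])

lemma thl_ra: "mlin (Suc p) f ==> z : PC (int p) ==> thl p f (ra z x) = thl p f z <> x"
 by (rule PC_eqI[of z "int p" "%z. thl p f (ra z x)" "%z. thl p f z <> x"])
  (auto simp: thl_T mul_assoc simp del: mlin.simps intro!: lin_ins lin_ra1 lin_compose[OF thl_lin])

lemma thl_la: "mlin (Suc p) f ==> z : PC (int p) ==> thl p f (la x z) = thl p (%xs. f ((x <> hd xs) # tl xs)) z"
proof (rule PC_eqI[of z "int p" "%z. thl p f (la x z)" "%z. thl p (%xs. f ((x <> hd xs) # tl xs)) z"])
 fix u w v assume f: "mlin (Suc p) f" "dgr w = int p"
 show "thl p f (la x (T (bs u) w (bs v))) = thl p (%xs. f ((x <> hd xs) # tl xs)) (T (bs u) w (bs v))"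
  by (simp only: la_T thl_T[OF f] thl_T[OF mlin_merge[OF f(1)] f(2)] list.sel mul_assoc)
qed (auto intro!: lin_ins lin_la2 lin_compose[OF thl_lin])

lemma thl_hd: "thl p (%xs. hd xs <> f (tl xs)) z = px (psi p f) z"
 unfolding thl_def px_def by (simp add: psi_lmul)

lemma thl_0_aug: "z : PC 0 ==> thl 0 (%xs. c <> hd xs) z = c <> aug z"
proof (rule PC_eqI[of z 0 "%z. thl 0 (%xs. c <> hd xs) z" "%z. c <> aug z"])
 fix u w v assume "dgr w = 0" "okk u w v"
 then obtain i where w: "w = (0, 0, i)" by (cases w) (auto simp: okk_def)
 have "mlin (Suc 0) (%xs. c <> hd xs)" by simp
 from thl_T[OF this, of w "bs u" "bs v"]
 show "thl 0 (%xs. c <> hd xs) (T (bs u) w (bs v)) = c <> aug (T (bs u) w (bs v))"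
  by (simp add: w aug_T mul_assoc vt_vt)
qed (auto intro!: lin_ins lin_compose[OF aug_lin])

text \<open>Expresses that this comparison map respects the differentials. The recursion for
  \<open>psi\<close> introduces a second differential, and the vanishing of
  \<open>bd (bd z)\<close>, or of \<open>aug (bd z)\<close> in the lowest degree, removes the extra
  term.\<close>

lemma thl_dp: "mlin (Suc q) f ==> z : PC (int (Suc q)) ==> thl (Suc q) (dp (<>) (Suc q) f) z = - thl q f (bd z)"
proof (induction q arbitrary: f z rule: less_induct)
 case (less q f z)
 show ?case
 proof (rule PC_eqI[OF less.prems(2), of "thl (Suc q) (dp (<>) (Suc q) f)" "%z. - thl q f (bd z)"])
  fix u w v assume w: "dgr w = int (Suc q)" "okk u w v" "ng w = w"
  let ?G = "%xs. dp (<>) (Suc q) f (bs u # xs)" and ?f = "%xs. f (bs u # xs)"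
  have b: "bd (ow w) : PC (int q)" using bd_PC[OF one_of_PC[OF w(1)]] by simp
  have 0: "thl q (dp (<>) q ?f) (bd (ow w)) = 0"
  proof (cases q)
   case 0
   hence "dp (<>) 0 ?f = (%xs. f [bs u] <> hd xs)" by (intro ext) simp
   thus ?thesis using b thl_0_aug[of "bd (ow w)" "f [bs u]"] 0 w(1) by (simp add: aug_bd one_of_PC)
  next
   case (Suc l)
   have "thl (Suc l) (dp (<>) (Suc l) ?f) (bd (ow w)) = - thl l ?f (bd (bd (ow w)))"
    by (rule less.IH) (use Suc less.prems(1) b in auto)
   thus ?thesis unfolding Suc bdbd[OF one_of_PC[OF w(1)]] by (simp add: lin_0[OF thl_lin])
  qed
  have "thl q ?G (bd (ow w)) = thl q (%xs. f ((bs u <> hd xs) # tl xs)) (bd (ow w)) - thl q (dp (<>) q ?f) (bd (ow w))"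
   unfolding thl_sub[symmetric] by (rule thl_cong) simp
  hence e: "thl q ?G (bd (ow w)) = thl q f (la (bs u) (bd (ow w)))"
   unfolding 0 thl_la[OF less.prems(1) b] by simp
  have "thl (Suc q) (dp (<>) (Suc q) f) (T (bs u) w (bs v)) = psi (Suc q) ?G w <> bs v"
   using w by (simp add: T_bs Tb_def thl_def[of "Suc q"] del: dp.simps)
  also have "... = - thl q f (ra (la (bs u) (bd (ow w))) (bs v))"
   unfolding psi_Suc[of q] e using thl_ra[OF less.prems(1) la_PC[OF b]] by (simp add: mul_minus_left)
  also have "ra (la (bs u) (bd (ow w))) (bs v) = bd (T (bs u) w (bs v))"
   by (simp add: bd_T_one[of "bs u"] bimP(7))
  finally show "thl (Suc q) (dp (<>) (Suc q) f) (T (bs u) w (bs v)) = - thl q f (bd (T (bs u) w (bs v)))" .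
 qed (auto intro!: lin_uminus lin_compose[OF thl_lin])
qed

lemma thl_dl: "mlin n f ==> z : PC (int n) ==>
 thl n (dl n f) z = px (psi n f) z + (case n of 0 => - (f [] <> aug z) | Suc q => thl q f (bd z))"
proof -
 assume f: "mlin n f" and z: "z : PC (int n)"
 have 1: "thl n (dl n f) z = px (psi n f) z - thl n (dp (<>) n f) z"
  unfolding del_def[abs_def] thl_sub thl_hd ..
 have 2: "- thl n (dp (<>) n f) z = (case n of 0 => - (f [] <> aug z) | Suc q => thl q f (bd z))"
 proof (cases n)
  case 0
  thus ?thesis using thl_0_aug[of z "f []"] z by (simp add: thl_def)
 next
  case (Suc q)
  thus ?thesis using thl_dp[of q f z] f z by simp
 qed
 show ?thesis unfolding 1 2[symmetric] by simp
qed

text \<open>The homotopy between the identity of the bar resolution and its passage through the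
  small complex: the first arguments are kept, the remaining ones go through \<open>Z\<close> and
  back, with a sign that alternates with the place of the cut.\<close>

primrec tt :: "('k::field fam) => nat => ('k co) => 'k co" where
 "tt Z 0 f xs = thl 0 f (Z 0 [])"
| "tt Z (Suc n) f xs = thl (Suc n) f (Z (Suc n) xs) - tt Z n (%ys. f (hd xs # ys)) (tl xs)"

lemma tt_sub: "tt Z n (%ys. f ys - f' ys) xs = tt Z n f xs - tt Z n f' xs"
 by (induction n arbitrary: f f' xs) (auto simp: thl_sub)

lemma tt_plus: "tt Z n (%ys. f ys + f' ys) xs = tt Z n f xs + tt Z n f' xs"
 by (induction n arbitrary: f f' xs) (auto simp: thl_plus)

lemma tt_0: "tt Z n (%ys. 0) xs = 0"
 by (induction n arbitrary: xs) (auto simp: thl_0)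

lemma tt_lmul: "tt Z n (%ys. x <> f ys) xs = x <> tt Z n f xs"
 by (induction n arbitrary: f xs) (auto simp: thl_lmul mul_diff_right)

lemma tt_cong: "(!!ys. length ys = Suc n ==> f ys = f' ys) ==> tt Z n f xs = tt Z n f' xs"
proof (induction n arbitrary: f f' xs)
 case 0
 thus ?case by (auto intro: thl_cong)
next
 case (Suc n)
 have "tt Z n (%ys. f (hd xs # ys)) (tl xs) = tt Z n (%ys. f' (hd xs # ys)) (tl xs)"
  by (rule Suc.IH) (simp add: Suc.prems)
 moreover have "thl (Suc n) f (Z (Suc n) xs) = thl (Suc n) f' (Z (Suc n) xs)"
  by (rule thl_cong) (simp add: Suc.prems)
 ultimately show ?case by simp
qed

lemma tt_lin: "(!!ys. length ys = Suc n ==> lin (%u. f u ys)) ==> lin (%u. tt Z n (f u) xs)"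
proof (induction n arbitrary: f xs)
 case 0
 thus ?case by (auto intro: thl_lin2)
next
 case (Suc n)
 have "lin (%u. tt Z n (%ys. f u (hd xs # ys)) (tl xs))"
  by (rule Suc.IH) (simp add: Suc.prems)
 thus ?case using Suc.prems by (auto intro!: lin_sub thl_lin2)
qed

lemma mlin_tt: "(!!n. mlin n (Z n)) ==> mlin (Suc n) f ==> mlin n (tt Z n f)"
proof (induction n arbitrary: f)
 case (Suc n)
 have 1: "mlin (Suc n) (%xs. thl (Suc n) f (Z (Suc n) xs))"
  by (rule mlin_compose[OF thl_lin]) (rule Suc.prems)
 have "lin (%x. tt Z n (%ys. f (x # ys)) xs)" for xs
  by (rule tt_lin) (use Suc.prems(2) in simp)
 hence 2: "mlin (Suc n) (%xs. tt Z n (%ys. f (hd xs # ys)) (tl xs))"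
  using Suc.IH[OF Suc.prems(1)] Suc.prems(2) by simp
 show ?case using mlin_sub[OF 1 2] by (subst mlin_cong) auto
qed simp

lemma tt_m: "tt Z n (%ys. hd ys <> f (tl ys)) xs = px (psi n f) (Z n (if n = 0 then [] else xs))
 - (case n of 0 => 0 | Suc j => hd xs <> tt Z j f (tl xs))"
 by (cases n) (auto simp: thl_hd tt_lmul)

text \<open>Pulling a cochain back to the small complex and forth again is homotopic to the identity.\<close>

lemma tt_homotopy:
 assumes Z: "cmap Z" and f: "mlin n f" and v: "!!xs. f xs <> wd 0 = f xs" and l: "length xs = n"
 shows "f xs = px (psi n f) (Z n xs) - tt Z n (dl n f) xs - (case n of 0 => 0 | Suc k => dl k (tt Z k f) xs)"
 using f v l
proof (induction n arbitrary: f xs)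
 case 0
 have "Z 0 [] : PC (int 0)" by (rule cmapD(2)[OF Z])
 from thl_dl[OF _ this, of f] show ?case using 0 by (simp add: cmapD(4)[OF Z] del: psi.simps(1))
next
 case (Suc k)
 then obtain x ys where xs: "xs = x # ys" "length ys = k" by (metis length_Suc_conv)
 define fx where "fx = (%zs. f (x # zs))"
 have fx: "mlin k fx" using Suc.prems(1) by (simp add: fx_def)
 have pk: "Z k zs : PC (int k)" for zs by (rule cmapD(2)[OF Z])
 have IH: "fx ys = px (psi k fx) (Z k ys) - tt Z k (dl k fx) ys - (case k of 0 => 0 | Suc j => dl j (tt Z j fx) ys)"
  by (rule Suc.IH[OF fx _ xs(2)]) (simp add: fx_def Suc.prems)
 have A: "thl (Suc k) (dl (Suc k) f) (Z (Suc k) xs) = px (psi (Suc k) f) (Z (Suc k) xs)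
  - thl k f (la x (Z k ys)) + thl k f (dp ra k (Z k) xs)"
 proof -
  have "bd (Z (Suc k) xs) = - del la ra k (Z k) xs" by (rule cmapD(3)[OF Z Suc.prems(3)])
  thus ?thesis
   using thl_dl[OF Suc.prems(1) cmapD(2)[OF Z], of xs]
   by (simp add: lin_minus[OF thl_lin] lin_diff[OF thl_lin] del_def xs)
 qed
 have Bf: "dl (Suc k) f (x # zs) = x <> f zs - f ((x <> hd zs) # tl zs) + hd zs <> fx (tl zs) - dl k fx zs" for zs
  by (simp add: del_def fx_def)
 have B: "tt Z k (%zs. dl (Suc k) f (x # zs)) ys = x <> tt Z k f ys - tt Z k (%zs. f ((x <> hd zs) # tl zs)) ys
  + (px (psi k fx) (Z k ys) - (case k of 0 => 0 | Suc j => hd ys <> tt Z j fx (tl ys))) - tt Z k (dl k fx) ys"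
  unfolding Bf tt_sub tt_plus tt_lmul tt_m using xs by (cases k) simp_all
 have C: "dl k (tt Z k f) xs = x <> tt Z k f ys - dp (<>) k (tt Z k f) xs"
  by (simp add: del_def xs)
 have thlR: "dp (<>) k (%zs. thl k f (Z k zs)) xs = thl k f (dp ra k (Z k) xs)"
 proof -
  have "thl k f (dp ra n H zs) = dp (<>) n (%zs. thl k f (H zs)) zs" if "!!zs. H zs : PC (int k)" for n H zs
   using that by (induction n arbitrary: H zs) (auto simp: thl_ra[OF Suc.prems(1)] lin_diff[OF thl_lin])
  thus ?thesis using pk by simp
 qed
 have la: "thl k (%zs. f ((x <> hd zs) # tl zs)) (Z k zs) = thl k f (la x (Z k zs))" for zs
  by (rule thl_la[OF Suc.prems(1) pk, symmetric])
 define c where "c = (case k of 0 => 0 | Suc j => tt Z j (%vs. f ((x <> hd ys) # vs)) (tl ys))"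
 define d where "d = (case k of 0 => 0 | Suc j => dp (<>) j (tt Z j fx) ys)"
 have D: "dp (<>) k (tt Z k f) xs = thl k f (dp ra k (Z k) xs) - (c - d)"
 proof (cases k)
  case 0
  thus ?thesis using thlR by (simp add: c_def d_def)
 next
  case (Suc j)
  define Q where "Q zs = tt Z j (%vs. f (hd zs # vs)) (tl zs)" for zs
  have "tt Z k f = (%zs. thl k f (Z k zs) - Q zs)" by (rule ext) (simp add: Suc Q_def)
  hence "dp (<>) k (tt Z k f) xs = thl k f (dp ra k (Z k) xs) - dp (<>) k Q xs"
   unfolding thlR[symmetric] by (simp only:) (rule dp_sub, simp)
  also have "dp (<>) k Q xs = c - d" using xs by (simp add: Suc Q_def fx_def c_def d_def)
  finally show ?thesis .
 qed
 have E: "tt Z k (%zs. f ((x <> hd zs) # tl zs)) ys = thl k f (la x (Z k ys)) - c"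
  using la[of ys] xs by (cases k) (simp_all add: c_def)
 have G: "(case k of 0 => 0 | Suc j => dl j (tt Z j fx) ys) = (case k of 0 => 0 | Suc j => hd ys <> tt Z j fx (tl ys)) - d"
  using xs by (cases k) (simp_all add: del_def d_def)
 have H: "tt Z (Suc k) (dl (Suc k) f) xs = thl (Suc k) (dl (Suc k) f) (Z (Suc k) xs) - tt Z k (%zs. dl (Suc k) f (x # zs)) ys"
  by (simp add: xs)
 have "f xs = fx ys" by (simp add: fx_def xs)
 thus ?case
  unfolding nat.case H A B C D E IH[unfolded G] by (simp add: algebra_simps)
qed

text \<open>The outer vertices make \<open>psi\<close> parallel on all triples, whatever their
  degree; on chains they change nothing (\<open>px_pull\<close>).\<close>

definition pull :: "nat => ('k::field co) => 'k gv" where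
 "pull n f w = vt (sr w) <> psi n f w <> vt (tg w)"

lemma pull_par: "par (pull n f)"
 unfolding par_def pull_def by (auto simp: psi_nn mul_assoc vt_vt) (auto simp: mul_assoc[symmetric] vt_vt psi_nn)

lemma px_pull: "z : PC k ==> px (pull n f) z = px (psi n f) z"
 unfolding px_def
proof (rule lin_ext_cong, clarify)
 fix u w v assume z: "z : PC k" "(u, w, v) : ks z"
 hence "okk u w v" by (auto simp: PC_def)
 hence "bs u <> vt (sr w) = bs u" "vt (tg w) <> bs v = bs v" by (auto simp: okk_def bs_vt vt_bs)
 thus "bs u <> pull n f w <> bs v = bs u <> psi n f w <> bs v"
  unfolding pull_def by (metis mul_assoc)
qed

lemma pull_pcc: "zc n f ==> pcc (int n) (pull n f)"
proof -
 assume f: "zc n f"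
 have m: "mlin n f" using f by (simp add: zc_def)
 have "px (pull n f) (bd (ow w)) = 0" if w: "dgr w = int n + 1" for w
 proof -
  have b: "bd (ow w) : PC (int n)" using bd_PC[OF one_of_PC[OF w]] by simp
  have z: "(case n of 0 => - (f [] <> aug (bd (ow w))) | Suc q => thl q f (bd (bd (ow w)))) = 0"
   using w by (cases n) (auto simp: aug_bd one_of_PC bdbd[OF one_of_PC[OF w]] lin_0[OF thl_lin])
  have "thl n (dl n f) (bd (ow w)) = thl n (%_. 0) (bd (ow w))"
   by (rule thl_cong) (use f in \<open>auto simp: zc_def\<close>)
  with thl_dl[OF m b] z show ?thesis by (simp add: px_pull[OF b] thl_0)
 qed
 thus ?thesis by (simp add: pcc_def pull_par)
qed

lemma coh_pull:
 assumes Z: "cmap Z" and f: "zc n f" and v: "!!xs. f xs <> wd 0 = f xs"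
 shows "coh n f (%xs. px (pull n f) (Z n xs))"
proof -
 have m: "mlin n f" using f by (simp add: zc_def)
 have h: "f xs - px (pull n f) (Z n xs) = - (case n of 0 => 0 | Suc k => dl k (tt Z k f) xs)" if l: "length xs = n" for xs
 proof -
  have "tt Z n (dl n f) xs = tt Z n (%_. 0) xs"
   by (rule tt_cong) (use f in \<open>auto simp: zc_def\<close>)
  thus ?thesis
   using tt_homotopy[OF Z m v l] by (simp add: tt_0 px_pull[OF cmapD(2)[OF Z]])
 qed
 show ?thesis
 proof (cases n)
  case 0
  thus ?thesis using h[of "[]"] by (simp add: coh_def)
 next
  case (Suc k)
  have mt: "mlin k (%xs. - tt Z k f xs)"
   using mlin_sg[OF mlin_tt[OF cmapD(1)[OF Z], of k f], of 1] m Suc by simp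
  show ?thesis unfolding Suc
   by (rule cohI[OF mt]) (use h Suc del_sg[OF bim_mul, of k 1 "tt Z k f"] in auto)
 qed
qed

end

section \<open>The two gradings\<close>

definition hom :: "('s => int) => int => ('s \<Rightarrow>\<^sub>0 'k::field) => bool" where
 "hom wt d z <-> (ALL p:ks z. wt p = d)"

lemma hom_keys: "hom wt d z <-> ks z <= {p. wt p = d}"
 by (auto simp: hom_def)

lemma hom_plus: "hom wt d x ==> hom wt d y ==> hom wt d (x + y)"
 unfolding hom_keys by (rule keys_addI)

lemma hom_sub: "hom wt d x ==> hom wt d y ==> hom wt d (x - y)"
 unfolding hom_keys by (rule keys_diffI)

lemma hom_0 [simp]: "hom wt d 0" and hom_sg: "hom wt d x ==> hom wt d (sg n x)"
 and hom_uminus: "hom wt d x ==> hom wt d (- x)"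
 by (auto simp: hom_def)

lemma hom_sum: "(!!s. s : S ==> hom wt d (f s)) ==> hom wt d (sum f S)"
 unfolding hom_keys by (rule keys_sumI)

lemma hom_lin: "lin f ==> (!!p. p : ks z ==> hom wt d (f (bs p))) ==> hom wt d (f z)"
 unfolding hom_keys by (rule keys_lin)

context bis begin

text \<open>The numbers of arrows \<open>a\<close> and, in \<open>nb\<close>, of arrows
  \<open>a-bar\<close> in the alternating word \<open>k\<close>.\<close>

definition na :: "int => int" where "na k = (if k > 0 then (k + 1) div 2 else (- k) div 2)"
definition nb :: "int => int" where "nb k = (if k > 0 then k div 2 else (1 - k) div 2)"

text \<open>The weights \<open>X\<close> and \<open>Y\<close> of the two kinds of arrows stay
  variable: a statement for all weights contains both gradings, and the weights 1 and -1 give the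
  grading behind the derivation.\<close>

definition wk :: "int => int => int => int" where "wk X Y k = X * na k + Y * nb k"

definition wb :: "int => int => bas => int" where "wb X Y p = wk X Y (snd p)"

text \<open>The number of arrows \<open>a\<close> in every path that occurs in the generator with
  indices \<open>s\<close> and \<open>r\<close>; exchanging \<open>s\<close> and \<open>r\<close>
  gives the number of arrows \<open>a-bar\<close>.\<close>

definition gA :: "int => int => int" where "gA s r = int N * min s r + max (s - r) 0"

fun wg :: "int => int => gen => int" where
 "wg X Y (s, r, i) = X * gA s r + Y * gA r s"

fun wP :: "int => int => bas \<times> gen \<times> bas => int" where
 "wP X Y (u, w, v) = wb X Y u + wg X Y w + wb X Y v"

lemma wg_ng [simp]: "wg X Y (ng w) = wg X Y w"
 by (cases w) simp

lemma na_nb_0 [simp]: "na 0 = 0" "nb 0 = 0" "wk X Y 0 = 0"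
 by (auto simp: na_def nb_def wk_def)

lemma na_nb_abs: "na k + nb k = \<bar>k\<bar>" and na_nb_sft: "na k - nb k = sft k"
 by (cases "even k"; auto simp: na_def nb_def sft_def elim!: evenE oddE; presburger)+

lemma na_eq: "na k = x <-> 2 * x = \<bar>k\<bar> + sft k" and nb_eq: "nb k = x <-> 2 * x = \<bar>k\<bar> - sft k"
 using na_nb_abs[of k] na_nb_sft[of k] by auto

lemma na_jn: "fits k l ==> na (jn k l) = na k + na l" and nb_jn: "fits k l ==> nb (jn k l) = nb k + nb l"
 using na_nb_abs[of k] na_nb_sft[of k] na_nb_abs[of l] na_nb_sft[of l] by (auto simp: na_eq nb_eq jn_abs sft_jn)

lemma na_nrm [simp]: "na (nrm k) = na k" "nb (nrm k) = nb k"
 using N1 by (auto simp: na_def nb_def nrm_def)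

lemma wk_jn: "fits k l ==> wk X Y (nrm (jn k l)) = wk X Y k + wk X Y l"
 by (simp add: wk_def na_jn nb_jn algebra_simps)

lemma hom_mul: "hom (wb X Y) d x ==> hom (wb X Y) e y ==> hom (wb X Y) (d + e) (x <> y)"
proof (rule hom_lin[OF mul_lin1])
 fix p assume x: "hom (wb X Y) d x" "hom (wb X Y) e y" "p : ks x"
 show "hom (wb X Y) (d + e) (bs p <> y)"
 proof (rule hom_lin[OF mul_lin2])
  fix q assume "q : ks y"
  with x have "wb X Y p = d" "wb X Y q = e" by (auto simp: hom_def)
  thus "hom (wb X Y) (d + e) (bs p <> bs q)"
   by (auto simp: mulb_def hom_def wb_def wk_jn)
 qed
qed

lemma hom_bs: "hom wt (wt p) (bs p)"
 by (simp add: hom_def)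

lemma hom_wd: "hom (wb X Y) (wk X Y k) (wd k)"
 unfolding wd_def by (auto intro!: hom_sum) (auto simp: hom_def wb_def wk_def)

lemma hom_vt: "hom (wb X Y) 0 (vt i)"
 by (simp add: vt_def hom_def wb_def)

lemma hom_T: "hom (wb X Y) d x ==> hom (wb X Y) e y ==> D = d + wg X Y w + e ==> hom (wP X Y) D (T x w y)"
proof (rule hom_lin[OF T_lin1])
 fix u assume x: "hom (wb X Y) d x" "hom (wb X Y) e y" "D = d + wg X Y w + e" "u : ks x"
 show "hom (wP X Y) D (T (bs u) w y)"
 proof (rule hom_lin[OF T_lin2])
  fix v assume "v : ks y"
  with x have "wb X Y u = d" "wb X Y v = e" by (auto simp: hom_def)
  thus "hom (wP X Y) D (T (bs u) w (bs v))"
   by (auto simp: T_bs Tb_def hom_def x)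
 qed
qed

lemma hom_T_wd: "hom (wb X Y) d x ==> hom (wb X Y) e y ==> D = d + wk X Y k + wg X Y w + wk X Y l + e ==>
 hom (wP X Y) D (T (x <> wd k) w (wd l <> y))"
 by (rule hom_T[OF hom_mul[OF _ hom_wd] hom_mul[OF hom_wd]]) auto

lemma gA_le: "s <= r ==> gA s r = int N * s" and gA_ge: "r <= s ==> gA s r = int N * r + s - r"
 by (auto simp: gA_def)

lemma gA_steps:
 "s > r ==> gA s r = gA (s - 1) r + 1" "s > r ==> gA r s = gA r (s - 1)"
 "s <= r ==> gA s r = gA (s - 1) r + int N" "s <= r ==> gA r s = gA r (s - 1) + int N - 1"
 by (auto simp: gA_le gA_ge int_distrib)

lemma na_vals: "na 1 = 1" "nb 1 = 0" "na (- 1) = 0" "nb (- 1) = 1"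
 "na (NN - 1) = int N" "nb (NN - 1) = int N - 1" "na (1 - NN) = int N - 1" "nb (1 - NN) = int N"
 "na NN = int N" "nb NN = int N"
 using N1 by (auto simp: na_eq nb_eq sft_def)

lemma na_vals_l: assumes "l < N" shows "na (- 2 * int l) = int l" "nb (- 2 * int l) = int l"
 "na (NN - 1 - 2 * int l) = int N - int l" "nb (NN - 1 - 2 * int l) = int N - int l - 1"
 "na (2 * int l + 1) = int l + 1" "nb (2 * int l + 1) = int l"
 "na (NN - 2 - 2 * int l) = int N - int l - 1" "nb (NN - 2 - 2 * int l) = int N - int l - 1"
 "na (- 2 * int l - 1) = int l" "nb (- 2 * int l - 1) = int l + 1"
 "na (2 + 2 * int l - NN) = int N - int l - 1" "nb (2 + 2 * int l - NN) = int N - int l - 1"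
 "na (2 * int l) = int l" "nb (2 * int l) = int l"
 "na (1 + 2 * int l - NN) = int N - int l - 1" "nb (1 + 2 * int l - NN) = int N - int l"
 using assms by (auto simp: na_eq nb_eq sft_def)

lemma wk_sums: assumes "l < N"
 shows "wk X Y (- 2 * int l) + wk X Y (NN - 1 - 2 * int l) = X * int N + Y * (int N - 1)"
  "wk X Y (2 * int l + 1) + wk X Y (NN - 2 - 2 * int l) = X * int N + Y * (int N - 1)"
  "wk X Y (- 2 * int l - 1) + wk X Y (2 + 2 * int l - NN) = X * (int N - 1) + Y * int N"
  "wk X Y (2 * int l) + wk X Y (1 + 2 * int l - NN) = X * (int N - 1) + Y * int N"
 unfolding wk_def na_vals_l[OF assms] by (simp_all only: algebra_simps)

lemma wg_ka: "wg X Y (s - 1, r, j) + wk X Y (ka s r) = wg X Y (s, r, i)"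
proof -
 have "gA (s - 1) r + na (ka s r) = gA s r" "gA r (s - 1) + nb (ka s r) = gA r s"
  using gA_steps[of r s] gA_steps[of s r] by (auto simp: ka_def na_vals)
 thus ?thesis by (simp add: wk_def flip: distrib_left)(simp add: algebra_simps flip: distrib_left)
qed

lemma wg_kb: "wg X Y (s, r - 1, j) + wk X Y (kb s r) = wg X Y (s, r, i)"
proof -
 have "gA s (r - 1) + na (kb s r) = gA s r" "gA (r - 1) s + nb (kb s r) = gA r s"
  using gA_steps[of r s] gA_steps[of s r] by (auto simp: kb_def na_vals)
 thus ?thesis by (simp add: wk_def flip: distrib_left)(simp add: algebra_simps flip: distrib_left)
qed

lemma hom_dgb:
 assumes "hom (wb X Y) d x" "hom (wb X Y) e y" "D = d + wg X Y w + e"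
 shows "hom (wP X Y) D (dgb x w y)"
proof -
 obtain s r i where w: "w = (s, r, i)" by (cases w)
 show ?thesis
 proof (cases "s = r")
  case False
  have 1: "hom (wP X Y) D (T x (s - 1, r, j) (wd (ka s r) <> y))" for j
   by (rule hom_T[OF assms(1) hom_mul[OF hom_wd assms(2)]]) (use assms(3) wg_ka[of X Y s r j i] w in simp)
  have 2: "hom (wP X Y) D (T (x <> wd (ka s r)) (s - 1, r, j) y)" for j
   by (rule hom_T[OF hom_mul[OF assms(1) hom_wd] assms(2)]) (use assms(3) wg_ka[of X Y s r j i] w in simp)
  have 3: "hom (wP X Y) D (T x (s, r - 1, j) (wd (kb s r) <> y))" for j
   by (rule hom_T[OF assms(1) hom_mul[OF hom_wd assms(2)]]) (use assms(3) wg_kb[of X Y s r j i] w in simp)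
  have 4: "hom (wP X Y) D (T (x <> wd (kb s r)) (s, r - 1, j) y)" for j
   by (rule hom_T[OF hom_mul[OF assms(1) hom_wd] assms(2)]) (use assms(3) wg_kb[of X Y s r j i] w in simp)
  show ?thesis using False unfolding w dgb.simps by (simp add: hom_plus hom_sg 1 2 3 4)
 next
  case True
  have a: "wg X Y (s - 1, s, j) + X * int N + Y * (int N - 1) = wg X Y (s, s, i)"
   "wg X Y (s, s - 1, j) + X * (int N - 1) + Y * int N = wg X Y (s, s, i)" for j
   using wg_ka[of X Y s s j i] wg_kb[of X Y s s j i] by (simp_all add: ka_def kb_def wk_def na_vals)
  note aa = a[unfolded w True]
  show ?thesis unfolding w dgb.simps True
   apply simp
   apply (intro hom_sum hom_plus hom_sg hom_T_wd[OF assms(1,2)])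
   using a(1)[of i] a(1)[of "i + 1"] a(2)[of i] a(2)[of "i - 1"] assms(3) wk_sums[of _ X Y]
   by (auto simp: w True simp del: wg.simps; smt (verit) lessThan_iff)+
 qed
qed

lemma hom_bd: "hom (wP X Y) d z ==> hom (wP X Y) d (bd z)"
proof (rule hom_lin[OF bd_lin], clarify)
 fix u :: bas and w :: gen and v :: bas assume "hom (wP X Y) d z" "(u, w, v) : ks z"
 hence "wP X Y (u, w, v) = d" by (auto simp: hom_def)
 thus "hom (wP X Y) d (bd (bs (u, w, v)))"
  unfolding bd_bs by (intro hom_dgb[OF hom_bs hom_bs]) auto
qed

lemma hom_Tb: "wP X Y (u, w, v) = d ==> hom (wP X Y) d (Tb u w v)"
 by (auto simp: Tb_def hom_def)

lemma hom_s0: "z : PC n ==> hom (wP X Y) d z ==> hom (wP X Y) d (s0 z)"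
proof (rule hom_lin[OF s0_lin], clarify)
 fix u :: bas and w :: gen and v :: bas assume z: "z : PC n" "hom (wP X Y) d z" "(u, w, v) : ks z"
 hence d: "wP X Y (u, w, v) = d" and ok: "okk u w v" by (auto simp: hom_def PC_def)
 obtain s r i j k where w: "w = (s, r, i)" "v = (j, k)" by (metis prod.exhaust)
 have k: "- NN < k" "k <= NN" using ok by (auto simp: okk_def w val_def)
 have 1: "wk X Y (1 - k) + X = wk X Y k" if "k > 0"
 proof -
  have "na (1 - k) + 1 = na k" "nb (1 - k) = nb k" using that by (auto simp: na_def nb_def; presburger)+
  thus ?thesis by (auto simp: wk_def distrib_left simp flip: `na (1 - k) + 1 = na k`)
 qed
 have 2: "wk X Y (- 1 - k') + Y = wk X Y k'" if "k' < 0" for k'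
 proof -
  have "na (- 1 - k') = na k'" "nb (- 1 - k') + 1 = nb k'" using that by (auto simp: na_def nb_def; presburger)+
  thus ?thesis by (auto simp: wk_def distrib_left simp flip: `nb (- 1 - k') + 1 = nb k'`)
 qed
 have 3: "wk X Y (NN - 1) + Y = wk X Y NN" unfolding wk_def na_vals by (simp add: algebra_simps)
 have 4: "wg X Y (s + 1, r, i) = wg X Y (s, r, i) + X" if "s >= r"
  using gA_steps(1,2)[of r "s + 1"] that by (simp add: distrib_left)
 have 5: "wg X Y (s, r + 1, i) = wg X Y (s, r, i) + Y" if "s <= r"
  using gA_steps(1,2)[of s "r + 1"] that by (simp add: distrib_left)
 have 6: "wg X Y (s + 1, r, i) = wg X Y (s, r, i) + wk X Y (NN - 1)" if "s = r - 1"
  using gA_steps(3,4)[of "s + 1" r] that unfolding wk_def na_vals wg.simps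
  by simp (simp add: algebra_simps gA_le gA_ge)
 have d': "d = wb X Y u + wg X Y (s, r, i) + wk X Y k" using d by (simp add: w wb_def)
 show "hom (wP X Y) d (s0 (bs (u, w, v)))"
  unfolding s0_def lin_ext_bs prod.case w s0b.simps
  using 1 2[of k] 2[of "- NN"] 3 4 5 6 NN_pos
  by (auto intro!: hom_sg hom_Tb simp: d' wb_def simp del: wg.simps)
qed

lemma hom_sig: "z : PC n ==> hom (wP X Y) d z ==> hom (wP X Y) d (sig z)" (is "PROP ?A")
proof -
 have "hom (wP X Y) d (sigk t z)" if "z : PC n" "hom (wP X Y) d z" for t and z :: "'a pp"
  using that
 proof (induction t arbitrary: z)
  case (Suc t)
  have "nu z : PC n" unfolding nu_def using bd_PC[OF s0_PC[OF Suc.prems(1)]] by (auto intro!: PC_diff Suc.prems)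
  moreover have "hom (wP X Y) d (nu z)" unfolding nu_def by (intro hom_sub hom_bd hom_s0[OF Suc.prems(1)] Suc.prems)
  ultimately show ?case using Suc by (auto intro!: hom_plus hom_s0)
 qed simp
 thus "PROP ?A" unfolding sig_def by blast
qed

lemma hom_la: "hom (wb X Y) e x ==> hom (wP X Y) d z ==> hom (wP X Y) (d + e) (la x z)"
proof (rule hom_lin[OF la_lin2], clarify)
 fix u :: bas and w :: gen and v :: bas assume a: "hom (wb X Y) e x" "hom (wP X Y) d z" "(u, w, v) : ks z"
 hence "wP X Y (u, w, v) = d" by (auto simp: hom_def)
 thus "hom (wP X Y) (d + e) (la x (bs (u, w, v)))"
  unfolding la_bs by (intro hom_T[OF hom_mul[OF a(1) hom_bs] hom_bs]) auto
qed

lemma hom_ra: "hom (wb X Y) e x ==> hom (wP X Y) d z ==> hom (wP X Y) (d + e) (ra z x)"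
proof (rule hom_lin[OF ra_lin1], clarify)
 fix u :: bas and w :: gen and v :: bas assume a: "hom (wb X Y) e x" "hom (wP X Y) d z" "(u, w, v) : ks z"
 hence "wP X Y (u, w, v) = d" by (auto simp: hom_def)
 thus "hom (wP X Y) (d + e) (ra (bs (u, w, v)) x)"
  unfolding ra_bs by (intro hom_T[OF hom_bs hom_mul[OF hom_bs a(1)]]) auto
qed

lemma hom_px:
 assumes "!!w. dgr w = n ==> nn w ==> ng w = w ==> hom (wb X Y) (wg X Y w + e) (y w)" "z : PC n" "hom (wP X Y) d z"
 shows "hom (wb X Y) (d + e) (px y z)"
proof (rule hom_lin[OF px_lin], clarify)
 fix u :: bas and w :: gen and v :: bas assume a: "(u, w, v) : ks z"
 with assms have "wP X Y (u, w, v) = d" "dgr w = n" "nn w" "ng w = w" by (auto simp: hom_def PC_def okk_def)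
 with hom_mul[OF hom_mul[OF hom_bs assms(1)] hom_bs, of w u v]
 show "hom (wb X Y) (d + e) (px y (bs (u, w, v)))" by (simp add: px_def algebra_simps)
qed

text \<open>Homogeneity in all arguments with total shift \<open>e\<close>, in the recursive style
  of \<open>mlin\<close>.\<close>

primrec homl :: "int => int => ('s => int) => nat => int => ('k::field vv list => ('s \<Rightarrow>\<^sub>0 'k)) => bool" where
 "homl X Y wt 0 e f = hom wt e (f [])"
| "homl X Y wt (Suc n) e f = (ALL x d. hom (wb X Y) d x --> homl X Y wt n (e + d) (%xs. f (x # xs)))"

lemma homl_cong: "(!!xs. length xs = n ==> f xs = f' xs) ==> homl X Y wt n e f = homl X Y wt n e f'"
proof (induction n arbitrary: e f f')
 case (Suc n)
 have "homl X Y wt n (e + d) (%xs. f (x # xs)) = homl X Y wt n (e + d) (%xs. f' (x # xs))" for x d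
  by (rule Suc.IH) (simp add: Suc.prems)
 thus ?case by simp
qed simp

lemma homl_compose:
 assumes "!!d z. z : S ==> hom wt d z ==> hom wt' (d + e') (h z)"
 shows "homl X Y wt n e f ==> (!!xs. f xs : S) ==> homl X Y wt' n (e + e') (%xs. h (f xs))"
proof (induction n arbitrary: e f)
 case (Suc n)
 have "homl X Y wt' n (e + d + e') (%xs. h (f (x # xs)))" if "hom (wb X Y) d x" for d x
  using Suc.IH[of "e + d" "%xs. f (x # xs)"] Suc.prems that by simp
 thus ?case by (simp add: ac_simps)
qed (auto simp: assms)

lemma homl_sub: "homl X Y wt n e f ==> homl X Y wt n e f' ==> homl X Y wt n e (%xs. f xs - f' xs)"
 by (induction n arbitrary: e f f') (auto intro: hom_sub)

lemma homl_plus: "homl X Y wt n e f ==> homl X Y wt n e f' ==> homl X Y wt n e (%xs. f xs + f' xs)"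
 by (induction n arbitrary: e f f') (auto intro: hom_plus)

lemma homl_sg: "homl X Y wt n e f ==> homl X Y wt n e (%xs. sg k (f xs))"
 by (induction n arbitrary: e f) (auto intro: hom_sg)

lemma homl_merge: "homl X Y wt (Suc n) e f ==> hom (wb X Y) d x ==> homl X Y wt (Suc n) (e + d) (%xs. f ((x <> hd xs) # tl xs))"
 using hom_mul[of X Y d x] by (auto simp: add.assoc)

lemma homl_dp:
 assumes R: "!!d e z x. hom wt d z ==> hom (wb X Y) e x ==> hom wt (d + e) (R z x)"
 shows "homl X Y wt n e f ==> homl X Y wt (Suc n) e (dp R n f)"
proof (induction n arbitrary: e f)
 case (Suc n)
 have "homl X Y wt (Suc n) (e + d) (%xs. dp R (Suc n) f (x # xs))" if x: "hom (wb X Y) d x" for d x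
  unfolding dp.simps list.sel
  by (intro homl_sub homl_merge[OF Suc.prems x] Suc.IH) (use Suc.prems x in auto)
 thus ?case by (subst homl.simps) blast
qed (auto intro: R)

lemma homl_ins: "homl X Y wt (Suc n) e f ==> homl X Y (wb X Y) q e' h ==> homl X Y wt (q + n) (e + e') (%xs. f (h (take q xs) # drop q xs))"
proof (induction q arbitrary: e' h)
 case (Suc q)
 have "homl X Y wt (q + n) (e + (e' + d)) (%xs. f (h (x # take q xs) # drop q xs))" if "hom (wb X Y) d x" for x d
  by (rule Suc.IH) (use Suc.prems that in auto)
 thus ?case by (simp add: add.assoc)
qed auto

lemma homl_0: "homl X Y wt n e (%_. 0)"
 by (induction n arbitrary: e) auto

lemma homl_cp: "homl X Y wt n e f ==> homl X Y (wb X Y) q e' h ==> k + 1 = n + q ==> homl X Y wt k (e + e') (cp n q f h)"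
proof (induction n arbitrary: e f k)
 case 0
 thus ?case using homl_0 by (subst homl_cong[of k _ "%xs. 0"]) auto
next
 case (Suc n)
 have k: "k = q + n" using Suc.prems by simp
 have 1: "homl X Y wt k (e + e') (%xs. f (h (take q xs) # drop q xs))"
  unfolding k by (rule homl_ins) (use Suc.prems in auto)
 have 2: "homl X Y wt k (e + e') (%xs. cp n q (%ys. f (hd xs # ys)) h (tl xs))"
 proof (cases n)
  case (Suc n')
  hence k': "k = Suc (q + n')" using k by simp
  have "homl X Y wt (q + n') (e + d + e') (cp n q (%ys. f (x # ys)) h)" if "hom (wb X Y) d x" for x d
   by (rule Suc.IH) (use Suc.prems Suc that in auto)
  thus ?thesis by (simp add: k' ac_simps)
 qed (simp add: homl_0)
 show ?case using homl_plus[OF 1 homl_sg[OF 2]] by (subst homl_cong) auto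
qed

lemma homl_br: "homl X Y (wb X Y) n e f ==> homl X Y (wb X Y) q e' h ==> k + 1 = n + q ==> homl X Y (wb X Y) k (e + e') (br n q f h)"
 using homl_sub[OF homl_cp[of X Y "wb X Y" n e f q e' h k] homl_sg[OF homl_cp[of X Y "wb X Y" q e' h n e f k, unfolded add.commute[of e']]]]
 by (subst homl_cong) (auto simp: br_def add.commute)

lemma homl_Xi: "homl X Y (wP X Y) n 0 (Xi n :: 'k::field vv list => 'k pp)"
proof (induction n)
 case 0
 have "hom (wP X Y) 0 (ow (0, 0, i) :: 'k pp)" for i
  unfolding ow_def by (rule hom_T[OF hom_vt hom_vt]) (simp add: gA_def)
 thus ?case by (auto intro: hom_sum)
next
 case (Suc n)
 let ?F = "Xi n :: 'k vv list => 'k pp"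
 have 1: "homl X Y (wP X Y) (Suc n) 0 (dp ra n ?F)"
  by (rule homl_dp[OF _ Suc]) (metis hom_ra)
 have 2: "homl X Y (wP X Y) (Suc n) 0 (%xs. la (hd xs) (?F (tl xs)))"
 proof -
  have "homl X Y (wP X Y) n (0 + d) (%xs. la x (?F xs))" if "hom (wb X Y) d x" for x d
   by (rule homl_compose[of UNIV]) (use Suc hom_la[OF that] in auto)
  thus ?thesis by simp
 qed
 have 3: "homl X Y (wP X Y) (Suc n) 0 (%xs. sg 1 (la (hd xs) (?F (tl xs)) - dp ra n ?F xs))"
  by (intro homl_sg homl_sub 1 2)
 have 4: "homl X Y (wP X Y) (Suc n) (0 + 0) (%xs. sig (sg 1 (la (hd xs) (?F (tl xs)) - dp ra n ?F xs)))"
  by (rule homl_compose[OF _ 3, of "PC (int n)"]) (auto intro: hom_sig intro!: PC_sg PC_diff la_PC dp_PC Xi_PC)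
 thus ?case by (subst homl_cong) (auto simp: del_def)
qed

lemma homl_pXi:
 assumes "!!w. dgr w = int n ==> nn w ==> ng w = w ==> hom (wb X Y) (wg X Y w + e) (y w)"
 shows "homl X Y (wb X Y) n e (%xs. px y (Xi n xs))"
proof -
 have "homl X Y (wb X Y) n (0 + e) (%xs. px y (Xi n xs))"
  by (rule homl_compose[OF _ homl_Xi, of "PC (int n)"]) (use hom_px[OF assms] Xi_PC in auto)
 thus ?thesis by simp
qed

lemma hom_psi: "homl X Y (wb X Y) p e f ==> dgr w = int p ==> hom (wb X Y) (wg X Y w + e) (psi p f w)"
proof (induction p arbitrary: e f w)
 case 0
 obtain s r i where w: "w = (s, r, i)" by (cases w)
 show ?case
 proof (cases "nn w")
  case True
  hence "s = 0" "r = 0" using 0 w by auto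
  thus ?thesis using hom_mul[OF _ hom_vt, of X Y e "f []" i] 0 by (simp add: w gA_def)
 qed simp
next
 case (Suc p)
 have h: "hom (wP X Y) (wg X Y w) (bd (ow w :: 'a pp))"
  unfolding ow_def by (intro hom_bd hom_T[OF hom_vt hom_vt]) simp
 have b: "bd (ow w :: 'a pp) : PC (int p)" using bd_PC[OF one_of_PC[OF Suc.prems(2)]] by simp
 have "hom (wb X Y) (wg X Y w + e) (thl p f (bd (ow w)))"
  unfolding thl_def
 proof (rule hom_lin[OF lin_lin_ext], clarify)
  fix u :: bas and w' :: gen and v :: bas
  assume a: "(u, w', v) : ks (bd (ow w :: 'a pp))"
  hence e1: "wb X Y u + wg X Y w' + wb X Y v = wg X Y w" and d: "dgr w' = int p"
   using a b h by (auto simp: hom_def PC_def)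
  have "hom (wb X Y) (wg X Y w' + (e + wb X Y u)) (psi p (%xs. f (bs u # xs)) w')"
   by (rule Suc.IH[OF _ d]) (use Suc.prems(1) hom_bs[of "wb X Y" u] in auto)
  from hom_mul[OF this hom_bs[of _ v]]
  have h: "hom (wb X Y) (wg X Y w' + (e + wb X Y u) + wb X Y v) (psi p (%xs. f (bs u # xs)) w' <> bs v)" .
  have "wg X Y w' + (e + wb X Y u) + wb X Y v = wg X Y w + e" using e1 by simp
  with h show "hom (wb X Y) (wg X Y w + e) (lin_ext (%(u, w, v). psi p (%xs. f (bs u # xs)) w <> bs v) (bs (u, w', v)))"
   by simp
 qed
 thus ?case by (simp add: psi_Suc hom_uminus)
qed

lemma hom_pull: "homl X Y (wb X Y) p e f ==> dgr w = int p ==> hom (wb X Y) (wg X Y w + e) (pull p f w)"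
 using hom_mul[OF hom_mul[OF hom_vt hom_psi] hom_vt, of X Y p e f w] by (simp add: pull_def)

text \<open>\<open>e1\<close> and \<open>e2\<close> are the changes in the numbers of arrows
  \<open>a\<close> and \<open>a-bar\<close> from a generator to its value; quantifying over the
  weights states both at once.\<close>

definition bideg :: "nat => ('k::field gv) => int => int => bool" where
 "bideg n y e1 e2 <-> (ALL X Y w. dgr w = int n --> nn w --> ng w = w --> hom (wb X Y) (wg X Y w + (X * e1 + Y * e2)) (y w))"

lemma br_vals:
 fixes f h :: "'k::field co"
 shows "(!!xs. f xs <> wd 0 = f xs) ==> (!!xs. h xs <> wd 0 = h xs) ==> br n q f h xs <> wd 0 = br n q f h xs"
proof -
 assume f: "!!xs. f xs <> wd 0 = f xs" "!!xs. h xs <> wd 0 = h xs"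
 have c: "cp n q f h xs <> wd 0 = cp n q f h xs" if "!!xs. f xs <> wd 0 = f xs"
  for n q and f h :: "'k co" and xs
  using that by (induction n arbitrary: f xs) (auto simp: mul_add_left mul_sg_left)
 show ?thesis by (simp add: br_def mul_diff_left mul_sg_left c[OF f(1)] c[OF f(2)])
qed

lemma px_vals: "px y z <> wd 0 = px y z"
 by (rule lin_eqI[of "%z. px y z <> wd 0" "%z. px y z"])
  (auto simp: px_def mul_assoc mul_wd_0 split: prod.split intro!: lin_mul1)

text \<open>Up to coboundaries brackets do not depend on the comparison map, so they may be formed
  with the bihomogeneous \<open>Xi\<close>; returning to the small complex with \<open>pull\<close>
  keeps the bidegree.\<close>

lemma br_pull:
 assumes Z: "cmap Z" and y: "pcc (int n) y" "pcc (int q) y'" and b: "bideg n y e1 e2" "bideg q y' e1' e2'"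
  and nq: "n + q >= 2"
 shows "EX v. pcc (int (n + q - 1)) v & bideg (n + q - 1) v (e1 + e1') (e2 + e2') &
  coh (n + q - 1) (br n q (%xs. px y (Z n xs)) (%xs. px y' (Z q xs))) (%xs. px v (Z (n + q - 1) xs))"
proof -
 let ?f = "%xs. px y (Xi n xs)" and ?h = "%xs. px y' (Xi q xs)"
 let ?w = "br n q ?f ?h"
 let ?v = "pull (n + q - 1) ?w"
 have z: "zc n ?f" "zc q ?h" using zc_pb[OF cmap_Xi] y by auto
 have zw: "zc (n + q - 1) ?w" by (rule zc_br[OF z]) (use nq in simp)
 have v: "pcc (int (n + q - 1)) ?v" by (rule pull_pcc[OF zw])
 have bv: "bideg (n + q - 1) ?v (e1 + e1') (e2 + e2')"
  unfolding bideg_def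
 proof (intro allI impI)
  fix X Y w assume w: "dgr w = int (n + q - 1)"
  have "homl X Y (wb X Y) (n + q - 1) ((X * e1 + Y * e2) + (X * e1' + Y * e2')) ?w"
   by (intro homl_br homl_pXi) (use b nq in \<open>auto simp: bideg_def\<close>)
  from hom_pull[OF this w] show "hom (wb X Y) (wg X Y w + (X * (e1 + e1') + Y * (e2 + e2'))) (?v w)"
   by (simp add: algebra_simps)
 qed
 have "coh (n + q - 1) (br n q (%xs. px y (Z n xs)) (%xs. px y' (Z q xs))) ?w"
  by (rule coh_br) (use cmap_coh[OF Z cmap_Xi] y z zc_pb[OF Z] nq in auto)
 moreover have "coh (n + q - 1) ?w (%xs. px ?v (Z (n + q - 1) xs))"
  by (rule coh_pull[OF Z zw]) (intro br_vals px_vals)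
 ultimately show ?thesis using v bv coh_trans by blast
qed

lemma bideg_keys:
 assumes "bideg n y e1 e2" "dgr (s, r, i) = int n" "nn (s, r, i)" "ng (s, r, i) = (s, r, i)" "p : ks (y (s, r, i))"
 shows "na (snd p) = gA s r + e1" (is ?A) "nb (snd p) = gA r s + e2" (is ?B)
proof -
 have h: "hom (wb X Y) (wg X Y (s, r, i) + (X * e1 + Y * e2)) (y (s, r, i))" for X Y
  using assms by (auto simp: bideg_def)
 from h[of 1 0] h[of 0 1] assms(5) show ?A ?B
  by (auto simp: hom_def wb_def wk_def)
qed

lemma par_keys: "par y ==> p : ks (y w) ==> val p"
 using keys_mul[of "vt (sr w)" "y w"] by (auto simp: parD(2))

lemma br_zero:
 assumes Z: "cmap Z" and y: "pcc (int n) y" "pcc (int q) y'" and b: "bideg n y e1 e2" "bideg q y' e1' e2'"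
  and nq: "n + q >= 2"
  and none: "!!s r k. s >= 0 ==> r >= 0 ==> s + r = int (n + q - 1) ==> - NN < k ==> k <= NN ==>
   na k = gA s r + (e1 + e1') ==> nb k = gA r s + (e2 + e2') ==> False"
 shows "coh (n + q - 1) (br n q (%xs. px y (Z n xs)) (%xs. px y' (Z q xs))) (%xs. 0)"
proof -
 obtain v where v: "pcc (int (n + q - 1)) v" "bideg (n + q - 1) v (e1 + e1') (e2 + e2')"
  "coh (n + q - 1) (br n q (%xs. px y (Z n xs)) (%xs. px y' (Z q xs))) (%xs. px v (Z (n + q - 1) xs))"
  using br_pull[OF Z y b nq] by blast
 have "v w = 0" if w: "dgr w = int (n + q - 1)" "nn w" "ng w = w" for w
 proof (rule ccontr)
  assume "v w ~= 0"
  then obtain p where p: "p : ks (v w)" by (metis all_not_in_conv keys_eq_empty)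
  have "val p" using par_keys[of v p w] p v by (simp add: pcc_def)
  moreover obtain s r i where "w = (s, r, i)" by (cases w)
  ultimately show False using bideg_keys[OF v(2), of s r i p] none[of s r "snd p"] w p by (auto simp: val_def)
 qed
 hence "px v (Z (n + q - 1) xs) = px (%_. 0) (Z (n + q - 1) xs)" for xs
  by (intro px_cong[OF cmapD(2)[OF Z]]) auto
 with v(3) show ?thesis by (simp add: px_def[of "%_. 0"] split_def)
qed

subsection \<open>Extending a partial homotopy\<close>

definition pr :: "gen => 'k::field pp => 'k pp" where
 "pr w z = la (vt (sr w)) (ra z (vt (tg w)))"

lemma pr_PC: "z : PC n ==> pr w z : PC n"
 unfolding pr_def by (intro la_PC ra_PC)

lemma pr_idem: "la (vt (sr w)) (pr w z) = pr w z" "ra (pr w z) (vt (tg w)) = pr w z"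
 by (simp_all add: pr_def bimP(5,6,7)[symmetric] vt_vt)

lemma pr_id: "la (vt (sr w)) z = z ==> ra z (vt (tg w)) = z ==> pr w z = z"
 by (simp add: pr_def)

lemma bd_pr: "bd (pr w z) = pr w (bd z)"
 by (simp add: pr_def bd_la bd_ra)

lemma hom_pr: "hom (wP X Y) d z ==> hom (wP X Y) d (pr w z)"
 unfolding pr_def using hom_la[OF hom_vt hom_ra[OF hom_vt], of X Y d z] by simp

lemma hom_hx:
 assumes h: "!!w. hom (wP X Y) (wg X Y w + e) (h w)" and z: "hom (wP X Y) d z"
 shows "hom (wP X Y) (d + e) (hx h z)"
proof (rule hom_lin[OF hx_lin], clarify)
 fix u :: bas and w :: gen and v :: bas
 assume "(u, w, v) : ks z"
 with z have "wP X Y (u, w, v) = d" by (auto simp: hom_def)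
 with hom_la[OF hom_bs[of _ u] hom_ra[OF hom_bs[of _ v] h], of w]
 show "hom (wP X Y) (d + e) (hx h (bs (u, w, v)))" by (simp add: hx_def algebra_simps)
qed

lemma hx_cong: "(!!u w v. (u, w, v) : ks z ==> h w = h' w) ==> hx h z = hx h' z"
 unfolding hx_def by (rule lin_eqI[OF lin_lin_ext lin_lin_ext]) auto

text \<open>Stage \<open>Suc n\<close> adds degree \<open>n\<close>: the prescribed values on
  \<open>S\<close>, and elsewhere a chain bounding the obstruction, projected by \<open>pr\<close>
  to the end vertices of the generator.\<close>

primrec hst :: "'k::field vv => gen set => (gen => 'k pp) => nat => gen => 'k pp" where
 "hst c S h0 0 = (%w. 0)"
| "hst c S h0 (Suc n) = (%w. if dgr w ~= int n | ~ nn w then hst c S h0 n w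
  else if ng w : S then h0 (ng w)
  else pr w (sig (la c (ow w) - ra (ow w) c - hx (hst c S h0 n) (bd (ow w)))))"

context
 fixes c :: "'k::field vv" and S :: "gen set" and h0 :: "gen => 'k pp" and wc :: "int => int => int"
 assumes c: "!!x. c <> x = x <> c"
  and h0: "!!w. w : S ==> pr w (h0 w) = h0 w" "!!w. w : S ==> h0 w : PC (dgr w + 1)"
  and cl: "!!w u w' v. w : S ==> (u, w', v) : ks (bd (ow w :: 'k pp)) ==> w' : S"
  and eq0: "!!w. w : S ==> nn w ==> ng w = w ==> bd (h0 w) + hx h0 (bd (ow w)) = la c (ow w) - ra (ow w) c"
  and wc: "!!X Y. hom (wb X Y) (wc X Y) c" "!!X Y w. w : S ==> hom (wP X Y) (wg X Y w + wc X Y) (h0 w)"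
begin

lemma hst_stable: "dgr w < int n ==> dgr w < int n' ==> n <= n' ==> hst c S h0 n' w = hst c S h0 n w"
proof (induction n' arbitrary: n)
 case (Suc n')
 show ?case
 proof (cases "n = Suc n'")
  case False
  with Suc.prems have "n <= n'" "dgr w < int n'" by auto
  thus ?thesis using Suc.IH[of n] Suc.prems by simp
 qed simp
qed simp

lemma hst_neg: "dgr w < 0 ==> hst c S h0 n w = 0"
 by (induction n) auto

lemma hst_S: "w : S ==> nn w ==> ng w = w ==> dgr w < int n ==> hst c S h0 n w = h0 w"
 by (induction n) (auto simp: hst_neg elim!: nn.elims)

lemma hst_hpar: "hpar (hst c S h0 n) & (ALL X Y w. hom (wP X Y) (wg X Y w + wc X Y) (hst c S h0 n w))
  & (ALL w. dgr w < int n --> nn w --> ng w = w -->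
   bd (hst c S h0 n w) + hx (hst c S h0 n) (bd (ow w)) = la c (ow w) - ra (ow w) c)"
proof (induction n)
 case 0
 have "hpar (%_. 0 :: 'k pp)" by (simp add: hpar_def lin_0[OF la_lin2] lin_0[OF ra_lin1])
 moreover have "~ dgr w < 0" if "nn w" for w using that by (cases w) auto
 ultimately show ?case by auto
next
 case (Suc n)
 let ?G = "hst c S h0 n" and ?G' = "hst c S h0 (Suc n)"
 let ?y = "%w. la c (ow w) - ra (ow w) c - hx ?G (bd (ow w :: 'k pp))"
 note hp = Suc[THEN conjunct1]
 have hm: "hom (wP X Y) (wg X Y w + wc X Y) (?G w)" for X Y w using Suc by blast
 have eqn: "bd (?G w) + hx ?G (bd (ow w)) = la c (ow w) - ra (ow w) c"
  if "dgr w < int n" "nn w" "ng w = w" for w using Suc that by blast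
 have yPC: "?y w : PC (int n)" if "dgr w = int n" for w
 proof -
  have 1: "ow w : PC (int n)" by (rule one_of_PC[OF that])
  have "hx ?G (bd (ow w)) : PC (int n)" using hx_PC[OF hp bd_PC[OF 1]] by simp
  thus ?thesis by (intro PC_diff la_PC ra_PC 1)
 qed
 have sPC: "pr w (sig (?y w)) : PC (dgr w + 1)" if "dgr w = int n" for w
  using pr_PC[OF sig_PC[OF yPC[OF that]], of w] that by simp
 have hp': "hpar ?G'"
  unfolding hpar_def
 proof (intro allI conjI impI)
  fix w
  show "?G' (ng w) = ?G' w" using hparD(1)[OF hp, of w] by (simp add: pr_def)
  show "la (vt (sr w)) (?G' w) = ?G' w" "ra (?G' w) (vt (tg w)) = ?G' w" "?G' w : PC (dgr w + 1)"
   using hparD(2,3,5)[OF hp, of w] h0(1,2)[of "ng w"] pr_idem[of "ng w" "h0 (ng w)"] pr_idem[of w] sPC[of w]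
   by (auto simp: pr_def)
  show "?G' w = 0" if "~ nn w" using hparD(4)[OF hp that] that by simp
 qed
 have hm': "hom (wP X Y) (wg X Y w + wc X Y) (?G' w)" for X Y w
 proof -
  have 1: "hom (wP X Y) (wg X Y w) (ow w :: 'k pp)"
   unfolding ow_def by (rule hom_T[OF hom_vt hom_vt]) simp
  have "hom (wP X Y) (wg X Y w + wc X Y) (pr w (sig (?y w)))" if "dgr w = int n"
   by (intro hom_pr hom_sig[OF yPC[OF that]] hom_sub hom_la hom_ra wc(1) 1 hom_hx hm hom_bd)
  thus ?thesis using hm[of X Y w] wc(2)[of "ng w" X Y] by auto
 qed
 have hxe: "hx ?G' (bd (ow w)) = hx ?G (bd (ow w))" if "dgr w <= int n" for w
 proof (rule hx_cong)
  fix u w' v assume "(u, w', v) : ks (bd (ow w :: 'k pp))"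
  with bd_PC[OF one_of_PC[OF refl, of w]] have "dgr w' = dgr w - 1" by (auto simp: PC_def)
  with that show "?G' w' = ?G w'" by simp
 qed
 have "bd (?G' w) + hx ?G' (bd (ow w)) = la c (ow w) - ra (ow w) c"
  if w: "dgr w < int (Suc n)" "nn w" "ng w = w" for w
 proof (cases "dgr w = int n")
  case False
  thus ?thesis using eqn[of w] w hxe[of w] by simp
 next
  case True
  note b = bd_PC[OF one_of_PC[OF True]]
  show ?thesis
  proof (cases "w : S")
   case S: True
   have "hx ?G (bd (ow w)) = hx h0 (bd (ow w))"
   proof (rule hx_cong)
    fix u w' v assume k: "(u, w', v) : ks (bd (ow w :: 'k pp))"
    with b have "dgr w' = int n - 1" "nn w'" "ng w' = w'" by (auto simp: PC_def okk_def)
    thus "?G w' = h0 w'" using hst_S[of w' n] cl[OF S k] by simp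
   qed
   thus ?thesis using eq0[OF S] w hxe[of w] True S by simp
  next
   case nS: False
   \<comment> \<open>The homotopy equation one degree lower makes the obstruction a cycle; in degree
     0 the augmentation kills it because \<open>c\<close> is central.\<close>
   have "cyc (int n) (?y w)"
   proof (cases "n = 0")
    case n0: True
    have 0: "bd (ow w :: 'k pp) = 0" using b n0 by (intro PC_neg[of "-1"]) auto
    have 1: "ow w : PC 0" using one_of_PC[OF True] n0 by simp
    show ?thesis using yPC[OF True] n0 c by (simp add: cyc_def 0 lin_0[OF hx_lin] lin_diff[OF aug_lin] aug_la[OF 1] aug_ra[OF 1])
   next
    case False
    have "bd (hx ?G (bd (ow w))) + hx ?G (bd (bd (ow w))) = la c (bd (ow w)) - ra (bd (ow w)) c"
     by (rule hx_homotopy_deg[OF hp eqn c b]) auto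
    hence "bd (?y w) = 0"
     by (simp add: bd_simps bd_la bd_ra bdbd[OF one_of_PC[OF refl]] lin_0[OF hx_lin])
    thus ?thesis using yPC[OF True] False by (simp add: cyc_def)
   qed
   hence bs: "bd (sig (?y w)) = ?y w" by (rule bd_sig) simp
   have cx: "la (vt (sr w)) (la c z) = la c (la (vt (sr w)) z)" "ra (ra z c) (vt (tg w)) = ra (ra z (vt (tg w))) c"
    for z :: "'k pp" by (simp_all add: c flip: bimP(5,6))
   have cz: "ra (la c (ow w)) (vt (tg w)) = la c (ow w)"
    by (simp add: one_of_vt flip: bimP(7))
   have "pr w (?y w) = ?y w"
    by (rule pr_id) (simp_all add: lin_diff[OF la_lin2] lin_diff[OF ra_lin1] cx cz bimP(7) one_of_vt
     flip: hx_la[OF hp] hx_ra[OF hp] bd_la bd_ra)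
   thus ?thesis using w True nS hxe[of w] by (simp add: bd_pr bs)
  qed
 qed
 with hp' hm' show ?case by blast
qed

text \<open>An explicit homotopy is wanted only where it will be evaluated: a bihomogeneous solution
  on a set of generators closed under the differential extends to all generators with the same
  bidegree.\<close>

lemma homotopy_extend:
 "EX h. hpar h & (ALL w. nn w --> ng w = w --> bd (h w) + hx h (bd (ow w)) = la c (ow w) - ra (ow w) c)
  & (ALL w:S. nn w --> ng w = w --> h w = h0 w) & (ALL X Y w. hom (wP X Y) (wg X Y w + wc X Y) (h w))"
proof -
 define h where "h w = hst c S h0 (Suc (nat (dgr w))) w" for w
 have e: "h w = hst c S h0 n w" if "dgr w < int n" for w n
 proof (cases "dgr w < 0")
  case True thus ?thesis by (simp add: h_def hst_neg)
 next
  case False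
  thus ?thesis unfolding h_def by (intro hst_stable[symmetric]) (use that in auto)
 qed
 have "hpar h"
  unfolding hpar_def
 proof (intro allI)
  fix w show "h (ng w) = h w & la (vt (sr w)) (h w) = h w & ra (h w) (vt (tg w)) = h w & (~ nn w --> h w = 0) & h w : PC (dgr w + 1)"
   using hparD[OF hst_hpar[THEN conjunct1, of "Suc (nat (dgr w))"], of w] unfolding h_def dgr_ng by blast
 qed
 moreover have "bd (h w) + hx h (bd (ow w)) = la c (ow w) - ra (ow w) c" if w: "nn w" "ng w = w" for w
 proof -
  have d: "dgr w < int (Suc (nat (dgr w)))" by simp
  have "hx h (bd (ow w)) = hx (hst c S h0 (Suc (nat (dgr w)))) (bd (ow w))"
  proof (rule hx_cong)
   fix u w' v assume "(u, w', v) : ks (bd (ow w :: 'k pp))"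
   with bd_PC[OF one_of_PC[OF refl, of w]] have "dgr w' = dgr w - 1" by (auto simp: PC_def)
   thus "h w' = hst c S h0 (Suc (nat (dgr w))) w'" by (intro e) auto
  qed
  moreover have "h w = hst c S h0 (Suc (nat (dgr w))) w" by (rule e[OF d])
  ultimately show ?thesis using hst_hpar[of "Suc (nat (dgr w))"] d w by metis
 qed
 moreover have "h w = h0 w" if "w : S" "nn w" "ng w = w" for w
  unfolding h_def by (rule hst_S[OF that]) simp
 moreover have "hom (wP X Y) (wg X Y w + wc X Y) (h w)" for X Y w
  unfolding h_def using hst_hpar by blast
 ultimately show ?thesis by blast
qed

end


subsection \<open>Explicit homotopies\<close>

text \<open>The central element \<open>eps i\<close>, as identified in
  \<open>cl_elts\<close>.\<close>

definition cI :: "int => 'k::field vv" where "cI i = vt i <> wd NN"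

lemma cI_bs: "cI i = bs (i mod M, NN)"
 using NN_pos by (simp add: cI_def vt_wd nrm_def)

lemma cI_comm: "cI i <> x = x <> cI i"
proof (rule lin_eqI[of "%x. cI i <> x" "%x. x <> cI i"])
 fix p show "cI i <> bs p = bs p <> cI i"
  using NN_pos M_pos by (cases p) (auto simp: cI_bs mulb_def val_def en_def sft_def)
qed auto

lemma one_of_wd: "ow w = T (wd 0) w (wd 0)"
proof -
 have m: "sr w mod M = sr w" "tg w mod M = tg w" by (cases w; simp)+
 have "T (vt (sr w)) w (vt (tg w)) = T (wd 0 <> vt (sr w)) w (vt (tg w) <> wd 0)"
  by (simp only: T_wd0_left T_wd0_right)
 also have "... = T (wd 0) w (wd 0)" by (simp only: T_vt_left T_vt_right m refl if_True)
 finally show ?thesis by (simp add: ow_def)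
qed

lemma la_cI: "la (cI i) (ow w :: 'k::field pp) = (if sr w = i mod M then T (wd NN) w (wd 0) else 0)"
proof -
 have "vt i <> wd NN = (wd NN :: 'k vv) <> vt i"
  using vt_wd_comm[of i NN, where ?'a = 'k] by simp
 hence "la (cI i) (ow w :: 'k pp) = T (wd NN <> vt i) w (wd 0)"
  by (simp add: one_of_wd cI_def)
 thus ?thesis by (auto simp: T_vt_left)
qed

lemma ra_cI: "ra (ow w) (cI i) = (if tg w = i mod M then T (wd 0) w (wd NN) else 0)"
proof -
 have "ra (ow w) (cI i) = T (wd 0) w (vt i <> wd NN)"
  by (simp add: one_of_wd cI_def)
 thus ?thesis by (auto simp: T_vt_right)
qed

lemma wd_big: "\<bar>k\<bar> > NN ==> wd k = 0"
 by (simp add: wd_def)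

lemma pr_T:
 assumes "j' = j + sft k" "j + s - r - sft l = j' + s' - r'"
 shows "pr (s, r, j) (T (wd k) (s', r', j') (wd l)) = T (wd k) (s', r', j') (wd l)"
proof -
 have "pr (s, r, j) (T (wd k) (s', r', j') (wd l)) = T (wd k <> vt (j + sft k)) (s', r', j') (vt (j + s - r - sft l) <> wd l)"
  by (simp add: pr_def wd_vt_comm flip: vt_wd_comm)
 thus ?thesis using assms by (simp add: T_vt_left T_vt_right)
qed

lemma pr_lin [simp]: "lin (pr w)"
 unfolding pr_def[abs_def] by (intro lin_la2 lin_ra1 lin_id)

lemmas pr_simps = lin_add[OF pr_lin] lin_diff[OF pr_lin] lin_minus[OF pr_lin] lin_sum[OF pr_lin]
 sg_lin[OF pr_lin] lin_0[OF pr_lin]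

lemmas hx_simps = lin_add[OF hx_lin] lin_diff[OF hx_lin] lin_minus[OF hx_lin] lin_sum[OF hx_lin]
 sg_lin[OF hx_lin] lin_0[OF hx_lin]

lemmas la_simps = lin_add[OF la_lin2] lin_diff[OF la_lin2] lin_minus[OF la_lin2] lin_sum[OF la_lin2]
 sg_lin[OF la_lin2] lin_0[OF la_lin2]

lemmas ra_simps = lin_add[OF ra_lin1] lin_diff[OF ra_lin1] lin_minus[OF ra_lin1] lin_sum[OF ra_lin1]
 sg_lin[OF ra_lin1] lin_0[OF ra_lin1]

text \<open>At \<open>(0, 0)\<close> this is, up to sign, the noncommutative derivative of
  \<open>(a a-bar)^N\<close>, one term per letter. On the column \<open>s = 0\<close> the number
  \<open>k\<close> says after how many arrows \<open>a-bar\<close> the path from \<open>j\<close>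
  meets \<open>i\<close>: the value vanishes if this does not happen within \<open>r\<close> steps,
  it is exceptional if \<open>i\<close> is the start or next to it, and otherwise only its sign
  depends on \<open>k\<close>.\<close>

fun hF :: "int => gen => 'k::field pp" where
 "hF i (s, r, j) = (let k = (j - i) mod M in
  if s = 0 then
   if r = 0 then if k = 0 then - (\<Sum>l<N. T (wd (2 * int l)) (1, 0, j) (wd (1 + 2 * int l - NN))
    - T (wd (2 * int l + 1)) (0, 1, j + 1) (wd (NN - 2 - 2 * int l))) else 0
   else if k = 0 then T (wd (NN - 1)) (0, r + 1, j + 1) (wd 0)
   else if k = 1 then T (wd (- 1)) (1, r, j - 1) (wd 0) - T (wd 0) (0, r + 1, j) (wd (NN - 1))
   else if k <= r then sg k (T (wd 0) (0, r + 1, j) (wd (NN - 1))) else 0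
  else if k = 0 then T (wd 0) (1, 1, j) (wd 1) + T (wd (1 - NN)) (2, 0, j - 1) (wd 0)
  else if k = M - 1 then - T (wd 0) (2, 0, j) (wd (1 - NN)) else 0)"

text \<open>Closed under the differential. The column below degree \<open>m\<close> serves the
  brackets with cochains of degree \<open>m\<close>, the generators of degree 1 the bracket with
  \<open>chi_2_0\<close>. The bound on \<open>r\<close> ensures that a path along the column meets
  each vertex at most once.\<close>

definition SF :: "gen set" where
 "SF = {(s, r, j). s = 0 & 0 <= r & r < M | s = 1 & r = 0}"

lemma sft_vals: "sft 1 = 1" "sft (- 1) = - 1" "sft (NN - 1) = 1" "sft (1 - NN) = - 1" "sft 0 = 0" "sft NN = 0"
 "sft (2 * int l) = 0" "sft (2 * int l + 1) = 1" "sft (- 2 * int l) = 0" "sft (- 2 * int l - 1) = - 1"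
 "sft (- (2 * int l)) = 0" "sft (- (2 * int l) - 1) = - 1"
 "sft (NN - 2 - 2 * int l) = 0" "sft (2 + 2 * int l - NN) = 0"
 "l < N ==> sft (NN - 1 - 2 * int l) = 1" "l < N ==> sft (1 + 2 * int l - NN) = - 1"
 using NN_pos by (auto simp: sft_def)

lemma hF_pr: "w : SF ==> pr w (hF i w) = hF i w"
 using M3 by (cases w) (auto simp: SF_def Let_def pr_simps pr_T sft_vals intro!: sum.cong)

lemma T_mod: "T x (s, r, j mod M) y = T x (s, r, j) y" "T x (s, r, j mod M + 1) y = T x (s, r, j + 1) y"
  "T x (s, r, j mod M - 1) y = T x (s, r, j - 1) y"
 by (rule T_cong, simp add: mod_add_left_eq mod_diff_left_eq)+

lemma hF_ng: "hF i (ng w) = hF i w"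
 by (cases w; simp only: ng.simps hF.simps T_mod mod_diff_left_eq mod_diff_right_eq)+

lemma hx_T_loc:
 assumes "h (ng w) = h w" "pr w (h w) = h w" "nn w"
 shows "hx h (T u w v) = la u (ra (h w) v)"
proof (rule bilin_eqI[of "%u v. hx h (T u w v)" "%u v. la u (ra (h w) v)"])
 have i: "la (vt (sr w)) (h w) = h w" "ra (h w) (vt (tg w)) = h w" using pr_idem[of w "h w"] assms(2) by simp_all
 fix u v
 have "la (bs u) (ra (h w) (bs v)) = 0" if n: "~ okk u w v"
 proof -
  have e: "la (bs u) (ra (h w) (bs v)) = la (bs u <> vt (sr w)) (ra (h w) (vt (tg w) <> bs v))"
   using i by (simp add: bimP(5,6,7))
  show ?thesis unfolding e using n assms(3) by (auto simp: okk_def bs_vt vt_bs lin_0[OF ra_lin2] lin_0[OF la_lin1] la_simps val_mod)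
 qed
 thus "hx h (T (bs u) w (bs v)) = la (bs u) (ra (h w) (bs v))"
  by (auto simp: T_bs Tb_def hx_def assms(1))
qed (auto intro!: lin_ins lin_la1 lin_la2 lin_ra1 lin_ra2 lin_compose[OF hx_lin])

lemma hF_PC: "w : SF ==> hF i w : PC (dgr w + 1)"
 using M3 by (cases w) (auto simp: SF_def Let_def intro!: PC_add PC_diff PC_minus PC_sum PC_sg T_PC)

lemma keys_T: "(u, w', v) : ks (T x w y) ==> nn w & w' = ng w" (is "PROP ?A")
proof -
 have "T x w y : PC (dgr w)" by (simp add: T_PC)
 have "ks (T x w y) <= {(u, w', v). nn w & w' = ng w}"
  by (rule keys_lin[OF T_lin1], rule keys_lin[OF T_lin2]) (auto simp: T_bs Tb_def okk_def)
 thus "PROP ?A" by auto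
qed

lemma bd_keys:
 assumes "(u, w', v) : ks (bd (ow (s, r, j) :: 'k::field pp))"
 shows "nn w' & (EX j'. w' = (s - 1, r, j') | w' = (s, r - 1, j'))"
proof -
 let ?R = "{(u :: bas, w', v :: bas). nn w' & (EX j'. w' = (s - 1, r, j') | w' = (s, r - 1, j'))}"
 have T: "ks (T x (s - 1, r, j') y) <= ?R" "ks (T x (s, r - 1, j') y) <= ?R"
  for j' and x y :: "'k vv" by (auto dest!: keys_T)
 have "ks (bd (ow (s, r, j) :: 'k pp)) <= ?R"
 proof (cases "s = r")
  case True
  hence "~ s ~= r" by simp
  show ?thesis unfolding ow_def bd_T dgb.simps if_not_P[OF `~ s ~= r`]
   by (intro keys_sumI keys_addI; (simp only: keys_sg)?; rule T)
 next
  case False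
  show ?thesis unfolding ow_def bd_T dgb.simps if_P[OF False]
   by (intro keys_sumI keys_addI; (simp only: keys_sg)?; rule T)
 qed
 with assms show ?thesis by auto
qed

lemma SF_cl: "w : SF ==> (u, w', v) : ks (bd (ow w :: 'k::field pp)) ==> w' : SF"
 using M_pos by (cases w) (auto simp: SF_def dest!: bd_keys)

lemma mod_M_sub1: "(j - 1 - i) mod M = (if (j - i) mod M = 0 then M - 1 else (j - i) mod M - 1)"
proof -
 have "(j - 1 - i) mod M = ((j - i) mod M - 1) mod M" by (simp add: mod_diff_left_eq diff_right_commute)
 moreover have "0 <= (j - i) mod M" "(j - i) mod M < M" using M_pos by auto
 ultimately show ?thesis using zmod_minus1[OF M_pos] by (auto intro!: mod_pos_pos_trivial)
qed

lemma wd_prods: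
 assumes "l < N"
 shows "wd 1 <> wd (1 + 2 * int l - NN) = wd (NN - 2 * int l)" "wd (2 * int l) <> wd 1 = wd (2 * int l + 1)"
  "wd (2 * int l + 1) <> wd (- 1) = wd (2 + 2 * int l)" "wd (- 1) <> wd (NN - 2 - 2 * int l) = wd (1 + 2 * int l - NN)"
  "wd (1 + 2 * int l - NN) <> wd (- 1) = 0" "wd (NN - 2 - 2 * int l) <> wd (- 1) = (if l = N - 1 then wd (- 1) else 0)"
  "wd (- 1) <> wd (2 * int l) = wd (- 1 - 2 * int l)" "wd (- 1) <> wd (2 * int l + 1) = wd (- 2 - 2 * int l)"
  "wd (- 1) <> wd (- (2 * int l)) = (if l = 0 then wd (- 1) else 0)" "wd (- 1) <> wd (- (2 * int l) - 1) = 0"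
  "wd (1 + 2 * int l - NN) <> wd 1 = wd (2 * int l - NN)" "wd (NN - 2 - 2 * int l) <> wd 1 = wd (NN - 1 - 2 * int l)"
  "wd (NN - 1 - 2 * int l) <> wd 1 = 0" "wd (2 + 2 * int l - NN) <> wd 1 = (if l = N - 1 then wd 1 else 0)"
 using assms by (auto simp: wd_wd fits_def jn_def intro!: arg_cong[of _ _ wd])

lemma wd_prods2: "wd (NN - 1) <> wd (- 1) = wd NN" "wd (- 1) <> wd (NN - 1) = wd NN" "wd (- 1) <> wd (- 1) = 0"
 "wd (1 - NN) <> wd 1 = wd NN" "wd 1 <> wd (1 - NN) = wd NN" "wd 1 <> wd 1 = 0"
 using NN_pos wd_NN by (auto simp: wd_wd fits_def jn_def)

lemma wd_00: "wd k <> wd 0 = wd k" "wd 0 <> wd k = wd k"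
 by (simp_all add: wd_wd)

lemma kab: "ka 1 0 = 1" "kb 1 0 = 1 - NN" "ka 0 1 = NN - 1" "kb 0 1 = - 1" "r > 0 ==> kb 0 r = - 1" "s > 0 ==> ka s 0 = 1"
 "r > 1 ==> ka 1 r = NN - 1" "r > 1 ==> kb 1 r = - 1" "s > 1 ==> ka s 1 = 1" "s > 1 ==> kb s 1 = 1 - NN"
 by (auto simp: ka_def kb_def)

lemma hxF: "w : SF ==> nn w ==> hx (hF i) (T x w y) = la x (ra (hF i w) y)"
 by (rule hx_T_loc) (auto simp: hF_ng hF_pr)

lemma bd_0r: "r > 0 ==> bd (T x (0, r, j) y) = T (x <> wd (- 1)) (0, r - 1, j - 1) y + sg r (T x (0, r - 1, j) (wd (- 1) <> y))"
 by (subst bd_ne) (auto simp: T_neg kab)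

lemma bd_s0: "s > 0 ==> bd (T x (s, 0, j) y) = T x (s - 1, 0, j) (wd 1 <> y) + sg s (T (x <> wd 1) (s - 1, 0, j + 1) y)"
 by (subst bd_ne) (auto simp: T_neg kab)

lemma bd_00: "bd (T x (0, 0, j) y) = 0"
 by (simp add: bd_eq T_neg)

text \<open>The fundamental identity of the noncommutative derivative: the contributions of the
  letters telescope to the difference of the two one-sided products with the full word.\<close>

lemma hF_eq00: "bd (hF i (0, 0, j)) = (if (j - i) mod M = 0 then T (wd NN) (0, 0, j) (wd 0) - T (wd 0) (0, 0, j) (wd NN) else 0)"
proof -
 let ?f = "%l. T (wd (2 * int l)) (0, 0, j) (wd (NN - 2 * int l)) :: 'a pp"
 have s: "?f (Suc l) = T (wd (2 + 2 * int l)) (0, 0, j) (wd (NN - 2 - 2 * int l))" for l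
  by (simp add: algebra_simps)
 have "bd (T (wd (2 * int l)) (1, 0, j) (wd (1 + 2 * int l - NN)) - T (wd (2 * int l + 1)) (0, 1, j + 1) (wd (NN - 2 - 2 * int l)))
   = ?f l - ?f (Suc l)" if "l < N" for l
  unfolding s by (simp add: bd_simps bd_0r bd_s0 wd_prods[OF that])
 hence "bd (\<Sum>l<N. T (wd (2 * int l)) (1, 0, j) (wd (1 + 2 * int l - NN)) - T (wd (2 * int l + 1)) (0, 1, j + 1) (wd (NN - 2 - 2 * int l)))
   = (\<Sum>l<N. ?f l - ?f (Suc l))"
  unfolding lin_sum[OF bd_lin] by (intro sum.cong) auto
 also have "... = ?f 0 - ?f N" by (rule sum_lessThan_telescope')
 finally show ?thesis by (simp add: bd_simps)
qed

lemma hF_eq01: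
 "bd (hF i (0, 1, j)) + hx (hF i) (bd (ow (0, 1, j))) = (if (j - i) mod M = 0 then T (wd NN) (0, 1, j) (wd 0) else 0)
  - (if (j - i) mod M = 1 then T (wd 0) (0, 1, j) (wd NN) else 0)"
proof -
 have SF: "(0, 0, j) : SF" "(0, 0, j - 1) : SF" using M_pos by (auto simp: SF_def)
 have x: "hx (hF i) (bd (ow (0, 1, j))) = la (wd (- 1)) (hF i (0, 0, j - 1)) - ra (hF i (0, 0, j)) (wd (- 1))"
  by (simp add: one_of_wd bd_0r hx_simps hxF[OF SF(1)] hxF[OF SF(2)] wd_00 del: hF.simps)
   (simp add: wd_00 Let_def la_simps ra_simps)
 have M1: "M - 1 ~= 0" "M - 1 ~= 1" using M3 by auto
 consider "(j - i) mod M = 0" | "(j - i) mod M = 1" | "(j - i) mod M ~= 0" "(j - i) mod M ~= 1" by blast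
 thus ?thesis
 proof cases
  case 1
  have a: "ra (hF i (0, 0, j)) (wd (- 1)) = T (wd (NN - 1)) (0, 1, j + 1) (wd (- 1))"
  proof -
   have "N - 1 < N" "2 * int (N - 1) + 1 = NN - 1" using N1 by auto
   thus ?thesis
    using 1 by (simp add: Let_def ra_simps wd_prods sum_subtractf sum_negf if_distrib[of "T _ _"] cong: sum.cong_simp if_cong)
  qed
  have b: "la (wd (- 1)) (hF i (0, 0, j - 1)) = 0" using M1 1 by (simp add: mod_M_sub1 la_simps)
  have h: "hF i (0, 1, j) = T (wd (NN - 1)) (0, 2, j + 1) (wd 0)" using 1 by (simp add: Let_def)
  show ?thesis unfolding x a b h using 1
   by (simp add: bd_0r wd_prods2 wd_00 sg_def)
 next
  case 2
  hence e: "(j - 1 - i) mod M = 0" by (simp add: mod_M_sub1)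
  have l: "la (wd (- 1)) (hF i (0, 0, j - 1)) = (\<Sum>l<N. T (wd (- 2 - 2 * int l)) (0, 1, j) (wd (NN - 2 - 2 * int l)))
   - (\<Sum>l<N. T (wd (- 1 - 2 * int l)) (1, 0, j - 1) (wd (1 + 2 * int l - NN)))"
   using e by (simp add: Let_def la_simps wd_prods sum_subtractf cong: sum.cong_simp)
  have b: "bd (T (wd (- 1)) (1, 1, j - 1) (wd 0)) = T (wd (- 1)) (0, 1, j - 1) (wd (NN - 1))
   - (\<Sum>l<N. T (wd (- 2 - 2 * int l)) (0, 1, j) (wd (NN - 2 - 2 * int l)))
   + (\<Sum>l<N. T (wd (- 1 - 2 * int l)) (1, 0, j - 1) (wd (1 + 2 * int l - NN)))"
  proof -
   have "(\<Sum>l<N. if l = 0 then T (wd (- 1)) (0, 1, j - 1) (wd (NN - 1 - 2 * int l)) else 0) = T (wd (- 1)) (0, 1, j - 1) (wd (NN - 1))"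
    using N1 by (simp add: sum.delta)
   thus ?thesis
    by (simp add: bd_eq wd_prods wd_00 sum.distrib sum_negf sum_subtractf if_distrib[of "%x. T x _ _"] cong: sum.cong_simp if_cong)
  qed
  have r: "ra (hF i (0, 0, j)) (wd (- 1)) = 0" using 2 by (simp add: ra_simps)
  have d: "bd (T (wd 0) (0, 2, j) (wd (NN - 1))) = T (wd (- 1)) (0, 1, j - 1) (wd (NN - 1)) + T (wd 0) (0, 1, j) (wd NN)"
   by (simp add: bd_0r wd_prods2 wd_00 sg_def)
  have h: "hF i (0, 1, j) = T (wd (- 1)) (1, 1, j - 1) (wd 0) - T (wd 0) (0, 2, j) (wd (NN - 1))" using 2 by (simp add: Let_def)
  show ?thesis unfolding x l r h bd_simps b d using 2 by simp
 next
  case 3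
  hence "(j - 1 - i) mod M ~= 0" using M1 by (simp add: mod_M_sub1)
  moreover have "~ (j - i) mod M <= 1" using 3 M_pos by (smt (verit) pos_mod_sign)
  ultimately show ?thesis unfolding x using 3 by (simp add: bd_simps la_simps ra_simps)
 qed
qed

lemma hF_eq10:
 "bd (hF i (1, 0, j)) + hx (hF i) (bd (ow (1, 0, j))) = (if (j - i) mod M = 0 then T (wd NN) (1, 0, j) (wd 0) else 0)
  - (if (j - i) mod M = M - 1 then T (wd 0) (1, 0, j) (wd NN) else 0)"
proof -
 have SF: "(0, 0, j) : SF" "(0, 0, j + 1) : SF" using M_pos by (auto simp: SF_def)
 have x: "hx (hF i) (bd (ow (1, 0, j))) = ra (hF i (0, 0, j)) (wd 1) - la (wd 1) (hF i (0, 0, j + 1))"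
  by (simp add: one_of_wd bd_s0 hx_simps hxF[OF SF(1)] hxF[OF SF(2)] wd_00 del: hF.simps)
   (simp add: wd_00 Let_def la_simps ra_simps)
 have m: "(j - i) mod M = (if (j + 1 - i) mod M = 0 then M - 1 else (j + 1 - i) mod M - 1)"
  using mod_M_sub1[of "j + 1" i] by simp
 have M1: "M - 1 ~= 0" using M3 by auto
 have m2: "(j + 1 - i) mod M < M" using M_pos by simp
 consider "(j - i) mod M = 0" | "(j - i) mod M = M - 1" | "(j - i) mod M ~= 0" "(j - i) mod M ~= M - 1" by blast
 thus ?thesis
 proof cases
  case 1
  have r: "ra (hF i (0, 0, j)) (wd 1) = (\<Sum>l<N. T (wd (2 * int l + 1)) (0, 1, j + 1) (wd (NN - 1 - 2 * int l)))
   - (\<Sum>l<N. T (wd (2 * int l)) (1, 0, j) (wd (2 * int l - NN)))"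
   using 1 by (simp add: Let_def ra_simps wd_prods sum_subtractf cong: sum.cong_simp)
  have b: "bd (T (wd 0) (1, 1, j) (wd 1)) = (\<Sum>l<N. T (wd (2 * int l)) (1, 0, j) (wd (2 * int l - NN)))
   - (\<Sum>l<N. T (wd (2 * int l + 1)) (0, 1, j + 1) (wd (NN - 1 - 2 * int l))) - T (wd (1 - NN)) (1, 0, j - 1) (wd 1)"
  proof -
   have "(\<Sum>l<N. if l = N - 1 then T (wd (- (2 * int l) - 1)) (1, 0, j - 1) (wd 1) else 0) = T (wd (1 - NN)) (1, 0, j - 1) (wd 1)"
    using N1 by (simp add: sum.delta of_nat_diff algebra_simps)
   thus ?thesis
    by (simp add: bd_eq wd_prods wd_00 sum.distrib sum_negf sum_subtractf if_distrib[of "T _ _"] cong: sum.cong_simp if_cong)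
  qed
  have d: "bd (T (wd (1 - NN)) (2, 0, j - 1) (wd 0)) = T (wd (1 - NN)) (1, 0, j - 1) (wd 1) + T (wd NN) (1, 0, j) (wd 0)"
   by (simp add: bd_s0 wd_prods2 wd_00 sg_def)
  have "(j + 1 - i) mod M ~= 0" using 1 m M1 by auto
  hence l: "la (wd 1) (hF i (0, 0, j + 1)) = 0" by (simp add: la_simps)
  have h: "hF i (1, 0, j) = T (wd 0) (1, 1, j) (wd 1) + T (wd (1 - NN)) (2, 0, j - 1) (wd 0)" using 1 by (simp add: Let_def)
  show ?thesis unfolding x l r h bd_simps b d using 1 M1 by simp
 next
  case 2
  hence e: "(j + 1 - i) mod M = 0" using m m2 by (auto simp del: pos_mod_bound split: if_splits)
  have l: "la (wd 1) (hF i (0, 0, j + 1)) = - T (wd 1) (1, 0, j + 1) (wd (1 - NN))"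
   using e N1 by (simp add: Let_def la_simps wd_wd fits_def sum_subtractf if_distrib[of "%x. T x _ _"]
    cong: sum.cong_simp if_cong)
  have d: "bd (T (wd 0) (2, 0, j) (wd (1 - NN))) = T (wd 0) (1, 0, j) (wd NN) + T (wd 1) (1, 0, j + 1) (wd (1 - NN))"
   by (simp add: bd_s0 wd_prods2 wd_00 sg_def)
  have r: "ra (hF i (0, 0, j)) (wd 1) = 0" using 2 M1 by (simp add: ra_simps)
  have h: "hF i (1, 0, j) = - T (wd 0) (2, 0, j) (wd (1 - NN))" using 2 M1 by (simp add: Let_def)
  show ?thesis unfolding x l r h bd_simps d using 2 M1 by simp
 next
  case 3
  hence "(j + 1 - i) mod M ~= 0" using m by auto
  thus ?thesis unfolding x using 3 by (simp add: bd_simps la_simps ra_simps)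
 qed
qed

lemma hF_eq0r:
 assumes r: "2 <= r" "r < M"
 shows "bd (hF i (0, r, j)) + hx (hF i) (bd (ow (0, r, j) :: 'k::field pp)) = (if (j - i) mod M = 0 then T (wd NN) (0, r, j) (wd 0) else 0)
  - (if (j - i) mod M = r then T (wd 0) (0, r, j) (wd NN) else 0)"
proof -
 have SF: "(0, r - 1, j) : SF" "(0, r - 1, j - 1) : SF" using r by (auto simp: SF_def)
 have x: "hx (hF i) (bd (ow (0, r, j))) = la (wd (- 1)) (hF i (0, r - 1, j - 1)) + sg r (ra (hF i (0, r - 1, j)) (wd (- 1)))"
  using r by (simp add: one_of_wd bd_0r hx_simps hxF[OF SF(1)] hxF[OF SF(2)] wd_00 del: hF.simps)
   (auto simp: wd_00 Let_def la_simps ra_simps)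
 define k where "k = (j - i) mod M"
 have k: "0 <= k" "k < M" using M_pos by (auto simp: k_def)
 have km: "(j - 1 - i) mod M = (if k = 0 then M - 1 else k - 1)" unfolding k_def by (rule mod_M_sub1)
 have hr: "(hF i (0, r', j) :: 'k pp) = (if k = 0 then T (wd (NN - 1)) (0, r' + 1, j + 1) (wd 0)
   else if k = 1 then T (wd (- 1)) (1, r', j - 1) (wd 0) - T (wd 0) (0, r' + 1, j) (wd (NN - 1))
   else if k <= r' then sg k (T (wd 0) (0, r' + 1, j) (wd (NN - 1))) else 0)" if "r' >= 1" for r'
  using that by (simp add: k_def Let_def)
 have bs: "bd (T x (0, r + 1, j') y) = T (x <> wd (- 1)) (0, r, j' - 1) y - sg r (T x (0, r, j') (wd (- 1) <> y))" for x y :: "'k vv" and j'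
  using r by (simp add: bd_0r) (simp add: sg_def)
 consider "k = 0" | "k = 1" | "2 <= k" "k <= r" | "r < k" using k by linarith
 thus ?thesis
 proof cases
  case 1
  have "hF i (0, r - 1, j - 1) = (0 :: 'k pp)" using r 1 km by (simp add: Let_def)
  thus ?thesis unfolding x k_def[symmetric] using r 1
   by (simp add: hr bs wd_00 wd_prods2 la_simps del: hF.simps)
 next
  case 2
  have 3: "hF i (0, r - 1, j - 1) = (T (wd (NN - 1)) (0, r, j) (wd 0) :: 'k pp)" using r 2 km by (simp add: Let_def)
  have 4: "bd (T (wd (- 1)) (1, r, j - 1) (wd 0) :: 'k pp) = T (wd (- 1)) (0, r, j - 1) (wd (NN - 1)) - T (wd NN) (0, r, j) (wd 0)
   - sg r (T (wd (- 1)) (1, r - 1, j - 1) (wd (- 1)))"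
   using r by (simp add: bd_ne kab wd_00 wd_prods2) (simp add: sg_def)
  show ?thesis unfolding x k_def[symmetric] using r 2
   by (simp add: hr bs bd_simps 3 4 wd_00 wd_prods2 ra_simps sg_diff del: hF.simps)
 next
  case 3
  have 4: "la (wd (- 1)) (hF i (0, r - 1, j - 1) :: 'k pp) = sg (k - 1) (T (wd (- 1)) (0, r, j - 1) (wd (NN - 1)))"
   using r 3 km by (auto simp: Let_def la_simps wd_00 wd_prods2)
  show ?thesis unfolding x k_def[symmetric] 4 using r 3
   by (simp add: hr bs bd_simps wd_00 wd_prods2 ra_simps del: hF.simps) (simp add: sg_def)
 next
  case 4
  have "hF i (0, r - 1, j - 1) = (0 :: 'k pp)" using r 4 km by (simp add: Let_def)
  thus ?thesis unfolding x k_def[symmetric] using r 4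
   by (simp add: hr bs bd_simps la_simps ra_simps del: hF.simps)
 qed
qed

lemma hF_eq:
 assumes w: "w : SF" "nn w" "ng w = w"
 shows "bd (hF i w) + hx (hF i) (bd (ow w)) = la (cI i) (ow w) - ra (ow w) (cI i :: 'k::field vv)"
proof -
 obtain s r j where e: "w = (s, r, j)" by (cases w)
 have m: "(j - i) mod M = x mod M <-> (j - x) mod M = i mod M" for x
  by (auto simp: mod_eq_dvd_iff algebra_simps)
 consider "s = 0" "r = 0" | "s = 0" "r = 1" | "s = 0" "2 <= r" "r < M" | "s = 1" "r = 0"
  using w(1) by (cases "r = 0"; cases "r = 1") (auto simp: e SF_def)
 thus ?thesis
 proof cases
  case 1
  have "bd (ow (0, 0, j) :: 'k pp) = 0" by (simp add: one_of_wd bd_00)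
  thus ?thesis using m[of 0] by (simp add: e 1 hF_eq00 la_cI ra_cI hx_simps del: hF.simps)
 next
  case 2
  show ?thesis using m[of 0] m[of 1] M3 by (simp add: e 2 hF_eq01 la_cI ra_cI del: hF.simps)
 next
  case 3
  show ?thesis using m[of 0] m[of r] 3 by (simp add: e hF_eq0r la_cI ra_cI del: hF.simps)
 next
  case 4
  have "(- 1) mod M = M - 1" using zmod_minus1[OF M_pos] .
  thus ?thesis using m[of 0] m[of "- 1"] by (simp add: e 4 hF_eq10 la_cI ra_cI del: hF.simps)
 qed
qed

lemma hom_cI: "hom (wb X Y) (X * int N + Y * int N) (cI i)"
 using hom_mul[OF hom_vt hom_wd, of X Y NN i] by (simp add: cI_def wk_def na_vals)

lemma hF_hom: "w : SF ==> hom (wP X Y) (wg X Y w + (X * int N + Y * int N)) (hF i w)"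
 using M3 by (cases w) (auto simp: SF_def Let_def gA_ge gA_le wk_def na_vals na_vals_l na_vals_l[simplified]
  intro!: hom_plus hom_sub hom_uminus hom_sum hom_sg hom_T[OF hom_wd hom_wd], auto simp: algebra_simps)

lemma homotopy_F:
 "EX h :: gen => 'k::field pp. hpar h &
  (ALL w. nn w --> ng w = w --> bd (h w) + hx h (bd (ow w)) = la (cI i) (ow w) - ra (ow w) (cI i))
  & (ALL w:SF. nn w --> ng w = w --> h w = hF i w) & (ALL X Y w. hom (wP X Y) (wg X Y w + (X * int N + Y * int N)) (h w))"
 by (rule homotopy_extend[OF cI_comm hF_pr hF_PC _ hF_eq hom_cI hF_hom]) (auto intro: SF_cl)


subsection \<open>Cochains with a single bidegree\<close>

abbreviation pb :: "('k::field fam) => nat => ('k gv) => 'k co" where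
 "pb Z n y \<equiv> %xs. px y (Z n xs)"

definition bk :: "('k::field fam) => nat => ('k gv) => nat => ('k gv) => ('k gv) => bool" where
 "bk Z n y q y' z <-> coh (n + q - 1) (br n q (pb Z n y) (pb Z q y')) (pb Z (n + q - 1) z)"

definition yE :: "int => int => (int => 'k::field vv) => 'k gv" where
 "yE sa ra0 u w = (case w of (s, r, j) => if s = sa & r = ra0 then u j else 0)"

lemma yE_simp [simp]: "yE sa ra0 u (s, r, j) = (if s = sa & r = ra0 then u j else 0)"
 by (simp add: yE_def)

definition uok :: "int => int => (int => 'k::field vv) => bool" where
 "uok s r u <-> s >= 0 & r >= 0 & (ALL j. u (j mod M) = u j & vt j <> u j = u j & u j <> vt (j + s - r) = u j)"

lemma par_yE: "uok s r u ==> par (yE s r u)"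
 unfolding par_def
proof
 fix w :: gen assume u: "uok s r u"
 obtain s' r' j where w: "w = (s', r', j)" by (cases w)
 show "yE s r u (ng w) = yE s r u w & vt (sr w) <> yE s r u w = yE s r u w & yE s r u w <> vt (tg w) = yE s r u w
  & (~ nn w --> yE s r u w = 0)"
  using u by (auto simp: w uok_def)
qed

lemma vt_wd_0 [simp]: "vt i <> wd 0 = vt i" "wd 0 <> vt i = vt i"
 using vt_wd[of i 0] NN_pos wd_vt[of 0 i] by (auto simp: vt_def nrm_def sft_def)

lemma par_wd_0: assumes "par y" shows "y w <> wd 0 = y w" "wd 0 <> y w = y w"
 using parD(2,3)[OF assms, of w] vt_wd_0 by (metis mul_assoc)+

lemma wd_vt_l: "wd k <> (vt j <> x) = vt (j - sft k) <> (wd k <> x)"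
 by (simp add: wd_vt_comm flip: mul_assoc)

lemma cob_ne: "s ~= r ==> par y ==> cob y (s, r, j) = y (s - 1, r, j) <> wd (ka s r)
  + sg s (wd (ka s r) <> y (s - 1, r, j + 1)) + sg s (wd (kb s r) <> y (s, r - 1, j - 1)) + sg (s + r) (y (s, r - 1, j) <> wd (kb s r))"
 by (simp add: cob_def one_of_wd bd_ne lin_add[OF px_lin] sg_lin[OF px_lin] px_T wd_00 par_wd_0 mul_assoc)

lemma px_zero: "(!!u w v. (u, w, v) : ks z ==> y w = 0) ==> px y z = 0"
 unfolding px_def by (rule lin_eqI[of _ "%_. 0"]) auto

lemma cob_yE_0: "~ (s' = s + 1 & r' = r) ==> ~ (s' = s & r' = r + 1) ==> cob (yE s r u) (s', r', j) = 0"
 unfolding cob_def by (rule px_zero) (auto dest!: bd_keys)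

text \<open>A cochain supported at one pair \<open>(s, r)\<close> has its coboundary at
  \<open>(s + 1, r)\<close> and \<open>(s, r + 1)\<close>. The two inequalities keep both pairs off
  the diagonal, so that the differential with four terms applies; these give the conditions on
  \<open>u\<close>.\<close>

lemma pcc_yE:
 assumes u: "uok s r u" and "n = s + r" "s + 1 ~= r" "s ~= r + 1"
  and 1: "!!j. u j <> wd (ka (s + 1) r) = sg s (wd (ka (s + 1) r) <> u (j + 1))"
  and 2: "!!j. wd (kb s (r + 1)) <> u (j - 1) = sg r (u j <> wd (kb s (r + 1)))"
 shows "pcc n (yE s r u)"
proof -
 note p = par_yE[OF u]
 have a: "cob (yE s r u) (s + 1, r, j) = 0" for j
  using 1[of j] by (simp add: cob_ne[OF `s + 1 ~= r` p]) (simp add: sg_def)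
 have b: "cob (yE s r u) (s, r + 1, j) = 0" for j
  using 2[of j] by (simp add: cob_ne[OF `s ~= r + 1` p]) (simp add: sg_def)
 have "cob (yE s r u) w = 0" for w
  using a b cob_yE_0[of _ s _ r u] by (cases w) metis
 thus ?thesis using p by (simp add: pcc_def cob_def)
qed

lemma pcc_cong:
 assumes "pcc n y" "par y'" "!!w. dgr w = n ==> ng w = w ==> nn w ==> y w = y' w"
 shows "pcc n y'"
proof -
 have "px y' (bd (ow w)) = 0" if "dgr w = n + 1" "ng w = w" "nn w" for w
 proof -
  have "bd (ow w) : PC n" using bd_PC[OF one_of_PC[OF that(1)]] by simp
  hence "px y' (bd (ow w)) = px y (bd (ow w))" by (rule px_cong) (simp add: assms(3))
  moreover have "px y (bd (ow w)) = 0" using assms(1) that unfolding pcc_def by blast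
  ultimately show ?thesis by simp
 qed
 thus ?thesis using assms(2) by (simp add: pcc_def)
qed

lemma bideg_yE:
 assumes "int n = s + r" "!!X Y j. hom (wb X Y) (X * (gA s r + e1) + Y * (gA r s + e2)) (u j)"
 shows "bideg n (yE s r u) e1 e2"
 unfolding bideg_def
proof (intro allI impI)
 fix X Y and w :: gen
 obtain s' r' j where w: "w = (s', r', j)" by (cases w)
 show "hom (wb X Y) (wg X Y w + (X * e1 + Y * e2)) (yE s r u w)"
  using assms(2)[of X Y j] by (auto simp: w algebra_simps)
qed

text \<open>The weights determine \<open>(s, r)\<close> up to finitely many possibilities, because they differ by
 at most one on every path.\<close>

lemma bk_zero:
 assumes Z: "cmap Z" and y: "pcc (int n) y" "pcc (int q) y'" and b: "bideg n y e1 e2" "bideg q y' e1' e2'"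
  and nq: "n + q >= 2"
  and none: "!!s r a b. s >= 0 ==> r >= 0 ==> s + r = int n + int q - 1 ==> 0 <= a ==> a <= int N ==> 0 <= b ==> b <= int N ==>
   \<bar>a - b\<bar> <= 1 ==> a - b = s - r + (e1 + e1') - (e2 + e2') ==>
   a = gA s r + (e1 + e1') ==> b = gA r s + (e2 + e2') ==> False"
 shows "bk Z n y q y' (%_. 0)"
proof -
 have px0: "px (%_. 0) z = 0" for z by (rule px_zero) simp
 have "coh (n + q - 1) (br n q (pb Z n y) (pb Z q y')) (%xs. 0)"
 proof (rule br_zero[OF Z y b nq])
  fix s r k :: int
  assume a: "0 <= s" "0 <= r" "s + r = int (n + q - 1)" "- NN < k" "k <= NN" "na k = gA s r + (e1 + e1')" "nb k = gA r s + (e2 + e2')"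
  have k: "na k + nb k = \<bar>k\<bar>" "na k - nb k = sft k" by (rule na_nb_abs na_nb_sft)+
  have k2: "\<bar>sft k\<bar> <= 1" "\<bar>k\<bar> <= NN" using a by (auto simp: sft_def)
  have "na k >= 0" "nb k >= 0" by (auto simp: na_def nb_def)
  moreover have "na k <= int N" "nb k <= int N"
   using k a(4,5) NN_pos by (auto simp: sft_def split: if_splits elim!: evenE)
  moreover have "gA s r - gA r s = s - r" by (cases "s <= r") (auto simp: gA_le gA_ge)
  ultimately show False using none[OF a(1,2), of "na k" "nb k"] a nq k k2 by (auto simp: of_nat_diff)
 qed
 thus ?thesis by (simp add: bk_def px0)
qed

lemma bk_00: "bk Z 0 y 0 y' (%_. 0)"
proof -
 have px0: "px (%_. 0) z = 0" for z by (rule px_zero) simp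
 show ?thesis unfolding bk_def px0 by (rule coh_eqI) (simp add: br_def)
qed

subsection \<open>The generators\<close>

text \<open>The cocycles of the theorem on the small complex: \<open>yX\<close>, \<open>yN\<close>,
  \<open>yP\<close>, \<open>yF\<close>, \<open>yG\<close> are \<open>chi_2_0\<close>,
  \<open>chi_m_neg\<close>, \<open>chi_m_pos\<close>, \<open>phi_m1_neg\<close>,
  \<open>psi_m1_pos\<close>, and \<open>yD\<close> is the sum of \<open>phi_1_0\<close> and
  \<open>psi_1_0\<close>; see \<open>elts_xb\<close>.\<close>

abbreviation yC :: "'k::field vv => 'k gv" where "yC c \<equiv> yE 0 0 (%j. vt j <> c)"
abbreviation yX :: "'k::field gv" where "yX \<equiv> yE 1 1 (%j. sg j (vt j))"
abbreviation yN :: "'k::field gv" where "yN \<equiv> yE 0 M vt"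
abbreviation yP :: "'k::field gv" where "yP \<equiv> yE M 0 vt"
abbreviation yF :: "'k::field gv" where "yF \<equiv> yE 0 (M - 1) (%j. sg j (vt j <> wd (NN - 1)))"
abbreviation yG :: "'k::field gv" where "yG \<equiv> yE (M - 1) 0 (%j. sg j (vt j <> wd (1 - NN)))"
abbreviation yD :: "'k::field gv" where
 "yD \<equiv> %w. yE 1 0 (%j. vt j <> wd 1) w + yE 0 1 (%j. vt j <> wd (- 1)) w"

definition cF :: "int => 'k::field vv" where "cF i = vt i <> wd 2 + vt (i + 1) <> wd (- 2)"

lemma sg_mod: "sg (j mod M) x = sg j x"
 by (rule sg_parity) (use m_even in \<open>simp add: even_mod_2_iff mod_mod_cancel dvd_mod_iff\<close>)

lemma M_even: "even M" and M4: "M >= 4"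
 using m_even m3 by (auto elim!: evenE)

lemma vt_M: "vt (i + M) = vt i" "vt (i - M) = vt i"
 by (simp_all add: vt_def)

lemma vt_vt_same [simp]: "vt i <> vt i = vt i" "vt i <> (vt i <> x) = vt i <> x"
 by (simp_all add: vt_vt flip: mul_assoc)

lemma uok_gens: "uok 1 1 (%j. sg j (vt j :: 'k::field vv))" "uok 0 M (vt :: int => 'k vv)" "uok M 0 (vt :: int => 'k vv)"
 "uok 0 (M - 1) (%j. sg j (vt j <> wd (NN - 1) :: 'k vv))" "uok (M - 1) 0 (%j. sg j (vt j <> wd (1 - NN) :: 'k vv))"
 "uok 1 0 (%j. vt j <> wd 1 :: 'k vv)" "uok 0 1 (%j. vt j <> wd (- 1) :: 'k vv)"
 using M4 by (auto simp: uok_def sg_mod mul_sg_right mul_sg_left mul_assoc wd_vt_comm sft_vals vt_M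
  diff_diff_eq2 add_diff_eq diff_add_eq)

lemma uok_c: "(!!x. c <> x = x <> c) ==> uok 0 0 (%j. vt j <> (c :: 'k::field vv))"
 by (auto simp: uok_def mul_assoc)

lemma pcc_c: assumes c: "!!x. c <> x = x <> c" shows "pcc 0 (yC (c :: 'k::field vv))"
proof (rule pcc_yE[OF uok_c[OF c]])
 show "vt j <> c <> wd (ka (0 + 1) 0) = sg 0 (wd (ka (0 + 1) 0) <> (vt (j + 1) <> c))" for j
  by (simp add: mul_assoc c wd_vt_l)
 show "wd (kb 0 (0 + 1)) <> (vt (j - 1) <> c) = sg 0 (vt j <> c <> wd (kb 0 (0 + 1)))" for j
  by (simp add: mul_assoc c wd_vt_l)
qed auto

lemma wd_sq: "wd (NN - 1) <> wd (NN - 1) = 0" "wd (1 - NN) <> wd (1 - NN) = 0"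
 using NN_pos by (auto simp: wd_wd fits_def)

lemma pcc_yX: "pcc 2 (yX :: 'k::field gv)"
 by (rule pcc_yE[OF uok_gens(1)]; use M4 M_even in \<open>(simp add: ka_def kb_def mul_sg_right mul_sg_left mul_assoc
  wd_vt_comm wd_vt_l wd_prods2 wd_sq sft_vals; simp add: sg_def)?\<close>)

lemma pcc_yN: "pcc M (yN :: 'k::field gv)"
 by (rule pcc_yE[OF uok_gens(2)]; use M4 M_even in \<open>(simp add: ka_def kb_def mul_sg_right mul_sg_left mul_assoc
  wd_vt_comm wd_vt_l wd_prods2 wd_sq sft_vals; simp add: sg_def)?\<close>)

lemma pcc_yP: "pcc M (yP :: 'k::field gv)"
 by (rule pcc_yE[OF uok_gens(3)]; use M4 M_even in \<open>(simp add: ka_def kb_def mul_sg_right mul_sg_left mul_assoc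
  wd_vt_comm wd_vt_l wd_prods2 wd_sq sft_vals; simp add: sg_def)?\<close>)

lemma pcc_yF: "pcc (M - 1) (yF :: 'k::field gv)"
 by (rule pcc_yE[OF uok_gens(4)]; use M4 M_even in \<open>(simp add: ka_def kb_def mul_sg_right mul_sg_left mul_assoc
  wd_vt_comm wd_vt_l wd_prods2 wd_sq sft_vals; simp add: sg_def)?\<close>)

lemma pcc_yG: "pcc (M - 1) (yG :: 'k::field gv)"
 by (rule pcc_yE[OF uok_gens(5)]; use M4 M_even in \<open>(simp add: ka_def kb_def mul_sg_right mul_sg_left mul_assoc
  wd_vt_comm wd_vt_l wd_prods2 wd_sq sft_vals; simp add: sg_def)?\<close>)

lemma gA_nonneg: "s >= 0 ==> r >= 0 ==> gA s r >= 0 & gA r s >= 0"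
 by (simp add: gA_def)

lemma hom_vt_wd: "hom (wb X Y) (wk X Y k) (vt j <> wd k)"
 using hom_mul[OF hom_vt hom_wd, of X Y k j] by simp

lemma hom_vt_c: "hom (wb X Y) d c ==> hom (wb X Y) d (vt j <> c)"
 using hom_mul[OF hom_vt, of X Y d c j] by simp

lemma bideg_cI: "bideg 0 (yC (cI i)) (int N) (int N)"
 by (rule bideg_yE) (auto simp: gA_def intro!: hom_vt_c hom_cI)

lemma hom_cF: "hom (wb X Y) (X + Y) (cF i)"
proof -
 have "wk X Y 2 = X + Y" "wk X Y (- 2) = X + Y" by (auto simp: wk_def na_def nb_def)
 thus ?thesis unfolding cF_def by (intro hom_plus) (metis hom_vt_wd)+
qed

lemma bideg_cF: "bideg 0 (yC (cF i)) 1 1"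
 by (rule bideg_yE) (auto simp: gA_def intro!: hom_vt_c hom_cF)

lemma bideg_gens: "bideg 2 yX (- int N) (- int N)" (is ?A) "bideg m yN 0 (- M)" "bideg m yP (- M) 0"
 "bideg (m - 1) yF (int N) (int N - M)" (is ?B) "bideg (m - 1) yG (int N - M) (int N)" (is ?C)
proof -
 show ?A
  by (rule bideg_yE) (auto simp: gA_def intro!: hom_sg hom_vt)
 show "bideg m yN 0 (- M)" "bideg m yP (- M) 0"
  by (rule bideg_yE; auto simp: gA_def intro!: hom_sg hom_vt)+
 have k: "wk X Y (NN - 1) = X * int N + Y * (int N - 1)" "wk X Y (1 - NN) = X * (int N - 1) + Y * int N" for X Y
  unfolding wk_def na_vals by simp_all
 show ?B
  using M4 by (intro bideg_yE) (auto simp: gA_def of_nat_diff k intro!: hom_sg ssubst[OF k(1), of "%d. hom (wb _ _) d _"] hom_vt_wd[of _ _ "NN - 1", unfolded k])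
 show ?C
  using M4 by (intro bideg_yE) (auto simp: gA_def of_nat_diff k intro!: hom_sg hom_vt_wd[of _ _ "1 - NN", unfolded k])
qed

lemma bk_swap: "bk Z n y q y' (%_. 0) ==> bk Z q y' n y (%_. 0)"
proof -
 have px0: "px (%_. 0) z = 0" for z by (rule px_zero) simp
 assume "bk Z n y q y' (%_. 0)"
 hence "coh (n + q - 1) (br n q (pb Z n y) (pb Z q y')) (%_. 0)" by (simp add: bk_def px0)
 from coh_minus[OF coh_sg[OF this]] show ?thesis
  unfolding bk_def px0 br_anti[of q n, abs_def] by (simp add: add.commute)
qed

lemma pcc_gens_nat: "pcc (int 2) (yX :: 'k::field gv)" "pcc (int (m - 1)) (yF :: 'k gv)" "pcc (int (m - 1)) (yG :: 'k gv)"
 using pcc_yX pcc_yF pcc_yG m3 by (simp_all add: of_nat_diff)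

context
 fixes Z :: "'k::field fam"
 assumes Z: "cmap Z"
begin

text \<open>\<open>yF\<close> raises the number of arrows \<open>a\<close> by \<open>N\<close>, the
  maximum on a path, and \<open>yG\<close> does so with \<open>a-bar\<close>; a central factor of
  positive degree exceeds the maximum.\<close>

lemma bk_c_FG:
 assumes "pcc 0 (yC c)" "bideg 0 (yC c) d d" "d > 0"
 shows "bk Z 0 (yC c) (m - 1) yF (%_. 0)" (is ?A) "bk Z 0 (yC c) (m - 1) yG (%_. 0)" (is ?B)
proof -
 have p: "pcc (int 0) (yC c)" using assms(1) by simp
 show ?A
  by (rule bk_zero[OF Z p pcc_gens_nat(2) assms(2) bideg_gens(4)]) (use m3 assms(3) in \<open>auto dest: gA_nonneg\<close>)
 show ?B
  by (rule bk_zero[OF Z p pcc_gens_nat(3) assms(2) bideg_gens(5)]) (use m3 assms(3) in \<open>auto dest: gA_nonneg\<close>)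
qed

lemma bk_FF: "bk Z (m - 1) yF (m - 1) yF (%_. 0)"
 by (rule bk_zero[OF Z pcc_gens_nat(2) pcc_gens_nat(2) bideg_gens(4) bideg_gens(4)]) (use m3 N1 in \<open>auto dest: gA_nonneg\<close>)

lemma m1: "int (m - 1) = M - 1" using m3 by simp

lemma bk_FN: "bk Z (m - 1) yF m yN (%_. 0)"
proof (rule bk_zero[OF Z pcc_gens_nat(2) pcc_yN bideg_gens(4) bideg_gens(2)])
 show "False" if "0 <= s" "s + r = int (m - 1) + int m - 1" "\<bar>a - b\<bar> <= 1" "a - b = s - r + (int N + 0) - (int N - M + - M)" for s r a b :: int
  using that m1 by linarith
qed (use m3 in auto)

lemma bk_XX: "bk Z 2 yX 2 yX (%_. 0)"
proof (rule bk_zero[OF Z pcc_gens_nat(1) pcc_gens_nat(1) bideg_gens(1) bideg_gens(1)])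
 fix s r a b :: int
 assume *: "s >= 0" "r >= 0" "s + r = int 2 + int 2 - 1" "0 <= a" "0 <= b" "\<bar>a - b\<bar> <= 1"
  "a - b = s - r + (- int N + - int N) - (- int N + - int N)" "a = gA s r + (- int N + - int N)" "b = gA r s + (- int N + - int N)"
 hence "s = 2 & r = 1 | s = 1 & r = 2" by auto
 thus False using * N1 by (auto simp: gA_def)
qed simp

lemma bk_XN: "bk Z 2 yX m yN (%_. 0)"
proof (rule bk_zero[OF Z pcc_gens_nat(1) pcc_yN bideg_gens(1) bideg_gens(2)])
 fix s r a b :: int
 assume *: "s >= 0" "r >= 0" "s + r = int 2 + int m - 1" "0 <= a" "0 <= b" "\<bar>a - b\<bar> <= 1"
  "a - b = s - r + (- int N + 0) - (- int N + - M)" "a = gA s r + (- int N + 0)" "b = gA r s + (- int N + - M)"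
 hence "s = 0 & r = M + 1 | s = 1 & r = M" by auto
 thus False using * N1 M4 by (auto simp: gA_def)
qed simp

lemma bk_NN: "bk Z m yN m yN (%_. 0)"
proof (rule bk_zero[OF Z pcc_yN pcc_yN bideg_gens(2) bideg_gens(2)])
 fix s r a b :: int
 assume *: "s >= 0" "r >= 0" "s + r = int m + int m - 1" "0 <= a" "0 <= b" "\<bar>a - b\<bar> <= 1"
  "a - b = s - r + (0 + 0) - (- M + - M)" "a = gA s r + (0 + 0)" "b = gA r s + (- M + - M)"
 hence "s = 0 & r = 2 * M - 1" by auto
 thus False using * N1 M4 by (auto simp: gA_def)
qed (use m3 in auto)

text \<open>The products of \<open>N\<close> with \<open>m\<close> that appear in the degree counts
  are expressed by one bounded unknown \<open>K\<close>, so that the rest is linear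
  arithmetic.\<close>

lemma N_cases: obtains K where "int N * M = K + 2 * int N" "int N * (M - 1) = K + int N" "int N * (M - 2) = K"
 "int N = 1 & K = M - 2 | int N >= 2 & K >= 2 * (M - 2) & K >= 2 * int N"
proof
 show "int N * M = int N * (M - 2) + 2 * int N" "int N * (M - 1) = int N * (M - 2) + int N" by (simp_all add: algebra_simps)
 show "int N = 1 & int N * (M - 2) = M - 2 | int N >= 2 & int N * (M - 2) >= 2 * (M - 2) & int N * (M - 2) >= 2 * int N"
  using mult_right_mono[of 2 "int N" "M - 2"] mult_left_mono[of 2 "M - 2" "int N"] M4 N1 by (cases "N = 1") auto
qed simp

lemma bk_NP: "bk Z m yN m yP (%_. 0)"
proof (rule bk_zero[OF Z pcc_yN pcc_yP bideg_gens(2) bideg_gens(3)])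
 fix s r a b :: int
 assume *: "s >= 0" "r >= 0" "s + r = int m + int m - 1" "0 <= a" "a <= int N" "0 <= b" "b <= int N" "\<bar>a - b\<bar> <= 1"
  "a - b = s - r + (0 + - M) - (- M + 0)" "a = gA s r + (0 + - M)" "b = gA r s + (- M + 0)"
 \<comment> \<open>The weights come out as \<open>N (m - 1) - m\<close> and one more: for
   \<open>N = 1\<close> the smaller is negative, for larger \<open>N\<close> the bigger exceeds
   \<open>N\<close>.\<close>
 hence sr: "s = M & r = M - 1 | s = M - 1 & r = M" by auto
 obtain K where K: "int N * M = K + 2 * int N" "int N * (M - 1) = K + int N" "int N * (M - 2) = K"
  "int N = 1 & K = M - 2 | int N >= 2 & K >= 2 * (M - 2) & K >= 2 * int N" by (rule N_cases)
 have g: "gA s r = int N * (M - 1) + 1 & gA r s = int N * (M - 1) | gA s r = int N * (M - 1) & gA r s = int N * (M - 1) + 1"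
  using sr by (auto simp: gA_ge gA_le)
 have "N > 1 ==> int N ~= 1" by simp
 thus False using * M4 K g by (smt (verit))
qed (use m3 in auto)

text \<open>The weights would be \<open>(N - 1) m\<close> and one more, beyond \<open>N\<close> as
  soon as \<open>N > 1\<close>. For \<open>N = 1\<close> they are 0 and 1, those of a single arrow,
  and the count decides nothing.\<close>

lemma bk_FG: "N > 1 ==> bk Z (m - 1) yF (m - 1) yG (%_. 0)"
proof (rule bk_zero[OF Z pcc_gens_nat(2) pcc_gens_nat(3) bideg_gens(4) bideg_gens(5)])
 fix s r a b :: int
 assume *: "N > 1" "s >= 0" "r >= 0" "s + r = int (m - 1) + int (m - 1) - 1" "0 <= a" "a <= int N" "0 <= b" "b <= int N" "\<bar>a - b\<bar> <= 1"
  "a - b = s - r + (int N + (int N - M)) - (int N - M + int N)" "a = gA s r + (int N + (int N - M))" "b = gA r s + (int N - M + int N)"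
 hence sr: "s = M - 1 & r = M - 2 | s = M - 2 & r = M - 1" using m1 by auto
 obtain K where K: "int N * M = K + 2 * int N" "int N * (M - 1) = K + int N" "int N * (M - 2) = K"
  "int N = 1 & K = M - 2 | int N >= 2 & K >= 2 * (M - 2) & K >= 2 * int N" by (rule N_cases)
 have g: "gA s r = int N * (M - 2) + 1 & gA r s = int N * (M - 2) | gA s r = int N * (M - 2) & gA r s = int N * (M - 2) + 1"
  using sr by (auto simp: gA_ge gA_le)
 have "N > 1 ==> int N ~= 1" by simp
 thus False using * M4 K g by (smt (verit))
qed (use M4 in auto)

text \<open>Both weights would be \<open>(N - 1) m\<close>; for \<open>N = 1\<close> these are the
  weights of a trivial path.\<close>

lemma bk_FP: "N > 1 ==> bk Z (m - 1) yF m yP (%_. 0)"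
proof (rule bk_zero[OF Z pcc_gens_nat(2) pcc_yP bideg_gens(4) bideg_gens(3)])
 fix s r a b :: int
 assume *: "N > 1" "s >= 0" "r >= 0" "s + r = int (m - 1) + int m - 1" "0 <= a" "a <= int N" "0 <= b" "b <= int N" "\<bar>a - b\<bar> <= 1"
  "a - b = s - r + (int N + - M) - (int N - M + 0)" "a = gA s r + (int N + - M)" "b = gA r s + (int N - M + 0)"
 hence sr: "s = M - 1 & r = M - 1" using m1 by auto
 obtain K where K: "int N * M = K + 2 * int N" "int N * (M - 1) = K + int N" "int N * (M - 2) = K"
  "int N = 1 & K = M - 2 | int N >= 2 & K >= 2 * (M - 2) & K >= 2 * int N" by (rule N_cases)
 have g: "gA s r = int N * (M - 1) + 0 & gA r s = int N * (M - 1) | gA s r = int N * (M - 1) & gA r s = int N * (M - 1) + 0"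
  using sr by (auto simp: gA_ge gA_le)
 have "N > 1 ==> int N ~= 1" by simp
 thus False using * M4 K g by (smt (verit))
qed (use M4 in auto)

end


subsection \<open>The derivation given by the grading\<close>

text \<open>The degree counts arrows \<open>a\<close> minus arrows \<open>a-bar\<close>. This
  matches the sum of \<open>phi_1_0\<close> and \<open>psi_1_0\<close> because
  \<open>g 1 1 i\<close> is minus an arrow, so that this cocycle sends \<open>a-bar\<close> to its
  negative.\<close>

definition Dh :: "'k::field vv => 'k vv" where
 "Dh = lin_ext (%p. scl (of_int (wb 1 (-1) p)) (bs p <> wd 0))"

lemma Dh_lin [simp]: "lin Dh"
 by (simp add: Dh_def)

lemma Dh_hom: "hom (wb 1 (-1)) d x ==> Dh x = scl (of_int d) (x <> wd 0)"
 by (rule lin_eqI[of Dh "%x. scl (of_int d) (x <> wd 0)"]) (auto simp: Dh_def hom_def intro!: lin_sclI)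

lemma Dh_mul: "Dh (x <> y) = Dh x <> y + x <> Dh y"
proof (rule bilin_eqI[of "%x y. Dh (x <> y)" "%x y. Dh x <> y + x <> Dh y"])
 fix u v :: bas
 have 1: "Dh (bs u <> bs v) = scl (of_int (wb 1 (-1) u + wb 1 (-1) v)) (bs u <> bs v <> wd 0)"
  by (rule Dh_hom[OF hom_mul[OF hom_bs hom_bs]])
 show "Dh (bs u <> bs v) = Dh (bs u) <> bs v + bs u <> Dh (bs v)"
  unfolding 1 Dh_hom[OF hom_bs] mul_scl_left mul_scl_right mul_assoc mul_wd_0 mul_wd_0' of_int_add scl_add_left by simp
qed (auto intro!: lin_ins lin_compose[OF Dh_lin])

lemma Dh_wd_0: "Dh x <> wd 0 = Dh x"
 by (rule lin_eqI[of "%x. Dh x <> wd 0" Dh])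
  (auto simp: Dh_def mul_scl_left mul_assoc wd_00 intro!: lin_mul1)

abbreviation Dk :: "'k::field co" where "Dk \<equiv> %xs. Dh (hd xs)"

lemma zc_Dk: "zc 1 (Dk :: 'k::field co)"
proof -
 have "dl 1 Dk xs = 0" if l: "length xs = 2" for xs :: "'k vv list"
 proof -
  obtain x y where "xs = [x, y]" using l by (metis (no_types, lifting) One_nat_def Suc_1 length_0_conv length_Suc_conv)
  thus ?thesis by (simp add: del_def Dh_mul)
 qed
 moreover have "mlin 1 (Dk :: 'k co)" by simp
 ultimately show ?thesis unfolding zc_def by simp
qed

abbreviation nz :: "'k::field vv list => 'k vv list" where "nz xs \<equiv> map (%x. x <> wd 0) xs"

text \<open>Euler's identity: bracketing a homogeneous cochain with the derivation that multiplies
  by the degree multiplies it by its own degree. The last two assumptions keep out the junk basis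
  elements, on which \<open>Dh\<close> vanishes.\<close>

lemma br_Dk:
 assumes "mlin n f" "homl 1 (-1) (wb 1 (-1)) n e f" "length xs = n" "!!xs. f (nz xs) = f xs" "!!xs. f xs <> wd 0 = f xs"
 shows "br 1 n Dk f xs = scl (of_int e) (f xs)"
proof -
 have "Dh (f xs) - cp n 1 f Dk xs = scl (of_int e) (f xs)"
  using assms
 proof (induction n arbitrary: e f xs)
  case 0
  thus ?case by (simp add: Dh_hom)
 next
  case (Suc n)
  then obtain x ys where xs: "xs = x # ys" "length ys = n" by (metis length_Suc_conv)
  have l: "lin (%x. f (x # ys))" using Suc.prems xs by simp
  have lc: "lin (%x. cp n 1 (%zs. f (x # zs)) Dk ys)"
   by (rule cp_lin) (use Suc.prems xs in auto)
  have nz: "f (x # nz zs) = f (x # zs)" "f ((x <> wd 0) # zs) = f (x # zs)" for x zs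
   using Suc.prems(4)[of "x # zs"] Suc.prems(4)[of "x # nz zs"] Suc.prems(4)[of "(x <> wd 0) # zs"]
   by (simp_all add: mul_assoc wd_00 comp_def)
  have "Dh (f (x # ys)) - (f (Dh x # ys) + cp n 1 (%zs. f (x # zs)) Dk ys) = scl (of_int e) (f (x # ys))"
  proof (rule lin_eqI[of "%x. Dh (f (x # ys)) - (f (Dh x # ys) + cp n 1 (%zs. f (x # zs)) Dk ys)"])
   fix p
   have "Dh (f (bs p # ys)) - cp n 1 (%zs. f (bs p # zs)) Dk ys = scl (of_int (e + wb 1 (-1) p)) (f (bs p # ys))"
    by (rule Suc.IH) (use Suc.prems xs nz hom_bs[of "wb 1 (- 1)" p] in auto)
   moreover have "f (Dh (bs p) # ys) = scl (of_int (wb 1 (-1) p)) (f (bs p # ys))"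
    unfolding Dh_hom[OF hom_bs] lin_scl[OF l] nz ..
   ultimately show "Dh (f (bs p # ys)) - (f (Dh (bs p) # ys) + cp n 1 (%zs. f (bs p # zs)) Dk ys) = scl (of_int e) (f (bs p # ys))"
    by (simp add: scl_add_left algebra_simps)
  next
   show "lin (%x. Dh (f (x # ys)) - (f (Dh x # ys) + cp n 1 (%zs. f (x # zs)) Dk ys))"
    by (rule lin_sub[OF lin_compose[OF Dh_lin l] lin_plus[OF lin_compose[OF l Dh_lin] lc]])
  qed (rule lin_sclI[OF l])
  thus ?case by (simp add: xs sg_def)
 qed
 thus ?thesis using assms(3) by (simp add: br_def sg_def)
qed

text \<open>A comparison map that ignores the invalid basis elements, so that the grading derivation acts
 on its pullbacks by scalars.\<close>

definition Xj :: "'k::field fam" where "Xj n xs = Xi n (nz xs)"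

lemma homl_nz: "homl X Y wt n e H ==> homl X Y wt n e (%xs. H (nz xs))"
proof (induction n arbitrary: e H)
 case (Suc n)
 have "homl X Y wt n (e + d) (%xs. H ((x <> wd 0) # nz xs))" if "hom (wb X Y) d x" for x d
  by (rule Suc.IH) (use Suc.prems hom_mul[OF that hom_wd[of X Y 0]] in auto)
 thus ?case by simp
qed simp

lemma cmap_Xj: "cmap Xj"
 unfolding cmap_def
proof (intro conjI allI impI)
 show "mlin n (Xj n)" for n unfolding Xj_def by (rule mlin_map[OF mlin_Xi]) (intro lin_mul1 lin_id)
 show "Xj n xs : PC (int n)" for n xs unfolding Xj_def by (rule Xi_PC)
 show "aug (Xj 0 []) = wd 0" unfolding Xj_def by (simp only: Xi_aug)
 fix n and xs :: "'a vv list" assume l: "length xs = Suc n"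
 then obtain x ys where xs: "xs = x # ys" by (cases xs) auto
 have la: "la (x <> wd 0) z = la x z" for z :: "'a pp"
  unfolding la_def by (simp add: mul_assoc mul_wd_0')
 have "bd (Xj (Suc n) xs) = - del la ra n (Xi n) (nz xs)"
  unfolding Xj_def by (rule Xi_bd) (simp add: l)
 moreover have "dp ra n (Xi n) (nz xs) = dp ra n (Xj n) xs"
  unfolding Xj_def by (rule dp_map[of "%x. x <> wd 0" "%z. z", OF _ _ _ l]) (simp_all add: mul_assoc mul_wd_0 mul_wd_0' ra_def)
 hence "del la ra n (Xi n) (nz xs) = del la ra n (Xj n) xs"
  unfolding del_def Xj_def using xs by (simp add: la)
 ultimately show "bd (Xj (Suc n) xs) = - del la ra n (Xj n) xs" by simp
qed

lemma pull_Dk: "dgr w = 1 ==> nn w ==> pull 1 Dk w = (yD w :: 'k::field vv)"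
proof -
 assume w: "dgr w = 1" "nn w"
 have m: "mlin (Suc 0) (Dk :: 'k co)" by simp
 have D0: "Dh (vt i) = (0 :: 'k vv)" for i by (simp add: Dh_hom[OF hom_vt])
 have D1: "Dh (vt i <> wd 1) = (vt i <> wd 1 :: 'k vv)" "Dh (vt i <> wd (- 1)) = (- (vt i <> wd (- 1)) :: 'k vv)" for i
  by (simp_all add: Dh_hom[OF hom_vt_wd] wk_def na_vals mul_assoc wd_00 scl_minus_left)
 obtain s r j where e: "w = (s, r, j)" by (cases w)
 hence "s = 1 & r = 0 | s = 0 & r = 1" using w by auto
 thus ?thesis
  by (auto simp: e pull_def psi_Suc one_of_wd bd_s0 bd_0r wd_00 lin_diff[OF thl_lin] sg_lin[OF thl_lin] lin_add[OF thl_lin]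
   thl_T[OF m] D0 D1 wd_vt_comm sft_vals mul_assoc wd_vt_l mul_minus_left mul_minus_right)
qed

lemma pcc_yD: "pcc 1 (yD :: 'k::field gv)"
proof (rule pcc_cong)
 show "pcc 1 (pull 1 Dk :: 'k gv)" using pull_pcc[OF zc_Dk] by simp
 have "par (yE 1 0 (%j. vt j <> wd 1) :: 'k gv)" "par (yE 0 1 (%j. vt j <> wd (- 1)) :: 'k gv)"
  by (intro par_yE uok_gens)+
 thus "par (yD :: 'k gv)" unfolding par_def by (simp add: mul_add_left mul_add_right)
qed (use pull_Dk in auto)

lemma coh_Dk: "cmap Z ==> coh 1 Dk (pb Z 1 yD)"
proof -
 assume Z: "cmap Z"
 have "px (pull 1 Dk) (Z 1 xs) = px yD (Z 1 xs)" for xs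
  by (rule px_cong[OF cmapD(2)[OF Z]], rule pull_Dk) auto
 thus ?thesis using coh_pull[OF Z zc_Dk] by (simp add: Dh_wd_0)
qed

lemma bk_indep:
 assumes "cmap Z" "cmap \<Theta>" "pcc (int n) y" "pcc (int q) y'" "pcc (int (n + q - 1)) z" "n + q >= 2" "bk \<Theta> n y q y' z"
 shows "bk Z n y q y' z"
proof -
 have "coh (n + q - 1) (br n q (pb Z n y) (pb Z q y')) (br n q (pb \<Theta> n y) (pb \<Theta> q y'))"
  by (rule coh_br) (use cmap_coh[OF assms(1,2)] zc_pb[OF assms(1)] zc_pb[OF assms(2)] assms in auto)
 with coh_trans cmap_coh[OF assms(2,1,5)] assms(7) show ?thesis unfolding bk_def by blast
qed

lemma px_neg: "px (%w. - y w) z = - px y z"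
 using px_scl[of "-1" y z] by (simp add: scl_minus_left)

lemma px_sg: "px (%w. sg k (y w)) z = sg k (px y z)"
 unfolding sg_scl by (rule px_scl)

subsection \<open>Transport of brackets along the symmetry\<close>

lemma mi_nz: "map mi (map mi xs) = nz xs" by (simp add: mi_mi)

lemma mp_la: "mp (la (mi x) z) = la x (mp z)" (is ?A) and mp_ra: "mp (ra z (mi x)) = ra (mp z) x" (is ?B)
proof -
 have 1: "mp (la (mi x) (bs p)) = la x (mp (bs p))" "mp (ra (bs p) (mi x)) = ra (mp (bs p)) x" for p :: "bas \<times> gen \<times> bas"
 proof -
  obtain u s r i v where p: "p = (u, (s, r, i), v)" by (metis prod.exhaust)
  show "mp (la (mi x) (bs p)) = la x (mp (bs p))" "mp (ra (bs p) (mi x)) = ra (mp (bs p)) x"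
   by (simp_all add: p la_bs ra_bs mp_T mi_mul mi_mi mul_assoc mul_wd_0 mul_wd_0' sg_lin[OF la_lin2] sg_lin[OF ra_lin1])
    (simp_all add: mp_def sg_lin[OF la_lin2] sg_lin[OF ra_lin1])
 qed
 show ?A
  by (rule lin_eqI[of "%z. mp (la (mi x) z)" "%z. la x (mp z)"]) (auto simp: 1 intro!: lin_la2 lin_compose[OF mp_lin])
 show ?B
  by (rule lin_eqI[of "%z. mp (ra z (mi x))" "%z. ra (mp z) x"]) (auto simp: 1 intro!: lin_ra1 lin_compose[OF mp_lin])
qed

lemma mp_PC: "z : PC n ==> mp z : PC n"
proof (rule PC_closed[of z n mp])
 fix u w v assume "dgr w = n"
 thus "mp (T (bs u) w (bs v)) : PC n" by (cases w) (auto simp: mp_T intro!: PC_sg T_PC)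
qed simp_all

text \<open>The symmetry acts compatibly on the algebra and, thanks to the signs \<open>cs\<close>,
  on the complex, so conjugating a comparison map gives another one.\<close>

lemma cmap_mp:
 fixes Z :: "'a::field fam"
 assumes Z: "cmap Z"
 shows "cmap (%n xs. mp (Z n (map mi xs)))"
 unfolding cmap_def
proof (intro conjI allI impI)
 show "mlin n (%xs. mp (Z n (map mi xs)))" for n
  by (intro mlin_compose[OF mp_lin] mlin_map[OF cmapD(1)[OF Z]] mi_lin)
 show "mp (Z n (map mi xs)) : PC (int n)" for n xs by (intro mp_PC cmapD(2)[OF Z])
 have "aug (mp z) = mi (aug z)" if "z : PC 0" for z :: "'a pp"
 proof (rule PC_eqI[OF that, of "%z. aug (mp z)" "%z. mi (aug z)"])
  fix u w v assume "dgr w = 0" "okk u w v"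
  then obtain i where "w = (0, 0, i)" by (cases w) (auto simp: okk_def)
  thus "aug (mp (T (bs u) w (bs v))) = mi (aug (T (bs u) w (bs v)))" by (simp add: mp_T aug_T mi_mul cs_def)
 qed (auto intro!: lin_compose[OF mi_lin] lin_compose[OF aug_lin])
 thus "aug (mp (Z 0 (map mi []))) = wd 0" using cmapD(2)[OF Z, of 0] cmapD(4)[OF Z] by simp
 fix n and xs :: "'a vv list" assume l: "length xs = Suc n"
 have "mp (del la ra n (Z n) (map mi xs)) = del la ra n (%ys. mp (Z n (map mi ys))) xs"
  unfolding del_def lin_diff[OF mp_lin] dp_map[of mi mp ra ra, OF mi_mul lin_diff[OF mp_lin] mp_ra l]
  using l by (cases xs) (auto simp: mp_la)
 thus "bd (mp (Z (Suc n) (map mi xs))) = - del la ra n (%ys. mp (Z n (map mi ys))) xs"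
  using cmapD(3)[OF Z, of "map mi xs" n] l by (simp add: lin_minus[OF mp_lin] flip: mp_bd)
qed

definition ym :: "('k::field gv) => 'k gv" where
 "ym y w = (case w of (s, r, j) => mi (y (r, s, - j)))"

lemma par_ym: "par y ==> par (ym y)"
 unfolding par_def[of "ym y"]
proof
 fix w :: gen assume y: "par y"
 obtain s r j where w: "w = (s, r, j)" by (cases w)
 have g: "y (r, s, - (j mod M)) = y (r, s, - j)"
  using parD(1)[OF y, of "(r, s, - j)"] parD(1)[OF y, of "(r, s, - (j mod M))"] by (simp add: mod_minus_eq)
 have "mi (vt (- j) <> y (r, s, - j)) = mi (y (r, s, - j))" "mi (y (r, s, - j) <> vt (- j + r - s)) = mi (y (r, s, - j))"
  using parD(2,3)[OF y, of "(r, s, - j)"] by simp_all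
 thus "ym y (ng w) = ym y w & vt (sr w) <> ym y w = ym y w & ym y w <> vt (tg w) = ym y w & (~ nn w --> ym y w = 0)"
  using parD(4)[OF y, of "(r, s, - j)"] by (auto simp: w ym_def g mi_mul lin_0[OF mi_lin] algebra_simps)
qed

lemma px_mp: "par y ==> z : PC n ==> px y (mp z) = sg (cs n) (mi (px (ym y) z))"
proof (rule PC_eqI[of z n "%z. px y (mp z)" "%z. sg (cs n) (mi (px (ym y) z))"])
 fix u w v assume y: "par y" "dgr w = n"
 obtain s r j where "w = (s, r, j)" by (cases w)
 thus "px y (mp (T (bs u) w (bs v))) = sg (cs n) (mi (px (ym y) (T (bs u) w (bs v))))"
  using y(2) by (simp add: mp_T px_T[OF y(1)] px_T[OF par_ym[OF y(1)]] ym_def mi_mul mi_mi sg_lin[OF px_lin] mul_assoc mul_wd_0')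
qed (auto intro!: lin_sg lin_compose[OF mi_lin] lin_compose[OF px_lin])

lemma pcc_ym: "pcc n y ==> pcc n (ym (y :: 'k::field gv))"
 unfolding pcc_def[of n "ym y"]
proof (intro conjI allI impI)
 assume y: "pcc n y"
 hence p: "par y" by (simp add: pcc_def)
 show "par (ym y)" by (rule par_ym[OF p])
 fix w assume "dgr w = n + 1"
 hence o: "ow w : PC (n + 1)" by (rule one_of_PC)
 have "bd (ow w) : PC n" using bd_PC[OF o] by simp
 from px_mp[OF p this] have "sg (cs n) (mi (px (ym y) (bd (ow w)))) = 0"
  using pcc_bd[OF y mp_PC[OF o]] by (simp add: mp_bd)
 hence "mi (mi (px (ym y) (bd (ow w)))) = (0 :: 'k vv)" by (simp add: sg_def lin_0[OF mi_lin] split: if_splits)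
 thus "px (ym y) (bd (ow w)) = 0" by (simp add: mi_mi px_vals)
qed

lemma cp_mi:
 fixes F G :: "'k::field co"
 assumes F: "!!xs. F' (nz xs) = F' xs" "!!xs. F' xs <> wd 0 = F' xs" and G: "!!xs. G (nz xs) = G xs" "!!xs. G xs <> wd 0 = G xs"
  and l: "length xs + 1 = n + q"
 shows "mi (cp n q (%xs. mi (F' (map mi xs))) (%xs. mi (G (map mi xs))) (map mi xs)) = cp n q F' G (xs :: 'k vv list)"
proof -
 have "F' (nz as @ z # nz bs) = F' (as @ z # bs)" for as bs and z :: "'k vv"
  using F(1)[of "nz as @ z # nz bs"] F(1)[of "as @ z # bs"] by (simp add: mul_assoc wd_00 comp_def)
 thus ?thesis
  using l by (simp add: cp_sum lin_sum[OF mi_lin] sg_lin[OF mi_lin] take_map drop_map mi_mi F(2) G comp_def)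
qed

lemma coh_mi: "coh n f h ==> coh n (%xs. mi (f (map mi xs))) (%xs. mi (h (map mi xs)))"
proof (cases n)
 case (Suc l)
 assume "coh n f h"
 then obtain t where t: "mlin l t" "!!xs. length xs = n ==> f xs - h xs = dl l t xs" unfolding coh_def Suc by auto
 show ?thesis unfolding Suc
 proof (rule cohI[of l "%xs. mi (t (map mi xs))"])
  show "mlin l (%xs. mi (t (map mi xs)))" by (intro mlin_compose[OF mi_lin] mlin_map[OF t(1)] mi_lin)
  fix xs :: "'a vv list" assume l: "length xs = Suc l"
  have "mi (z <> mi x) = mi z <> x" for x z :: "'a vv" by (simp add: mi_mul mi_mi mul_wd_0)
  from dp_map[of mi mi "%z x. z <> x" "%z x. z <> x", OF mi_mul lin_diff[OF mi_lin] this l] have "mi (dl l t (map mi xs)) = dl l (%ys. mi (t (map mi ys))) xs"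
   using l by (cases xs) (auto simp: del_def lin_diff[OF mi_lin] mi_mul mi_mi mul_assoc mul_wd_0')
  thus "mi (f (map mi xs)) - mi (h (map mi xs)) = dl l (%xs. mi (t (map mi xs))) xs"
   using t(2)[of "map mi xs"] l Suc by (simp flip: lin_diff[OF mi_lin])
 qed
qed (simp add: coh_def)

lemma pcc_sg: "pcc n y ==> pcc n (%w. sg k (y w))"
 by (cases "even k") (auto simp: sg_def pcc_def par_def px_neg mul_minus_left mul_minus_right)

text \<open>The identity is assumed for all comparison maps because it is applied to a conjugate of
  \<open>Xj\<close>; independence of the comparison map then carries the mirrored identity to
  \<open>Z\<close>. The exponent collects the signs \<open>cs\<close> of the three degrees.\<close>

lemma bk_mirror:
 assumes Z: "cmap (Z :: 'k::field fam)" and y: "pcc (int n) y" "pcc (int q) y'" "pcc (int (n + q - 1)) z" and nq: "n + q >= 2"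
  and b: "!!Z :: 'k fam. cmap Z ==> bk Z n y q y' z"
 shows "bk Z n (ym y) q (ym y') (%w. sg (cs (int n) + cs (int q) + cs (int (n + q - 1))) (ym z w))"
proof -
 let ?k = "n + q - 1" and ?P = "Xj :: 'k fam"
 note P = cmap_Xj[where 'a = 'k]
 have pb: "pb (%n xs. mp (?P n (map mi xs))) n y xs = sg (cs (int n)) (mi (pb ?P n (ym y) (map mi xs)))" if "pcc (int n) y" for n y xs
  using px_mp[of y "?P n (map mi xs)" "int n"] that cmapD(2)[OF P] by (simp add: pcc_def)
 let ?F = "pb ?P n (ym y)" and ?G = "pb ?P q (ym y')" and ?H = "pb ?P ?k (ym z)"
 let ?m = "%h xs. mi (h (map mi xs)) :: 'k vv"
 let ?e = "cs (int n) + cs (int q)"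
 have nz: "pb ?P n y (nz xs) = pb ?P n y xs" for n y xs by (simp add: Xj_def comp_def mul_assoc wd_00)
 have mF: "mlin n (?m ?F)" "mlin q (?m ?G)"
  by (intro mlin_compose[OF mi_lin] mlin_map[OF mlin_pb[OF P]] mi_lin)+
 have br: "br n q (%xs. sg (cs (int n)) (?m ?F xs)) (%xs. sg (cs (int q)) (?m ?G xs)) xs = sg ?e (br n q (?m ?F) (?m ?G) xs)"
  if l: "length xs = ?k" for xs
 proof -
  have l: "length xs + 1 = n + q" "length xs + 1 = q + n" using that nq by auto
  show ?thesis
   unfolding br_def cp_sg unfolding cp_sg2[OF mF(1) l(1)] cp_sg2[OF mF(2) l(2)] sg_diff by (simp add: sg_sg ac_simps)
 qed
 have "coh ?k (br n q (%xs. sg (cs (int n)) (?m ?F xs)) (%xs. sg (cs (int q)) (?m ?G xs))) (%xs. sg (cs (int ?k)) (?m ?H xs))"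
  using b[OF cmap_mp[OF P]] unfolding bk_def pb[OF y(1)] pb[OF y(2)] pb[OF y(3)] .
 hence "coh ?k (%xs. sg ?e (br n q (?m ?F) (?m ?G) xs)) (%xs. sg (cs (int ?k)) (?m ?H xs))"
  by (rule coh_trans[OF coh_eqI, rotated]) (simp add: br)
 from coh_sg[OF coh_mi[OF this], of ?e]
 have "coh ?k (%xs. mi (br n q (?m ?F) (?m ?G) (map mi xs))) (%xs. sg (?e + cs (int ?k)) (?m (?m ?H) xs))"
  unfolding sg_lin[OF mi_lin] sg_sg by (simp add: sg_def)
 hence c: "coh ?k (%xs. mi (br n q (?m ?F) (?m ?G) (map mi xs))) (%xs. sg (?e + cs (int ?k)) (?H xs))"
  unfolding mi_nz mi_mi nz px_vals .
 have "mi (br n q (?m ?F) (?m ?G) (map mi xs)) = br n q ?F ?G xs" if "length xs = ?k" for xs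
  using that nq by (simp only: br_def lin_diff[OF mi_lin] sg_lin[OF mi_lin]) (subst cp_mi[of ?F ?G, OF nz px_vals nz px_vals], simp, subst cp_mi[of ?G ?F, OF nz px_vals nz px_vals], simp_all)
 hence "coh ?k (br n q ?F ?G) (%xs. sg (?e + cs (int ?k)) (?H xs))"
  by (intro coh_trans[OF coh_eqI c]) simp
 hence "bk ?P n (ym y) q (ym y') (%w. sg (?e + cs (int ?k)) (ym z w))" unfolding bk_def px_sg .
 thus ?thesis
  by (rule bk_indep[OF Z P pcc_ym[OF y(1)] pcc_ym[OF y(2)] pcc_sg[OF pcc_ym[OF y(3)]] nq])
qed

lemma ym_yE: "ym (yE s r u) = yE r s (%j. mi (u (- j)))"
 by (auto simp: ym_def lin_0[OF mi_lin] intro!: ext)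

lemma ym_gens: "ym yX = (yX :: 'k::field gv)" "ym yN = (yP :: 'k gv)" "ym yP = (yN :: 'k gv)"
 "ym yF = (yG :: 'k gv)" "ym (yC (cI i)) = (yC (cI (- i)) :: 'k gv)" (is ?A) "ym (yC (cF i)) = (yC (cF (- i - 1)) :: 'k gv)" (is ?B)
 "ym (%_. 0) = (%_. 0 :: 'k vv)" (is ?C) "ym (%w. sg k (y w)) = (%w. sg k (ym y w) :: 'k vv)" (is ?D)
proof -
 have s: "sg (- j) x = (sg j x :: 'k vv)" for j x by (simp add: sg_def)
 have n: "- 1 - i = - i - 1" for i :: int by simp
 show "ym yX = (yX :: 'k gv)" "ym yN = (yP :: 'k gv)" "ym yP = (yN :: 'k gv)" "ym yF = (yG :: 'k gv)"
  ?A ?B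
  by (simp_all add: ym_yE sg_lin[OF mi_lin] s mi_mul cI_def cF_def wd_NN lin_add[OF mi_lin] add.commute n)
 show ?C ?D
  by (auto simp: ym_def lin_0[OF mi_lin] sg_lin[OF mi_lin] intro!: ext)
qed

subsection \<open>Brackets with central elements\<close>

text \<open>In degree 0 the pullback is independent of the comparison map, since the augmentation of
  the latter is prescribed.\<close>

lemma pb_yC:
 assumes "cmap Z" "!!x. c <> x = x <> c" "wd 0 <> c = c"
 shows "px (yC c) (Z 0 []) = (c :: 'k::field vv)"
proof -
 have z: "Z 0 [] : PC 0" using cmapD(2)[OF assms(1), of 0] by simp
 have "px (yC c) (Z 0 []) = aug (Z 0 []) <> c"
 proof (rule PC_eqI[OF z, of "px (yC c)" "%z. aug z <> c"])
  fix u w v assume "dgr w = 0" "okk u w v"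
  then obtain i where w: "w = (0, 0, i)" by (cases w) (auto simp: okk_def)
  show "px (yC c) (T (bs u) w (bs v)) = aug (T (bs u) w (bs v)) <> c"
   unfolding w by (simp add: px_T[OF par_yE[OF uok_c[OF assms(2)]]] aug_T mul_assoc assms(2))
 qed (auto intro!: lin_mul1)
 thus ?thesis using cmapD(4)[OF assms(1)] assms(3) by simp
qed

lemma br_yC:
 assumes "cmap Z" "!!x. c <> x = x <> c" "wd 0 <> c = c" "length xs + 1 = q"
 shows "br 0 q (pb Z 0 (yC c)) h xs = br 0 q (%_. c) h xs"
 by (rule br_cong) (use assms pb_yC[OF assms(1-3)] in auto)

lemma cI_wd_0: "wd 0 <> cI i = cI i"
 by (simp add: cI_def wd_vt_l wd_00 sft_vals flip: mul_assoc)

lemma scl_diff_left: "scl (a - b) x = scl a x - scl b x"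
 using scl_add_left[of a "- b" x] by (simp add: scl_minus_left)

lemma mod_neq: "(j - i) mod M = k ==> even (j - i) = even k"
 using m_even by (metis dvd_mod_iff even_of_nat)

context
 fixes Z :: "'k::field fam"
 assumes Z: "cmap Z"
begin

text \<open>By \<open>br_0_coh\<close> the bracket is represented by minus the composite of
  \<open>yN\<close> with the homotopy. On the column \<open>s = 0\<close> the explicit values give
  the claim; elsewhere the bidegree forces zero.\<close>

lemma bk_eps_N: "bk Z 0 (yC (cI i)) m yN (%w. sg (i + 1) (yF w))"
proof -
 obtain h :: "gen => 'k pp" where h: "hpar h"
  "!!w. nn w ==> ng w = w ==> bd (h w) + hx h (bd (ow w)) = la (cI i) (ow w) - ra (ow w) (cI i)"
  "!!w. w : SF ==> nn w ==> ng w = w ==> h w = hF i w"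
  "!!X Y w. hom (wP X Y) (wg X Y w + (X * int N + Y * int N)) (h w)"
  using homotopy_F[of i] by metis
 note pN = par_yE[OF uok_gens(2)]
 have n: "odd (m - 1)" "Suc (m - 1) = m" "int (m - 1) + 1 = M" using m3 m_even by auto
 have c: "coh (m - 1) (br 0 m (%_. cI i) (pb Z m yN)) (%xs. - px (%w. px yN (h w)) (Z (m - 1) xs))"
  using br_0_coh[OF h(1,2) cI_comm Z _ n(1), of yN] pcc_yN n by simp
 have v: "- px yN (h w) = sg (i + 1) (yF w)" if w: "dgr w = int (m - 1)" "nn w" "ng w = w" for w
 proof -
  obtain s r j where e: "w = (s, r, j)" by (cases w)
  have sr: "s + r = M - 1" "s >= 0" "r >= 0" using w m3 by (auto simp: e of_nat_diff)
  show ?thesis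
  proof (cases "s = 0")
   case True
   define k where "k = (j - i) mod M"
   have k: "0 <= k" "k <= M - 1" using pos_mod_bound[OF M_pos, of "j - i"] M_pos by (auto simp: k_def)
   have S: "w : SF" using sr True by (auto simp: e SF_def)
   have T: "px yN (T x (0, M, j') y) = x <> vt j' <> y" "px yN (T x (1, M - 1, j') y) = 0" for x y :: "'k vv" and j'
    using M4 by (simp_all add: px_T[OF pN])
   have hF: "hF i w = (if k = 0 then T (wd (NN - 1)) (0, M, j + 1) (wd 0)
    else if k = 1 then T (wd (- 1)) (1, M - 1, j - 1) (wd 0) - T (wd 0) (0, M, j) (wd (NN - 1))
    else sg k (T (wd 0) (0, M, j) (wd (NN - 1)) :: 'k pp))"
    using sr True k M4 by (simp add: e k_def Let_def)
   have "px yN (hF i w) = sg k (vt j <> (wd (NN - 1) :: 'k vv))"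
    unfolding hF by (auto simp: T lin_diff[OF px_lin] sg_lin[OF px_lin] mul_assoc wd_00 wd_vt_comm sft_vals)
   hence "- px yN (hF i w) = sg (1 + (k + j)) (sg j (vt j <> (wd (NN - 1) :: 'k vv)))"
    by (simp add: sg_sg) (simp add: sg_def)
   \<comment> \<open>\<open>k + j\<close> has the parity of \<open>i\<close>, because
     \<open>k\<close> is \<open>j - i\<close> reduced modulo the even number
     \<open>m\<close>.\<close>
   also have "... = sg (i + 1) (sg j (vt j <> wd (NN - 1)))"
    by (rule sg_parity) (use mod_neq[OF k_def[symmetric]] in auto)
   finally show ?thesis using h(3)[OF S w(2,3)] sr True by (simp add: e)
  next
   case False
   \<comment> \<open>The homotopy adds \<open>N\<close> arrows \<open>a\<close> and
     \<open>yN\<close> changes their number by 0, so for \<open>s > 0\<close> a nonzero value would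
     contain a path with more than \<open>N\<close> of them.\<close>
   have "px yN (h w) = 0"
   proof (rule ccontr)
    assume "px yN (h w) ~= 0"
    then obtain p where p: "p : ks (px yN (h w))" by (metis all_not_in_conv keys_eq_empty)
    have "h w : PC M" using hparD(5)[OF h(1), of w] w m3 by (simp add: of_nat_diff)
    hence hm: "hom (wb X Y) (wg X Y w + (X * int N + Y * int N) + (X * 0 + Y * (- M))) (px yN (h w))" for X Y
     using bideg_gens(2) h(4) by (intro hom_px[of M]) (unfold bideg_def, blast+)
    have "na (snd p) = gA s r + int N" using hm[of 1 0] p by (auto simp: hom_def wb_def wk_def e)
    moreover have "val p"
    proof -
     have "px yN (h w) = px yN (h w) <> wd 0" by (simp add: px_vals)
     hence "p : ks (px yN (h w) <> wd 0)" using p by simp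
     thus ?thesis using keys_mul[of "px yN (h w)" "wd 0"] by auto
    qed
    hence "na (snd p) <= int N" by (auto simp: val_def na_def)
    ultimately have "gA s r <= 0" by simp
    moreover have "gA s r > 0"
    proof (cases "s <= r")
     case True
     thus ?thesis using False sr N1 by (simp add: gA_le)
    next
     case F2: False
     have "int N * r >= 0" using sr by simp
     thus ?thesis using F2 by (simp add: gA_ge)
    qed
    ultimately show False by simp
   qed
   thus ?thesis using False by (simp add: e)
  qed
 qed
 have "px (%w. - px yN (h w)) (Z (m - 1) xs) = px (%w. sg (i + 1) (yF w)) (Z (m - 1) xs)" for xs
  by (rule px_cong[OF cmapD(2)[OF Z]], rule v)
 hence e1: "- px (%w. px yN (h w)) (Z (m - 1) xs) = px (%w. sg (i + 1) (yF w)) (Z (m - 1) xs)" for xs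
  by (simp only: px_neg)
 have e2: "coh (m - 1) (br 0 m (pb Z 0 (yC (cI i))) (pb Z m yN)) (br 0 m (%_. cI i) (pb Z m yN))"
  by (rule coh_eqI) (use br_yC[OF Z cI_comm cI_wd_0] n in auto)
 show ?thesis using coh_trans[OF e2 c] unfolding bk_def e1 by simp
qed

text \<open>The homotopy yields a cocycle supported on the two arrows between \<open>i\<close> and
  \<open>i + 1\<close>, while the claimed class is spread over the whole cycle with coefficient
  \<open>1 / m\<close>. Their difference is a coboundary, by invertibility of
  \<open>m\<close>.\<close>

lemma bk_eps_X:
 assumes Mk: "(of_nat m :: 'k) ~= 0"
 shows "bk Z 0 (yC (cI i)) 2 yX (%w. sg (i + 1) (scl (1 / of_nat m) (yD w)))"
proof -
 obtain h :: "gen => 'k pp" where h: "hpar h"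
  "!!w. nn w ==> ng w = w ==> bd (h w) + hx h (bd (ow w)) = la (cI i) (ow w) - ra (ow w) (cI i)"
  "!!w. w : SF ==> nn w ==> ng w = w ==> h w = hF i w"
  using homotopy_F[of i] by metis
 note pN = par_yE[OF uok_gens(1)]
 have c: "coh 1 (br 0 2 (%_. cI i) (pb Z 2 yX)) (%xs. - px (%w. px yX (h w)) (Z 1 xs))"
  using br_0_coh[OF h(1,2) cI_comm Z, of 1 yX] pcc_yX by (simp add: numeral_2_eq_2)
 \<comment> \<open>Coefficients of the cobounding 0-cochain: they rise by \<open>1 / m\<close> with
   each step round the cycle, except for an additional drop by 1 from \<open>i\<close> to
   \<open>i + 1\<close>, where the given cocycle is supported.\<close>
 define l :: "int => 'k" where "l j = of_int ((j - 1 - i) mod M) / of_nat m" for j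
 have 3: "scl (l j) z - scl (l (j + 1)) z = - scl (1 / of_nat m) z + (if (j - i) mod M = 0 then z else 0)" for j and z :: "'k vv"
 proof -
  have a: "l (j + 1) = of_int ((j - i) mod M) / of_nat m" by (simp add: l_def)
  have "l (j + 1) - l j = 1 / of_nat m - (if (j - i) mod M = 0 then 1 else 0)"
   unfolding a unfolding l_def mod_M_sub1 using Mk by (simp add: diff_divide_distrib)
  moreover have "scl (l j) z - scl (l (j + 1)) z = - scl (l (j + 1) - l j) z" by (simp add: scl_diff_left)
  ultimately show ?thesis by (auto simp: scl_diff_left)
 qed
 define x :: "'k gv" where "x = yE 0 0 (%j. scl (l j) (sg i (vt j)))"
 have "uok 0 0 (%j. scl (l j) (sg i (vt j)) :: 'k vv)"
 proof -
  have "l (j mod M) = l j" for j by (simp add: l_def mod_diff_left_eq diff_diff_eq)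
  thus ?thesis by (auto simp: uok_def mul_scl_right mul_scl_left mul_sg_left mul_sg_right)
 qed
 hence px: "par x" unfolding x_def by (rule par_yE)
 have v: "sg (i + 1) (scl (1 / of_nat m) (yD w)) - (- px yX (h w)) = cob x w" if w: "dgr w = int (Suc 0)" "ng w = w" "nn w" for w
 proof -
  obtain s r j where e: "w = (s, r, j)" by (cases w)
  hence "s = 1 & r = 0 | s = 0 & r = 1" using w by auto
  thus ?thesis
  proof (elim disjE conjE)
   assume sr: "s = 1" "r = 0"
   have S: "w : SF" using sr by (auto simp: e SF_def)
   have 1: "px yX (h w) = (if (j - i) mod M = 0 then sg i (vt j <> wd 1) else 0)"
   proof -
    have "px yX (hF i w) = (if (j - i) mod M = 0 then sg j (vt j <> (wd 1 :: 'k vv)) else 0)"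
     using M4 by (auto simp: e sr Let_def lin_add[OF px_lin] lin_minus[OF px_lin] lin_0[OF px_lin] px_T[OF pN] mul_sg_left mul_sg_right mul_assoc wd_00)
    moreover have "sg j z = sg i z" if "(j - i) mod M = 0" for z :: "'k vv"
     by (rule sg_parity) (use mod_neq[OF that] in auto)
    ultimately show ?thesis using h(3)[OF S w(3,2)] by simp
   qed
   have 2: "cob x w = scl (l j) (sg i (vt j <> wd 1)) - scl (l (j + 1)) (sg i (vt j <> wd 1))"
    using px by (simp add: e sr cob_ne kab x_def mul_scl_left mul_scl_right mul_sg_left mul_sg_right wd_vt_comm sft_vals)
   show ?thesis unfolding 1 2 3 by (auto simp: e sr scl_sg) (auto simp: sg_def)
  next
   assume sr: "s = 0" "r = 1"
   have S: "w : SF" using sr M4 by (auto simp: e SF_def)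
   have m1: "(j - i) mod M = 1 <-> (j - 1 - i) mod M = 0"
    using mod_M_sub1[of j i] M4 by auto
   have 1: "px yX (h w) = (if (j - 1 - i) mod M = 0 then sg i (vt j <> wd (- 1)) else 0)"
   proof -
    have "px yX (hF i w) = (if (j - i) mod M = 1 then sg (j - 1) (vt j <> (wd (- 1) :: 'k vv)) else 0)"
     using M4 by (auto simp: e sr Let_def lin_diff[OF px_lin] lin_0[OF px_lin] sg_lin[OF px_lin] px_T[OF pN] mul_sg_left mul_sg_right mul_assoc wd_00 wd_vt_comm sft_vals)
    moreover have "sg (j - 1) z = sg i z" if "(j - 1 - i) mod M = 0" for z :: "'k vv"
     by (rule sg_parity) (use mod_neq[OF that] in auto)
    ultimately show ?thesis using h(3)[OF S w(3,2)] m1 by simp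
   qed
   have 2: "cob x w = scl (l (j - 1)) (sg i (vt j <> wd (- 1))) - scl (l j) (sg i (vt j <> wd (- 1)))"
    using px by (simp add: e sr cob_ne kab x_def mul_scl_left mul_scl_right mul_sg_left mul_sg_right wd_vt_comm sft_vals)
   show ?thesis unfolding 1 2 3[of "j - 1", simplified] by (auto simp: e sr scl_sg) (auto simp: sg_def)
  qed
 qed
 have "coh (Suc 0) (pb Z (Suc 0) (%w. - px yX (h w))) (pb Z (Suc 0) (%w. sg (i + 1) (scl (1 / of_nat m) (yD w))))"
  by (rule coh_sym[OF coh_pb[OF Z px]], rule v)
 moreover have "coh 1 (br 0 2 (pb Z 0 (yC (cI i))) (pb Z 2 yX)) (br 0 2 (%_. cI i) (pb Z 2 yX))"
  by (rule coh_eqI) (use br_yC[OF Z cI_comm cI_wd_0] in auto)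
 ultimately have "coh 1 (br 0 2 (pb Z 0 (yC (cI i))) (pb Z 2 yX)) (pb Z 1 (%w. sg (i + 1) (scl (1 / of_nat m) (yD w))))"
  using coh_trans[OF coh_trans[OF _ c]] unfolding px_neg One_nat_def by blast
 thus ?thesis by (simp add: bk_def)
qed

end

lemma cF_N1: assumes "N = 1" shows "cF i = (cI i + cI (i + 1) :: 'k::field vv)"
proof -
 have n: "NN = 2" using assms by simp
 show ?thesis unfolding cF_def cI_def n using wd_NN[where 'a = 'k, unfolded n] by simp
qed

lemma cF_comm: "cF i <> x = x <> (cF i :: 'k::field vv)"
proof (cases "N = 1")
 case True
 show ?thesis unfolding cF_N1[OF True] by (simp add: mul_add_left mul_add_right cI_comm)
next
 case False
 hence n: "NN > 2" using N1 by linarith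
 have cf: "cF i = (bs (i mod M, 2) + bs ((i + 1) mod M, - 2) :: 'k vv)"
  using n by (simp add: cF_def vt_wd nrm_def)
 have v: "val (i mod M, 2)" "val ((i + 1) mod M, - 2)" "en (i mod M, 2) = i mod M" "en ((i + 1) mod M, - 2) = (i + 1) mod M"
  using n M_pos by (auto simp: val_def en_def sft_def)
 show ?thesis
 proof (rule lin_eqI[of "%x. cF i <> x" "%x. x <> cF i"])
  fix p :: bas
  obtain j k where p: "p = (j, k)" by (cases p)
  show "cF i <> bs p = (bs p <> cF i :: 'k vv)"
  proof (cases "val p")
   case True
   hence j: "j mod M = j" by (simp add: p val_def)
   have s: "(j + 1) mod M = (i + 1) mod M <-> i mod M = j" "(j - 1) mod M = i mod M <-> (i + 1) mod M = j"
    using mod_shift[of j 1 i] mod_shift[of j "- 1" "i + 1"] j by auto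
   have a: "nrm (2 + k) = nrm (k + 2)" by (simp add: add.commute)
   consider "k = 0" | "k > 0" "even k" | "k > 0" "odd k" | "k < 0" "even k" | "k < 0" "odd k" by linarith
   thus ?thesis
    by cases (auto simp: cf mul_add_left mul_add_right mulb_def p True[unfolded p] v en_def sft_def fits_def jn_def j s a mod_add_left_eq)
  qed (simp add: cf mul_add_left mul_add_right mulb_def)
 qed auto
qed

lemma pcc_cF: "pcc 0 (yC (cF i))" and pcc_cI: "pcc 0 (yC (cI i))"
 by (intro pcc_c cF_comm cI_comm)+

context
 fixes Z :: "'k::field fam"
 assumes Z: "cmap Z"
begin

text \<open>For \<open>N = 1\<close> the central element \<open>cF i\<close> is the sum of
  \<open>cI i\<close> and \<open>cI (i + 1)\<close>, whose brackets carry opposite signs.\<close>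

lemma bk_f_N1:
 assumes N: "N = 1" and y: "!!i. bk Z 0 (yC (cI i)) q y (%w. sg (i + 1) (z w))" "pcc (int q) y" "q >= 2"
 shows "bk Z 0 (yC (cF i)) q y (%_. 0)"
proof -
 have c: "cF i = (cI i + cI (i + 1) :: 'k vv)" by (rule cF_N1[OF N])
 have s: "yC (cF i) w = yC (cI i) w - (- yC (cI (i + 1)) w :: 'k vv)" for w
  by (cases w) (simp add: c mul_add_right)
 have p: "px (yC (cF i)) u = px (yC (cI i)) u - (- px (yC (cI (i + 1))) u)" for u :: "'k pp"
  unfolding s[abs_def] by (simp add: px_plus)
 have m: "mlin q (pb Z q y)" by (rule mlin_pb[OF Z])
 have b: "br 0 q (pb Z 0 (yC (cF i))) (pb Z q y) xs
  = br 0 q (pb Z 0 (yC (cI i))) (pb Z q y) xs + br 0 q (pb Z 0 (yC (cI (i + 1)))) (pb Z q y) xs" if "length xs + 1 = q" for xs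
  unfolding p using br_sub[OF m, of xs 0 "pb Z 0 (yC (cI i))" "%ys. - px (yC (cI (i + 1))) (Z 0 ys)"]
   br_sub[OF m, of xs 0 "%_. 0" "pb Z 0 (yC (cI (i + 1)))"] br_0[OF m, of xs 0] that by simp
 have "coh (q - 1) (br 0 q (pb Z 0 (yC (cF i))) (pb Z q y))
  (%xs. px (%w. sg (i + 1) (z w)) (Z (q - 1) xs) + px (%w. sg (i + 1 + 1) (z w)) (Z (q - 1) xs))"
 proof -
  have 1: "coh (q - 1) (br 0 q (pb Z 0 (yC (cI i))) (pb Z q y)) (pb Z (q - 1) (%w. sg (i + 1) (z w)))" for i
   using y(1)[of i] by (simp add: bk_def)
  show ?thesis by (rule coh_trans[OF coh_eqI coh_plus[OF 1 1]]) (use b y(3) in auto)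
 qed
 moreover have "px (%w. sg (i + 1) (z w)) u + px (%w. sg (i + 1 + 1) (z w)) u = px (%_. 0) u" for u
  unfolding px_sg using px_zero[of u "%_. 0"] by (simp add: sg_def)
 ultimately show ?thesis by (simp add: bk_def)
qed

lemma bk_f_X:
 assumes Mk: "(of_nat m :: 'k) ~= 0"
 shows "bk Z 0 (yC (cF i)) 2 yX (%_. 0)"
proof (cases "N = 1")
 case True
 show ?thesis by (rule bk_f_N1[OF True bk_eps_X[OF Z Mk]]) (use pcc_yX in auto)
next
 case False
 have p: "pcc (int 0) (yC (cF i :: 'k vv))" using pcc_cF by simp
 show ?thesis
 proof (rule bk_zero[OF Z p pcc_gens_nat(1) bideg_cF bideg_gens(1)])
  fix s r a b :: int
  assume *: "s >= 0" "r >= 0" "s + r = int 0 + int 2 - 1" "0 <= a" "0 <= b" "a = gA s r + (1 + - int N)" "b = gA r s + (1 + - int N)"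
  hence "s = 1 & r = 0 | s = 0 & r = 1" by auto
  thus False using * False N1 by (auto simp: gA_def)
 qed simp
qed

lemma keys_single: "ks x <= {p} ==> x = scl (lk x p) (bs p :: 's \<Rightarrow>\<^sub>0 'k)"
 by (rule poly_mapping_eqI) (auto simp: lookup_scl lookup_single when_def in_keys_iff)

text \<open>For \<open>N > 1\<close> the bidegree leaves only multiples \<open>c j\<close> of the
  arrow \<open>a\<close> as values on the column \<open>s = 0\<close>. The cocycle condition at
  \<open>(0, m)\<close> has \<open>c (j - 1)\<close> and \<open>c j\<close> as coefficients of two
  different paths of length 2, so they all vanish.\<close>

lemma bk_f_N: "bk Z 0 (yC (cF i)) m yN (%_. 0)"
proof (cases "N = 1")
 case True
 show ?thesis by (rule bk_f_N1[OF True bk_eps_N[OF Z] pcc_yN]) (use m3 in auto)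
next
 case False
 hence n: "NN > 2" using N1 by linarith
 have p: "pcc (int 0) (yC (cF i :: 'k vv))" using pcc_cF by simp
 have nq: "0 + m >= 2" using m3 by simp
 obtain v where v: "pcc (int (m - 1)) v" "bideg (m - 1) v 1 (1 - M)"
  "coh (m - 1) (br 0 m (pb Z 0 (yC (cF i))) (pb Z m yN)) (pb Z (m - 1) v)"
  using br_pull[OF Z p pcc_yN bideg_cF bideg_gens(2) nq] by auto
 have pv: "par v" using v(1) by (simp add: pcc_def)
 have key: "s = 0 & q = (j, 1)" if w: "s + r = M - 1" "s >= 0" "r >= 0" "j mod M = j" and q: "q : ks (v (s, r, j))" for s r j q
 proof -
  have b: "na (snd q) = gA s r + 1" "nb (snd q) = gA r s + (1 - M)"
   using bideg_keys[OF v(2), of s r j q] w q m1[OF Z] by auto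
  have d: "gA s r - gA r s = s - r" by (cases "s <= r") (auto simp: gA_le gA_ge)
  have "\<bar>sft (snd q)\<bar> <= 1" by (auto simp: sft_def)
  hence "s = 0" using na_nb_sft[of "snd q"] b d w by linarith
  moreover hence "na (snd q) = 1" "nb (snd q) = 0" using b w M4 by (auto simp: gA_def)
  hence "\<bar>snd q\<bar> = 1" "sft (snd q) = 1" using na_nb_abs[of "snd q"] na_nb_sft[of "snd q"] by auto
  hence "snd q = 1" by (auto simp: sft_def split: if_splits)
  moreover have "fst q = j"
  proof -
   have "v (s, r, j) = vt j <> v (s, r, j)" using parD(2)[OF pv, of "(s, r, j)"] by simp
   moreover have "ks (vt j <> v (s, r, j)) <= {q. fst q = j mod M}"
    by (rule keys_lin[OF mul_lin2]) (auto simp: vt_bs)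
   ultimately show ?thesis using q w by auto
  qed
  ultimately show ?thesis by (cases q) auto
 qed
 define c where "c j = lk (v (0, M - 1, j)) (j, 1)" for j
 have vc: "v (0, M - 1, j) = scl (c j) (vt j <> wd 1)" if "j mod M = j" for j
 proof -
  have "ks (v (0, M - 1, j)) <= {(j, 1)}" using key[of 0 "M - 1" j] that M4 by auto
  from keys_single[OF this] show ?thesis unfolding c_def using that n by (simp add: vt_wd nrm_def)
 qed
 have vc': "v (0, M - 1, j) = scl (c (j mod M)) (vt j <> wd 1)" for j
  using vc[of "j mod M"] parD(1)[OF pv, of "(0, M - 1, j)"] by simp
 have c0: "c j = 0" if j: "j mod M = j" for j
 proof -
  have "cob v (0, M, j) = 0" using v(1) j m1[OF Z] by (simp add: pcc_def cob_def)
  moreover have "cob v (0, M, j) = wd (- 1) <> v (0, M - 1, j - 1) + v (0, M - 1, j) <> wd (- 1)"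
  proof -
   have z: "v (- 1, M, k) = 0" for k by (rule parD(4)[OF pv]) simp
   show ?thesis using M4 M_even by (simp add: cob_ne[OF _ pv] z kab) (simp add: sg_def)
  qed
  ultimately have "scl (c ((j - 1) mod M)) (vt j <> (wd (- 1) <> wd 1)) + scl (c j) (vt j <> (wd 1 <> wd (- 1))) = (0 :: 'k vv)"
   using j by (simp add: vc' mul_scl_left mul_scl_right mul_assoc wd_vt_l sft_vals)
  hence "scl (c ((j - 1) mod M)) (bs (j, - 2)) + scl (c j) (bs (j, 2)) = (0 :: 'k vv)"
   using n j by (simp add: wd_wd fits_def jn_def vt_wd nrm_def)
  from arg_cong[OF this, of "%x. lk x (j, 2)"] show ?thesis
   by (simp add: lookup_add lookup_scl lookup_single)
 qed
 have "v w = 0" if w: "dgr w = int (m - 1)" "nn w" "ng w = w" for w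
 proof -
  obtain s r j where e: "w = (s, r, j)" by (cases w)
  have sr: "s + r = M - 1" "s >= 0" "r >= 0" "j mod M = j" using w m1[OF Z] by (auto simp: e)
  show ?thesis
  proof (cases "s = 0")
   case True
   thus ?thesis using sr vc'[of j] c0[of j] by (simp add: e)
  next
   case False
   have "ks (v w) = {}" using key[OF sr] False unfolding e by blast
   thus ?thesis by (simp only: keys_eq_empty)
  qed
 qed
 hence "px v (Z (m - 1) xs) = px (%_. 0) (Z (m - 1) xs)" for xs
  by (intro px_cong[OF cmapD(2)[OF Z]]) auto
 thus ?thesis using v(3) by (simp add: bk_def)
qed

text \<open>In the Jacobi identity for \<open>eps 0\<close>, \<open>chi_2_0\<close> and
  \<open>chi_m_neg\<close> the bracket of the last two vanishes. That of the first two is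
  \<open>- 1 / m\<close> times the grading derivation, for which \<open>chi_m_neg\<close> has degree
  \<open>m\<close>, so the factors \<open>m\<close> cancel.\<close>

lemma bk_X_F:
 assumes Mk: "(of_nat m :: 'k) ~= 0"
 shows "bk Z 2 yX (m - 1) yF yN"
proof -
 \<comment> \<open>\<open>br_Dk\<close> asks for cochains that ignore junk, hence \<open>Xj\<close>;
   \<open>bk_indep\<close> carries the result over to \<open>Z\<close> at the end.\<close>
 let ?P = "Xj :: 'k fam"
 let ?E = "pb ?P 0 (yC (cI 0))" and ?X = "pb ?P 2 yX" and ?Y = "pb ?P m yN" and ?Z = "pb ?P (m - 1) yF"
 note P = cmap_Xj[where 'a = 'k]
 have zE: "zc 0 ?E" using zc_pb[OF P, of 0 "yC (cI 0)"] by (simp add: pcc_cI)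
 have zX: "zc 2 ?X" using zc_pb[OF P, of 2 yX] pcc_yX by simp
 have zY: "zc m ?Y" using zc_pb[OF P, of m yN] by (simp add: pcc_yN)
 have m: "mlin 0 ?E" "mlin 2 ?X" "mlin m ?Y" using zE zX zY by (simp_all only: zc_def)
 have mm: "m >= 3" "even m" using m3 m_even by auto
 have 1: "coh m (br 1 m (br 0 2 ?E ?X) ?Y) (%xs. - ?Y xs)"
 proof -
  have "coh 1 (br 0 2 ?E ?X) (%xs. scl (- (1 / of_nat m)) (pb ?P 1 yD xs))"
   using bk_eps_X[OF P Mk, of 0] by (simp add: bk_def px_neg px_scl scl_minus_left)
  hence "coh 1 (br 0 2 ?E ?X) (%xs. scl (- (1 / of_nat m)) (Dk xs))"
   by (rule coh_trans[OF _ coh_sym[OF coh_scl[OF coh_Dk[OF P]]]])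
  from coh_br1[OF this zY]
  have 1: "coh m (br 1 m (br 0 2 ?E ?X) ?Y) (br 1 m (%xs. scl (- (1 / of_nat m)) (Dk xs)) ?Y)"
   using mm by simp
  have "homl 1 (- 1) (wb 1 (- 1)) m (1 * 0 + (- 1) * (- M)) (%xs. px (yN :: 'k gv) (Xi m xs))"
   by (rule homl_pXi) (use bideg_gens(2) in \<open>unfold bideg_def, blast\<close>)
  from homl_nz[OF this] have h: "homl 1 (- 1) (wb 1 (- 1)) m M ?Y" by (simp add: Xj_def)
  have "?Y (nz xs) = ?Y xs" for xs by (simp add: Xj_def comp_def mul_assoc wd_00)
  from br_scl[OF m(3), of _ 1 "- (1 / of_nat m)" Dk] br_Dk[OF m(3) h _ this px_vals]
  have "br 1 m (%xs. scl (- (1 / of_nat m)) (Dk xs)) ?Y xs = - ?Y xs" if "length xs = m" for xs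
   using that Mk by (simp add: scl_minus_left)
  thus ?thesis by (rule coh_trans[OF 1 coh_eqI])
 qed
 have 2: "coh m (br 0 (m + 1) ?E (br 2 m ?X ?Y)) (%_. 0)"
 proof -
  have "coh (m + 1) (br 2 m ?X ?Y) (%_. 0)" using bk_XN[OF P] by (simp add: bk_def px_zero[of _ "%_. 0"])
  from coh_br2[OF this zE] have "coh m (br 0 (m + 1) ?E (br 2 m ?X ?Y)) (br 0 (m + 1) ?E (%_. 0))" using mm by simp
  thus ?thesis by (rule coh_trans[OF _ coh_eqI]) (use br_02[OF m(1)] in auto)
 qed
 have 3: "coh m (br (m - 1) 2 (br 0 m ?E ?Y) ?X) (%xs. - br (m - 1) 2 ?Z ?X xs)"
 proof -
  have "coh (m - 1) (br 0 m ?E ?Y) (%xs. - ?Z xs)" using bk_eps_N[OF P, of 0] by (simp add: bk_def px_neg)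
  from coh_br1[OF this zX] have "coh m (br (m - 1) 2 (br 0 m ?E ?Y) ?X) (br (m - 1) 2 (%xs. - ?Z xs) ?X)" using mm by simp
  thus ?thesis
   by (rule coh_trans[OF _ coh_eqI]) (use br_scl[OF m(2), of _ "m - 1" "- 1" ?Z] mm in \<open>simp add: scl_minus_left\<close>)
 qed
 have "br 1 m (br 0 2 ?E ?X) ?Y xs = br 0 (m + 1) ?E (br 2 m ?X ?Y) xs - br (m - 1) 2 (br 0 m ?E ?Y) ?X xs"
  if "length xs = m" for xs
  using jacobi[OF m, of xs] that mm by (simp add: add.commute) (simp add: sg_def)
 hence "coh m (br 1 m (br 0 2 ?E ?X) ?Y) (br (m - 1) 2 ?Z ?X)"
  using coh_trans[OF coh_eqI coh_plus[OF 2 coh_minus[OF 3]], of "br 1 m (br 0 2 ?E ?X) ?Y"] by simp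
 from coh_minus[OF coh_trans[OF coh_sym[OF this] 1]] have "coh m (%xs. - br (m - 1) 2 ?Z ?X xs) ?Y" by simp
 moreover have "br 2 (m - 1) ?X ?Z = (%xs. - br (m - 1) 2 ?Z ?X xs)"
  using br_anti[of 2 "m - 1" ?X ?Z] mm by (intro ext) (simp add: sg_def of_nat_diff)
 ultimately have "bk ?P 2 yX (m - 1) yF yN" using mm unfolding bk_def by simp
 thus ?thesis
  using bk_indep[OF Z P, of 2 yX "m - 1" yF yN] pcc_yX pcc_yF pcc_yN m1[OF Z] mm by simp
qed

end

lemma bk_mirror_0:
 assumes "cmap (Z :: 'k::field fam)" "pcc (int n) y" "pcc (int q) y'" "n + q >= 2"
  "!!Z :: 'k fam. cmap Z ==> bk Z n y q y' (%_. 0)"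
 shows "bk Z n (ym y) q (ym y') (%_. 0)"
proof -
 have "pcc (int (n + q - 1)) (%_. 0 :: 'k vv)" by (auto simp: pcc_def par_def intro!: px_zero)
 from bk_mirror[OF assms(1-3) this assms(4,5)] show ?thesis by (simp add: ym_gens)
qed

context
 fixes Z :: "'k::field fam"
 assumes Z: "cmap Z"
begin

lemma bk_mirrored: "bk Z (m - 1) yG (m - 1) yG (%_. 0)" (is ?A) "bk Z (m - 1) yG m yP (%_. 0)" (is ?B) "bk Z 2 yX m yP (%_. 0)"
 "bk Z m yP m yP (%_. 0)" "N > 1 ==> bk Z (m - 1) yG m yN (%_. 0)" "bk Z 0 (yC (cF i)) m yP (%_. 0)" (is ?C)
proof -
 have p0: "pcc (int 0) (yC (cF (- i - 1)) :: 'k gv)" using pcc_cF by simp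
 note q = pcc_gens_nat[where 'k = 'k]
 have g: "m - 1 + (m - 1) >= 2" "m - 1 + m >= 2" "2 + m >= 2" "m + m >= 2" "0 + m >= 2" using m3 by auto
 note M = bk_mirror_0[OF Z]
 show ?A using M[OF q(2,2) g(1) bk_FF] by (simp only: ym_gens)
 show ?B using M[OF q(2) pcc_yN g(2) bk_FN] by (simp only: ym_gens)
 show "bk Z 2 yX m yP (%_. 0)" using M[OF q(1) pcc_yN g(3) bk_XN] by (simp only: ym_gens)
 show "bk Z m yP m yP (%_. 0)" using M[OF pcc_yN pcc_yN g(4) bk_NN] by (simp only: ym_gens)
 show "bk Z (m - 1) yG m yN (%_. 0)" if "N > 1" using M[OF q(2) pcc_yP g(2) bk_FP[OF _ that]] by (simp only: ym_gens)
 have "- (- i - 1) - 1 = i" by simp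
 thus ?C using M[OF p0 pcc_yN g(5) bk_f_N] by (simp only: ym_gens)
qed

lemma cs_even: "even (cs M + cs (M - 1))"
proof -
 have "cs M = cs (M - 1) + M" unfolding cs_def by (simp add: algebra_simps)
 thus ?thesis using M_even by simp
qed

lemma bk_eps_P: "bk Z 0 (yC (cI i)) m yP (%w. sg (i + 1) (yG w))"
proof -
 have p: "pcc (int 0) (yC (cI (- i)) :: 'k gv)" by (simp add: pcc_cI)
 have z: "pcc (int (0 + m - 1)) (%w. sg (- i + 1) (yF w :: 'k vv))"
  using pcc_sg[OF pcc_gens_nat(2)] by simp
 have s: "sg (cs (int 0) + cs M + cs (int (0 + m - 1))) (sg (- i + 1) x) = (sg (i + 1) x :: 'k vv)" for x
  unfolding sg_sg by (rule sg_parity) (use cs_even m1[OF Z] in \<open>simp add: cs_def[of 0]\<close>)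
 have "0 + m >= 2" using m3 by simp
 from bk_mirror[OF Z p pcc_yN z this bk_eps_N] show ?thesis by (simp only: ym_gens s minus_minus)
qed

text \<open>The minus sign arises because \<open>cs 2 = 3\<close> is odd, while \<open>cs m\<close>
  and \<open>cs (m - 1)\<close> differ by the even number \<open>m\<close>.\<close>

lemma bk_X_G:
 assumes Mk: "(of_nat m :: 'k) ~= 0"
 shows "bk Z 2 yX (m - 1) yG (%w. - yP w)"
proof -
 have e: "2 + (m - 1) - 1 = m" "2 + (m - 1) >= 2" using m3 by auto
 have s: "sg (cs (int 2) + cs (int (m - 1)) + cs M) x = - x" for x :: "'k vv"
  using cs_even m1[OF Z] by (simp add: sg_def cs_def[of 2] add.commute)
 have z: "pcc (int (2 + (m - 1) - 1)) (yN :: 'k gv)" unfolding e by (rule pcc_yN)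
 from bk_mirror[OF Z pcc_gens_nat(1,2) z e(2) bk_X_F[OF _ Mk]] show ?thesis by (simp only: ym_gens s e(1))
qed

end


subsection \<open>Paths\<close>

primrec pend :: "int => arrow list => int" where
 "pend u [] = u"
| "pend u (e # es) = pend (head (quiver m) e) es"

primrec pok :: "int => arrow list => bool" where
 "pok u [] <-> u : {0..<M}"
| "pok u (e # es) <-> e : arcs (quiver m) & tail (quiver m) e = u & pok (head (quiver m) e) es"

lemma quiver_simps [simp]: "head (quiver m) (Fwd i) = (i + 1) mod M" "head (quiver m) (Bwd i) = i"
 "tail (quiver m) (Fwd i) = i" "tail (quiver m) (Bwd i) = (i + 1) mod M"
 "Fwd i : arcs (quiver m) <-> i : {0..<M}" "Bwd i : arcs (quiver m) <-> i : {0..<M}" "verts (quiver m) = {0..<M}"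
 by (auto simp: quiver_def)

lemma path_end_eq: "path_end m (u, p) = pend u p"
proof -
 have "pre_digraph.awalk_verts (quiver m) u p ~= [] & last (pre_digraph.awalk_verts (quiver m) u p) = pend u p"
  by (induction p arbitrary: u) (auto simp: pre_digraph.awalk_verts.simps)
 thus ?thesis by (simp add: path_end_def)
qed

lemma arcs_ends: "e : arcs (quiver m) ==> head (quiver m) e : {0..<M} & tail (quiver m) e : {0..<M}"
 using M_pos by (cases e) auto

lemma paths_eq: "(u, p) : paths m <-> pok u p"
proof -
 have "pok u p <-> u : {0..<M} & set p <= arcs (quiver m) & (EX v. pre_digraph.cas (quiver m) u p v)"
 proof (induction p arbitrary: u)
  case (Cons e p)
  thus ?case using arcs_ends[of e] by (auto simp: pre_digraph.cas.simps)
 qed (auto simp: pre_digraph.cas.simps)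
 thus ?thesis by (simp add: paths_def pre_digraph.awalk_def)
qed

lemma pend_append [simp]: "pend u (p @ q) = pend (pend u p) q"
 by (induction p arbitrary: u) auto

lemma pok_append [simp]: "pok u (p @ q) <-> pok u p & pok (pend u p) q"
proof (induction p arbitrary: u)
 case Nil
 have "pok u q ==> u : {0..<M}" using arcs_ends by (cases q) auto
 thus ?case by auto
qed auto

lemma pok_range: "pok u p ==> u : {0..<M} & pend u p : {0..<M}"
 using arcs_ends by (induction p arbitrary: u) auto

lemma path_comp_eq: "path_comp m (u, p) (v, q) = (if pend u p = v then bs (u, p @ q) else 0)"
 by (simp add: path_comp_def path_end_eq)

abbreviation KQ_pow :: "'k::field pathvec => nat => 'k pathvec" (infixr "[^]K" 75) where
 "x [^]K n == x [^]\<^bsub>KQ\<^esub> n"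

abbreviation A_add :: "'k::field elt => 'k elt => 'k elt" (infixl "+A" 65) where
 "x +A y == x \<oplus>\<^bsub>A\<^esub> y"

abbreviation A_diff :: "'k::field elt => 'k elt => 'k elt" (infixl "-A" 65) where
 "x -A y == x \<ominus>\<^bsub>A\<^esub> y"

subsection \<open>The path algebra is a ring\<close>

lemma star: "x \<star> y = lin_ext (%p. lin_ext (%q. path_comp m p q) y) x"
 by (simp add: KQ_def)

lemma star_lin1 [simp]: "lin (%x. x \<star> y)"
 unfolding star by simp

lemma star_lin2 [simp]: "lin (%y. x \<star> y)"
 unfolding star by (rule lin_lin_extD) simp

lemma star_bs [simp]: "bs (u, p) \<star> bs (v, q) = (if pend u p = v then bs (u, p @ q) else 0)"
 by (simp add: star path_comp_eq)

lemma lin_star1: "lin f ==> lin (%x. f x \<star> y)" and lin_star2: "lin f ==> lin (%x. y \<star> f x)"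
 by (rule lin_compose[OF star_lin1] lin_compose[OF star_lin2]; assumption)+

lemma star_assoc: "(x \<star> y) \<star> z = x \<star> (y \<star> z)"
proof (rule lin_eqI[of "%x. (x \<star> y) \<star> z" "%x. x \<star> (y \<star> z)"])
 fix p :: path
 show "(bs p \<star> y) \<star> z = bs p \<star> (y \<star> z)"
 proof (rule lin_eqI[of "%y. (bs p \<star> y) \<star> z" "%y. bs p \<star> (y \<star> z)"])
  fix q :: path
  show "(bs p \<star> bs q) \<star> z = bs p \<star> (bs q \<star> z)"
  proof (rule lin_eqI[of "%z. (bs p \<star> bs q) \<star> z" "%z. bs p \<star> (bs q \<star> z)"])
   fix r :: path
   show "(bs p \<star> bs q) \<star> bs r = bs p \<star> (bs q \<star> bs r)"
    by (cases p; cases q; cases r) (auto simp: lin_0[OF star_lin1] lin_0[OF star_lin2])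
  qed (auto intro!: lin_star1 lin_star2)
 qed (auto intro!: lin_star1 lin_star2)
qed (auto intro!: lin_star1 lin_star2)

lemma KQ_simps [simp]: "carrier KQ = {x. ks x <= paths m}" "\<zero>\<^bsub>KQ\<^esub> = 0" "x \<oplus>\<^bsub>KQ\<^esub> y = x + y"
 "\<one>\<^bsub>KQ\<^esub> = (SUM i:{0..<M}. vert i)"
 by (simp_all add: KQ_def)

lemma star_closed: "ks x <= paths m ==> ks y <= paths m ==> ks (x \<star> y) <= paths m"
proof (rule keys_lin[OF star_lin1])
 fix p assume x: "ks x <= paths m" "ks y <= paths m" "p : ks x"
 show "ks (bs p \<star> y) <= paths m"
 proof (rule keys_lin[OF star_lin2])
  fix q assume "q : ks y"
  thus "ks (bs p \<star> bs q) <= paths m"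
   using x by (cases p; cases q) (auto simp: paths_eq dest!: subsetD)
 qed
qed

lemma vert_bs: "vert i = bs (i mod M, [])" and arr_bs: "arr i = bs (i mod M, [Fwd (i mod M)])"
 and arr'_bs: "arr' i = bs ((i + 1) mod M, [Bwd (i mod M)])"
 by (simp_all add: vert_def arr_def arr'_def)

lemma one_star: "x : carrier KQ ==> \<one>\<^bsub>KQ\<^esub> \<star> x = x" and star_one: "x : carrier KQ ==> x \<star> \<one>\<^bsub>KQ\<^esub> = x"
proof -
 assume x: "x : carrier KQ"
 have "\<one>\<^bsub>KQ\<^esub> \<star> bs (u, p) = bs (u, p)" "bs (u, p) \<star> \<one>\<^bsub>KQ\<^esub> = bs (u, p)" if "pok u p" for u p
  using pok_range[OF that] by (auto simp: lin_sum[OF star_lin1] lin_sum[OF star_lin2] vert_bs cong: sum.cong_simp)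
 hence a: "\<one>\<^bsub>KQ\<^esub> \<star> bs p = bs p" "bs p \<star> \<one>\<^bsub>KQ\<^esub> = bs p" if "p : ks x" for p
  using x that by (cases p; auto simp: paths_eq simp del: KQ_simps(4) dest!: subsetD)+
 show "\<one>\<^bsub>KQ\<^esub> \<star> x = x" by (rule lin_eqI[of "%x. \<one>\<^bsub>KQ\<^esub> \<star> x" "%x. x"]) (erule a | simp)+
 show "x \<star> \<one>\<^bsub>KQ\<^esub> = x" by (rule lin_eqI[of "%x. x \<star> \<one>\<^bsub>KQ\<^esub>" "%x. x"]) (erule a | simp)+
qed

lemma ring_KQ: "ring (KQ :: 'k::field pathvec ring)"
proof (rule ringI)
 show "abelian_group (KQ :: 'k pathvec ring)"
 proof (rule abelian_groupI)
  fix x :: "'k pathvec" assume "x : carrier KQ"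
  thus "EX y:carrier KQ. y \<oplus>\<^bsub>KQ\<^esub> x = \<zero>\<^bsub>KQ\<^esub>" by (intro bexI[of _ "- x"]) auto
 qed (auto simp: add.assoc add.commute keys_addI)
 show "monoid (KQ :: 'k pathvec ring)"
 proof (rule monoidI)
  show "x \<star> y : carrier KQ" if "x : carrier KQ" "y : carrier KQ" for x y :: "'k pathvec"
   using star_closed that by simp
  have "(\<Sum>i = 0..<M. vert i :: 'k pathvec) : carrier KQ"
   unfolding KQ_simps mem_Collect_eq by (intro keys_sumI) (auto simp: vert_bs paths_eq)
  thus "\<one>\<^bsub>KQ\<^esub> : carrier (KQ :: 'k pathvec ring)" unfolding KQ_simps(4) .
 qed (erule one_star star_one | rule star_assoc)+
qed (auto simp: lin_add[OF star_lin1] lin_add[OF star_lin2])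

interpretation KQ: ring "KQ :: 'k::field pathvec ring"
 by (rule ring_KQ)

subsection \<open>The algebra is the concrete one\<close>

primrec evx :: "arrow => 'k::field vv" where
 "evx (Fwd i) = vt i <> wd 1"
| "evx (Bwd i) = vt (i + 1) <> wd (- 1)"

primrec evl :: "arrow list => 'k::field vv" where
 "evl [] = wd 0"
| "evl (e # es) = evx e <> evl es"

text \<open>Evaluation of paths in the concrete algebra; its kernel on the path algebra will turn
  out to be exactly \<open>rel_ideal\<close>.\<close>

definition ev :: "'k::field pathvec => 'k vv" where
 "ev = lin_ext (%(u, p). vt u <> evl p)"

lemma ev_lin [simp]: "lin ev" by (simp add: ev_def)

lemma ev_bs [simp]: "ev (bs (u, p)) = vt u <> evl p" by (simp add: ev_def)

lemma vt_modp [simp]: "vt (i mod M + 1) = vt (i + 1)"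
 by (simp add: vt_def mod_add_left_eq)

lemma evx_ends: "vt (tail (quiver m) e) <> evx e = evx e" "evx e <> vt (head (quiver m) e) = evx e"
 by (cases e; simp add: mul_assoc wd_vt_comm sft_vals)+

lemma wd_0_evl: "wd 0 <> evl p = evl p"
proof (cases p)
 case (Cons e es)
 thus ?thesis by (cases e) (simp_all add: mul_assoc wd_vt_l sft_vals wd_wd_l)
qed (simp add: wd_00)

lemma evl_append: "evl (p @ q) = evl p <> evl q"
 by (induction p) (auto simp: wd_0_evl mul_assoc)

lemma evl_end: "pok u p ==> vt u <> evl p <> vt v = (if pend u p = v mod M then vt u <> evl p else (0 :: 'k::field vv))"
proof (induction p arbitrary: u)
 case (Cons e es)
 let ?w = "head (quiver m) e"
 have e: "vt u <> (evx e <> x) = evx e <> (vt ?w <> x)" for x :: "'k vv"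
  using Cons.prems evx_ends[of e] by (metis mul_assoc pok.simps(2))
 have "(vt u :: 'k vv) <> (evx e <> evl es) <> vt v = evx e <> (vt ?w <> evl es <> vt v)"
  by (simp add: e mul_assoc)
 also have "... = (if pend ?w es = v mod M then evx e <> (vt ?w <> evl es) else 0)"
  using Cons by simp
 finally show ?case by (simp add: e)
qed (auto simp: vt_vt)

lemma ev_star:
 fixes x y :: "'k::field pathvec"
 shows "x : carrier KQ ==> y : carrier KQ ==> ev (x \<star> y) = ev x <> ev y"
proof (rule lin_eqI[of "%x. ev (x \<star> y)" "%x. ev x <> ev y"])
 fix p assume x: "x : carrier KQ" "y : carrier KQ" "p : ks x"
 show "ev (bs p \<star> y) = ev (bs p) <> ev y"
 proof (rule lin_eqI[of "%y. ev (bs p \<star> y)" "%y. ev (bs p) <> ev y"])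
  fix q assume q: "q : ks y"
  obtain u s v t where e: "p = (u, s)" "q = (v, t)" by (metis prod.exhaust)
  have pk: "pok u s" "pok v t" using x q by (auto simp: e paths_eq dest!: subsetD)
  hence "v mod M = v" using pok_range by simp
  thus "ev (bs p \<star> bs q) = ev (bs p) <> (ev (bs q) :: 'k vv)"
   using evl_end[OF pk(1), of v, where ?'k = 'k]
   by (auto simp: e evl_append lin_0[OF ev_lin] simp flip: mul_assoc)
 qed (auto intro!: lin_compose[OF ev_lin] lin_mul2)
qed (auto intro!: lin_compose[OF ev_lin] lin_mul1 lin_star1)

fun wl :: "int => nat => bool => arrow list" where
 "wl i 0 f = []"
| "wl i (Suc n) True = Fwd (i mod M) # wl (i + 1) n False"
| "wl i (Suc n) False = Bwd ((i - 1) mod M) # wl (i - 1) n True"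

lemma wl_mod: "i mod M = j mod M ==> wl i n f = wl j n f"
proof (induction i n f arbitrary: j rule: wl.induct)
 case (2 i n)
 hence "(i + 1) mod M = (j + 1) mod M" using mod_shift[of i 1 j] by simp
 thus ?case using 2 by simp
next
 case (3 i n)
 hence "(i - 1) mod M = (j - 1) mod M" using mod_shift[of i "- 1" j] by simp
 thus ?case using 3 by simp
qed simp

definition wrd :: "int => int => arrow list" where
 "wrd i k = wl i (nat \<bar>k\<bar>) (k > 0)"

lemma pok_wl: "pok (i mod M) (wl i n f)"
proof (induction i n f rule: wl.induct)
 case (1 i f) thus ?case using M_pos by simp
next
 case (2 i n)
 have "(i mod M + 1) mod M = (i + 1) mod M" by (simp add: mod_add_left_eq)
 thus ?case using 2 M_pos by simp
next
 case (3 i n)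
 have "((i - 1) mod M + 1) mod M = i mod M" by (simp add: mod_add_left_eq)
 thus ?case using 3 M_pos by simp
qed

lemma evl_wl: "(vt i :: 'k::field vv) <> evl (wl i n f) = vt i <> wd (if f then int n else - int n)"
proof (induction i n f rule: wl.induct)
 case (2 i n)
 have r: "wd 1 <> wd (- int n) = (wd (int (Suc n)) :: 'k vv)"
  by (auto simp: wd_wd fits_def jn_def intro!: arg_cong[of _ _ wd])
 have "(vt i :: 'k vv) <> evl (wl i (Suc n) True) = vt i <> (wd 1 <> (vt (i + 1) <> evl (wl (i + 1) n False)))"
  by (simp add: wd_vt_l sft_vals mul_assoc)
 also have "... = vt i <> (wd 1 <> wd (- int n))" unfolding 2 by (simp add: wd_vt_l sft_vals)
 finally show ?case unfolding r by (simp only: if_True)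
next
 case (3 i n)
 have r: "wd (- 1) <> wd (int n) = (wd (- int (Suc n)) :: 'k vv)"
  by (auto simp: wd_wd fits_def jn_def intro!: arg_cong[of _ _ wd])
 have "(vt i :: 'k vv) <> evl (wl i (Suc n) False) = vt i <> (wd (- 1) <> (vt (i - 1) <> evl (wl (i - 1) n True)))"
  by (simp add: wd_vt_l sft_vals mul_assoc)
 also have "... = vt i <> (wd (- 1) <> wd (int n))" unfolding 3 by (simp add: wd_vt_l sft_vals)
 finally show ?case unfolding r by (simp only: if_False)
qed simp

text \<open>A linear section of \<open>ev\<close> by representative paths. That the kernel of
  \<open>ev\<close> lies in the ideal follows once every \<open>x\<close> is congruent to
  \<open>nf (ev x)\<close>, which is proved by prepending one arrow at a time.\<close>

definition nf :: "'k::field vv => 'k pathvec" where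
 "nf = lin_ext (%(i, k). if val (i, k) then bs (i, wrd i k) else 0)"

lemma nf_lin [simp]: "lin nf" by (simp add: nf_def)

lemma nf_bs: "nf (bs (i, k)) = (if val (i, k) then bs (i, wrd i k) else 0)" by (simp add: nf_def)

lemma nf_carrier: "nf v : carrier KQ"
proof -
 have "ks (nf v) <= paths m"
 proof (rule keys_lin[OF nf_lin])
  fix p :: bas assume "p : ks v"
  show "ks (nf (bs p)) <= paths m"
   using pok_wl[of "fst p"] by (cases p) (auto simp: nf_bs paths_eq wrd_def val_def)
 qed
 thus ?thesis by simp
qed

lemma evl_wrd: "vt i <> evl (wrd i k) = vt i <> wd k"
proof -
 have "(if k > 0 then int (nat \<bar>k\<bar>) else - int (nat \<bar>k\<bar>)) = k" by simp
 thus ?thesis unfolding wrd_def evl_wl by simp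
qed

lemma ev_nf: "ev (nf v) = v <> wd 0"
proof (rule lin_eqI[of "%v. ev (nf v)" "%v. v <> wd 0"])
 fix p :: bas
 show "ev (nf (bs p)) = bs p <> wd 0"
  by (cases p) (auto simp: nf_bs bs_wd_0 evl_wrd bs_eq lin_0[OF ev_lin])
qed (auto intro!: lin_compose[OF ev_lin])

lemma arr_carrier: "vert i : carrier KQ" "arr i : carrier KQ" "arr' i : carrier KQ"
 using M_pos by (auto simp: vert_bs arr_bs arr'_bs paths_eq mod_add_left_eq)

lemma arr_carrier' [simp]: "ks (vert i) <= paths m" "ks (arr i) <= paths m" "ks (arr' i) <= paths m"
 using arr_carrier[of i] by simp_all

lemma pow_wl:
 "n >= 1 ==> (arr i \<star> arr' i) [^]K n = bs (i mod M, wl i (2 * n) True)" (is "PROP ?A")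
 "n >= 1 ==> (arr' (i - 1) \<star> arr (i - 1)) [^]K n = bs (i mod M, wl i (2 * n) False)" (is "PROP ?B")
proof -
 have x: "arr i \<star> arr' i = bs (i mod M, wl i 2 True)" "arr' (i - 1) \<star> arr (i - 1) = bs (i mod M, wl i 2 False)"
  by (simp_all add: arr_bs arr'_bs numeral_2_eq_2 mod_add_left_eq)
 have c: "arr i \<star> arr' i : carrier KQ" "arr' (i - 1) \<star> arr (i - 1) : carrier KQ"
  by (simp_all add: star_closed)
 have w: "wl i (2 * Suc n) f = wl i 2 f @ wl i (2 * n) f" for n f
  using wl_mod[of "i - 1 + 1" i] by (cases f) (auto simp: numeral_2_eq_2)
 have e: "pend (i mod M) (wl i 2 f) = i mod M" for f
  by (cases f) (auto simp: numeral_2_eq_2 mod_add_left_eq)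
 have one: "bs (i mod M, wl i 2 f) \<star> \<one>\<^bsub>KQ\<^esub> = bs (i mod M, wl i 2 f)" for f
  using pok_wl[of i 2 f] by (intro star_one) (simp add: paths_eq)
 show "PROP ?A"
 proof (induction n rule: dec_induct)
  case (step n)
  thus ?case unfolding KQ.nat_pow_Suc2[OF c(1)] by (simp only: x w star_bs e refl if_True)
 qed (use one_star[OF c(1)] in \<open>simp only: One_nat_def KQ.nat_pow_Suc KQ.nat_pow_0 x mult_Suc_right mult_0_right add_0_right\<close>)
 show "PROP ?B"
 proof (induction n rule: dec_induct)
  case (step n)
  thus ?case unfolding KQ.nat_pow_Suc2[OF c(2)] by (simp only: x w star_bs e refl if_True)
 qed (use one_star[OF c(2)] in \<open>simp only: One_nat_def KQ.nat_pow_Suc KQ.nat_pow_0 x mult_Suc_right mult_0_right add_0_right\<close>)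
qed

lemma rel_carrier: "relations <= carrier KQ"
proof -
 have "bs (i mod M, wl i n f) : carrier KQ" for i n f using pok_wl[of i n f] by (simp add: paths_eq)
 hence "bs (i mod M, wl i n f) - bs (i mod M, wl i n f') : carrier KQ" for i n f f'
  unfolding KQ_simps mem_Collect_eq by (intro keys_diffI) auto
 thus ?thesis
  using N1 by (auto simp: relations_def pow_wl simp del: KQ_simps) (auto simp: star_closed dest!: subsetD[OF star_closed, rotated 2])
qed

lemma ideal_rel: "ideal rel_ideal KQ"
 unfolding rel_ideal_def by (rule KQ.genideal_ideal[OF rel_carrier])

lemma rel_in: "x : relations ==> x : rel_ideal"
 unfolding rel_ideal_def using KQ.genideal_self[OF rel_carrier] by blast

lemma ev_arr [simp]: "ev (vert i) = vt i" "ev (arr i) = vt i <> wd 1" "ev (arr' i) = vt (i + 1) <> wd (- 1)"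
 by (simp_all add: vert_bs arr_bs arr'_bs wd_00 mul_assoc)

lemma ker_ev: "ideal {x : carrier KQ. ev x = (0 :: 'k::field vv)} KQ"
proof (rule idealI[OF ring_KQ])
 show "subgroup {x : carrier KQ. ev x = (0 :: 'k vv)} (add_monoid KQ)"
 proof (rule KQ.add.subgroupI)
  fix x :: "'k pathvec" assume x: "x : {x : carrier KQ. ev x = 0}"
  hence "\<ominus>\<^bsub>KQ\<^esub> x = - x" by (intro KQ.minus_equality) auto
  thus "\<ominus>\<^bsub>KQ\<^esub> x : {x : carrier KQ. ev x = 0}" using x by (simp add: lin_minus[OF ev_lin])
 qed (auto simp: lin_add[OF ev_lin] lin_0[OF ev_lin] keys_addI intro: exI[of _ 0])
qed (auto simp: ev_star star_closed)

lemma rel_ev: "(x :: 'k::field pathvec) : rel_ideal ==> x : carrier KQ & ev x = 0"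
proof -
 have "relations <= {x : carrier KQ. ev x = (0 :: 'k vv)}"
 proof -
  have "ev (arr i \<star> arr (i + 1)) = (0 :: 'k vv)" "ev (arr' (i + 1) \<star> arr' i) = (0 :: 'k vv)" for i
   by (simp_all add: ev_star mul_assoc wd_vt_l sft_vals wd_prods2)
  moreover have "ev ((arr i \<star> arr' i) [^]K N - (arr' (i - 1) \<star> arr (i - 1)) [^]K N) = (0 :: 'k vv)" for i
   using N1 wd_NN[where 'a = 'k] by (simp add: pow_wl lin_diff[OF ev_lin] evl_wl)
  ultimately show ?thesis using rel_carrier unfolding relations_def by auto
 qed
 hence "rel_ideal <= {x : carrier KQ. ev x = (0 :: 'k vv)}"
  unfolding rel_ideal_def by (rule KQ.genideal_minimal[OF ker_ev])
 thus "x : rel_ideal ==> x : carrier KQ & ev x = (0 :: 'k vv)" by auto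
qed

lemma rel_mult: "x : rel_ideal ==> y : carrier KQ ==> y \<star> x : rel_ideal" "x : rel_ideal ==> y : carrier KQ ==> x \<star> y : rel_ideal"
 using ideal.I_l_closed[OF ideal_rel] ideal.I_r_closed[OF ideal_rel] by auto

lemma rel_add: "x : rel_ideal ==> y : rel_ideal ==> x + y : rel_ideal"
 using additive_subgroup.a_closed[OF ideal.axioms(1)[OF ideal_rel]] by (metis KQ_simps(3))

lemma rel_0: "0 : rel_ideal"
 using additive_subgroup.zero_closed[OF ideal.axioms(1)[OF ideal_rel]] by simp

lemma scl_star: "scl c x \<star> y = scl c (x \<star> y)" "x \<star> scl c y = scl c (x \<star> y)"
 by (simp_all add: lin_scl[OF star_lin1, of c x y] lin_scl[OF star_lin2])

lemma one_carrier: "\<one>\<^bsub>KQ\<^esub> : carrier KQ"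
 by (rule KQ.one_closed)

lemma scl_carrier: "x : carrier KQ ==> scl c x : carrier KQ"
 by (simp add: keys_sclI)

lemma rel_scl: "x : rel_ideal ==> scl c x : rel_ideal"
proof -
 assume x: "x : rel_ideal"
 have "scl c \<one>\<^bsub>KQ\<^esub> \<star> x : rel_ideal" by (rule rel_mult(1)[OF x scl_carrier[OF one_carrier]])
 moreover have "scl c \<one>\<^bsub>KQ\<^esub> \<star> x = scl c x"
  unfolding scl_star using one_star[of x] rel_ev[OF x] by (simp del: KQ_simps)
 ultimately show ?thesis by simp
qed

lemma rel_diff: "x : rel_ideal ==> y : rel_ideal ==> x - y : rel_ideal"
 using rel_add[of x "scl (-1) y"] rel_scl[of y "-1"] by (simp add: scl_minus_left)

lemma rel_aa: "pok u (Fwd i # Fwd j # p) ==> bs (u, Fwd i # Fwd j # p) : rel_ideal"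
proof -
 assume p: "pok u (Fwd i # Fwd j # p)"
 hence e: "bs (u, Fwd i # Fwd j # p) = (arr i \<star> arr (i + 1)) \<star> bs ((j + 1) mod M, p)"
  by (simp add: arr_bs mod_add_left_eq)
 show ?thesis unfolding e
  by (rule rel_mult(2)[OF rel_in]) (use p in \<open>auto simp: relations_def paths_eq\<close>)
qed

lemma rel_bb: "pok u (Bwd i # Bwd j # p) ==> bs (u, Bwd i # Bwd j # p) : rel_ideal"
proof -
 assume p: "pok u (Bwd i # Bwd j # p)"
 moreover have "u = (j + 1 + 1) mod M" using p by (auto simp: mod_add_left_eq)
 ultimately have e: "bs (u, Bwd i # Bwd j # p) = (arr' (j + 1) \<star> arr' j) \<star> bs (j, p)"
  by (auto simp: arr'_bs mod_add_left_eq)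
 show ?thesis unfolding e
  by (rule rel_mult(2)[OF rel_in]) (use p in \<open>auto simp: relations_def paths_eq\<close>)
qed

lemma rel_NN: "bs (i mod M, wl i (2 * N) True) - bs (i mod M, wl i (2 * N) False) : rel_ideal"
 by (rule rel_in) (use N1 in \<open>auto simp: relations_def pow_wl(1)[of N i, symmetric] pow_wl(2)[of N i, symmetric]\<close>)

lemma wl_Suc: "n > 0 ==> wl i n True = Fwd (i mod M) # wl (i + 1) (n - 1) False"
 "n > 0 ==> wl i n False = Bwd ((i - 1) mod M) # wl (i - 1) (n - 1) True"
 by (cases n; simp)+

text \<open>Prepending an arrow to a normal form either repeats a letter, giving an element of the
  ideal, or yields an alternating word. The relation \<open>rel_NN\<close> enters twice: a word of
  length \<open>2 * N\<close> starting with \<open>a-bar\<close> is rewritten to start with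
  \<open>a\<close>, and an \<open>a-bar\<close> in front of a full word meets a second one after the
  full word has been rewritten.\<close>

lemma step_rel:
 assumes v: "val (v, k)" "e : arcs (quiver m)" "head (quiver m) e = v"
 shows "bs (tail (quiver m) e, e # wrd v k) - nf (evx e <> bs (v, k)) : (rel_ideal :: 'k::field pathvec set)"
proof -
 have vm: "v mod M = v" using v(1) by (simp add: val_def)
 have pk: "pok (tail (quiver m) e) (e # wrd v k)" using v pok_wl[of v "nat \<bar>k\<bar>" "k > 0"] vm by (simp add: wrd_def)
 note kr = v(1)[unfolded val_def fst_conv snd_conv]
 have bvk: "(bs (v, k) :: 'k vv) = vt v <> wd k" by (rule bs_eq[OF v(1)])
 show ?thesis
 proof (cases e)
  case (Fwd i)
  hence i: "0 <= i" "i < M" "v = (i + 1) mod M" using v by auto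
  have ee: "evx e <> bs (v, k) = (vt i <> (wd 1 <> wd k) :: 'k vv)"
   unfolding bvk by (simp add: Fwd i mul_assoc wd_vt_l sft_vals)
  show ?thesis
  proof (cases "k > 0")
   case True
   hence "wrd v k = Fwd v # wl (v + 1) (nat \<bar>k\<bar> - 1) False" using vm by (simp add: wrd_def wl_Suc)
   hence "bs (tail (quiver m) e, e # wrd v k) : (rel_ideal :: 'k pathvec set)" using rel_aa pk Fwd by metis
   moreover have "wd 1 <> wd k = (0 :: 'k vv)" using True by (simp add: wd_wd fits_def)
   ultimately show ?thesis unfolding ee by (simp add: lin_0[OF nf_lin])
  next
   case False
   have w: "wd 1 <> wd k = (wd (1 - k) :: 'k vv)" using False by (auto simp: wd_wd fits_def jn_def)
   have r: "\<bar>1 - k\<bar> <= NN" "1 - k > - NN" using False kr by auto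
   have "nf (vt i <> wd (1 - k)) = (bs (i, wrd i (1 - k)) :: 'k pathvec)"
    using r i NN_pos by (auto simp: vt_wd nrm_def nf_bs val_def)
   moreover have "nat \<bar>1 - k\<bar> = Suc (nat \<bar>k\<bar>)" using False by simp
   hence "wrd i (1 - k) = Fwd i # wrd v k"
    using False i wl_mod[of v "i + 1" "nat \<bar>k\<bar>" False] by (simp add: wrd_def)
   ultimately show ?thesis unfolding ee w using rel_0 by (simp add: Fwd i)
  qed
 next
  case (Bwd i)
  hence i: "0 <= i" "i < M" "v = i" using v by auto
  have ee: "evx e <> bs (v, k) = (vt (i + 1) <> (wd (- 1) <> wd k) :: 'k vv)"
   unfolding bvk by (simp add: Bwd i mul_assoc wd_vt_l sft_vals)
  have t: "tail (quiver m) e = (i + 1) mod M" by (simp add: Bwd)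
  consider "k < 0" | "0 <= k" "k < NN" | "k = NN" using kr by linarith
  thus ?thesis
  proof cases
   case 1
   hence "wrd v k = Bwd ((v - 1) mod M) # wl (v - 1) (nat \<bar>k\<bar> - 1) True" by (simp add: wrd_def wl_Suc)
   hence "bs (tail (quiver m) e, e # wrd v k) : (rel_ideal :: 'k pathvec set)" using rel_bb pk Bwd by metis
   moreover have "wd (- 1) <> wd k = (0 :: 'k vv)" using 1 by (simp add: wd_wd fits_def)
   ultimately show ?thesis unfolding ee by (simp add: lin_0[OF nf_lin])
  next
   case 2
   have w: "wd (- 1) <> wd k = (wd (- 1 - k) :: 'k vv)" using 2 by (auto simp: wd_wd fits_def jn_def)
   have n: "nat \<bar>- 1 - k\<bar> = Suc (nat \<bar>k\<bar>)" using 2 by simp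
   have f: "(k > 0) = True | nat \<bar>k\<bar> = 0" using 2 by auto
   have l: "e # wrd v k = wl (i + 1) (Suc (nat \<bar>k\<bar>)) False"
    using f i by (auto simp: wrd_def Bwd)
   show ?thesis
   proof (cases "k = NN - 1")
    case True
    have k2: "Suc (nat \<bar>k\<bar>) = 2 * N" using True N1 by auto
    have "nf (vt (i + 1) <> wd (- 1 - k)) = (bs ((i + 1) mod M, wl (i + 1) (2 * N) True) :: 'k pathvec)"
     using True NN_pos M_pos by (auto simp: vt_wd nrm_def nf_bs val_def wrd_def wl_mod[of "(i + 1) mod M" "i + 1"] nat_mult_distrib)
    moreover have "bs ((i + 1) mod M, wl (i + 1) (2 * N) False) - bs ((i + 1) mod M, wl (i + 1) (2 * N) True) : (rel_ideal :: 'k pathvec set)"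
    proof -
     have "bs ((i + 1) mod M, wl (i + 1) (2 * N) True) - bs ((i + 1) mod M, wl (i + 1) (2 * N) False) : (rel_ideal :: 'k pathvec set)"
      by (rule rel_NN)
     from rel_scl[OF this, of "-1"] show ?thesis by (simp add: scl_minus_left)
    qed
    ultimately show ?thesis unfolding ee w l k2 t by simp
   next
    case False
    have "nf (vt (i + 1) <> wd (- 1 - k)) = (bs ((i + 1) mod M, wrd ((i + 1) mod M) (- 1 - k)) :: 'k pathvec)"
     using False 2 M_pos by (auto simp: vt_wd nrm_def nf_bs val_def)
    moreover have "wrd ((i + 1) mod M) (- 1 - k) = wl (i + 1) (Suc (nat \<bar>k\<bar>)) False"
     using 2 by (simp only: wrd_def n) (simp add: wl_mod[of "(i + 1) mod M" "i + 1"] del: wl.simps)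
    ultimately show ?thesis unfolding ee w l t using rel_0 by simp
   qed
  next
   case 3
   have "bs (t', [e]) \<star> (bs (v, wl v (2 * N) True) - bs (v, wl v (2 * N) False)) : (rel_ideal :: 'k pathvec set)"
    if "t' = (i + 1) mod M" for t'
    by (rule rel_mult(1)) (use rel_NN[of v] vm that i in \<open>auto simp: paths_eq Bwd\<close>)
   hence "bs (t', e # wl v (2 * N) True) - bs (t', e # wl v (2 * N) False) : (rel_ideal :: 'k pathvec set)"
    if "t' = (i + 1) mod M" for t' using that by (simp add: lin_diff[OF star_lin2] Bwd i)
   moreover have "bs ((i + 1) mod M, e # wl v (2 * N) False) : (rel_ideal :: 'k pathvec set)"
   proof -
    have "wl v (2 * N) False = Bwd ((v - 1) mod M) # wl (v - 1) (2 * N - 1) True" using N1 by (simp add: wl_Suc)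
    moreover have "pok ((i + 1) mod M) (e # wl v (2 * N) False)" using pok_wl[of v "2 * N" False] i by (simp add: Bwd)
    ultimately show ?thesis using rel_bb Bwd by metis
   qed
   ultimately have "bs ((i + 1) mod M, e # wl v (2 * N) True) : (rel_ideal :: 'k pathvec set)"
    using rel_add by fastforce
   moreover have "wrd v k = wl v (2 * N) True" using 3 N1 by (simp add: wrd_def nat_mult_distrib)
   moreover have "wd (- 1) <> wd k = (0 :: 'k vv)" using 3 N1 by (simp add: wd_wd fits_def jn_def wd_big)
   ultimately show ?thesis unfolding ee t by (simp add: lin_0[OF nf_lin])
  qed
 qed
qed


lemma ev_path: "pok u p ==> vt u <> evl p = (0 :: 'k::field vv) | (EX k. val (u, k) & vt u <> evl p = (bs (u, k) :: 'k vv))"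
proof (induction p arbitrary: u)
 case Nil
 hence "u mod M = u" "val (u, 0)" using NN_pos by (auto simp: val_def)
 hence "vt u <> evl [] = (bs (u, 0) :: 'k vv)" by (simp add: bs_wd_0 vt_def)
 thus ?case using `val (u, 0)` by blast
next
 case (Cons e es)
 let ?w = "head (quiver m) e"
 have "vt u <> (evx e <> evl es) = evx e <> (vt ?w <> (evl es :: 'k vv))"
 proof -
  have "vt u <> evx e = (evx e :: 'k vv)" "evx e <> vt ?w = (evx e :: 'k vv)" using Cons.prems by (auto simp: evx_ends)
  thus ?thesis by (metis mul_assoc)
 qed
 moreover have "evx e <> bs (?w, k) = (0 :: 'k vv) | (EX l. val (u, l) & evx e <> bs (?w, k) = (bs (u, l) :: 'k vv))" for k
 proof -
  obtain l where "evx e = (bs (u, l) :: 'k vv)" "val (u, l)"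
  proof (cases e)
   case (Fwd i)
   thus ?thesis using that[of 1] Cons.prems NN_pos by (auto simp: vt_wd nrm_def val_def)
  next
   case (Bwd i)
   thus ?thesis using that[of "- 1"] Cons.prems NN_pos M_pos by (auto simp: vt_wd nrm_def val_def)
  qed
  thus ?thesis using nrm_range[of "jn l k"] by (auto simp: mulb_def val_def jn_abs)
 qed
 moreover have "u = tail (quiver m) e" "pok ?w es" using Cons.prems by auto
 ultimately show ?case using Cons.IH[of ?w] mul_0_right[of "evx e :: 'k vv"] unfolding evl.simps by metis
qed

lemma rel_nf_path: "pok u p ==> bs (u, p) - nf (ev (bs (u, p))) : (rel_ideal :: 'k::field pathvec set)"
proof (induction p arbitrary: u)
 case Nil
 hence "u mod M = u" "val (u, 0)" using NN_pos by (auto simp: val_def)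
 thus ?case using rel_0 by (simp add: vt_def bs_wd_0 nf_bs wrd_def)
next
 case (Cons e es)
 let ?w = "head (quiver m) e"
 have pk: "pok ?w es" "e : arcs (quiver m)" "tail (quiver m) e = u" using Cons.prems by auto
 have ev: "vt u <> (evx e <> evl es) = evx e <> (vt ?w <> (evl es :: 'k vv))"
 proof -
  have "vt u <> evx e = (evx e :: 'k vv)" "evx e <> vt ?w = (evx e :: 'k vv)" using Cons.prems by (auto simp: evx_ends)
  thus ?thesis by (metis mul_assoc)
 qed
 have "bs (u, [e]) \<star> (bs (?w, es) - nf (ev (bs (?w, es)))) : (rel_ideal :: 'k pathvec set)"
  by (rule rel_mult(1)[OF Cons.IH[OF pk(1)]]) (use pk arcs_ends[of e] in \<open>auto simp: paths_eq\<close>)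
 hence 1: "bs (u, e # es) - bs (u, [e]) \<star> nf (vt ?w <> evl es) : (rel_ideal :: 'k pathvec set)"
  by (simp add: lin_diff[OF star_lin2])
 have 2: "bs (u, [e]) \<star> nf (vt ?w <> evl es) - nf (evx e <> (vt ?w <> evl es)) : (rel_ideal :: 'k pathvec set)"
 proof (cases "vt ?w <> evl es = (0 :: 'k vv)")
  case True
  thus ?thesis using rel_0 by (simp add: lin_0[OF nf_lin] lin_0[OF star_lin2])
 next
  case False
  then obtain k where k: "val (?w, k)" "vt ?w <> evl es = (bs (?w, k) :: 'k vv)" using ev_path[OF pk(1), where 'k = 'k] by auto
  thus ?thesis using step_rel[OF k(1) pk(2), where 'k = 'k] pk(3) by (simp add: nf_bs)
 qed
 show ?case using rel_add[OF 1 2] by (simp add: ev)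
qed

lemma rel_sum: "(!!s. s : S ==> f s : rel_ideal) ==> sum f S : rel_ideal"
 by (induction S rule: infinite_finite_induct) (auto intro: rel_0 rel_add)

lemma rel_nf: "x : carrier KQ ==> x - nf (ev x) : rel_ideal"
proof -
 assume x: "x : carrier KQ"
 have l: "lin (%x. x - nf (ev x))" by (intro lin_sub lin_id lin_compose[OF nf_lin ev_lin])
 have "x - nf (ev x) = (SUM p:ks x. scl (lk x p) (bs p - nf (ev (bs p))))"
  using lin_expand[OF l, of x] .
 also have "... : rel_ideal"
 proof (rule rel_sum, rule rel_scl)
  fix p assume "p : ks x"
  with x show "bs p - nf (ev (bs p)) : rel_ideal" by (cases p) (auto simp: paths_eq intro!: rel_nf_path simp del: ev_bs)
 qed
 finally show ?thesis .
qed

lemma ring_A: "ring (A :: 'k::field elt ring)"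
 unfolding A_def by (rule ideal.quotient_is_ring[OF ideal_rel])

interpretation A: ring "A :: 'k::field elt ring"
 by (rule ring_A)

lemma cl_hom: "cl : ring_hom KQ A"
 unfolding A_def cl_def[abs_def] by (rule ideal.rcos_ring_hom[OF ideal_rel])

lemma cl_carrier: "x : carrier KQ ==> cl x : carrier A" (is "PROP ?A")
 and cl_mult: "x : carrier KQ ==> y : carrier KQ ==> cl (x \<star> y) = cl x \<cdot> cl y" (is "PROP ?B")
 and cl_add: "x : carrier KQ ==> y : carrier KQ ==> cl (x + y) = cl x +A cl y" (is "PROP ?C")
 and cl_one: "cl \<one>\<^bsub>KQ\<^esub> = \<one>\<^bsub>A\<^esub>" (is ?D)
proof -
 show "PROP ?A" by (rule ring_hom_closed[OF cl_hom])
 show "PROP ?B" by (rule ring_hom_mult[OF cl_hom])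
 show "PROP ?C"
  using ring_hom_add[OF cl_hom, of x y] unfolding KQ_simps(3) .
 show ?D by (rule ring_hom_one[OF cl_hom])
qed

lemma cl_eq: "x : carrier KQ ==> y : carrier KQ ==> cl x = cl y <-> ev x = ev y"
proof -
 assume x: "x : carrier KQ" "y : carrier KQ"
 have y: "- y : carrier KQ" using x by simp
 have "\<ominus>\<^bsub>KQ\<^esub> y = - y" using x by (intro KQ.minus_equality) auto
 hence "x \<ominus>\<^bsub>KQ\<^esub> y = x - y" by (simp add: a_minus_def)
 hence "cl x = cl y <-> x - y : rel_ideal"
  unfolding cl_def using KQ.quotient_eq_iff_same_a_r_cos[OF ideal_rel x] by simp
 moreover have "x - y : rel_ideal <-> ev x = ev y"
 proof
  show "x - y : rel_ideal ==> ev x = ev y" using rel_ev[of "x - y"] by (simp add: lin_diff[OF ev_lin])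
  show "x - y : rel_ideal" if "ev x = ev y"
   using rel_diff[OF rel_nf[OF x(1)] rel_nf[OF x(2)]] that by simp
 qed
 ultimately show ?thesis by simp
qed

text \<open>\<open>kap\<close> and \<open>rho\<close> are inverse isomorphisms between the concrete
  algebra and \<open>A\<close>, except that \<open>kap\<close> forgets the junk basis elements;
  hence \<open>rho (kap v)\<close> is \<open>v <> wd 0\<close>.\<close>

definition kap :: "'k::field vv => 'k elt" where "kap v = cl (nf v)"

definition rho :: "'k::field elt => 'k vv" where "rho a = ev (SOME x. x : carrier KQ & cl x = a)"

lemma kap_carrier [simp]: "kap v : carrier A"
 unfolding kap_def by (rule cl_carrier[OF nf_carrier])

lemma cl_kap: "x : carrier KQ ==> cl x = kap (ev x)"
 unfolding kap_def by (subst cl_eq) (use rel_ev[OF rel_nf, of x] nf_carrier[of "ev x"] in \<open>simp_all add: lin_diff[OF ev_lin] del: KQ_simps\<close>)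

lemma carrier_A: "a : carrier A ==> EX x:carrier KQ. a = cl x"
 by (auto simp: A_def cl_def FactRing_def A_RCOSETS_def')

lemma rho_cl: "x : carrier KQ ==> rho (cl x) = ev x"
proof -
 assume x: "x : carrier KQ"
 have "(SOME y. y : carrier KQ & cl y = cl x) : carrier KQ & cl (SOME y. y : carrier KQ & cl y = cl x) = cl x"
  by (rule someI_ex) (use x in blast)
 thus ?thesis unfolding rho_def using cl_eq x by blast
qed

lemma rho_kap: "rho (kap v) = v <> wd 0"
 unfolding kap_def rho_cl[OF nf_carrier] ev_nf ..

lemma kap_rho [simp]: "a : carrier A ==> kap (rho a) = a"
 using carrier_A[of a] rho_cl cl_kap by metis

lemma kap_add: "kap (x + y) = kap x +A kap y"
 unfolding kap_def lin_add[OF nf_lin] by (rule cl_add[OF nf_carrier nf_carrier])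

lemma kap_wd_0 [simp]: "kap (x <> wd 0) = kap x"
 using kap_rho[OF kap_carrier, of x] by (simp add: rho_kap)

lemma kap_mul: "kap (x <> y) = kap x \<cdot> kap y"
proof -
 have "kap x \<cdot> kap y = cl (nf x \<star> nf y)" unfolding kap_def by (rule cl_mult[OF nf_carrier nf_carrier, symmetric])
 also have "... = kap (ev (nf x \<star> nf y))" by (rule cl_kap[OF KQ.m_closed[OF nf_carrier nf_carrier]])
 also have "ev (nf x \<star> nf y) = x <> y"
  unfolding ev_star[OF nf_carrier nf_carrier] ev_nf by (simp add: mul_assoc mul_wd_0 mul_wd_0')
 finally show ?thesis by simp
qed

lemma kap_one: "kap (wd 0) = \<one>\<^bsub>A\<^esub>"
proof -
 have "ev \<one>\<^bsub>KQ\<^esub> = wd 0" by (simp add: lin_sum[OF ev_lin] wd_0)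
 thus ?thesis using cl_kap[OF one_carrier] cl_one by metis
qed

lemma kap_0: "kap 0 = \<zero>\<^bsub>A\<^esub>"
 using A.add.r_cancel_one[OF kap_carrier kap_carrier, of 0 0] kap_add[of 0 0] by simp

lemma kap_minus: "\<ominus>\<^bsub>A\<^esub> kap x = kap (- x)"
 by (rule A.minus_equality) (simp_all add: kap_0 flip: kap_add)

lemma kap_diff: "kap x -A kap y = kap (x - y)"
 by (simp add: a_minus_def kap_minus flip: kap_add)

lemma sclA_kap: "sclA c (kap x) = kap (scl c x)"
proof -
 have "sclA c (kap x) = cl (scl c \<one>\<^bsub>KQ\<^esub> \<star> nf x)"
  unfolding sclA_def kap_def by (rule cl_mult[OF scl_carrier[OF one_carrier] nf_carrier, symmetric])
 also have "scl c \<one>\<^bsub>KQ\<^esub> \<star> nf x = nf (scl c x)"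
  unfolding scl_star one_star[OF nf_carrier] by (simp add: lin_scl[OF nf_lin])
 finally show ?thesis by (simp add: kap_def)
qed

lemma kap_sum: "finite S ==> (\<Oplus>\<^bsub>A\<^esub>s\<in>S. kap (f s)) = kap (sum f S)"
 by (induction S rule: finite_induct) (auto simp: kap_0 kap_add)

lemma rho_wd_0: "a : carrier A ==> rho a <> wd 0 = rho a"
 using rho_kap[of "rho a"] by simp

lemma rho_ops:
 assumes "a : carrier A" "b : carrier A"
 shows "rho (a +A b) = rho a + rho b" (is ?A) "rho (a \<cdot> b) = rho a <> rho b" (is ?B) "rho (a -A b) = rho a - rho b" (is ?C)
  "rho (sclA c a) = scl c (rho a)" (is ?D)
proof -
 have *: "a = kap (rho a)" "b = kap (rho b)" "rho a <> wd 0 = rho a" "rho b <> wd 0 = rho b"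
  using assms rho_wd_0 by simp_all
 show ?A
  using rho_kap[of "rho a + rho b"] by (simp add: kap_add assms mul_add_left *(3,4))
 show ?B
  using rho_kap[of "rho a <> rho b"] by (simp add: kap_mul assms mul_assoc *(3,4))
 show ?C
  using rho_kap[of "rho a - rho b"] kap_diff[of "rho a" "rho b"] by (simp add: assms mul_diff_left *(3,4))
 show ?D
  using rho_kap[of "scl c (rho a)"] sclA_kap[of c "rho a"] by (simp add: assms mul_scl_left *(3))
qed

lemma rho_zero: "rho \<zero>\<^bsub>A\<^esub> = 0" and rho_one: "rho \<one>\<^bsub>A\<^esub> = wd 0"
 using rho_kap[of 0] rho_kap[of "wd 0"] by (simp_all add: kap_0 kap_one wd_00)

lemma kap_eq: "kap x = kap y <-> x <> wd 0 = y <> wd 0"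
 by (metis rho_kap kap_wd_0)

lemma cl_gens: "cl (vert j) = kap (vt j)" (is ?A) "cl (arr j) = kap (vt j <> wd 1)" (is ?B) "cl (arr' j) = kap (vt (j + 1) <> wd (- 1))" (is ?C)
 "cl aa = kap (wd 1 :: 'k::field vv)" "cl bb = kap (wd (- 1) :: 'k vv)" (is ?D)
proof -
 show ?A ?B ?C
  using cl_kap[OF arr_carrier(1)] cl_kap[OF arr_carrier(2)] cl_kap[OF arr_carrier(3)] by simp_all
 have c: "aa : carrier (KQ :: 'k pathvec ring)" "bb : carrier (KQ :: 'k pathvec ring)"
  unfolding aa_def bb_def KQ_simps mem_Collect_eq by (intro keys_sumI arr_carrier')+
 have "ev aa = (wd 1 :: 'k vv)" "ev bb = (wd (- 1) :: 'k vv)"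
 proof -
  show "ev aa = (wd 1 :: 'k vv)" by (simp add: aa_def lin_sum[OF ev_lin] wd_00 flip: mul_sum_left wd_0)
  have "(SUM i:{0..<M}. vt (i + 1)) = (wd 0 :: 'k vv)"
   unfolding wd_0
   by (rule sum.reindex_bij_witness[of _ "%i. (i - 1) mod M" "%i. (i + 1) mod M"])
    (use M_pos in \<open>auto simp: mod_diff_left_eq mod_add_left_eq\<close>)
  thus "ev bb = (wd (- 1) :: 'k vv)" by (simp add: bb_def lin_sum[OF ev_lin] wd_00 flip: mul_sum_left)
 qed
 thus "cl aa = kap (wd 1 :: 'k vv)" ?D using cl_kap c by metis+
qed

lemma kap_pow: "(kap (wd 1) \<cdot> kap (wd (- 1))) [^]\<^bsub>A\<^esub> (l :: nat) = kap (wd (2 * int l))" (is ?A)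
 "(kap (wd (- 1)) \<cdot> kap (wd 1)) [^]\<^bsub>A\<^esub> (l :: nat) = kap (wd (- (2 * int l)))" (is ?B)
proof -
 have 1: "wd (2 * int l) <> (wd 1 <> wd (- 1)) = wd (2 * int (Suc l))"
  "wd (- (2 * int l)) <> (wd (- 1) <> wd 1) = wd (- (2 * int (Suc l)))" for l
  by (auto simp: wd_wd fits_def jn_def intro!: arg_cong[of _ _ wd])
 show ?A
 proof (induction l)
  case (Suc l) show ?case by (simp only: A.nat_pow_Suc Suc) (simp only: kap_mul[symmetric] 1)
 qed (simp add: kap_one)
 show ?B
 proof (induction l)
  case (Suc l) show ?case by (simp only: A.nat_pow_Suc Suc) (simp only: kap_mul[symmetric] 1)
 qed (simp add: kap_one)
qed

lemma cl_elts:
 "cl ((arr i \<star> arr' i) [^]K N) = kap (cI i :: 'k::field vv)"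
 "cl (arr i \<star> arr' i + arr' i \<star> arr i) = kap (cF i :: 'k vv)" (is ?A)
 "cl (arr i \<star> (arr' i \<star> arr i) [^]K (N - 1)) = kap (vt i <> wd (NN - 1) :: 'k vv)" (is ?B)
 "cl (arr' (i - 1) \<star> (arr (i - 1) \<star> arr' (i - 1)) [^]K (N - 1)) = kap (vt i <> wd (1 - NN) :: 'k vv)" (is ?C)
proof -
 have c: "arr j \<star> arr' j : carrier KQ" "arr' j \<star> arr j : carrier KQ" for j
  by (rule KQ.m_closed[OF arr_carrier(2,3)] KQ.m_closed[OF arr_carrier(3,2)])+
 have v [simp]: "vt (j mod M) = vt j" for j by (simp add: vt_def)
 have ev1: "ev (arr j \<star> arr' j) = (vt j <> wd 2 :: 'k vv)" "ev (arr' j \<star> arr j) = (vt (j + 1) <> wd (- 2) :: 'k vv)" for j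
  by (simp_all add: ev_star mul_assoc wd_vt_l sft_vals wd_wd fits_def jn_def)
 have p1: "ev ((arr j \<star> arr' j) [^]K n) = (if n = 0 then wd 0 else vt j <> wd (2 * int n) :: 'k vv)" for j n
  using evl_wl[of j "2 * n" True] cl_one by (cases "n = 0") (simp_all add: pow_wl lin_sum[OF ev_lin] wd_0)
 have p2: "ev ((arr' (j - 1) \<star> arr (j - 1)) [^]K n) = (if n = 0 then wd 0 else vt j <> wd (- (2 * int n)) :: 'k vv)" for j n
  using evl_wl[of j "2 * n" False] by (cases "n = 0") (simp_all add: pow_wl lin_sum[OF ev_lin] wd_0)
 note pc = KQ.nat_pow_closed[OF c(1)] KQ.nat_pow_closed[OF c(2)]
 have r: "NN - 1 = 1 + 2 * int (N - 1)" "1 - NN = - (1 + 2 * int (N - 1))" using N1 by simp_all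
 show "cl ((arr i \<star> arr' i) [^]K N) = kap (cI i :: 'k vv)"
  using N1 by (subst cl_kap[OF pc(1)]) (simp add: p1 cI_def)
 show ?A
  using KQ.add.m_closed[OF c] unfolding KQ_simps(3) by (subst cl_kap) (simp_all add: lin_add[OF ev_lin] ev1 cF_def)
 show ?B
  unfolding cl_kap[OF KQ.m_closed[OF arr_carrier(2) pc(2)]] ev_star[OF arr_carrier(2) pc(2)] r
  using p2[of "i + 1" "N - 1"]
  by (auto simp: mul_assoc wd_vt_l sft_vals wd_wd fits_def jn_def intro!: arg_cong[of _ _ kap] arg_cong[of _ _ wd] arg_cong2[of _ _ _ _ "(<>)"])
 show ?C
  unfolding cl_kap[OF KQ.m_closed[OF arr_carrier(3) pc(1)]] ev_star[OF arr_carrier(3) pc(1)] r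
  using p1[of "i - 1" "N - 1"]
  by (auto simp: mul_assoc wd_vt_l sft_vals wd_wd fits_def jn_def intro!: arg_cong[of _ _ kap] arg_cong[of _ _ wd] arg_cong2[of _ _ _ _ "(<>)"])
qed


subsection \<open>The elements \<open>g n r i\<close>\<close>

primrec cnt :: "arrow list => int" where
 "cnt [] = 0"
| "cnt (e # es) = (case e of Fwd _ => 1 | Bwd _ => - 1) + cnt es"

lemma cnt_append [simp]: "cnt (p @ q) = cnt p + cnt q"
 by (induction p) auto

lemma pend_cnt: "pok u p ==> pend u p = (u + cnt p) mod M"
proof (induction p arbitrary: u)
 case (Cons e p)
 thus ?case using mod_add_left_eq[of "pend u [e] + 1" M "cnt p - 1"] by (cases e) (auto simp: mod_simps algebra_simps)
qed simp

definition gp :: "int => int => 'k::field pathvec => bool" where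
 "gp c i x <-> ks x <= {(u, p). u = i mod M & pok u p & cnt p = c}"

lemma gp_carrier: "gp c i x ==> x : carrier KQ"
 by (force simp: gp_def paths_eq)

lemma star_aa: "pok u p ==> bs (u, p) \<star> aa = bs (u, p @ [Fwd (pend u p)])"
proof -
 assume "pok u p"
 hence "pend u p : {0..<M}" using pok_range by blast
 thus ?thesis by (simp add: aa_def lin_sum[OF star_lin2] arr_bs cong: sum.cong_simp)
qed

lemma star_bb: "pok u p ==> bs (u, p) \<star> bb = bs (u, p @ [Bwd ((pend u p - 1) mod M)])"
proof -
 assume "pok u p"
 hence r: "pend u p : {0..<M}" using pok_range by blast
 have "(SUM i:{0..<M}. bs (u, p) \<star> arr' i) = (SUM i:{0..<M}. if i = (pend u p - 1) mod M then bs (u, p @ [Bwd i]) else 0)"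
 proof (rule sum.cong)
  fix i assume i: "i : {0..<M}"
  have "pend u p = (i + 1) mod M <-> (i + 1) mod M = (pend u p - 1 + 1) mod M" using r by auto
  also have "... <-> i = (pend u p - 1) mod M" unfolding mod_shift using i by auto
  finally show "bs (u, p) \<star> arr' i = (if i = (pend u p - 1) mod M then bs (u, p @ [Bwd i]) else 0)"
   using i by (auto simp: arr'_bs)
 qed simp
 thus ?thesis using M_pos by (simp add: bb_def lin_sum[OF star_lin2])
qed

lemma gp_lin: "lin f ==> gp c i x ==> (!!p. pok (i mod M) p ==> cnt p = c ==> gp d i (f (bs (i mod M, p)))) ==> gp d i (f x)"
 unfolding gp_def by (rule keys_lin) (auto dest!: subsetD)

lemma gp_aa: "gp c i x ==> gp (c + 1) i (x \<star> aa)"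
proof (rule gp_lin[OF star_lin1])
 fix p assume p: "pok (i mod M) p" "cnt p = c"
 have "pend (i mod M) p : {0..<M}" using pok_range[OF p(1)] by simp
 thus "gp (c + 1) i (bs (i mod M, p) \<star> aa)" using p M_pos by (simp add: gp_def star_aa)
qed

lemma gp_bb: "gp c i x ==> gp (c - 1) i (x \<star> bb)"
proof (rule gp_lin[OF star_lin1])
 fix p assume p: "pok (i mod M) p" "cnt p = c"
 have "pend (i mod M) p : {0..<M}" using pok_range[OF p(1)] by simp
 thus "gp (c - 1) i (bs (i mod M, p) \<star> bb)" using p M_pos by (simp add: gp_def star_bb mod_add_left_eq)
qed

lemma gp_ops: "gp c i 0" "gp c i x ==> gp c i (scl d x)" "gp c i x ==> gp c i y ==> gp c i (x + y)"
 unfolding gp_def by (simp, erule keys_sclI, erule (1) keys_addI)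

text \<open>Left inverses of right multiplication by arrows: no \<open>g n r i\<close> in range vanishes.\<close>

definition cutl :: "bool => 'k::field pathvec => 'k pathvec" where
 "cutl f = lin_ext (%(u, p). if p ~= [] & (EX i. last p = (if f then Fwd i else Bwd i)) then bs (u, butlast p) else 0)"

lemma cutl_lin [simp]: "lin (cutl f)" by (simp add: cutl_def)

lemma cutl_simps:
 assumes "gp c i x"
 shows "cutl True (x \<star> aa) = x" (is ?A) "cutl False (x \<star> aa) = 0" (is ?B) "cutl False (x \<star> bb) = x" (is ?C) "cutl True (x \<star> bb) = 0" (is ?D)
proof -
 have p: "pok u p" if "(u, p) : ks x" for u p using assms that by (auto simp: gp_def)
 show ?A by (rule lin_eqI[of "%x. cutl True (x \<star> aa)" "%x. x"])
  (auto simp: cutl_def star_aa p intro!: lin_compose[OF lin_lin_ext])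
 show ?B by (rule lin_eqI[of "%x. cutl False (x \<star> aa)" "%x. 0"])
  (auto simp: cutl_def star_aa p intro!: lin_compose[OF lin_lin_ext])
 show ?C by (rule lin_eqI[of "%x. cutl False (x \<star> bb)" "%x. x"])
  (auto simp: cutl_def star_bb p intro!: lin_compose[OF lin_lin_ext])
 show ?D by (rule lin_eqI[of "%x. cutl True (x \<star> bb)" "%x. 0"])
  (auto simp: cutl_def star_bb p intro!: lin_compose[OF lin_lin_ext])
qed

lemma star_nz: "gp c i x ==> x ~= 0 ==> x \<star> aa ~= 0" "gp c i x ==> x ~= 0 ==> x \<star> bb ~= 0"
 using cutl_simps(1,3)[of c i x] lin_0[OF cutl_lin] by metis+

text \<open>Brings products with long words into the form on which \<open>cutl\<close> acts, with
  the last letter split off and a cofactor that does not vanish unless \<open>x\<close>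
  does.\<close>

lemma gp_words:
 fixes x a b :: "'k::field pathvec"
 assumes x: "gp c i x" and ab: "a = aa & b = bb | a = bb & b = aa"
 shows "EX z. gp c i z & x \<star> a \<star> (b \<star> a) [^]K (l :: nat) = z \<star> a & (x ~= 0 --> z ~= 0)"
proof (induction l)
 case 0
 have "x \<star> a : carrier KQ" using ab gp_carrier[OF gp_aa[OF x]] gp_carrier[OF gp_bb[OF x]] by metis
 thus ?case unfolding KQ.nat_pow_0 by (subst star_one) (use x in blast)+
next
 case (Suc l)
 then obtain z where z: "gp c i z" "x \<star> a \<star> (b \<star> a) [^]K l = z \<star> a" "x ~= 0 --> z ~= 0" by blast
 have "x \<star> a \<star> (b \<star> a) [^]K Suc l = z \<star> a \<star> b \<star> a"
  unfolding KQ.nat_pow_Suc star_assoc[symmetric] z(2) ..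
 moreover have "gp c i (z \<star> aa \<star> bb)" "gp c i (z \<star> bb \<star> aa)" using gp_bb[OF gp_aa[OF z(1)]] gp_aa[OF gp_bb[OF z(1)]] by simp_all
 hence "gp c i (z \<star> a \<star> b)" using ab by metis
 moreover have "x ~= 0 --> z \<star> a \<star> b ~= 0" using z star_nz gp_aa gp_bb ab by metis
 ultimately show ?case by blast
qed

text \<open>Paths ending in \<open>a\<close> cannot cancel against paths ending in
  \<open>a-bar\<close>.\<close>

lemma sum_nz:
 assumes "gp c i x" "gp d i y" "e ~= 0" "x ~= 0 | y ~= 0"
 shows "x \<star> aa + scl e (y \<star> bb) ~= (0 :: 'k::field pathvec)"
proof
 assume z: "x \<star> aa + scl e (y \<star> bb) = 0"
 have "cutl True (x \<star> aa + scl e (y \<star> bb)) = x" "cutl False (x \<star> aa + scl e (y \<star> bb)) = scl e y"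
  using assms(1,2) by (simp_all add: lin_add[OF cutl_lin] lin_scl[OF cutl_lin] cutl_simps)
 hence "x = 0" "scl e y = 0" unfolding z lin_0[OF cutl_lin] by simp_all
 moreover have "y = scl (inverse e) (scl e y)" using assms(3) by simp
 ultimately show False using assms(4) by simp
qed

lemma gp_g: "gp (int n - 2 * r) i (g n r i :: 'k::field pathvec) & (0 <= r & r <= int n --> g n r i ~= (0 :: 'k pathvec))"
proof (induction n arbitrary: r)
 case 0
 thus ?case using M_pos by (auto simp: gp_def vert_bs)
next
 case (Suc n)
 let ?x = "g n r i :: 'k pathvec" and ?y = "g n (r - 1) i :: 'k pathvec"
 have x: "gp (int n - 2 * r) i ?x" "0 <= r ==> r <= int n ==> ?x ~= 0" using Suc by auto
 have y: "gp (int n - 2 * (r - 1)) i ?y" "0 < r ==> r <= int (Suc n) ==> ?y ~= 0" using Suc[of "r - 1"] by auto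
 obtain zx where zx: "gp (int n - 2 * r) i zx" "?x \<star> aa \<star> (bb \<star> aa) [^]K (N - 1) = zx \<star> aa" "?x ~= 0 --> zx ~= 0"
  using gp_words[OF x(1), of aa bb] by blast
 obtain zy where zy: "gp (int n - 2 * (r - 1)) i zy" "?y \<star> bb \<star> (aa \<star> bb) [^]K (N - 1) = zy \<star> bb" "?y ~= 0 --> zy ~= 0"
  using gp_words[OF y(1), of bb aa] by blast
 have a: "gp (int (Suc n) - 2 * r) i (w \<star> aa)" if "gp (int n - 2 * r) i w" for w :: "'k pathvec"
  using gp_aa[OF that] by (simp add: algebra_simps)
 have b: "gp (int (Suc n) - 2 * r) i (w \<star> bb)" if "gp (int n - 2 * (r - 1)) i w" for w :: "'k pathvec"
  using gp_bb[OF that] by (simp add: algebra_simps)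
 have s: "((-1) ^ Suc n :: 'k) ~= 0" by simp
 consider "r < 0 | r > int (Suc n)" | "0 <= r" "r <= int (Suc n)" "int (Suc n) - 2 * r > 0"
  | "0 <= r" "r <= int (Suc n)" "int (Suc n) - 2 * r < 0" | "0 <= r" "r <= int (Suc n)" "int (Suc n) = 2 * r" by linarith
 thus ?case
 proof cases
  case 1 thus ?thesis by (auto simp: gp_ops)
 next
  case 2
  hence e: "g (Suc n) r i = ?x \<star> aa + scl ((-1) ^ Suc n) (zy \<star> bb)" by (simp only: g.simps zy(2)) simp
  have "?x ~= 0" using 2 by (intro x(2)) auto
  thus ?thesis unfolding e using sum_nz[OF x(1) zy(1) s] a[OF x(1)] b[OF zy(1)] by (auto intro: gp_ops)
 next
  case 3
  hence e: "g (Suc n) r i = zx \<star> aa + scl ((-1) ^ Suc n) (?y \<star> bb)" by (simp only: g.simps zx(2)) simp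
  have "?y ~= 0" using 3 by (intro y(2)) auto
  thus ?thesis unfolding e using sum_nz[OF zx(1) y(1) s] a[OF zx(1)] b[OF y(1)] by (auto intro: gp_ops)
 next
  case 4
  hence e: "g (Suc n) r i = zx \<star> aa + scl 1 (zy \<star> bb)" by (simp only: g.simps zx(2) zy(2)) simp
  have "?y ~= 0" using 4 by (intro y(2)) auto
  thus ?thesis unfolding e using sum_nz[OF zx(1) zy(1), of 1] zy(3) a[OF zx(1)] b[OF zy(1)] by (auto intro: gp_ops)
 qed
qed

lemma g_mod: "i mod M = j mod M ==> g n r i = g n r j"
proof (induction n arbitrary: r)
 case 0 thus ?case by (simp add: vert_bs)
next
 case (Suc n)
 hence "g n r i = (g n r j :: 'a pathvec)" for r by blast
 thus ?case by (simp only: g.simps)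
qed

lemma g_neg: "r < 0 | r > int n ==> g n r i = 0"
 by (cases n) auto

text \<open>Every path in \<open>g n r i\<close> starts at \<open>i\<close> and has an excess of
  \<open>n - 2 * r\<close> arrows \<open>a\<close> over \<open>a-bar\<close>. As the element is
  nonzero, one such path reveals both indices.\<close>

lemma g_inj:
 assumes "g n r i = (g n r' i' :: 'k::field pathvec)" "0 <= r" "r <= int n"
 shows "r = r'" "i mod M = i' mod M"
proof -
 have "g n r i ~= (0 :: 'k pathvec)" using gp_g assms by blast
 then obtain u p where "(u, p) : ks (g n r i :: 'k pathvec)" by (metis Poly_Mapping.keys_eq_empty equals0I surj_pair)
 hence "cnt p = int n - 2 * r" "u = i mod M" "cnt p = int n - 2 * r'" "u = i' mod M"
  using gp_g[of n r i, where 'k = 'k] gp_g[of n r' i', where 'k = 'k] assms(1) unfolding gp_def by auto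
 thus "r = r'" "i mod M = i' mod M" by auto
qed

lemma vert_g: "vert j \<star> g n r i = (if j mod M = i mod M then g n r i else 0 :: 'k::field pathvec)"
 and g_vert: "g n r i \<star> vert j = (if j mod M = (i + int n - 2 * r) mod M then g n r i else 0 :: 'k pathvec)" (is ?A)
proof -
 have mm: "(i mod M + int n - 2 * r) mod M = (i + int n - 2 * r) mod M" by (metis mod_add_left_eq mod_diff_left_eq)
 have k: "u = i mod M & pok u p & cnt p = int n - 2 * r" if "(u, p) : ks (g n r i :: 'k pathvec)" for u p
  using gp_g[of n r i, where 'k = 'k] that unfolding gp_def by auto
 show "vert j \<star> g n r i = (if j mod M = i mod M then g n r i else 0 :: 'k pathvec)"
  by (rule lin_eqI[of "%x. vert j \<star> x" "%x. if j mod M = i mod M then x else 0"])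
   (auto simp: vert_bs dest!: k intro: lin_def[THEN iffD2])
 show ?A
  by (rule lin_eqI[of "%x. x \<star> vert j" "%x. if j mod M = (i + int n - 2 * r) mod M then x else 0"])
   (auto simp: vert_bs pend_cnt mm add_diff_eq dest!: k intro: lin_def[THEN iffD2])
qed


subsection \<open>The resolution is the concrete complex\<close>

lemma g_nz [simp]: "0 <= r ==> r <= int n ==> g n r i ~= 0"
 using gp_g by blast

definition idx :: "nat => 'k::field pathvec => (int \<times> int) set" where
 "idx n b = {(r, i). 0 <= r & r <= int n & 0 <= i & i < M & g n r i = b}"

lemma idx_g: "0 <= r ==> r <= int n ==> idx n (g n r i :: 'k::field pathvec) = {(r, i mod M)}"
proof -
 assume r: "0 <= r" "r <= int n"
 have "g n r (i mod M) = (g n r i :: 'k pathvec)" by (rule g_mod) simp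
 moreover have "r' = r & i' = i mod M" if "g n r' i' = (g n r i :: 'k pathvec)" "0 <= r'" "r' <= int n" "0 <= i'" "i' < M" for r' i'
  using g_inj[OF that(1-3)] that by auto
 ultimately have "(%s. 0 <= fst s & fst s <= int n & 0 <= snd s & snd s < M & g n (fst s) (snd s) = (g n r i :: 'k pathvec)) = (%s. s = (r, i mod M))"
  using r M_pos by (intro ext iffI) (metis prod.collapse, metis fst_conv snd_conv pos_mod_sign pos_mod_bound)
 thus ?thesis unfolding idx_def split_def by simp
qed

lemma B_cases: "b : B n ==> EX r i. b = g n r i & 0 <= r & r <= int n & 0 <= i & i < M"
 by (auto simp: B_def)

lemma g_B: "0 <= r ==> r <= int n ==> g n r i : (B n :: 'k::field pathvec set)"
proof -
 assume "0 <= r" "r <= int n"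
 moreover have "g n r i = (g n r (i mod M) :: 'k pathvec)" by (rule g_mod) simp
 moreover have "0 <= i mod M & i mod M < M" using M_pos by simp
 ultimately show ?thesis unfolding B_def by blast
qed

text \<open>Maps representatives in \<open>F n\<close> to the concrete complex; the sum over
  \<open>idx\<close> has one term and recovers the indices of a basis element. As \<open>U n\<close>
  is killed (\<open>tau_U\<close>), congruences become equations.\<close>

definition tau :: "nat => 'k::field tens => 'k pp" where
 "tau n = lin_ext (%(x, b, y). \<Sum>(r, i)\<in>idx n b. T (rho x) (int n - r, r, i) (rho y))"

lemma tau_lin [simp]: "lin (tau n)" by (simp add: tau_def)

lemma tau_tens: "tau n (tens x (g n r i) y) = T (rho x) (int n - r, r, i) (rho (y :: 'k::field elt))"
proof (cases "0 <= r & r <= int n")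
 case True
 hence "tau n (tens x (g n r i) y) = T (rho x) (int n - r, r, i mod M) (rho y)"
  by (simp add: tens_def tau_def idx_g)
 also have "... = T (rho x) (int n - r, r, i) (rho y)" by (rule T_cong) simp
 finally show ?thesis .
next
 case False
 thus ?thesis by (auto simp: tens_def g_neg T_neg lin_0[OF tau_lin])
qed

lemma tau_PC: "tau n f : PC (int n)"
 unfolding PC_keys
proof (rule keys_lin[OF tau_lin])
 fix s :: "'a elt \<times> 'a pathvec \<times> 'a elt"
 obtain x b y where s: "s = (x, b, y)" by (cases s)
 have "tau n (bs s) : PC (int n)"
  by (auto simp: s tau_def split_def intro!: PC_sum T_PC)
 thus "ks (tau n (bs s)) <= {(u, w, v). okk u w v & ng w = w & dgr w = int n}"
  unfolding PC_keys .
qed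

lemma F_keys:
 assumes f: "f : F n" "s : ks f"
 obtains x r i y where "s = (x, g n r i, y)" "bs s = tens x (g n r i) y" "x : carrier A" "y : carrier A"
  "0 <= r" "r <= int n" "0 <= i" "i < M"
proof -
 obtain x b y where s: "s = (x, b, y)" "x : carrier A" "b : B n" "y : carrier A" using f unfolding F_def by blast
 obtain r i where b: "b = g n r i" "0 <= r" "r <= int n" "0 <= i" "i < M" using B_cases[OF s(3)] by blast
 have "bs s = tens x b y" using b by (simp add: tens_def s)
 thus thesis using that s b by metis
qed

lemma F_ops: "x : F n ==> y : F n ==> x + y : F n" (is "PROP ?A") "x : F n ==> scl c x : F n" (is "PROP ?B") "0 : F n"
 "u : carrier A ==> v : carrier A ==> tens u (g n r i) v : F n" (is "PROP ?C")
proof -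
 show "PROP ?A" unfolding F_def mem_Collect_eq by (rule keys_addI)
 show "PROP ?B" unfolding F_def mem_Collect_eq by (rule keys_sclI)
 show "0 : F n" by (simp add: F_def)
 show "PROP ?C"
 proof (cases "0 <= r & r <= int n")
  case True
  thus "PROP ?C"
   by (simp add: F_def tens_def g_B)
 qed (auto simp: F_def tens_def g_neg)
qed

lemma F_sum: "(!!s. s : S ==> f s : F n) ==> sum f S : F n"
 by (induction S rule: infinite_finite_induct) (simp_all add: F_ops)

lemma module_scl: "Modules.module (scl :: 'k::field => ('s \<Rightarrow>\<^sub>0 'k) => _)"
 by unfold_locales (simp_all add: scl_add scl_add_left)

lemma rho_vert: "rho (cl (vert j)) = vt j"
 by (simp add: cl_gens(1) rho_kap)

lemma tau_U: "f : U n ==> tau n f = (0 :: 'k::field pp)"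
proof -
 have c: "cl (vert j) : carrier (A :: 'k elt ring)" for j by (rule cl_carrier[OF arr_carrier(1)])
 note ts = lin_diff[OF tau_lin] lin_scl[OF tau_lin] tau_tens rho_ops c T_add_left T_add_right T_scl_left T_scl_right
 have 1: "tau n (tens (x +A x') b y - tens x b y - tens x' b y) = (0 :: 'k pp)"
  "tau n (tens x b (y +A y') - tens x b y - tens x b y') = (0 :: 'k pp)"
  "tau n (tens (sclA d x) b y - scl d (tens x b y)) = (0 :: 'k pp)" "tau n (tens x b (sclA d y) - scl d (tens x b y)) = (0 :: 'k pp)"
  "tau n (tens (x \<cdot> cl (vert j)) b y - tens x (vert j \<star> b) y) = (0 :: 'k pp)"
  "tau n (tens x b (cl (vert j) \<cdot> y) - tens x (b \<star> vert j) y) = (0 :: 'k pp)"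
  if xy: "x : carrier A" "x' : carrier A" "y : carrier A" "y' : carrier A" and b: "b : B n" for x x' y y' :: "'k elt" and b d j
 proof -
  obtain r i where b: "b = g n r i" using B_cases[OF b] by blast
  have z: "tens x 0 y = 0" for x y :: "'k elt" by (simp add: tens_def)
  show "tau n (tens (x +A x') b y - tens x b y - tens x' b y) = (0 :: 'k pp)"
   "tau n (tens x b (y +A y') - tens x b y - tens x b y') = (0 :: 'k pp)"
   "tau n (tens (sclA d x) b y - scl d (tens x b y)) = (0 :: 'k pp)" "tau n (tens x b (sclA d y) - scl d (tens x b y)) = (0 :: 'k pp)"
   unfolding b by (simp_all add: ts rho_ops(4)[OF xy(1) xy(1)] rho_ops(4)[OF xy(3) xy(3)] xy)
  show "tau n (tens (x \<cdot> cl (vert j)) b y - tens x (vert j \<star> b) y) = (0 :: 'k pp)"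
   unfolding b vert_g ts(1,3) rho_ops(2)[OF xy(1) c] rho_vert T_vt_left
   by (simp add: z lin_0[OF tau_lin] tau_tens)
  show "tau n (tens x b (cl (vert j) \<cdot> y) - tens x (b \<star> vert j) y) = (0 :: 'k pp)"
   unfolding b g_vert ts(1,3) rho_ops(2)[OF c xy(3)] rho_vert T_vt_right
   by (simp add: z lin_0[OF tau_lin] tau_tens algebra_simps)
 qed
 have "tens_relations n <= {f. tau n f = (0 :: 'k pp)}"
 proof
  fix f :: "'k tens" assume f: "f : tens_relations n"
  have "tau n f = (0 :: 'k pp)"
   using f unfolding tens_relations_def mem_Collect_eq Un_iff
   apply -
   apply (elim disjE exE conjE)
   by (hypsubst, rule 1, assumption+)+
  thus "f : {f. tau n f = (0 :: 'k pp)}" by simp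
 qed
 moreover have "Modules.module.subspace scl {f. tau n f = (0 :: 'k pp)}"
  unfolding Modules.module.subspace_def[OF module_scl] by (simp add: lin_0[OF tau_lin] lin_add[OF tau_lin] lin_scl[OF tau_lin])
 ultimately have "U n <= {f. tau n f = (0 :: 'k pp)}"
  unfolding U_def by (rule Modules.module.span_minimal[OF module_scl])
 thus "f : U n ==> tau n f = 0" by blast
qed

lemma bimod_lin [simp]: "lin (%f. bimod x f y)" by (simp add: bimod_def)

lemma bimod_F: "f : F n ==> x : carrier A ==> y : carrier A ==> bimod x f y : F n"
proof -
 assume f: "f : F n" "x : carrier A" "y : carrier A"
 have "ks (bimod x f y) <= carrier A \<times> B n \<times> carrier A"
 proof (rule keys_lin[OF bimod_lin])
  fix s assume "s : ks f"
  then obtain u b v where s: "s = (u, b, v)" "u : carrier A" "b : B n" "v : carrier A" using f unfolding F_def by blast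
  thus "ks (bimod x (bs s) y) <= carrier A \<times> B n \<times> carrier A"
   using f A.m_closed by (simp add: bimod_def)
 qed
 thus ?thesis by (simp add: F_def)
qed

lemma tau_bimod: "f : F n ==> x : carrier A ==> y : carrier A ==> tau n (bimod x f y) = la (rho x) (ra (tau n f) (rho y))"
proof (rule lin_eqI[of "%f. tau n (bimod x f y)" "%f. la (rho x) (ra (tau n f) (rho y))"])
 fix s assume f: "f : F n" "x : carrier A" "y : carrier A" "s : ks f"
 obtain u r i v where s: "s = (u, g n r i, v)" "bs s = tens u (g n r i) v" "u : carrier A" "v : carrier A" "0 <= r" "r <= int n" "0 <= i" "i < M"
  by (rule F_keys[OF f(1,4)])
 have "bimod x (bs s) y = tens (x \<cdot> u) (g n r i) (v \<cdot> y)"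
  using s(5,6) by (simp add: bimod_def s(1) tens_def)
 thus "tau n (bimod x (bs s) y) = la (rho x) (ra (tau n (bs s)) (rho y))"
  unfolding s(2) by (simp add: tau_tens rho_ops s f)
qed (auto intro!: lin_compose[OF tau_lin] lin_la2 lin_ra1)

lemma powi_sg: "scl ((-1) powi k) x = sg k x" and pow_sg: "scl ((-1) ^ l) x = sg (int l) x"
 by (auto simp: sg_scl power_int_def minus_one_power_iff even_nat_iff)

lemma diff_gen_F: "diff_gen (Suc n) r i : F n"
proof -
 have c: "cl aa : carrier A" "cl bb : carrier A" by (simp_all add: cl_gens)
 show ?thesis unfolding diff_gen_def Let_def
  by (simp add: c F_ops F_sum A.nat_pow_closed)
qed

lemma tau_diff_gen: "tau n (diff_gen (Suc n) r i :: 'k::field tens) = bd (T (wd 0) (int n + 1 - r, r, i) (wd 0))"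
proof -
 define s where "s = int n + 1 - r"
 have t: "tau n (tens (kap x) (g n r' j) (kap y)) = T x (int n - r', r', j) y" for x y :: "'k vv" and r' j
  by (simp add: tau_tens rho_kap)
 have w: "wd (- 1) <> wd (2 * int (N - 1)) = (wd (1 - NN) :: 'k vv)" "wd 1 <> wd (- (2 * int (N - 1))) = (wd (NN - 1) :: 'k vv)"
  using N1 by (auto simp: wd_wd fits_def jn_def intro!: arg_cong[of _ _ wd])
 show ?thesis
 proof (cases "s = r")
  case False
  have e: "diff_gen (Suc n) r i = tens (kap (wd 0)) (g n r i) (kap (wd (ka s r)))
   + sg s (tens (kap (wd (ka s r))) (g n r (i + 1)) (kap (wd 0)))
   + sg s (tens (kap (wd (kb s r))) (g n (r - 1) (i - 1)) (kap (wd 0)))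
   + sg (int n + 1) (tens (kap (wd 0)) (g n (r - 1) i) (kap (wd (kb s r) :: 'k vv)))"
   unfolding diff_gen_def Let_def cl_gens kap_pow unfolding kap_mul[symmetric] kap_one[symmetric] w powi_sg pow_sg
   using False by (cases "s > r") (simp_all add: s_def sg_def ka_def kb_def)
  show ?thesis unfolding e s_def[symmetric] bd_ne[OF False]
   by (simp add: lin_add[OF tau_lin] sg_lin[OF tau_lin] t wd_00) (simp add: s_def algebra_simps)
 next
  case s: True
  hence 3: "int (Suc n) - 2 * r = 0" by (simp add: s_def)
  have w2: "wd 1 <> wd (- (2 * int (N - 1 - l))) = (wd (NN - 1 - 2 * int l) :: 'k vv)" "wd (2 * int l) <> wd 1 = (wd (2 * int l + 1) :: 'k vv)"
   "wd (- (2 * int l)) <> wd (- 1) = (wd (- 2 * int l - 1) :: 'k vv)" "wd (- 1) <> wd (2 * int (N - 1 - l)) = (wd (1 + 2 * int l - NN) :: 'k vv)"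
   if "l < N" for l
   using that by (auto simp: wd_wd fits_def jn_def of_nat_diff intro!: arg_cong[of _ _ wd])
  have w3: "wd (2 * int (N - 1 - l)) = (wd (NN - 2 - 2 * int l) :: 'k vv)" "wd (- (2 * int (N - 1 - l))) = (wd (2 + 2 * int l - NN) :: 'k vv)"
   if "l < N" for l
   using that by (auto simp: wd_wd fits_def jn_def of_nat_diff intro!: arg_cong[of _ _ wd])
  have p: "scl ((-1) ^ (Suc n div 2)) x = sg s x" for x :: "'k tens"
   unfolding pow_sg by (rule sg_parity) (use 3 s in presburger)
  have S: "{0..N - 1} = {..<N}" using N1 by auto
  have "diff_gen (Suc n) r i = (\<Sum>l<N. tens (kap (wd (- 2 * int l))) (g n r i) (kap (wd (NN - 1 - 2 * int l)))
   + sg s (tens (kap (wd (2 * int l + 1))) (g n r (i + 1)) (kap (wd (NN - 2 - 2 * int l))))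
   + sg s (tens (kap (wd (- 2 * int l - 1))) (g n (r - 1) (i - 1)) (kap (wd (2 + 2 * int l - NN))))
   + tens (kap (wd (2 * int l))) (g n (r - 1) i) (kap (wd (1 + 2 * int l - NN) :: 'k vv)))"
   (is "_ = ?S")
  proof -
   have "~ int (Suc n) - 2 * r > 0" "~ int (Suc n) - 2 * r < 0" using 3 by auto
   thus ?thesis
    unfolding diff_gen_def Let_def cl_gens kap_pow unfolding kap_mul[symmetric] p S
    by (simp only: if_False) (rule sum.cong, rule refl, simp only: lessThan_iff w2 diff_Suc_1, simp only: lessThan_iff w3 mult_minus_left)
  qed
  hence "tau n (diff_gen (Suc n) r i :: 'k tens) = tau n ?S" by simp
  moreover have rr: "int n - r = r - 1" "int n - (r - 1) = r" using 3 by auto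
  have "tau n ?S = bd (T (wd 0) (s, s, i) (wd 0))"
   unfolding bd_eq lin_sum[OF tau_lin]
   by (rule sum.cong) (simp_all add: lin_add[OF tau_lin] sg_lin[OF tau_lin] t wd_00 s rr)
  ultimately show ?thesis using s by (simp add: s_def)
 qed
qed

lemma diff_lin [simp]: "lin (diff n)" by (simp add: diff_def)

lemma diff_tens: "0 <= r ==> r <= int n ==> 0 <= i ==> i < M ==> diff n (bs (u, g n r i, v)) = bimod u (diff_gen n r i) (v :: 'a::field elt)"
 using idx_g[of r n i, where 'k = 'a] by (simp add: diff_def flip: idx_def)

lemma diff_F: "f : F (Suc n) ==> diff (Suc n) f : F n"
proof -
 assume f: "f : F (Suc n)"
 have "ks (diff (Suc n) f) <= carrier A \<times> B n \<times> carrier A"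
 proof (rule keys_lin[OF diff_lin])
  fix s assume k: "s : ks f"
  obtain u r i v where s: "s = (u, g (Suc n) r i, v)" "bs s = tens u (g (Suc n) r i) v" "u : carrier A" "v : carrier A" "0 <= r" "r <= int (Suc n)" "0 <= i" "i < M"
   by (rule F_keys[OF f k])
  have "diff (Suc n) (bs s) : F n"
   unfolding s(1) diff_tens[OF s(5-8)] by (rule bimod_F[OF diff_gen_F s(3,4)])
  thus "ks (diff (Suc n) (bs s)) <= carrier A \<times> B n \<times> carrier A" by (simp add: F_def)
 qed
 thus ?thesis by (simp add: F_def)
qed

lemma tau_diff: "f : F (Suc n) ==> tau n (diff (Suc n) f) = bd (tau (Suc n) f)"
proof (rule lin_eqI[of "%f. tau n (diff (Suc n) f)" "%f. bd (tau (Suc n) f)"])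
 fix s assume f: "f : F (Suc n)" "s : ks f"
 obtain u r i v where s: "s = (u, g (Suc n) r i, v)" "bs s = tens u (g (Suc n) r i) v" "u : carrier A" "v : carrier A" "0 <= r" "r <= int (Suc n)" "0 <= i" "i < M"
  by (rule F_keys[OF f])
 have "tau n (diff (Suc n) (bs s)) = bd (la (rho u) (ra (T (wd 0) (int n + 1 - r, r, i) (wd 0)) (rho v)))"
  unfolding s(1) diff_tens[OF s(5-8)] tau_bimod[OF diff_gen_F s(3,4)] tau_diff_gen bd_la bd_ra ..
 also have "la (rho u) (ra (T (wd 0) (int n + 1 - r, r, i) (wd 0)) (rho v)) = tau (Suc n) (bs s)"
  unfolding s(2) tau_tens by (simp add: add.commute)
 finally show "tau n (diff (Suc n) (bs s)) = bd (tau (Suc n) (bs s))" .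
qed (auto intro!: lin_compose[OF tau_lin] lin_bd)


section \<open>Cochains of the resolution as functions of the indices\<close>

definition xr :: "nat => ('k::field pathvec => 'k elt) => 'k gv" where
 "xr n x w = (case w of (s, r, i) => if s >= 0 & r >= 0 & s + r = int n then rho (x (g n r i)) else 0)"

lemma xr_simp: "xr n x (s, r, i) = (if s >= 0 & r >= 0 & s + r = int n then rho (x (g n r i)) else 0)"
 by (simp add: xr_def)

lemma cochainsD:
 assumes "x : cochains n" "0 <= r" "r <= int n"
 shows "x (g n r i) : carrier A" (is ?A) "cl (vert i) \<cdot> x (g n r i) = x (g n r i)" (is ?B) "x (g n r i) \<cdot> cl (vert (i + int n - 2 * r)) = x (g n r i)" (is ?C)
proof -
 have b: "g n r i : B n" by (rule g_B[OF assms(2,3)])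
 have x: "x : B n \<rightarrow> carrier A" using assms(1) unfolding cochains_def PiE_def by blast
 show ?A by (rule funcset_mem[OF x b])
 have "vert i \<star> g n r i = g n r i" "g n r i \<star> vert (i + int n - 2 * r) = g n r i" by (simp_all add: vert_g g_vert)
 thus ?B ?C
  using assms(1) b unfolding cochains_def by blast+
qed

lemma par_xr: "(x :: 'k::field pathvec => 'k elt) : cochains n ==> par (xr n x)"
 unfolding par_def
proof
 fix w :: gen assume x: "x : cochains n"
 obtain s r i where w: "w = (s, r, i)" by (cases w)
 show "xr n x (ng w) = xr n x w & vt (sr w) <> xr n x w = xr n x w & xr n x w <> vt (tg w) = xr n x w & (~ nn w --> xr n x w = 0)"
 proof (cases "s >= 0 & r >= 0 & s + r = int n")
  case True
  hence r: "0 <= r" "r <= int n" by auto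
  note d = cochainsD[OF x r, of i]
  have c: "cl (vert j) : carrier A" for j by (rule cl_carrier[OF arr_carrier(1)])
  have "vt i <> rho (x (g n r i)) = rho (x (g n r i))" "rho (x (g n r i)) <> vt (i + int n - 2 * r) = rho (x (g n r i))"
   using rho_ops(2)[OF c d(1), of i] rho_ops(2)[OF d(1) c, of "i + int n - 2 * r"] unfolding d(2,3) rho_vert by simp_all
  note a = this
  have "i + int n - 2 * r = i + s - r" using True by auto
  note a(1) a(2)[unfolded this]
  moreover have "g n r (i mod M) = (g n r i :: 'k pathvec)" using True by (auto intro: g_mod)
  ultimately show ?thesis using True by (simp add: w xr_simp)
 qed (auto simp: w xr_simp)
qed

text \<open>The hypothesis speaks of the restriction to \<open>B n\<close>, so that the lemma also
  covers \<open>cl\<close>, which defines the augmentation in \<open>comparison_map\<close>.\<close>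

lemma ext_px:
 fixes x :: "'k::field pathvec => 'k elt"
 assumes "restrict x (B n) : cochains n" "f : F n"
 shows "ext x f = kap (px (xr n x) (tau n f))"
proof -
 have "xr n (restrict x (B n)) w = xr n x w" for w
  by (cases w) (auto simp: xr_simp g_B)
 hence p: "par (xr n x)" using par_xr[OF assms(1)] by (metis ext)
 have "(case t of (u, b, v) => u \<cdot> x b \<cdot> v) = kap (px (xr n x) (tau n (bs t)))" if k: "t : ks f" for t
 proof -
  obtain u r i v where s: "t = (u, g n r i, v)" "bs t = tens u (g n r i) v" "u : carrier A" "v : carrier A" "0 <= r" "r <= int n" "0 <= i" "i < M"
   by (rule F_keys[OF assms(2) k])
  have c: "x (g n r i) : carrier A" using cochainsD(1)[OF assms(1) s(5,6), of i] g_B[OF s(5,6), where 'k = 'k] by simp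
  have "px (xr n x) (tau n (bs t)) = rho u <> rho (x (g n r i)) <> rho v"
   unfolding s(2) tau_tens px_T[OF p] using s(5,6) by (simp add: xr_simp)
  thus ?thesis using c s(3,4) by (simp add: s(1) kap_mul)
 qed
 hence "ext x f = (\<Oplus>\<^bsub>A\<^esub>t\<in>ks f. kap (scl (lk f t) (px (xr n x) (tau n (bs t)))))"
  unfolding ext_def by (intro A.finsum_cong') (simp_all add: sclA_kap)
 also have "... = kap (SUM t:ks f. scl (lk f t) (px (xr n x) (tau n (bs t))))"
  by (rule kap_sum) simp
 also have "(SUM t:ks f. scl (lk f t) (px (xr n x) (tau n (bs t)))) = px (xr n x) (tau n f)"
  by (rule lin_expand[symmetric]) (rule lin_compose[OF px_lin tau_lin])
 finally show ?thesis .
qed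

definition xb :: "nat => ('k::field gv) => 'k pathvec => 'k elt" where
 "xb n y = (\<lambda>b\<in>B n. kap (\<Sum>(r, i)\<in>idx n b. y (int n - r, r, i)))"

lemma xb_g: "par y ==> 0 <= r ==> r <= int n ==> xb n y (g n r i) = kap (y (int n - r, r, i))"
 using parD(1)[of y "(int n - r, r, i)"] by (simp add: xb_def g_B idx_g)

lemma xb_cochain: "par y ==> xb n y : cochains n"
proof -
 assume y: "par y"
 have "xb n y : B n \<rightarrow>\<^sub>E carrier A" by (auto simp: xb_def)
 moreover have "(vert j \<star> b = b --> cl (vert j) \<cdot> xb n y b = xb n y b) & (b \<star> vert j = b --> xb n y b \<cdot> cl (vert j) = xb n y b)"
  if b: "b : B n" for b j
 proof -
  obtain r i where b: "b = g n r i" "0 <= r" "r <= int n" using B_cases[OF b] by blast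
  have "vt j <> y (int n - r, r, i) = y (int n - r, r, i)" if "j mod M = i mod M"
  proof -
   have "sr (int n - r, r, i) = j mod M" using that by simp
   thus ?thesis using parD(2)[OF y, of "(int n - r, r, i)"] by (simp only: vt_mod)
  qed
  moreover have "y (int n - r, r, i) <> vt j = y (int n - r, r, i)" if "j mod M = (i + int n - 2 * r) mod M"
  proof -
   have "tg (int n - r, r, i) = j mod M" using that by (simp add: algebra_simps)
   thus ?thesis using parD(3)[OF y, of "(int n - r, r, i)"] by (simp only: vt_mod)
  qed
  ultimately show ?thesis
   unfolding b(1) xb_g[OF y b(2,3)] cl_gens(1) kap_mul[symmetric] vert_g g_vert using g_nz[OF b(2,3)] by metis
 qed
 ultimately show ?thesis unfolding cochains_def by blast
qed

lemma xr_xb: "par y ==> dgr w = int n ==> nn w ==> xr n (xb n y) w = y w"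
proof -
 assume y: "par y" "dgr w = int n" "nn w"
 obtain s r i where w: "w = (s, r, i)" by (cases w)
 hence "0 <= r" "r <= int n" "s = int n - r" "0 <= s" using y by auto
 thus ?thesis using y by (simp add: w xr_simp xb_g rho_kap par_wd_0)
qed

lemma xb_cong:
 assumes "!!w. dgr w = int n ==> nn w ==> ng w = w ==> y w = y' w"
 shows "xb n y = xb n y'"
 unfolding xb_def by (intro restrict_ext arg_cong[of _ _ kap] sum.cong refl) (use assms in \<open>auto simp: idx_def\<close>)

lemma codiff_xb: "x : cochains n ==> codiff n x = xb (Suc n) (cob (xr n x))"
proof -
 assume x: "x : cochains n"
 hence "restrict x (B n) = x" unfolding cochains_def by (auto simp: extensional_restrict)
 note e = ext_px[of x n, unfolded this, OF x]
 show ?thesis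
 proof
  fix b
  show "codiff n x b = xb (Suc n) (cob (xr n x)) b"
  proof (cases "b : B (Suc n)")
   case True
   then obtain r i where b: "b = g (Suc n) r i" "0 <= r" "r <= int (Suc n)" using B_cases by blast
   have f: "tens \<one>\<^bsub>A\<^esub> b \<one>\<^bsub>A\<^esub> : F (Suc n)" unfolding b by (rule F_ops(4)) simp_all
   have "codiff n x b = kap (px (xr n x) (tau n (diff (Suc n) (tens \<one>\<^bsub>A\<^esub> b \<one>\<^bsub>A\<^esub>))))"
    using True by (simp add: codiff_def e[OF diff_F[OF f]])
   also have "tau n (diff (Suc n) (tens \<one>\<^bsub>A\<^esub> b \<one>\<^bsub>A\<^esub>)) = bd (ow (int (Suc n) - r, r, i))"
    unfolding tau_diff[OF f] unfolding b tau_tens rho_one one_of_wd ..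
   finally show ?thesis unfolding cob_def[symmetric] b xb_g[OF cob_par[OF par_xr[OF x]] b(2,3)] .
  qed (simp add: codiff_def xb_def)
 qed
qed

lemma zero_xb: "zero_cochain n = xb n (%_. 0)"
 by (rule ext) (simp add: zero_cochain_def xb_def kap_0)

lemma xb_cocycle: "pcc (int n) y ==> xb n y : cocycles n"
proof -
 assume y: "pcc (int n) y"
 hence p: "par y" by (simp add: pcc_def)
 have "codiff n (xb n y) = xb (Suc n) (%_. 0)"
  unfolding codiff_xb[OF xb_cochain[OF p]]
 proof (rule xb_cong)
  fix w assume "dgr w = int (Suc n)"
  hence o: "ow w : PC (int n + 1)" by (intro one_of_PC) simp
  have "px (xr n (xb n y)) (bd (ow w)) = px y (bd (ow w))"
   by (rule px_cong[of _ "int n"]) (use bd_PC[OF o] xr_xb[OF p] in auto)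
  thus "cob (xr n (xb n y)) w = 0" using pcc_bd[OF y o] by (simp add: cob_def)
 qed
 thus ?thesis unfolding cocycles_def zero_xb using xb_cochain[OF p] by simp
qed

lemma HH_class_xr:
 assumes "par (y :: 'k::field gv)" "x : HH_class n (xb n y)"
 shows "x : cochains n" "case n of 0 => (ALL w. dgr w = 0 --> nn w --> xr n x w = y w)
  | Suc l => EX t. par t & (ALL w. dgr w = int n --> nn w --> xr n x w - y w = cob t w)" (is ?A)
proof -
 show x: "x : cochains n" using assms(2) unfolding HH_class_def by blast
 have cb: "(\<lambda>b\<in>B n. x b -A xb n y b) : coboundaries n" using assms(2) unfolding HH_class_def by blast
 have d: "rho ((\<lambda>b\<in>B n. x b -A xb n y b) (g n r i)) = xr n x (s, r, i) - y (s, r, i)"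
  if "0 <= r" "0 <= s" "s + r = int n" for s r i
 proof -
  have r: "r <= int n" "s = int n - r" using that by auto
  note c = cochainsD(1)[OF x that(1) r(1), of i] cochainsD(1)[OF xb_cochain[OF assms(1)] that(1) r(1), of i]
  show ?thesis using xr_xb[OF assms(1), of "(s, r, i)" n] that r(1)
   by (simp add: g_B rho_ops(3)[OF c] xr_simp)
 qed
 show ?A
 proof (cases n)
  case 0
  hence "(\<lambda>b\<in>B n. x b -A xb n y b) = zero_cochain n" using cb by (simp add: coboundaries_def)
  hence "rho ((\<lambda>b\<in>B n. x b -A xb n y b) (g n r i)) = (0 :: 'k vv)" if "0 <= r" "r <= int n" for r i
   using g_B[OF that, where 'k = 'k] by (simp only: zero_cochain_def restrict_apply if_True rho_zero)
  hence "xr n x (s, r, i) - y (s, r, i) = 0" if "0 <= r" "0 <= s" "s + r = int n" for s r i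
   using d[OF that] that by simp
  thus ?thesis using 0 by auto
 next
  case (Suc l)
  then obtain c where c: "c : cochains l" "(\<lambda>b\<in>B n. x b -A xb n y b) = codiff l c"
   using cb unfolding coboundaries_def by auto
  note p = par_xr[OF c(1)]
  have "xr n x (s, r, i) - y (s, r, i) = cob (xr l c) (s, r, i)" if "0 <= r" "0 <= s" "s + r = int n" for s r i
  proof -
   have r: "r <= int n" "s = int n - r" using that by auto
   show ?thesis
    using d[OF that, of i] xb_g[OF cob_par[OF p] that(1) r(1), of i] par_wd_0[OF cob_par[OF p]]
    unfolding c(2) codiff_xb[OF c(1)] Suc[symmetric] r(2) by (metis rho_kap)
  qed
  thus ?thesis using p Suc by auto
 qed
qed


subsection \<open>Bar cochains\<close>

definition fv :: "('k::field elt list => 'k elt) => 'k co" where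
 "fv f xs = rho (f (map kap xs))"

lemma tuples_kap: "map kap xs : tuples n <-> length xs = n"
 unfolding tuples_def mem_Collect_eq set_map using kap_carrier by (metis image_subsetI length_map)

lemma tuples_rho: "xs : tuples n ==> map kap (map rho xs) = xs" "xs : tuples n ==> length xs = n"
proof -
 assume "xs : tuples n"
 hence x: "set xs <= carrier A" "length xs = n" unfolding tuples_def by blast+
 show "length xs = n" by (rule x(2))
 have "kap (rho x) = x" if "x : set xs" for x by (rule kap_rho[OF subsetD[OF x(1) that]])
 thus "map kap (map rho xs) = xs" unfolding map_map by (intro map_idI) simp
qed

lemma tuples_append: "xs @ x # ys : tuples n <-> set xs <= carrier A & x : carrier A & set ys <= carrier A & length xs + length ys + 1 = n"
 unfolding tuples_def by simp blast

lemma bar_E: "f : bar_cochains n ==> f : tuples n \<rightarrow>\<^sub>E carrier A"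
 unfolding bar_cochains_def by blast

lemma bar_closed: "f : bar_cochains n ==> xs : tuples n ==> f xs : carrier A"
 by (rule PiE_mem[OF bar_E])

lemma fv_kap: "f : tuples n \<rightarrow>\<^sub>E carrier A ==> length xs = n ==> f (map kap xs) = kap (fv f xs)"
proof -
 assume f: "f : tuples n \<rightarrow>\<^sub>E carrier A" "length xs = n"
 have "f (map kap xs) : carrier A" by (rule PiE_mem[OF f(1)]) (simp only: tuples_kap f(2))
 thus ?thesis unfolding fv_def by (rule kap_rho[symmetric])
qed

lemma fv_wd_0: "f : tuples n \<rightarrow>\<^sub>E carrier A ==> length xs = n ==> fv f xs <> wd 0 = fv f xs"
proof -
 assume f: "f : tuples n \<rightarrow>\<^sub>E carrier A" "length xs = n"
 have "f (map kap xs) : carrier A" by (rule PiE_mem[OF f(1)]) (simp only: tuples_kap f(2))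
 thus ?thesis unfolding fv_def by (rule rho_wd_0)
qed

lemma mlin_fv: "f : bar_cochains n ==> mlin n (fv f :: 'k::field co)"
proof (rule mlinI)
 fix xs ys :: "'k vv list" assume f: "f : bar_cochains n" and l: "length xs + length ys + 1 = n"
 have t: "map kap xs @ kap x # map kap ys : tuples n" for x
  using tuples_kap[of "xs @ x # ys" n] l by simp
 have c: "f (map kap xs @ kap x # map kap ys) : carrier A" for x by (rule bar_closed[OF f t])
 have "f (map kap xs @ (kap x +A kap y) # map kap ys) = f (map kap xs @ kap x # map kap ys) +A f (map kap xs @ kap y # map kap ys)"
  "f (map kap xs @ sclA d (kap x) # map kap ys) = sclA d (f (map kap xs @ kap x # map kap ys))" for x y d
  using f t[of x] kap_carrier[of y] unfolding bar_cochains_def by blast+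
 thus "lin (%x. fv f (xs @ x # ys))"
  unfolding fv_def kap_add[symmetric] sclA_kap by (intro linI) (simp_all add: rho_ops(1)[OF c c] rho_ops(4)[OF c c])
qed

lemma barI: "f : tuples n \<rightarrow>\<^sub>E carrier A ==> mlin n (fv f :: 'k::field co) ==> f : bar_cochains n"
proof -
 assume f: "f : tuples n \<rightarrow>\<^sub>E carrier A" and m: "mlin n (fv f :: 'k co)"
 have "f (xs @ (x +A y) # ys) = f (xs @ x # ys) +A f (xs @ y # ys) & f (xs @ sclA d x # ys) = sclA d (f (xs @ x # ys))"
  if t: "xs @ x # ys : tuples n" and y: "y : carrier A" for xs ys x y d
 proof -
  have x: "x : carrier A" and l: "length (map rho xs) + length (map rho ys) + 1 = n"
   using t unfolding tuples_append by simp_all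
  have s: "kap (fv f (map rho xs @ v # map rho ys)) = f (xs @ kap v # ys)" for v
  proof -
   have "map kap (map rho (xs @ x # ys)) = xs @ x # ys" by (rule tuples_rho[OF t])
   hence "map kap (map rho xs @ v # map rho ys) = xs @ kap v # ys" by simp
   thus ?thesis using fv_kap[OF f, of "map rho xs @ v # map rho ys"] l by simp
  qed
  note L = mlin_slot[OF m l]
  note e = s[of "rho x + rho y", symmetric] s[of "scl d (rho x)", symmetric] s[of "rho x", symmetric] s[of "rho y", symmetric]
  show ?thesis
   using e unfolding lin_add[OF L] lin_scl[OF L] kap_add sclA_kap[symmetric] kap_rho[OF x] kap_rho[OF y] by (simp only: simp_thms)
 qed
 thus ?thesis unfolding bar_cochains_def using f by blast
qed

lemma kap_merge: "1 <= i ==> i < length xs ==> merge i (map kap xs) = map kap (mrg i xs)"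
 by (simp add: merge_def mrg_def take_map drop_map kap_mul)

lemma sclA_sgn: "sclA ((-1) ^ l) (kap x) = kap (sg (int l) x)" "sclA ((-1) powi k) (kap x) = kap (sg k x)"
 unfolding sclA_kap pow_sg powi_sg by (rule refl)+

text \<open>The multiplicatively closed set \<open>D\<close> allows \<open>f\<close> to be described
  by \<open>G\<close> on part of the arguments: the lemma is applied with all vectors and with those
  free of junk.\<close>

lemma codiff_kap:
 assumes "length xs = Suc n" and D: "!!x y. x : D ==> y : D ==> x <> y : D" "set xs <= D"
  and f: "!!ys. length ys = n ==> set ys <= D ==> f (map kap ys) = kap (G ys)"
 shows "bar_codiff n f (map kap xs) = kap (dl n G xs)"
proof -
 have ne: "xs ~= []" using assms(1) by auto
 have 1: "f (map kap (tl xs)) = kap (G (tl xs))" "f (map kap (butlast xs)) = kap (G (butlast xs))"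
  using assms(1) D(2) by (intro f; auto dest: in_set_butlastD list.set_sel(2)[OF ne])+
 have 2: "f (merge i (map kap xs)) = kap (G (mrg i xs))" if "i : {1..n}" for i
 proof -
  have "xs ! (i - 1) : D" "xs ! i : D" using that assms(1) D(2) by (auto intro!: subsetD[OF D(2)] nth_mem)
  hence "f (map kap (mrg i xs)) = kap (G (mrg i xs))"
   using that assms(1) D by (intro f) (auto simp: mrg_def dest!: in_set_takeD in_set_dropD)
  thus ?thesis using that assms(1) by (simp add: kap_merge)
 qed
 have "(\<Oplus>\<^bsub>A\<^esub>i\<in>{1..n}. sclA ((-1) ^ i) (f (merge i (map kap xs)))) = (\<Oplus>\<^bsub>A\<^esub>i\<in>{1..n}. kap (sg (int i) (G (mrg i xs))))"
  by (intro A.finsum_cong') (simp_all add: 2 sclA_sgn)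
 also have "... = kap (SUM i:{1..n}. sg (int i) (G (mrg i xs)))" by (rule kap_sum) simp
 finally have 3: "(\<Oplus>\<^bsub>A\<^esub>i\<in>{1..n}. sclA ((-1) ^ i) (f (merge i (map kap xs)))) = kap (SUM i:{1..n}. sg (int i) (G (mrg i xs)))" .
 have "map kap xs : tuples (Suc n)" using tuples_kap assms(1) by blast
 hence "bar_codiff n f (map kap xs) = hd (map kap xs) \<cdot> f (tl (map kap xs))
  \<oplus>\<^bsub>A\<^esub> (\<Oplus>\<^bsub>A\<^esub>i\<in>{1..n}. sclA ((-1) ^ i) (f (merge i (map kap xs))))
  \<oplus>\<^bsub>A\<^esub> sclA ((-1) ^ Suc n) (f (butlast (map kap xs)) \<cdot> last (map kap xs))"
  by (simp only: bar_codiff_def restrict_apply if_True)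
 also have "... = kap (hd xs <> G (tl xs)) +A kap (SUM i:{1..n}. sg (int i) (G (mrg i xs))) +A kap (sg (int (Suc n)) (G (butlast xs) <> last xs))"
  unfolding 3 hd_map[OF ne] last_map[OF ne] map_tl[symmetric] map_butlast[symmetric] 1 kap_mul[symmetric] sclA_sgn ..
 finally show ?thesis unfolding kap_add[symmetric] del_def dp_sum[OF assms(1)] by (simp add: add.commute algebra_simps)
qed

lemma fv_diff:
 assumes "f : bar_cochains n" "h : bar_cochains n" "length xs = n"
 shows "h (map kap xs) -A f (map kap xs) = kap (fv h xs - fv f xs)"
 unfolding fv_kap[OF bar_E[OF assms(1)] assms(3)] fv_kap[OF bar_E[OF assms(2)] assms(3)] kap_diff ..

lemma restrict_eq_iff: "restrict f S = restrict h S <-> (ALL x:S. f x = h x)"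
 by (metis restrict_apply' restrict_ext)

lemma coh_bar_class:
 fixes f h :: "'k::field elt list => 'k elt"
 assumes f: "f : bar_cochains n" and h: "h : bar_cochains n"
 shows "h : bar_class n f <-> coh n (fv h) (fv f)"
proof -
 have fw: "fv f xs <> wd 0 = fv f xs" "fv h xs <> wd 0 = fv h xs" if "length xs = n" for xs
  using fv_wd_0[OF bar_E[OF f] that] fv_wd_0[OF bar_E[OF h] that] .
 have e: "h : bar_class n f <-> (\<lambda>xs\<in>tuples n. h xs -A f xs) : bar_coboundaries n"
  using h unfolding bar_class_def by blast
 show ?thesis
 proof (cases n)
  case 0
  have "tuples 0 = {[] :: 'k elt list}" unfolding tuples_def by auto
  hence "h : bar_class n f <-> h [] -A f [] = \<zero>\<^bsub>A\<^esub>"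
   unfolding e by (simp only: 0 bar_coboundaries_def nat.case singleton_iff restrict_eq_iff) simp
  also have "... <-> fv h [] - fv f [] = (0 :: 'k vv)"
   using fv_diff[OF f h, of "[]"] 0 fw[of "[]"] by (simp add: kap_eq mul_diff_left flip: kap_0)
  finally show ?thesis by (simp add: 0 coh_def)
 next
  case (Suc l)
  have "h : bar_class n f <-> (EX t:bar_cochains l. ALL xs:tuples n. h xs -A f xs = bar_codiff l t xs)"
  proof -
   have c: "restrict (bar_codiff l t) (tuples n) = bar_codiff l t" for t :: "'k elt list => 'k elt"
    unfolding bar_codiff_def Suc restrict_restrict Int_absorb by (rule refl)
   have r: "restrict u (tuples n) = bar_codiff l t <-> (ALL xs:tuples n. u xs = bar_codiff l t xs)" for u t :: "'k elt list => 'k elt"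
    by (subst c[symmetric]) (rule restrict_eq_iff)
   have cb: "bar_coboundaries n = bar_codiff l ` (bar_cochains l :: ('k elt list => 'k elt) set)"
    by (simp only: Suc bar_coboundaries_def nat.case)
   show ?thesis unfolding e cb image_iff r ..
  qed
  also have "... <-> coh n (fv h) (fv f)"
  proof
   assume "EX t:bar_cochains l. ALL xs:tuples n. h xs -A f xs = bar_codiff l t xs"
   then obtain t where t: "t : bar_cochains l" "!!xs. xs : tuples n ==> h xs -A f xs = bar_codiff l t xs" by blast
   show "coh n (fv h) (fv f)"
    unfolding Suc
   proof (rule cohI[OF mlin_fv[OF t(1)]])
    fix xs :: "'k vv list" assume l: "length xs = Suc l"
    have "kap (fv h xs - fv f xs) = bar_codiff l t (map kap xs)"
     using t(2)[of "map kap xs"] fv_diff[OF f h, of xs] l Suc tuples_kap by metis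
    also have "... = kap (dl l (fv t) xs)"
     by (rule codiff_kap[OF l, of UNIV]) (rule UNIV_I subset_UNIV | erule fv_kap[OF bar_E[OF t(1)]])+
    finally have "(fv h xs - fv f xs) <> wd 0 = dl l (fv t) xs <> wd 0" unfolding kap_eq .
    moreover have "dl l (fv t) xs <> wd 0 = dl l (fv t) xs"
    proof -
     have "dl l (fv t) xs <> wd 0 = dl l (%ys. fv t ys <> wd 0) xs"
      by (rule del_hom) (simp_all add: mul_assoc, metis mul_wd0_comm)
     also have "... = dl l (fv t) xs"
      by (rule del_cong[OF _ l]) (rule fv_wd_0[OF bar_E[OF t(1)]])
     finally show ?thesis .
    qed
    ultimately show "fv h xs - fv f xs = dl l (fv t) xs" using fw[of xs] l Suc by (simp add: mul_diff_left)
   qed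
  next
   assume "coh n (fv h) (fv f)"
   then obtain t where t: "mlin l t" "!!xs. length xs = n ==> fv h xs - fv f xs = dl l t xs" unfolding coh_def Suc by auto
   \<comment> \<open>The cobounding map is carried to \<open>A\<close> through \<open>rho\<close>,
     whose values are free of junk; on such arguments it agrees with \<open>t\<close>.\<close>
   define kb where "kb = (\<lambda>xs\<in>tuples l. kap (t (map rho xs)))"
   have kE: "kb : tuples l \<rightarrow>\<^sub>E carrier A" by (simp add: kb_def)
   have kb: "kb (map kap ys) = kap (t (map (%y. y <> wd 0) ys))" if "length ys = l" for ys
    using tuples_kap[of ys l] that by (simp add: kb_def rho_kap comp_def)
   have "mlin l (%ys. t (map (%y. y <> wd 0) ys) <> wd 0)"
   proof (rule mlinI)
    fix xs ys :: "'k vv list" assume "length xs + length ys + 1 = l"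
    hence "lin (%x. t (map (%y. y <> wd 0) xs @ x # map (%y. y <> wd 0) ys))" by (intro mlin_slot[OF t(1)]) simp
    from lin_compose[OF lin_mul1[OF this] mul_lin1] show "lin (%x. t (map (%y. y <> wd 0) (xs @ x # ys)) <> wd 0)" by simp
   qed
   hence "mlin l (fv kb)"
    by (subst mlin_cong[of l _ "%ys. t (map (%y. y <> wd 0) ys) <> wd 0"]) (simp_all add: fv_def kb rho_kap)
   hence k: "kb : bar_cochains l" by (rule barI[OF kE])
   have "h xs -A f xs = bar_codiff l kb xs" if xs: "xs : tuples n" for xs
   proof -
    note r = tuples_rho[OF xs]
    have s: "set (map rho xs) <= {y. y <> wd 0 = y}"
     using xs rho_wd_0 unfolding tuples_def by auto
    have "bar_codiff l kb (map kap (map rho xs)) = kap (dl l t (map rho xs))"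
    proof (rule codiff_kap[OF _ _ s])
     show "length (map rho xs) = Suc l" using r(2) Suc by simp
     fix ys :: "'k vv list" assume y: "length ys = l" "set ys <= {y. y <> wd 0 = y}"
     hence "map (%y. y <> wd 0) ys = ys" by (intro map_idI) auto
     thus "kb (map kap ys) = kap (t ys)" using kb[OF y(1)] by simp
    qed (simp add: mul_assoc)
    also have "dl l t (map rho xs) = fv h (map rho xs) - fv f (map rho xs)" using t(2) r(2) by simp
    also have "kap ... = h (map kap (map rho xs)) -A f (map kap (map rho xs))"
     using fv_diff[OF f h, of "map rho xs"] r(2) by simp
    finally show ?thesis unfolding r(1) ..
   qed
   thus "EX t:bar_cochains l. ALL xs:tuples n. h xs -A f xs = bar_codiff l t xs" using k by blast
  qed
  finally show ?thesis .
 qed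
qed


lemma gcirc_kap:
 assumes f: "f : tuples n \<rightarrow>\<^sub>E carrier A" and h: "h : tuples q \<rightarrow>\<^sub>E carrier A" and l: "length xs = n + q - 1"
 shows "gcirc n q f h (map kap xs) = kap (cp n q (fv f) (fv h) (xs :: 'k::field vv list))"
proof -
 have 1: "f (take (i - 1) (map kap xs) @ h (take q (drop (i - 1) (map kap xs))) # drop (i - 1 + q) (map kap xs))
  = kap (fv f (take (i - 1) xs @ fv h (take q (drop (i - 1) xs)) # drop (i - 1 + q) xs))" if "i : {1..n}" for i
 proof -
  have "h (map kap (take q (drop (i - 1) xs))) = kap (fv h (take q (drop (i - 1) xs)))"
   by (rule fv_kap[OF h]) (use that l in auto)
  moreover have "f (map kap (take (i - 1) xs @ fv h (take q (drop (i - 1) xs)) # drop (i - 1 + q) xs))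
   = kap (fv f (take (i - 1) xs @ fv h (take q (drop (i - 1) xs)) # drop (i - 1 + q) xs))"
   by (rule fv_kap[OF f]) (use that l in auto)
  ultimately show ?thesis by (simp add: take_map drop_map)
 qed
 have s: "sclA ((-1) powi ((int q - 1) * (int i - 1))) (kap z) = kap (sg ((int q + 1) * (int i - 1)) z)" for i and z :: "'k vv"
  unfolding sclA_sgn by (rule arg_cong[of _ _ kap], rule sg_parity) simp
 have "map kap xs : tuples (n + q - 1)" using tuples_kap l by blast
 hence "gcirc n q f h (map kap xs) = (\<Oplus>\<^bsub>A\<^esub>i\<in>{1..n}. sclA ((-1) powi ((int q - 1) * (int i - 1)))
   (f (take (i - 1) (map kap xs) @ h (take q (drop (i - 1) (map kap xs))) # drop (i - 1 + q) (map kap xs))))"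
  by (simp only: gcirc_def restrict_apply if_True)
 also have "... = (\<Oplus>\<^bsub>A\<^esub>i\<in>{1..n}. kap (sg ((int q + 1) * (int i - 1)) (fv f (take (i - 1) xs @ fv h (take q (drop (i - 1) xs)) # drop (i - 1 + q) xs))))"
  by (rule A.finsum_cong') (rule refl, rule Pi_I, rule kap_carrier, simp only: 1 s)
 also have "... = kap (cp n q (fv f) (fv h) xs)"
 proof (cases "n = 0")
  case True
  thus ?thesis by (simp only: kap_sum finite_atLeastAtMost) simp
 next
  case False
  hence "length xs + 1 = n + q" using l by simp
  thus ?thesis unfolding kap_sum[OF finite_atLeastAtMost] by (simp only: cp_sum)
 qed
 finally show ?thesis .
qed

lemma cp_wd_0: "f : tuples n \<rightarrow>\<^sub>E carrier A ==> length xs = n + q - 1 ==> cp n q (fv f) h xs <> wd 0 = cp n q (fv f) (h :: 'k::field co) xs"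
proof -
 assume f: "f : tuples n \<rightarrow>\<^sub>E carrier A" and l: "length xs = n + q - 1"
 have "fv f (take (i - 1) xs @ h (take q (drop (i - 1) xs)) # drop (i - 1 + q) xs) <> wd 0
  = fv f (take (i - 1) xs @ h (take q (drop (i - 1) xs)) # drop (i - 1 + q) xs)" if "i : {1..n}" for i
  by (rule fv_wd_0[OF f]) (use that l in auto)
 moreover have "n > 0 ==> length xs + 1 = n + q" using l by simp
 ultimately show ?thesis by (cases "n = 0") (simp_all add: cp_sum mul_sum_left mul_sg_left)
qed

lemma gbracket_bar:
 assumes f: "f : bar_cochains n" and h: "h : bar_cochains q"
 shows "gbracket n q f h : bar_cochains (n + q - 1)" (is ?A)
  "length xs = n + q - 1 ==> fv (gbracket n q f h) xs = br n q (fv f) (fv h) (xs :: 'k::field vv list)"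
proof -
 note fE = bar_E[OF f] and hE = bar_E[OF h]
 have k: "gbracket n q f h (map kap xs) = kap (br n q (fv f) (fv h) xs)" if l: "length xs = n + q - 1" for xs :: "'k vv list"
 proof -
  have t: "map kap xs : tuples (n + q - 1)" using tuples_kap l by blast
  have l': "length xs = q + n - 1" using l by auto
  have "sg ((int n - 1) * (int q - 1)) z = sg ((int n + 1) * (int q + 1)) z" for z :: "'k vv" by (rule sg_parity) simp
  thus ?thesis using t unfolding gbracket_def restrict_apply gcirc_kap[OF fE hE l] gcirc_kap[OF hE fE l'] sclA_sgn kap_diff br_def
   by (simp only: if_True)
 qed
 have w: "br n q (fv f) (fv h) xs <> wd 0 = br n q (fv f) (fv h) xs" if l: "length xs = n + q - 1" for xs :: "'k vv list"
  using cp_wd_0[OF fE, of xs q "fv h"] cp_wd_0[OF hE, of xs n "fv f"] l by (simp add: br_def mul_diff_left mul_sg_left)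
 show e: "fv (gbracket n q f h) xs = br n q (fv f) (fv h) xs" if "length xs = n + q - 1" for xs :: "'k vv list"
  unfolding fv_def[of "gbracket n q f h"] k[OF that] rho_kap by (rule w[OF that])
 have "gbracket n q f h : tuples (n + q - 1) \<rightarrow>\<^sub>E carrier A"
 proof (rule PiE_I)
  fix zs :: "'k elt list" assume z: "zs : tuples (n + q - 1)"
  hence "gbracket n q f h (map kap (map rho zs)) : carrier A"
   using k[of "map rho zs"] tuples_rho(2)[OF z] kap_carrier by simp
  thus "gbracket n q f h zs : carrier A" unfolding tuples_rho(1)[OF z] .
 qed (simp add: gbracket_def)
 moreover have "mlin (n + q - 1) (fv (gbracket n q f h) :: 'k co)"
  using mlin_br[OF mlin_fv[OF f] mlin_fv[OF h], of "n + q - 1"]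
  by (cases "n + q = 0") (simp, subst mlin_cong[OF e], auto)
 ultimately show ?A by (rule barI)
qed

subsection \<open>Comparison maps\<close>

definition Psi :: "(nat => 'k::field elt list => 'k tens) => 'k fam" where
 "Psi \<Phi> n xs = tau n (\<Phi> n (map kap xs))"

lemma wd_0_PC: "z : PC n ==> la (wd 0) z = z" "z : PC n ==> ra z (wd 0) = z"
 by (rule PC_eqI[of z n "la (wd 0)" "%z. z"] PC_eqI[of z n "%z. ra z (wd 0)" "%z. z"]; simp)+

lemma la_wd_0: "z : PC n ==> la (x <> wd 0) z = la x z" "z : PC n ==> ra z (x <> wd 0) = ra z x"
 using bimP(5)[of x "wd 0" z] wd_0_PC[of z n] bimP(6)[of z "wd 0" x] by (simp_all add: mul_wd0_comm[of x])

context
 fixes \<Phi> :: "nat => 'k::field elt list => 'k tens"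
 assumes cm: "comparison_map \<Phi>"
begin

lemma Phi_F: "xs : tuples n ==> \<Phi> n xs : F n"
 using cm unfolding comparison_map_def by blast

lemma Phi_aug: "ext cl (\<Phi> 0 []) = \<one>\<^bsub>A\<^esub>"
 using cm unfolding comparison_map_def by blast

lemma Phi_add: "xs @ x # ys : tuples n ==> y : carrier A ==> \<Phi> n (xs @ (x +A y) # ys) - (\<Phi> n (xs @ x # ys) + \<Phi> n (xs @ y # ys)) : U n" (is "PROP ?A")
 and Phi_scl: "xs @ x # ys : tuples n ==> \<Phi> n (xs @ sclA c x # ys) - scl c (\<Phi> n (xs @ x # ys)) : U n" (is "PROP ?B")
proof -
 have a: "ALL n xs ys x y c. xs @ x # ys : tuples n & y : carrier A -->
    \<Phi> n (xs @ (x +A y) # ys) - (\<Phi> n (xs @ x # ys) + \<Phi> n (xs @ y # ys)) : U n &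
    \<Phi> n (xs @ sclA c x # ys) - scl c (\<Phi> n (xs @ x # ys)) : U n"
  using cm unfolding comparison_map_def by (elim conjE)
 show "PROP ?A"
  using a[rule_format, OF conjI] by blast
 show "PROP ?B"
  using a[rule_format, OF conjI[OF _ A.zero_closed]] by blast
qed

lemma Phi_diff: "xs : tuples (Suc n) ==> - diff (Suc n) (\<Phi> (Suc n) xs)
    - (bimod (hd xs) (\<Phi> n (tl xs)) \<one>\<^bsub>A\<^esub>
     + (SUM i:{1..n}. scl ((-1) ^ i) (\<Phi> n (merge i xs)))
     + scl ((-1) ^ Suc n) (bimod \<one>\<^bsub>A\<^esub> (\<Phi> n (butlast xs)) (last xs))) : U n"
 using cm unfolding comparison_map_def by (elim conjE) (erule allE, erule bspec)

lemma mlin_Psi: "mlin n (Psi \<Phi> n)"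
proof (rule mlinI)
 fix xs ys :: "'k vv list" assume l: "length xs + length ys + 1 = n"
 have t: "map kap xs @ kap x # map kap ys : tuples n" for x
  using tuples_kap[of "xs @ x # ys" n] l by simp
 have "tau n (\<Phi> n (map kap xs @ (kap x +A kap y) # map kap ys)) = tau n (\<Phi> n (map kap xs @ kap x # map kap ys)) + tau n (\<Phi> n (map kap xs @ kap y # map kap ys))"
  "tau n (\<Phi> n (map kap xs @ sclA c (kap x) # map kap ys)) = scl c (tau n (\<Phi> n (map kap xs @ kap x # map kap ys)))" for x y c
  using tau_U[OF Phi_add[OF t kap_carrier]] tau_U[OF Phi_scl[OF t]]
  by (simp_all add: lin_diff[OF tau_lin] lin_add[OF tau_lin] lin_scl[OF tau_lin])
 thus "lin (%x. Psi \<Phi> n (xs @ x # ys))"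
  unfolding Psi_def kap_add[symmetric] sclA_kap by (intro linI) (simp_all only: list.map map_append)
qed

lemma Psi_bd:
 assumes l: "length xs = Suc n"
 shows "bd (Psi \<Phi> (Suc n) xs) = - del la ra n (Psi \<Phi> n) xs"
proof -
 have ne: "xs ~= []" using l by auto
 have neg: "- a - b = 0 ==> a = - b" for a b :: "'k pp" by (metis add.inverse_inverse right_minus_eq)
 have t: "map kap xs : tuples (Suc n)" "map kap (tl xs) : tuples n" "map kap (butlast xs) : tuples n"
  unfolding tuples_kap using l by simp_all
 have m: "\<Phi> n (merge i (map kap xs)) = \<Phi> n (map kap (mrg i xs))" if "i : {1..n}" for i
  using that l by (simp add: kap_merge)
 have S: "(SUM i:{1..n}. scl ((-1) ^ i) (\<Phi> n (merge i (map kap xs)))) = (SUM i:{1..n}. sg (int i) (\<Phi> n (map kap (mrg i xs))))"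
  by (rule sum.cong) (simp_all only: m pow_sg)
 have P: "Psi \<Phi> n ys : PC (int n)" for ys unfolding Psi_def by (rule tau_PC)
 have b: "tau n (bimod (kap x) (\<Phi> n (map kap ys)) (kap y)) = la x (ra (Psi \<Phi> n ys) y)" if "length ys = n" for x y ys
  unfolding tau_bimod[OF Phi_F[OF tuples_kap[THEN iffD2, OF that]] kap_carrier kap_carrier] rho_kap
   Psi_def[symmetric] la_wd_0(2)[OF P] la_wd_0(1)[OF ra_PC[OF P]] ..
 have "tau n (- diff (Suc n) (\<Phi> (Suc n) (map kap xs))
    - (bimod (hd (map kap xs)) (\<Phi> n (tl (map kap xs))) \<one>\<^bsub>A\<^esub>
     + (SUM i:{1..n}. scl ((-1) ^ i) (\<Phi> n (merge i (map kap xs))))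
     + scl ((-1) ^ Suc n) (bimod \<one>\<^bsub>A\<^esub> (\<Phi> n (butlast (map kap xs))) (last (map kap xs))))) = 0"
  by (rule tau_U[OF Phi_diff[OF t(1)]])
 hence "- bd (Psi \<Phi> (Suc n) xs) - (la (hd xs) (Psi \<Phi> n (tl xs)) + (SUM i:{1..n}. sg (int i) (Psi \<Phi> n (mrg i xs)))
   + sg (int (Suc n)) (ra (Psi \<Phi> n (butlast xs)) (last xs))) = 0"
  unfolding S unfolding pow_sg lin_diff[OF tau_lin] lin_minus[OF tau_lin] lin_add[OF tau_lin] lin_sum[OF tau_lin] sg_lin[OF tau_lin]
   tau_diff[OF Phi_F[OF t(1)]] hd_map[OF ne] last_map[OF ne] map_tl[symmetric] map_butlast[symmetric] kap_one[symmetric]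
  using l by (simp add: b wd_0_PC[OF P] wd_0_PC(1)[OF ra_PC[OF P]] wd_0_PC(2)[OF P] Psi_def[symmetric])
 hence "bd (Psi \<Phi> (Suc n) xs) = - (la (hd xs) (Psi \<Phi> n (tl xs)) + (SUM i:{1..n}. sg (int i) (Psi \<Phi> n (mrg i xs)))
   + sg (int (Suc n)) (ra (Psi \<Phi> n (butlast xs)) (last xs)))"
  by (rule neg)
 thus ?thesis unfolding del_def dp_sum[OF l] by (simp add: algebra_simps)
qed

lemma Psi_aug: "aug (Psi \<Phi> 0 []) = wd 0"
proof -
 \<comment> \<open>The augmentation is induced by the 0-cochain sending each generator to its
   vertex; in this form \<open>ext_px\<close> applies.\<close>
 define y :: "'k gv" where "y w = (if dgr w = 0 & nn w then vt (sr w) else 0)" for w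
 have p: "par y"
  unfolding par_def
 proof
  fix w :: gen
  show "y (ng w) = y w & vt (sr w) <> y w = y w & y w <> vt (tg w) = y w & (~ nn w --> y w = 0)"
  proof (cases "dgr w = 0 & nn w")
   case True
   then obtain i where "w = (0, 0, i)" by (cases w) auto
   thus ?thesis by (simp add: y_def)
  qed (auto simp: y_def)
 qed
 have m: "restrict cl (B 0) = xb 0 y"
 proof
  fix b :: "'k pathvec"
  show "restrict cl (B 0) b = xb 0 y b"
  proof (cases "b : B 0")
   case True
   then obtain r i where b: "b = g 0 r i" "0 <= r" "r <= int 0" using B_cases by blast
   hence r: "r = 0" by simp
   show ?thesis using True xb_g[OF p b(2,3), of i] unfolding b(1) r by (simp add: y_def cl_gens(1))
  qed (simp add: xb_def)
 qed
 have c: "restrict cl (B 0) : (cochains 0 :: ('k pathvec => 'k elt) set)" unfolding m by (rule xb_cochain[OF p])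
 have t: "[] : tuples 0" unfolding tuples_def by simp
 have P: "Psi \<Phi> 0 [] : PC 0" unfolding Psi_def using tau_PC[of 0] by simp
 have "xr 0 cl w = xr 0 (restrict (cl :: 'k pathvec => 'k elt) (B 0)) w" for w
  by (cases w) (simp add: xr_simp g_B del: g.simps)
 hence "px (xr 0 cl) (Psi \<Phi> 0 []) = px y (Psi \<Phi> 0 [])"
  by (intro px_cong[OF P]) (simp add: m xr_xb[OF p])
 also have y: "px y (Psi \<Phi> 0 []) = aug (Psi \<Phi> 0 [])"
 proof (rule PC_eqI[OF P px_lin aug_lin])
  fix u w v assume w: "dgr w = 0" "okk u w v"
  obtain s r i where e: "w = (s, r, i)" by (cases w)
  hence "s = 0" "r = 0" using w by (auto simp: okk_def)
  thus "px y (T (bs u) w (bs v)) = aug (T (bs u) w (bs v))" by (simp add: e px_T[OF p] aug_T y_def)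
 qed
 finally have "kap (aug (Psi \<Phi> 0 [])) = kap (wd 0)"
  using ext_px[OF c Phi_F[OF t]] Phi_aug unfolding kap_one Psi_def by simp
 hence "aug (Psi \<Phi> 0 []) <> wd 0 = wd 0" unfolding kap_eq wd_00 .
 moreover have "aug (Psi \<Phi> 0 []) <> wd 0 = aug (Psi \<Phi> 0 [])"
  unfolding y[symmetric] px_ra[OF p, symmetric] wd_0_PC(2)[OF P] ..
 ultimately show ?thesis by simp
qed

lemma cmap_Psi: "cmap (Psi \<Phi>)"
 unfolding cmap_def using mlin_Psi Psi_bd Psi_aug tau_PC by (auto simp: Psi_def)

lemma HH_class_refl: "par y ==> xb n y : HH_class n (xb n (y :: 'k gv))"
proof -
 assume y: "par y"
 note c = xb_cochain[OF y, of n]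
 have "(\<lambda>b\<in>B n. xb n y b -A xb n y b) = zero_cochain n"
  unfolding zero_cochain_def by (rule restrict_ext) (simp add: xb_def kap_diff kap_0)
 also have "... : coboundaries n"
 proof (cases n)
  case (Suc l)
  have p: "par (%_. 0 :: 'k vv)" by (simp add: par_def)
  have "xr l (xb l (%_. 0 :: 'k vv)) w = 0" for w
   by (cases w) (simp add: xr_simp xb_g[OF p] rho_kap)
  hence "cob (xr l (xb l (%_. 0 :: 'k vv))) = (%_. 0)" unfolding cob_def by (intro ext px_zero) simp
  hence "zero_cochain n = codiff l (xb l (%_. 0 :: 'k vv))"
   unfolding codiff_xb[OF xb_cochain[OF p]] zero_xb Suc by simp
  thus ?thesis using xb_cochain[OF p, of l] unfolding coboundaries_def Suc by simp
 qed (simp add: coboundaries_def)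
 finally show ?thesis using c unfolding HH_class_def by blast
qed

text \<open>The image of a class is a full bar class and nonempty. Both facts enter because
  \<open>bracket_is\<close> compares sets that are unions over representatives.\<close>

lemma to_bar_iff:
 assumes y: "pcc (int n) y"
 shows "f : to_bar \<Phi> n (HH_class n (xb n y)) <-> f : bar_cochains n & coh n (fv f) (pb (Psi \<Phi>) n y)" (is ?A)
  "to_bar \<Phi> n (HH_class n (xb n y)) ~= {}" (is ?B)
proof -
 have p: "par y" using y by (simp add: pcc_def)
 define bx where "bx x = (\<lambda>xs\<in>tuples n. ext x (\<Phi> n xs))" for x
 have fb: "fv (bx x) xs = px (xr n x) (Psi \<Phi> n xs)" if x: "x : cochains n" and l: "length xs = n" for x xs
 proof -
  have t: "map kap xs : tuples n" using tuples_kap l by blast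
  have r: "restrict x (B n) : cochains n" using x unfolding cochains_def by (auto simp: extensional_restrict)
  have "fv (bx x) xs = rho (ext x (\<Phi> n (map kap xs)))" using t unfolding fv_def bx_def restrict_apply by (simp only: if_True)
  also have "... = px (xr n x) (tau n (\<Phi> n (map kap xs))) <> wd 0"
   unfolding ext_px[OF r Phi_F[OF t]] rho_kap ..
  also have "... = px (xr n x) (Psi \<Phi> n xs)"
   unfolding px_ra[OF par_xr[OF x], symmetric] wd_0_PC(2)[OF tau_PC] Psi_def ..
  finally show ?thesis .
 qed
 have bb: "bx x : bar_cochains n" if x: "x : cochains n" for x
 proof (rule barI)
  have r: "restrict x (B n) : cochains n" using x unfolding cochains_def by (auto simp: extensional_restrict)
  show "bx x : tuples n \<rightarrow>\<^sub>E carrier A"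
   unfolding bx_def by (rule restrict_PiE_iff[THEN iffD2], rule ballI) (simp only: ext_px[OF r Phi_F] kap_carrier)
  show "mlin n (fv (bx x))" using mlin_pb[OF cmap_Psi, of n "xr n x"] by (subst mlin_cong[OF fb[OF x]])
 qed
 have cx: "coh n (fv (bx x)) (pb (Psi \<Phi>) n y)" if x: "x : HH_class n (xb n y)" for x
 proof (rule coh_trans[OF coh_eqI])
  note h = HH_class_xr[OF p x]
  show "fv (bx x) xs = pb (Psi \<Phi>) n (xr n x) xs" if "length xs = n" for xs by (rule fb[OF h(1) that])
  show "coh n (pb (Psi \<Phi>) n (xr n x)) (pb (Psi \<Phi>) n y)"
  proof (cases n)
   case 0
   have "px (xr n x) (Psi \<Phi> n xs) = px y (Psi \<Phi> n xs)" for xs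
    by (rule px_cong[OF cmapD(2)[OF cmap_Psi]]) (use h(2) 0 in auto)
   thus ?thesis by (intro coh_eqI)
  next
   case (Suc l)
   then obtain t where t: "par t" "!!w. dgr w = int n ==> nn w ==> xr n x w - y w = cob t w" using h(2) by auto
   show ?thesis using coh_pb[OF cmap_Psi t(1), of l "xr n x" y] t(2) unfolding Suc by blast
  qed
 qed
 have i: "f : to_bar \<Phi> n (HH_class n (xb n y)) <-> f : bar_cochains n & coh n (fv f) (pb (Psi \<Phi>) n y)" for f
 proof -
  have "f : to_bar \<Phi> n (HH_class n (xb n y)) <-> (EX x:HH_class n (xb n y). f : bar_class n (bx x))"
   unfolding to_bar_def bx_def by blast
  also have "... <-> (EX x:HH_class n (xb n y). f : bar_cochains n & coh n (fv f) (fv (bx x)))"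
  proof (rule bex_cong[OF refl])
   fix x assume "x : HH_class n (xb n y)"
   hence "bx x : bar_cochains n" using HH_class_xr(1)[OF p] bb by blast
   from coh_bar_class[OF this] show "f : bar_class n (bx x) <-> f : bar_cochains n & coh n (fv f) (fv (bx x))"
    unfolding bar_class_def by blast
  qed
  also have "... <-> f : bar_cochains n & coh n (fv f) (pb (Psi \<Phi>) n y)"
   using cx HH_class_refl[OF p, of n] coh_trans coh_sym by blast
  finally show ?thesis .
 qed
 thus ?A .
 show ?B
  using i[of "bx (xb n y)"] bb[OF xb_cochain[OF p]] cx[OF HH_class_refl[OF p]] by blast
qed

text \<open>All representatives of the two classes have cohomologous brackets, so the union in
  \<open>class_bracket\<close> is a single bar class, and \<open>bk\<close> identifies it.\<close>

lemma bracket_is_bk: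
 assumes y: "pcc (int n) y" and y': "pcc (int q) y'" and z: "pcc (int (n + q - 1)) z"
  and b: "bk (Psi \<Phi>) n y q y' z" and nq: "n + q >= 2 | n = 0 & q = 0"
 shows "bracket_is \<Phi> n (xb n y) q (xb q y') (xb (n + q - 1) z)"
proof -
 let ?k = "n + q - 1"
 have e: "h : bar_class ?k (gbracket n q f f') <-> h : bar_cochains ?k & coh ?k (fv h) (pb (Psi \<Phi>) ?k z)"
  if f: "f : bar_cochains n" "coh n (fv f) (pb (Psi \<Phi>) n y)" and f': "f' : bar_cochains q" "coh q (fv f') (pb (Psi \<Phi>) q y')" for f f' h
 proof -
  note gb = gbracket_bar[OF f(1) f'(1)]
  have zc: "zc q (fv f')" by (rule zc_coh[OF zc_pb[OF cmap_Psi y'] coh_sym[OF f'(2)] mlin_fv[OF f'(1)]])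
  have "coh ?k (fv (gbracket n q f f')) (br n q (fv f) (fv f'))" by (rule coh_eqI) (rule gb(2))
  hence "coh ?k (fv (gbracket n q f f')) (pb (Psi \<Phi>) ?k z)"
   using coh_br[OF f(2) f'(2) zc zc_pb[OF cmap_Psi y] nq] b coh_trans unfolding bk_def by blast
  thus ?thesis using coh_bar_class[OF gb(1)] coh_trans coh_sym unfolding bar_class_def by blast
 qed
 have "class_bracket n q (to_bar \<Phi> n (HH_class n (xb n y))) (to_bar \<Phi> q (HH_class q (xb q y'))) = to_bar \<Phi> ?k (HH_class ?k (xb ?k z))"
  (is "class_bracket n q ?X ?Y = ?Z")
 proof (rule Set.set_eqI)
  fix h
  have "h : class_bracket n q ?X ?Y <-> (EX f:?X. EX f':?Y. h : bar_class ?k (gbracket n q f f'))"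
   unfolding class_bracket_def by blast
  also have "... <-> (EX f:?X. EX f':?Y. h : ?Z)"
   by (intro bex_cong refl) (simp only: e to_bar_iff(1)[OF y] to_bar_iff(1)[OF y'] to_bar_iff(1)[OF z])
  also have "... <-> h : ?Z" using to_bar_iff(2)[OF y] to_bar_iff(2)[OF y'] by blast
  finally show "h : class_bracket n q ?X ?Y <-> h : ?Z" .
 qed
 thus ?thesis unfolding bracket_is_def using xb_cocycle y y' z by blast
qed

end


section \<open>The elements of the theorem\<close>

lemma xb_eqI:
 assumes "par y" "!!b. b ~: B n ==> x b = undefined" "!!r i. 0 <= r ==> r <= int n ==> 0 <= i ==> i < M ==> x (g n r i) = kap (y (int n - r, r, i))"
 shows "x = xb n y"
proof
 fix b
 show "x b = xb n y b"
 proof (cases "b : B n")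
  case True
  then obtain r i where b: "b = g n r i" "0 <= r" "r <= int n" "0 <= i" "i < M" using B_cases by blast
  show ?thesis unfolding b(1) xb_g[OF assms(1) b(2,3)] by (rule assms(3)[OF b(2-5)])
 next
  case False
  thus ?thesis by (simp add: xb_def assms(2))
 qed
qed

text \<open>Since \<open>g n r i\<close> determines \<open>r\<close> and \<open>i\<close> modulo
  \<open>m\<close>, at most one summand contributes at each basis element.\<close>

lemma cyc_xb:
 fixes u :: "int => 'k::field vv"
 assumes "0 <= r" "r <= int n" "uok (int n - r) r u"
 shows "cyc_sum n (%i. parallel n (g n r i) (kap (u i))) = xb n (yE (int n - r) r u)"
proof (rule xb_eqI[OF par_yE[OF assms(3)]])
 fix r' i assume r: "0 <= r'" "r' <= int n" "0 <= i" "i < M"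
 have b: "g n r' i : (B n :: 'k pathvec set)" by (rule g_B[OF r(1,2)])
 have e: "g n r' i = (g n r j :: 'k pathvec) <-> r' = r & j = i" if "j : {0..<M}" for j
  using g_inj[of n r' i r j, where 'k = 'k] r that by auto
 have "cyc_sum n (%i. parallel n (g n r i) (kap (u i))) (g n r' i) = (\<Oplus>\<^bsub>A\<^esub>j\<in>{0..<M}. kap (if r' = r & j = i then u j else 0))"
  unfolding cyc_sum_def parallel_def restrict_apply using b
  by (simp only: if_True) (rule A.finsum_cong', rule refl, rule Pi_I, rule kap_carrier, simp add: e kap_0)
 also have "... = kap (SUM j:{0..<M}. if r' = r & j = i then u j else 0)" by (rule kap_sum) simp
 also have "(SUM j:{0..<M}. if r' = r & j = i then u j else 0) = yE (int n - r) r u (int n - r', r', i)"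
  using r(3,4) by (cases "r' = r") simp_all
 finally show "cyc_sum n (%i. parallel n (g n r i) (kap (u i))) (g n r' i) = kap (yE (int n - r) r u (int n - r', r', i))" .
qed (simp add: cyc_sum_def)

lemma elts_xb:
 "chi_2_0 = xb 2 (yX :: 'k::field gv)" "chi_m_neg = xb m (yN :: 'k gv)" (is ?A) "chi_m_pos = xb m (yP :: 'k gv)" (is ?B)
 "phi_m1_neg = xb (m - 1) (yF :: 'k gv)" (is ?C) "psi_m1_pos = xb (m - 1) (yG :: 'k gv)" (is ?D)
 "phi_1_0 = xb 1 (yE 1 0 (%j. vt j <> wd 1) :: 'k gv)" (is ?E) "psi_1_0 = xb 1 (yE 0 1 (%j. vt j <> wd (- 1)) :: 'k gv)" (is ?H)
proof -
 have m1: "int (m - 1) = M - 1" using m3 by simp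
 show "chi_2_0 = xb 2 (yX :: 'k gv)"
  unfolding chi_2_0_def cl_gens sclA_sgn using cyc_xb[of 1 2 "%j. sg j (vt j :: 'k vv)"] uok_gens(1) by simp
 show ?A
  unfolding chi_m_neg_def cl_gens using cyc_xb[of M m "vt :: int => 'k vv"] uok_gens(2) by simp
 show ?B
  unfolding chi_m_pos_def cl_gens using cyc_xb[of 0 m "vt :: int => 'k vv"] uok_gens(3) by simp
 show ?C
  unfolding phi_m1_neg_def cl_elts sclA_sgn
  using cyc_xb[of "M - 1" "m - 1" "%j. sg j (vt j <> wd (NN - 1) :: 'k vv)"] uok_gens(4) M3 by (simp add: m1)
 show ?D
  unfolding psi_m1_pos_def cl_elts sclA_sgn
  using cyc_xb[of 0 "m - 1" "%j. sg j (vt j <> wd (1 - NN) :: 'k vv)"] uok_gens(5) M3 by (simp add: m1)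
 show ?E
  unfolding phi_1_0_def cl_gens using cyc_xb[of 0 1 "%j. vt j <> wd 1 :: 'k vv"] uok_gens(6) by simp
 show ?H
  unfolding psi_1_0_def cl_gens diff_add_cancel using cyc_xb[of 1 1 "%j. vt j <> wd (- 1) :: 'k vv"] uok_gens(7) by simp
qed

lemma central_xb: "par (yC c) ==> central (kap c) = xb 0 (yC (c :: 'k::field vv))"
proof (rule xb_eqI)
 fix r i assume "0 <= r" "r <= int 0"
 hence r: "r = 0" by simp
 have "g 0 0 i : (B 0 :: 'k pathvec set)" by (rule g_B) simp_all
 hence "central (kap c) (g 0 0 i) = cl (g 0 0 i) \<cdot> kap c" unfolding central_def restrict_apply by (simp only: if_True)
 thus "central (kap c) (g 0 r i) = kap (yC c (int 0 - r, r, i))"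
  unfolding r by (simp add: cl_gens kap_mul)
qed (simp_all add: central_def)

lemma central_elts: "eps i = xb 0 (yC (cI i :: 'k::field vv))" "fc i = xb 0 (yC (cF i :: 'k vv))"
 unfolding eps_def fc_def cl_elts using central_xb pcc_cI pcc_cF unfolding pcc_def by blast+

lemma cochain_ops:
 assumes "par y" "par (y' :: 'k::field gv)"
 shows "cochain_add n (xb n y) (xb n y') = xb n (%w. y w + y' w)" (is ?A) "cochain_scl n c (xb n y) = xb n (%w. scl c (y w))" (is ?B)
proof -
 have p: "par (%w. y w + y' w)" "par (%w. scl c (y w))"
  using assms by (auto simp: par_def mul_add_left mul_add_right mul_scl_left mul_scl_right)
 show ?A
  by (rule xb_eqI[OF p(1)]) (simp_all add: cochain_add_def g_B xb_g assms kap_add)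
 show ?B
  by (rule xb_eqI[OF p(2)]) (simp_all add: cochain_scl_def g_B xb_g assms sclA_kap)
qed

lemma pcc_scl: "pcc n y ==> pcc n (%w. scl c (y w))"
 by (auto simp: pcc_def par_def px_scl mul_scl_left mul_scl_right)

lemma pcc_0: "pcc n (%_. 0)"
 by (auto simp: pcc_def par_def intro!: px_zero)

lemma pccs: "pcc (int 0) (yC (cI i) :: 'k::field gv)" "pcc (int 0) (yC (cF i) :: 'k gv)" "pcc (int 1) (yD :: 'k gv)"
 "pcc (int m) (yN :: 'k gv)" "pcc (int m) (yP :: 'k gv)"
 using pcc_cI pcc_cF pcc_yD pcc_yN pcc_yP by simp_all

lemma bracket_0:
 assumes "comparison_map \<Phi>" "pcc (int n) y" "pcc (int q) y'" "bk (Psi \<Phi>) n y q y' (%_. 0)" "n + q >= 2 | n = 0 & q = 0"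
 shows "bracket_is \<Phi> n (xb n y) q (xb q y') (zero_cochain (n + q - 1))" "bracket_is \<Phi> q (xb q y') n (xb n y) (zero_cochain (q + n - 1))"
 unfolding zero_xb using assms bk_swap[OF assms(4)] by (intro bracket_is_bk pcc_0; auto)+

end

theorem proposition7p3:
  fixes N m :: nat and i j :: int
    and \<Phi> :: "nat \<Rightarrow> 'k::field elt list \<Rightarrow> 'k tens"
  assumes "N \<ge> 1" and "m \<ge> 3" and "even m"
    and "\<not> CHAR('k) dvd 2" and "\<not> CHAR('k) dvd N" and "\<not> CHAR('k) dvd m"
    and "i \<in> {0..<int m}" and "j \<in> {0..<int m}"
    and "biserial.comparison_map N m \<Phi>"
  shows
   "(biserial.bracket_is N m \<Phi> 0 (biserial.eps N m i) 2 (biserial.chi_2_0 N m)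
       (biserial.cochain_scl N m 1 ((-1) powi (i + 1) / of_nat m)
         (biserial.cochain_add N m 1 (biserial.phi_1_0 N m) (biserial.psi_1_0 N m)))) \<and>
    (biserial.bracket_is N m \<Phi> 0 (biserial.eps N m i) m (biserial.chi_m_neg N m)
       (biserial.cochain_scl N m (m - 1) ((-1) powi (i + 1)) (biserial.phi_m1_neg N m))) \<and>
    (biserial.bracket_is N m \<Phi> 0 (biserial.eps N m i) m (biserial.chi_m_pos N m)
       (biserial.cochain_scl N m (m - 1) ((-1) powi (i + 1)) (biserial.psi_m1_pos N m))) \<and>
    (\<forall>(q, Y) \<in> {(0, biserial.eps N m j), (0, biserial.fc N m j),
         (m - 1, biserial.phi_m1_neg N m), (m - 1, biserial.psi_m1_pos N m)}.
       biserial.bracket_is N m \<Phi> 0 (biserial.eps N m i) q Y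
         (biserial.zero_cochain N m (0 + q - 1))) \<and>
    (\<forall>(q, Y) \<in> {(0, biserial.eps N m j), (0, biserial.fc N m j), (2, biserial.chi_2_0 N m),
         (m - 1, biserial.phi_m1_neg N m), (m - 1, biserial.psi_m1_pos N m),
         (m, biserial.chi_m_neg N m), (m, biserial.chi_m_pos N m)}.
       biserial.bracket_is N m \<Phi> 0 (biserial.fc N m i) q Y
         (biserial.zero_cochain N m (0 + q - 1))) \<and>
    (biserial.bracket_is N m \<Phi> 2 (biserial.chi_2_0 N m) (m - 1) (biserial.phi_m1_neg N m)
       (biserial.chi_m_neg N m)) \<and>
    (biserial.bracket_is N m \<Phi> 2 (biserial.chi_2_0 N m) (m - 1) (biserial.psi_m1_pos N m)
       (biserial.cochain_scl N m m (-1) (biserial.chi_m_pos N m))) \<and>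
    (\<forall>(q, Y) \<in> {(0, biserial.fc N m j), (2, biserial.chi_2_0 N m),
         (m, biserial.chi_m_neg N m), (m, biserial.chi_m_pos N m)}.
       biserial.bracket_is N m \<Phi> 2 (biserial.chi_2_0 N m) q Y
         (biserial.zero_cochain N m (2 + q - 1))) \<and>
    (\<forall>(q, Y) \<in> {(0, biserial.eps N m j), (0, biserial.fc N m j),
         (m - 1, biserial.phi_m1_neg N m), (m, biserial.chi_m_neg N m)} \<union>
         (if N > 1 then {(m - 1, biserial.psi_m1_pos N m), (m, biserial.chi_m_pos N m)} else {}).
       biserial.bracket_is N m \<Phi> (m - 1) (biserial.phi_m1_neg N m) q Y
         (biserial.zero_cochain N m (m - 1 + q - 1))) \<and>
    (\<forall>(q, Y) \<in> {(0, biserial.eps N m j), (0, biserial.fc N m j),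
         (m - 1, biserial.psi_m1_pos N m), (m, biserial.chi_m_pos N m)} \<union>
         (if N > 1 then {(m - 1, biserial.phi_m1_neg N m), (m, biserial.chi_m_neg N m)} else {}).
       biserial.bracket_is N m \<Phi> (m - 1) (biserial.psi_m1_pos N m) q Y
         (biserial.zero_cochain N m (m - 1 + q - 1))) \<and>
    (\<forall>(q, Y) \<in> {(0, biserial.fc N m j), (2, biserial.chi_2_0 N m),
         (m - 1, biserial.phi_m1_neg N m),
         (m, biserial.chi_m_neg N m), (m, biserial.chi_m_pos N m)} \<union>
         (if N > 1 then {(m - 1, biserial.psi_m1_pos N m)} else {}).
       biserial.bracket_is N m \<Phi> m (biserial.chi_m_neg N m) q Y
         (biserial.zero_cochain N m (m + q - 1))) \<and>
    (\<forall>(q, Y) \<in> {(0, biserial.fc N m j), (2, biserial.chi_2_0 N m),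
         (m - 1, biserial.psi_m1_pos N m),
         (m, biserial.chi_m_neg N m), (m, biserial.chi_m_pos N m)} \<union>
         (if N > 1 then {(m - 1, biserial.phi_m1_neg N m)} else {}).
       biserial.bracket_is N m \<Phi> m (biserial.chi_m_pos N m) q Y
         (biserial.zero_cochain N m (m + q - 1)))"
proof -
 interpret bis N m by unfold_locales (use assms in auto)
 interpret KQ: ring "KQ :: 'k pathvec ring" by (rule ring_KQ)
 note C = assms(9)
 note W = cmap_Psi[OF C]
 have Mk: "(of_nat m :: 'k) ~= 0" using assms(6) by (simp add: of_nat_eq_0_iff_char_dvd)
 \<comment> \<open>The degree conditions are left unsimplified, so that they match the premises of
   \<open>bracket_0\<close> and \<open>bracket_is_bk\<close> literally.\<close>
 have g2: "2 <= 0 + (m - 1) | (0 :: nat) = 0 & m - 1 = 0" "2 <= 0 + m | (0 :: nat) = 0 & m = 0"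
  "2 <= 0 + (2 :: nat) | (0 :: nat) = 0 & (2 :: nat) = 0" "2 <= 2 + (m - 1) | (2 :: nat) = 0 & m - 1 = 0"
  "2 <= 2 + m | (2 :: nat) = 0 & m = 0" "2 <= 2 + (2 :: nat) | (2 :: nat) = 0 & (2 :: nat) = 0"
  "2 <= m - 1 + (m - 1) | m - 1 = 0 & m - 1 = 0" "2 <= m - 1 + m | m - 1 = 0 & m = 0" "2 <= m + m | m = 0 & m = 0"
  "2 <= 0 + (0 :: nat) | (0 :: nat) = 0 & (0 :: nat) = 0"
  using m3 by auto
 note p = pccs[where 'k = 'k] and q = pcc_gens_nat[where 'k = 'k]
 note par = p(1,2,4,5)[unfolded pcc_def, THEN conjunct1] q[unfolded pcc_def, THEN conjunct1]
 have sc: "cochain_scl n ((-1) powi k) (xb n y) = xb n (%w. sg k (y w))" if "par y" for n k and y :: "'k gv"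
  unfolding cochain_ops(2)[OF that that] powi_sg ..
 have ps: "pcc n (%w. sg k (y w))" "pcc n (%w. - y w)" if "pcc n y" for n k and y :: "'k gv"
  using pcc_scl[OF that, of "(-1) powi k"] pcc_scl[OF that, of "- 1"] unfolding powi_sg by (simp_all add: scl_minus_left)
 note cFG = bk_c_FG[OF W pcc_cI bideg_cI] bk_c_FG[OF W pcc_cF bideg_cF]
 have cFG: "bk (Psi \<Phi>) 0 (yC (cI k)) (m - 1) yF (%_. 0)" "bk (Psi \<Phi>) 0 (yC (cI k)) (m - 1) yG (%_. 0)"
  "bk (Psi \<Phi>) 0 (yC (cF k)) (m - 1) yF (%_. 0)" "bk (Psi \<Phi>) 0 (yC (cF k)) (m - 1) yG (%_. 0)" for k
  using cFG N1 by simp_all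
 note z = bracket_0[OF C]
 \<comment> \<open>\<open>bracket_0\<close> yields each vanishing bracket in both orders, so one
   computation serves two of the lists in the statement.\<close>
 note Z = z[OF p(1,1) bk_00 g2(10)] z[OF p(1,2) bk_00 g2(10)] z[OF p(2,2) bk_00 g2(10)]
  z[OF p(1) q(2) cFG(1) g2(1)] z[OF p(1) q(3) cFG(2) g2(1)] z[OF p(2) q(2) cFG(3) g2(1)] z[OF p(2) q(3) cFG(4) g2(1)]
  z[OF p(2) q(1) bk_f_X[OF W Mk] g2(3)] z[OF p(2,4) bk_f_N[OF W] g2(2)] z[OF p(2,5) bk_mirrored(6)[OF W] g2(2)]
  z[OF q(1,1) bk_XX[OF W] g2(6)] z[OF q(1) p(4) bk_XN[OF W] g2(5)] z[OF q(1) p(5) bk_mirrored(3)[OF W] g2(5)]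
  z[OF q(2,2) bk_FF[OF W] g2(7)] z[OF q(3,3) bk_mirrored(1)[OF W] g2(7)] z[OF q(2) p(4) bk_FN[OF W] g2(8)] z[OF q(3) p(5) bk_mirrored(2)[OF W] g2(8)]
  z[OF p(4,4) bk_NN[OF W] g2(9)] z[OF p(4,5) bk_NP[OF W] g2(9)] z[OF p(5,5) bk_mirrored(4)[OF W] g2(9)]
 have Z1: "bracket_is \<Phi> (m - 1) (xb (m - 1) yF) (m - 1) (xb (m - 1) yG) (zero_cochain (m - 1 + (m - 1) - 1))"
  "bracket_is \<Phi> (m - 1) (xb (m - 1) yG) (m - 1) (xb (m - 1) yF) (zero_cochain (m - 1 + (m - 1) - 1))"
  "bracket_is \<Phi> (m - 1) (xb (m - 1) yF) m (xb m yP) (zero_cochain (m - 1 + m - 1))"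
  "bracket_is \<Phi> m (xb m yP) (m - 1) (xb (m - 1) yF) (zero_cochain (m + (m - 1) - 1))"
  "bracket_is \<Phi> (m - 1) (xb (m - 1) yG) m (xb m yN) (zero_cochain (m - 1 + m - 1))"
  "bracket_is \<Phi> m (xb m yN) (m - 1) (xb (m - 1) yG) (zero_cochain (m + (m - 1) - 1))" if "N > 1"
  using z[OF q(2,3) bk_FG[OF W that] g2(7)] z[OF q(2) p(5) bk_FP[OF W that] g2(8)] z[OF q(3) p(4) bk_mirrored(5)[OF W that] g2(8)] by blast+
 have e1: "0 + 2 - 1 = (1 :: nat)" "0 + m - 1 = m - 1" "2 + (m - 1) - 1 = m" using m3 by auto
 have D: "cochain_scl 1 ((-1) powi (i + 1) / of_nat m) (cochain_add 1 (xb 1 (yE 1 0 (%j. vt j <> wd 1))) (xb 1 (yE 0 1 (%j. vt j <> wd (- 1)))))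
  = xb 1 (%w. sg (i + 1) (scl (1 / of_nat m) (yD w :: 'k vv)))"
 proof -
  have "scl ((-1) powi (i + 1) / of_nat m) x = sg (i + 1) (scl (1 / of_nat m) x)" for x :: "'k vv"
   unfolding powi_sg[symmetric] scl_scl by simp
  moreover have "par (yD :: 'k gv)" using p(3) unfolding pcc_def by (rule conjunct1)
  ultimately show ?thesis
   unfolding cochain_ops(1)[OF par_yE[OF uok_gens(6)] par_yE[OF uok_gens(7)]] by (simp only: cochain_ops(2))
 qed
 have m: "cochain_scl m (-1) (xb m yP) = xb m (%w. - (yP w :: 'k vv))"
  using cochain_ops(2)[OF par(4) par(4), of m "-1"] by (simp add: scl_minus_left)
 note E = bracket_is_bk[OF C]
 have NZ: "bracket_is \<Phi> 0 (xb 0 (yC (cI i))) 2 (xb 2 yX) (xb 1 (%w. sg (i + 1) (scl (1 / of_nat m) (yD w :: 'k vv))))"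
  "bracket_is \<Phi> 0 (xb 0 (yC (cI i))) m (xb m yN) (xb (m - 1) (%w. sg (i + 1) (yF w :: 'k vv)))"
  "bracket_is \<Phi> 0 (xb 0 (yC (cI i))) m (xb m yP) (xb (m - 1) (%w. sg (i + 1) (yG w :: 'k vv)))"
  "bracket_is \<Phi> 2 (xb 2 yX) (m - 1) (xb (m - 1) yF) (xb m (yN :: 'k gv))"
  "bracket_is \<Phi> 2 (xb 2 yX) (m - 1) (xb (m - 1) yG) (xb m (%w. - (yP w :: 'k vv)))"
  using E[OF p(1) q(1) _ bk_eps_X[OF W Mk] g2(3), unfolded e1, OF ps(1)[OF pcc_scl[OF p(3)]]]
   E[OF p(1,4) _ bk_eps_N[OF W] g2(2), unfolded e1, OF ps(1)[OF q(2)]] E[OF p(1,5) _ bk_eps_P[OF W] g2(2), unfolded e1, OF ps(1)[OF q(3)]]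
   E[OF q(1,2) _ bk_X_F[OF W Mk] g2(4), unfolded e1, OF p(4)] E[OF q(1,3) _ bk_X_G[OF W Mk] g2(4), unfolded e1, OF ps(2)[OF p(5)]]
  by - assumption+
 show ?thesis
  unfolding elts_xb central_elts D m sc[OF par(6)] sc[OF par(7)]
  by (cases "N > 1") (simp_all only: Z Z1 NZ ball_simps ball_Un prod.case if_True if_False simp_thms)
qed

end
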